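(* Assume Condition 1 (stated in the context). Then $\mathbb{P}$-a.s. the following hold. (a) For each $i\in\mathbb{Z}_+\cup\{\infty\}$, $\lim_{n\to\infty}X^{(i)}_n\cdot\ell=\infty$ for every $\ell\in\mathbb{R}^d$ such that $\ell\cdot\delta^{(0)}>0$. (b) For each $i\in\mathbb{Z}_+$, there exists a deterministic $\kappa_{(i)}\in[0,\infty)$ such that $$v^{(i)}:=\lim_{n\to\infty}n^{-1}X^{(i)}_n=\kappa_{(i)}\delta^{(0)}.$$
   Context: Model. Let $d\ge 2$, $[d]=\{1,\dots,d\}$, $\mathbb{N}=\{1,2,\dots\}$, $\mathbb{Z}_+=\{0,1,2,\dots\}$, and let $e_1,\dots,e_d$ be the standard basis vectors. Let $(\boldsymbol{p}^{(i)})_{i\in\mathbb{Z}_+\cup\{\infty\}}$ be probability distributions on $\{\pm e_j:j\in[d]\}$. For such a distribution $\boldsymbol{p}$ and a connected subgraph $\mathcal{Z}$ of $\mathbb{Z}^d$ (with nearest-neighbour edges) containing $0$, a $\boldsymbol{p}$-random walk on $\mathcal{Z}$ is the discrete-time Markov chain started at $0$ which moves from $x$ to $x+e$ with probability $p(e)/\sum_{e':(x,x+e')\in\mathcal{Z}}p(e')$ if $(x,x+e)$ is an edge of $\mathcal{Z}$, and with probability $0$ otherwise. Let $\mathcal{Z}^{(0)}=\mathbb{Z}^d$ and let $X^{(0)}$ be a $\boldsymbol{p}^{(0)}$-random walk on $\mathcal{Z}^{(0)}$. Recursively, given the walk $X^{(i)}$, $\mathcal{Z}^{(i+1)}$ is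 its trace, i.e. the graph with vertex set $\{X^{(i)}_n:n\in\mathbb{Z}_+\}$ and undirected edge set $\{(X^{(i)}_n,X^{(i)}_{n+1}):n\in\mathbb{Z}_+\}$; given $\mathcal{Z}^{(i+1)}$, the walk $X^{(i+1)}$ is a $\boldsymbol{p}^{(i+1)}$-random walk on $\mathcal{Z}^{(i+1)}$, conditionally independent of $X^{(j)}$, $j<i+1$. The graphs are decreasing in $i$; set $\mathcal{Z}^{(\infty)}:=\bigcap_{i\in\mathbb{Z}_+}\mathcal{Z}^{(i)}$ and let $X^{(\infty)}$ be (given $\mathcal{Z}^{(\infty)}$) a $\boldsymbol{p}^{(\infty)}$-random walk on $\mathcal{Z}^{(\infty)}$. All walks are defined on a probability space with probability measure $\mathbb{P}$. Notation. $\delta^{(i)}=(\delta^{(i)}_j)_{j\in[d]}$ with $\delta^{(i)}_j=p^{(i)}(e_j)-p^{(i)}(-e_j)$. When $p^{(i)}(e)>0$ for every $e$, $\hat\ell^{(i)}=(\hat\ell^{(i)}_j)_{j\in[d]}$ with $\hat\ell^{(i)}_j=\log\left(p^{(i)}(e_j)/p^{(i)}(-e_j)\right)$, and $\ell^{(i)}=\hat\ell^{(i)}/\|\hat\ell^{(i)}\|$ (Euclidean norm). Condition 1. (a) $\delta^{(0)}_j\ge 0$ for each $j\in[d]$, and $\delta^{(0)}_1>0$; (b) $p^{(i)}(e)>0$ for all $e\in\{\pm e_j:j\in[d]\}$ and all $i\in\mathbb{Z}_+\cup\{\infty\}$; (c) for each $i\in\mathbb{N}\cup\{\infty\}$, $\delta^{(0)}\cdot\ell^{(i)}>0$.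 *)

theory Defs
  imports "HOL-Probability.Probability"
begin

type_synonym 'd site = "int ^ 'd"

text \<open>A graph is a pair of a vertex set and a set of undirected edges, an edge being the
  set of its two end points.\<close>

type_synonym 'd lattice_graph = "'d site set \<times> 'd site set set"

definition unit_steps :: "('d::finite) site set" where
  "unit_steps = range (\<lambda>j. axis j 1) \<union> range (\<lambda>j. - axis j 1)"

definition lattice :: "('d::finite) lattice_graph" where
  "lattice = (UNIV, {{x, x + e} | x e. e \<in> unit_steps})"

definition trace_graph :: "(nat \<Rightarrow> ('d::finite) site) \<Rightarrow> 'd lattice_graph" where
  "trace_graph x = (range x, range (\<lambda>n. {x n, x (Suc n)}))"

definition real_site :: "('d::finite) site \<Rightarrow> real ^ 'd" where
  "real_site x = (\<chi> j. real_of_int (x $ j))"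

text \<open>Transition probabilities of the random walk on \<open>G\<close>. If \<open>x\<close> is not incident to any edge,
  they all vanish; no walk started at \<open>0\<close> reaches such a vertex unless \<open>0\<close> itself is isolated,
  in which case there is no walk on \<open>G\<close>.\<close>

definition step_prob ::
    "('d::finite) lattice_graph \<Rightarrow> 'd site pmf \<Rightarrow> 'd site \<Rightarrow> 'd site \<Rightarrow> real" where
  "step_prob G p x y =
    (if {x, y} \<in> snd G
     then pmf p (y - x) / (\<Sum>e \<in> {e \<in> unit_steps. {x, x + e} \<in> snd G}. pmf p e)
     else 0)"

text \<open>The probability that the Markov chain started at \<open>0\<close> with these transition probabilities
  follows \<open>x 0, \<dots>, x n\<close>. Over all \<open>n\<close> and \<open>x\<close>, these determine its law.\<close>

definition path_prob ::
    "('d::finite) lattice_graph \<Rightarrow> 'd site pmf \<Rightarrow> nat \<Rightarrow> (nat \<Rightarrow> 'd site) \<Rightarrow> real" where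
  "path_prob G p n x = (if x 0 = 0 then \<Prod>k<n. step_prob G p (x k) (x (Suc k)) else 0)"

definition graph_algebra :: "'w measure \<Rightarrow> ('w \<Rightarrow> ('d::finite) lattice_graph) \<Rightarrow> 'w measure" where
  "graph_algebra M Z = sigma (space M)
     ({{\<omega> \<in> space M. x \<in> fst (Z \<omega>)} | x. True} \<union> {{\<omega> \<in> space M. e \<in> snd (Z \<omega>)} | e. True})"

definition process_algebra ::
    "'w measure \<Rightarrow> (enat \<Rightarrow> nat \<Rightarrow> 'w \<Rightarrow> ('d::finite) site) \<Rightarrow> enat set \<Rightarrow> 'w measure" where
  "process_algebra M X J =
     sigma (space M) {{\<omega> \<in> space M. X j n \<omega> = x} | j n x. j \<in> J}"

text \<open>Conditionally on the random graph \<open>Z\<close>, \<open>Y\<close> is a \<open>p\<close>-random walk on \<open>Z\<close>. For constant \<open>Z\<close>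
  the conditioning is on the trivial algebra, and this fixes the unconditional law of \<open>Y\<close>.\<close>

definition random_walk_on ::
    "'w measure \<Rightarrow> ('w \<Rightarrow> ('d::finite) lattice_graph) \<Rightarrow> 'd site pmf \<Rightarrow> (nat \<Rightarrow> 'w \<Rightarrow> 'd site) \<Rightarrow> bool"
  where
  "random_walk_on M Z p Y \<longleftrightarrow>
     (\<forall>n x. AE \<omega> in M.
        real_cond_exp M (graph_algebra M Z)
          (indicator {\<omega> \<in> space M. \<forall>k\<le>n. Y k \<omega> = x k}) \<omega> = path_prob (Z \<omega>) p n x)"

definition cond_indep :: "'w measure \<Rightarrow> 'w measure \<Rightarrow> 'w measure \<Rightarrow> 'w measure \<Rightarrow> bool" where
  "cond_indep M F G H \<longleftrightarrow>
     (\<forall>A \<in> sets G. \<forall>B \<in> sets H. AE \<omega> in M.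
        real_cond_exp M F (indicator (A \<inter> B)) \<omega>
          = real_cond_exp M F (indicator A) \<omega> * real_cond_exp M F (indicator B) \<omega>)"

fun nested_graph_fin ::
    "(enat \<Rightarrow> nat \<Rightarrow> 'w \<Rightarrow> ('d::finite) site) \<Rightarrow> nat \<Rightarrow> 'w \<Rightarrow> 'd lattice_graph" where
  "nested_graph_fin X 0 \<omega> = lattice"
| "nested_graph_fin X (Suc i) \<omega> = trace_graph (\<lambda>n. X (enat i) n \<omega>)"

definition nested_graph ::
    "(enat \<Rightarrow> nat \<Rightarrow> 'w \<Rightarrow> ('d::finite) site) \<Rightarrow> enat \<Rightarrow> 'w \<Rightarrow> 'd lattice_graph" where
  "nested_graph X i \<omega> =
     (case i of
        enat k \<Rightarrow> nested_graph_fin X k \<omega>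
      | \<infinity> \<Rightarrow> (\<Inter>k. fst (nested_graph_fin X k \<omega>), \<Inter>k. snd (nested_graph_fin X k \<omega>)))"

locale nested_random_walks = prob_space M
  for M :: "'w measure" +
  fixes p :: "enat \<Rightarrow> ('d::finite) site pmf"
    and X :: "enat \<Rightarrow> nat \<Rightarrow> 'w \<Rightarrow> 'd site"
  assumes steps: "\<And>i. set_pmf (p i) \<subseteq> unit_steps"
    and measurable_X: "\<And>i n. X i n \<in> measurable M (count_space UNIV)"
    and walk: "\<And>i. random_walk_on M (nested_graph X i) (p i) (X i)"
    and cond_indep_X: "\<And>i::nat. cond_indep M
           (graph_algebra M (nested_graph X (enat (Suc i))))
           (process_algebra M X {enat (Suc i)})
           (process_algebra M X (enat ` {..<Suc i}))"

definition drift :: "('d::finite) site pmf \<Rightarrow> real ^ 'd" where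
  "drift q = (\<chi> j. pmf q (axis j 1) - pmf q (- axis j 1))"

definition log_ratio :: "('d::finite) site pmf \<Rightarrow> real ^ 'd" where
  "log_ratio q = (\<chi> j. ln (pmf q (axis j 1) / pmf q (- axis j 1)))"

definition direction :: "('d::finite) site pmf \<Rightarrow> real ^ 'd" where
  "direction q = (1 / norm (log_ratio q)) *\<^sub>R log_ratio q"

text \<open>The coordinate \<open>j1\<close> of the index type plays the role of the first coordinate.\<close>

definition condition1 :: "(enat \<Rightarrow> ('d::finite) site pmf) \<Rightarrow> 'd \<Rightarrow> bool" where
  "condition1 p j1 \<longleftrightarrow>
     (\<forall>j. drift (p 0) $ j \<ge> 0) \<and> drift (p 0) $ j1 > 0 \<and>
     (\<forall>i. \<forall>e \<in> unit_steps. pmf (p i) e > 0) \<and>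
     (\<forall>i. i \<noteq> 0 \<longrightarrow> drift (p 0) \<bullet> direction (p i) > 0)"

end

theory Submission
  imports Defs
begin

text \<open>
  The walk on a graph is reversible with conductances comparable to \<open>exp (l \<bullet> x)\<close>, where \<open>l\<close>
  is the vector of log ratios. If the weights \<open>exp (- (l \<bullet> x))\<close> are summable over an infinite
  connected graph, a Dirichlet form estimate bounds the Green function, so the walk visits each
  vertex finitely often. The first walk has speed \<open>\<delta>\<close> and \<open>l \<bullet> \<delta> > 0\<close>, so the weights are
  summable over its trace, which contains all later graphs. A walk that visits each vertex of this
  trace finitely often diverges in the same directions as the first walk, and has a speed parallel
  to \<open>\<delta>\<close> as soon as one coordinate of it has a speed.

  For that coordinate, call a level marked if no walk up to the present one returns below it after
  reaching it. Asymptotically, whether a high level is marked and what happens after it are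
  independent of the past. This mixing property passes from a walk to the walk on its trace: given
  the trace, the strong Markov property applies at the hitting time of a marked level, and until
  the new walk goes back it sees only the later part of the trace. Mixing makes the excursions
  between marked levels stationary and ergodic, and the ergodic theorem, applied to their durations
  and heights, gives a constant speed.
\<close>

section \<open>The Green function of the walk on a graph\<close>

text \<open>The Green function bound sees little of a graph: the resistance of a simple path is at
  most a constant times the sum of the weights of its vertices. It is therefore inherited by every
  subgraph, even by the infinite intersection, as soon as an infinite cluster remains.

  The obstacle to the speed is that excursions of a later walk are not independent, since its graph
  carries the history of all the earlier walks. Only a limiting measure \<open>\<nu>\<close> of the
  future beyond a high mark is accessible. It is not normalised: its mass is the limiting
  probability that a level is marked, and the induction over the walks must keep this mass positive.
  Stationarity makes the mean gap between marks finite, but nothing bounds the mean duration of an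
  excursion; if it is infinite, the speed is 0.

  One coordinate suffices because every position of a later walk is a position of the first walk at
  some other time, so that the ratio of the two times is the only unknown.\<close>

definition avail :: "('d::finite) site set set \<Rightarrow> 'd site \<Rightarrow> 'd site set" where
  "avail E x = {e \<in> unit_steps. {x, x + e} \<in> E}"

definition adj :: "('d::finite) site set set \<Rightarrow> ('d site \<times> 'd site) set" where
  "adj E = {(x, y). y - x \<in> avail E x}"

definition cluster :: "('d::finite) site set set \<Rightarrow> 'd site \<Rightarrow> 'd site set" where
  "cluster E x = {y. (x, y) \<in> (adj E)\<^sup>*}"

text \<open>By detailed balance, the walk on a graph is reversible with these conductances.\<close>

definition conduct :: "('d::finite) site pmf \<Rightarrow> 'd site \<Rightarrow> 'd site \<Rightarrow> real" where
  "conduct q x y = exp (log_ratio q \<bullet> real_site x) * pmf q (y - x)"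

text \<open>The probability that the walk from \<open>x\<close> is at \<open>z\<close> after
  \<open>n\<close> steps, defined without any measure by decomposing the first step;
  \<open>prob_walk_at\<close> makes the identification. The target is fixed and the start varies, so
  that sums over \<open>n\<close> are functions of the start to which the Dirichlet form applies. A
  vertex without available steps gets the value 0 for positive \<open>n\<close>.\<close>

primrec ret :: "('d::finite) site set set \<Rightarrow> 'd site pmf \<Rightarrow> 'd site \<Rightarrow> nat \<Rightarrow> 'd site \<Rightarrow> real" where
  "ret E q z 0 x = (if x = z then 1 else 0)"
| "ret E q z (Suc n) x =
     (\<Sum>e\<in>avail E x. pmf q e / (\<Sum>e\<in>avail E x. pmf q e) * ret E q z n (x + e))"

text \<open>Truncation at \<open>N\<close> makes the support finite, so that all summations by parts
  are finite sums; the bounds obtained below are uniform in \<open>N\<close>.\<close>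

definition green :: "('d::finite) site set set \<Rightarrow> 'd site pmf \<Rightarrow> 'd site \<Rightarrow> nat \<Rightarrow> 'd site \<Rightarrow> real" where
  "green E q z N x = (\<Sum>n<N. ret E q z n x)"

lemma finite_unit_steps [simp, intro]: "finite (unit_steps :: ('d::finite) site set)"
  by (simp add: unit_steps_def)

lemma uminus_unit_steps: "e \<in> unit_steps \<Longrightarrow> - e \<in> (unit_steps :: ('d::finite) site set)"
  by (auto simp: unit_steps_def)

lemma avail_subset: "avail E x \<subseteq> unit_steps"
  by (auto simp: avail_def)

lemma finite_avail [simp, intro]: "finite (avail E x)"
  by (rule finite_subset[OF avail_subset finite_unit_steps])

lemma avail_uminus: "e \<in> avail E x \<Longrightarrow> - e \<in> avail E (x + e)"
  by (auto simp: avail_def uminus_unit_steps insert_commute)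

lemma sym_adj: "sym (adj E)"
proof (rule symI)
  fix x y assume "(x, y) \<in> adj E"
  then show "(y, x) \<in> adj E"
    using avail_uminus[of "y - x" E x] by (simp add: adj_def)
qed

lemma real_site_add: "real_site (x + y) = real_site x + real_site y"
  by (simp add: real_site_def vec_eq_iff)

lemma real_site_diff: "real_site (x - y) = real_site x - real_site y"
  by (simp add: real_site_def vec_eq_iff)

lemma real_site_uminus: "real_site (- x) = - real_site x"
  by (simp add: real_site_def vec_eq_iff)

lemma real_site_axis: "real_site (axis j 1) = axis j 1"
  by (simp add: real_site_def vec_eq_iff axis_def)

text \<open>For a unit step \<open>e\<close>, the exponential of its product with the log ratios is
  \<open>pmf q e / pmf q (- e)\<close>, which exchanges the two orientations of an edge. No graph
  enters, so all graphs share the same conductances.\<close>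

lemma conduct_commute:
  assumes pos: "\<And>e. e \<in> unit_steps \<Longrightarrow> pmf q e > 0" and "y - x \<in> unit_steps"
  shows "conduct q x y = conduct q y x"
proof -
  have key: "exp (log_ratio q \<bullet> real_site e) = pmf q e / pmf q (- e)" if "e \<in> unit_steps" for e
  proof -
    from that consider j where "e = axis j 1" | j where "e = - axis j 1"
      by (auto simp: unit_steps_def)
    moreover have p: "pmf q e > 0" "pmf q (- e) > 0" using pos that uminus_unit_steps by auto
    ultimately show ?thesis
    proof cases
      case 1
      with p show ?thesis
        by (simp add: real_site_axis inner_axis log_ratio_def)
    next
      case 2
      with p show ?thesis
        by (simp add: real_site_axis real_site_uminus inner_axis log_ratio_def exp_minus)
    qed
  qed
  define e where "e = y - x"
  have y: "y = x + e" by (simp add: e_def)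
  have "pmf q (- e) > 0" using pos[OF uminus_unit_steps[OF assms(2)]] by (simp add: e_def)
  then show ?thesis
    using key[of e] assms(2) unfolding conduct_def y
    by (simp add: e_def[symmetric] real_site_add inner_add_right exp_add)
qed

lemma ret_nonneg: "ret E q z n x \<ge> 0"
  by (induction n arbitrary: x) (auto intro!: sum_nonneg divide_nonneg_nonneg)

lemma green_nonneg: "green E q z N x \<ge> 0"
  by (auto simp: green_def intro!: sum_nonneg ret_nonneg)

lemma finite_ret_support: "finite {x. ret E q z n x \<noteq> 0}"
proof (induction n)
  case (Suc n)
  have "{x. ret E q z (Suc n) x \<noteq> 0}
      \<subseteq> (\<Union>e\<in>unit_steps. (\<lambda>y. y - e) ` {x. ret E q z n x \<noteq> 0})"
  proof
    fix x assume "x \<in> {x. ret E q z (Suc n) x \<noteq> 0}"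
    then have "\<exists>e\<in>avail E x. ret E q z n (x + e) \<noteq> 0"
      by (intro ccontr[of "\<exists>e\<in>_. _ e"]) simp
    then obtain e where "e \<in> avail E x" "ret E q z n (x + e) \<noteq> 0" by blast
    then show "x \<in> (\<Union>e\<in>unit_steps. (\<lambda>y. y - e) ` {x. ret E q z n x \<noteq> 0})"
      using avail_subset by (force intro!: bexI[of _ e] image_eqI[of _ _ "x + e"])
  qed
  then show ?case
    by (rule finite_subset) (use Suc in auto)
qed auto

lemma finite_green_support: "finite {x. green E q z N x \<noteq> 0}"
proof (rule finite_subset)
  show "{x. green E q z N x \<noteq> 0} \<subseteq> (\<Union>n<N. {x. ret E q z n x \<noteq> 0})"
    unfolding green_def by (auto intro: ccontr)
qed (auto intro: finite_ret_support)

text \<open>The generator applied to a partial sum of transition probabilities telescopes: only the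
  terms of time 0 and of time \<open>N\<close> remain.\<close>

lemma green_step:
  "green E q z N x
     - (\<Sum>e\<in>avail E x. pmf q e / (\<Sum>e\<in>avail E x. pmf q e) * green E q z N (x + e))
   = ret E q z 0 x - ret E q z N x"
proof -
  have "(\<Sum>e\<in>avail E x. pmf q e / (\<Sum>e\<in>avail E x. pmf q e) * green E q z N (x + e))
      = (\<Sum>n<N. ret E q z (Suc n) x)"
    by (simp add: green_def sum_distrib_left) (rule sum.swap)
  then show ?thesis
    using sum_lessThan_telescope'[of "\<lambda>n. ret E q z n x" N]
    by (simp add: green_def sum_subtractf del: ret.simps)
qed

text \<open>Multiply \<open>green_step\<close> by \<open>f x\<close> and by the reversible mass of
  \<open>x\<close>, and sum. The term of time \<open>N\<close> has a favourable sign and is dropped;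
  the term of time 0 is concentrated at \<open>z\<close>. The mass of \<open>z\<close> is at most
  the exponential because the available steps have total probability at most 1.\<close>

lemma green_dirichlet:
  assumes pos: "\<And>e. e \<in> unit_steps \<Longrightarrow> pmf q e > 0"
    and S: "finite S" "{x. green E q z N x \<noteq> 0} \<subseteq> S"
  defines "f \<equiv> green E q z N"
  shows "(\<Sum>x\<in>S. \<Sum>e\<in>avail E x. f x * (conduct q x (x + e) * (f x - f (x + e))))
           \<le> exp (log_ratio q \<bullet> real_site z) * f z"
proof -
  let ?m = "\<lambda>x. exp (log_ratio q \<bullet> real_site x) * (\<Sum>e\<in>avail E x. pmf q e)"
  have m0: "?m x \<ge> 0" for x by (intro mult_nonneg_nonneg sum_nonneg) auto
  have eq: "(\<Sum>e\<in>avail E x. f x * (conduct q x (x + e) * (f x - f (x + e))))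
      = ?m x * f x * (ret E q z 0 x - ret E q z N x)" (is "?l = ?r") for x
  proof (cases "avail E x = {}")
    case False
    then obtain e where e: "e \<in> avail E x" by auto
    then have s: "(\<Sum>e\<in>avail E x. pmf q e) > 0"
      using pos avail_subset by (intro sum_pos2[of _ e]) auto
    have "?l = exp (log_ratio q \<bullet> real_site x) * f x *
        ((\<Sum>e\<in>avail E x. pmf q e) * f x - (\<Sum>e\<in>avail E x. pmf q e * f (x + e)))"
      by (simp add: conduct_def sum_distrib_left sum_distrib_right sum_subtractf right_diff_distrib
          mult_ac)
    also have "(\<Sum>e\<in>avail E x. pmf q e * f (x + e)) = (\<Sum>e\<in>avail E x. pmf q e)
        * (\<Sum>e\<in>avail E x. pmf q e / (\<Sum>e\<in>avail E x. pmf q e) * f (x + e))"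
      using s by (simp add: sum_divide_distrib[symmetric])
    also have "(\<Sum>e\<in>avail E x. pmf q e) * f x - \<dots>
        = (\<Sum>e\<in>avail E x. pmf q e) * (ret E q z 0 x - ret E q z N x)"
      unfolding f_def by (simp only: green_step[symmetric] right_diff_distrib)
    finally show ?thesis by (simp add: mult_ac)
  qed simp
  have m1: "?m z \<le> exp (log_ratio q \<bullet> real_site z)"
  proof -
    have "(\<Sum>e\<in>avail E z. pmf q e) \<le> 1"
      by (subst measure_measure_pmf_finite[symmetric]) auto
    then show ?thesis by simp
  qed
  have f0: "f x \<ge> 0" for x by (simp add: f_def green_nonneg)
  have "(\<Sum>x\<in>S. \<Sum>e\<in>avail E x. f x * (conduct q x (x + e) * (f x - f (x + e))))
      \<le> (\<Sum>x\<in>S. ?m x * f x * ret E q z 0 x)"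
    unfolding eq by (intro sum_mono mult_left_mono mult_nonneg_nonneg m0 f0) (simp add: ret_nonneg)
  also have "\<dots> = (\<Sum>x\<in>S. if x = z then ?m z * f z else 0)"
    by (intro sum.cong) auto
  also have "\<dots> \<le> ?m z * f z"
    using S(1) m0[of z] f0[of z] by (simp add: sum.delta)
  also have "\<dots> \<le> exp (log_ratio q \<bullet> real_site z) * f z"
    by (intro mult_right_mono m1 f0)
  finally show ?thesis .
qed

text \<open>A shortest path from \<open>y\<close> to a vertex outside \<open>S\<close> repeats no
  vertex, as cutting out a loop would shorten it. Injectivity matters later, when weights along the
  path are summed with each vertex counted once.\<close>

lemma simple_path_exists:
  assumes inf: "infinite (cluster E y)" and S: "finite S"
  shows "\<exists>v r. v 0 = y \<and> v r \<notin> S \<and> inj_on v {..r} \<and> (\<forall>k<r. (v k, v (Suc k)) \<in> adj E)"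
proof -
  have "\<exists>z\<in>cluster E y. z \<notin> S"
    using S inf by (meson finite_subset subsetI)
  then obtain z where z: "(y, z) \<in> (adj E)\<^sup>*" "z \<notin> S" by (auto simp: cluster_def)
  then have ex: "\<exists>n. (y, z) \<in> adj E ^^ n" by (simp add: rtrancl_power)
  define r where "r = (LEAST n. (y, z) \<in> adj E ^^ n)"
  have r: "(y, z) \<in> adj E ^^ r" using LeastI_ex[OF ex] by (simp add: r_def)
  have min: "n \<ge> r" if "(y, z) \<in> adj E ^^ n" for n
    using Least_le[of "\<lambda>n. (y, z) \<in> adj E ^^ n", OF that] by (simp add: r_def)
  from r obtain v where v: "v 0 = y" "v r = z" "\<And>i. i < r \<Longrightarrow> (v i, v (Suc i)) \<in> adj E"
    by (auto simp: relpow_fun_conv)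
  have seg: "(v i, v j) \<in> adj E ^^ (j - i)" if "i \<le> j" "j \<le> r" for i j
    unfolding relpow_fun_conv
    by (rule exI[of _ "\<lambda>k. v (i + k)"]) (use that v in auto)
  have "v i \<noteq> v j" if "i < j" "j \<le> r" for i j
  proof
    assume eq: "v i = v j"
    have "(y, v i) \<in> adj E ^^ i" "(v j, z) \<in> adj E ^^ (r - j)"
      using seg[of 0 i] seg[of j r] v that by auto
    then have "(y, z) \<in> adj E ^^ (i + (r - j))"
      using eq by (auto simp: relpow_add)
    with min[of "i + (r - j)"] that show False by auto
  qed
  then have "inj_on v {..r}"
    by (auto simp: inj_on_def) (metis nat_neq_iff)
  with v z show ?thesis by auto
qed

text \<open>The value at \<open>y\<close> is the potential drop along a simple path that leaves the
  finite support. By the Cauchy-Schwarz inequality its square is at most the resistance of the path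
  times the energy of \<open>f\<close>; the weights control the resistance and
  \<open>green_dirichlet\<close> the energy.\<close>

lemma green_sq_bound:
  assumes pos: "\<And>e. e \<in> unit_steps \<Longrightarrow> pmf q e > 0"
    and a: "a > 0" "\<And>e. e \<in> unit_steps \<Longrightarrow> pmf q e \<ge> a"
    and inf: "infinite (cluster E y)"
    and res: "\<And>F. finite F \<Longrightarrow> F \<subseteq> {x. avail E x \<noteq> {}} \<Longrightarrow>
                (\<Sum>x\<in>F. exp (- (log_ratio q \<bullet> real_site x))) \<le> C"
  shows "(green E q z N y)\<^sup>2 \<le> C / a * (exp (log_ratio q \<bullet> real_site z) * green E q z N z)"
proof -
  define f where "f = green E q z N"
  define T where "T = {x. f x \<noteq> 0}"
  have T: "finite T" unfolding T_def f_def by (rule finite_green_support)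
  \<comment> \<open>The support together with its neighbours, so that both ends of every edge with a
    nonzero potential difference lie in \<open>S\<close>.\<close>
  define S where "S = T \<union> (\<lambda>(x, e). x + e) ` (T \<times> unit_steps)"
  have S: "finite S" using T by (auto simp: S_def)
  define Q where "Q = {(x, y) \<in> S \<times> S. (x, y) \<in> adj E}"
  have Q: "finite Q" using S by (auto simp: Q_def intro: finite_subset[of _ "S \<times> S"])
  \<comment> \<open>Each edge occurs in both orientations, so \<open>D\<close> is twice the
    Dirichlet energy.\<close>
  define D where "D = (\<Sum>(x, y)\<in>Q. conduct q x y * (f x - f y)\<^sup>2)"
  have swapQ: "bij_betw prod.swap Q Q"
    using sym_adj[of E] by (auto simp: bij_betw_def Q_def image_iff sym_def)
  have adjD: "conduct q x y = conduct q y x" if "(x, y) \<in> adj E" for x y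
    by (rule conduct_commute[OF pos]) (use that avail_subset in \<open>auto simp: adj_def\<close>)
  have cpos: "conduct q x y > 0" if "(x, y) \<in> adj E" for x y
    using that avail_subset pos by (fastforce simp: adj_def conduct_def)
  have "(\<Sum>x\<in>S. \<Sum>e\<in>avail E x. f x * (conduct q x (x + e) * (f x - f (x + e))))
      = (\<Sum>x\<in>T. \<Sum>e\<in>avail E x. f x * (conduct q x (x + e) * (f x - f (x + e))))"
    using S by (intro sum.mono_neutral_right) (auto simp: S_def T_def)
  also have "\<dots> = (\<Sum>(x, e)\<in>Sigma T (avail E). f x * (conduct q x (x + e) * (f x - f (x + e))))"
    using T by (subst sum.Sigma) auto
  also have "\<dots> = (\<Sum>(x, y)\<in>{(x, y)\<in>Q. x \<in> T}. f x * (conduct q x y * (f x - f y)))"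
    by (rule sum.reindex_bij_witness[where i = "\<lambda>(x, y). (x, y - x)" and j = "\<lambda>(x, e). (x, x + e)"])
       (use avail_subset in \<open>auto simp: Q_def S_def adj_def intro!: image_eqI[of _ _ "(_, _)"]\<close>)
  also have "\<dots> = (\<Sum>(x, y)\<in>Q. f x * (conduct q x y * (f x - f y)))"
    using Q by (intro sum.mono_neutral_left) (auto simp: T_def)
  finally have half1: "(\<Sum>(x, y)\<in>Q. f x * (conduct q x y * (f x - f y)))
      \<le> exp (log_ratio q \<bullet> real_site z) * f z" (is "?A \<le> _")
    using green_dirichlet[OF pos S, of E z N] by (auto simp: f_def[symmetric] S_def T_def)
  \<comment> \<open>Reversing all edges maps \<open>Q\<close> to itself and exchanges
    \<open>x\<close> and \<open>y\<close> in the summand; adding the two versions produces the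
    squares in \<open>D\<close>.\<close>
  have "?A = (\<Sum>(x, y)\<in>Q. f y * (conduct q x y * (f y - f x)))"
    by (subst sum.reindex_bij_betw[OF swapQ, symmetric])
       (intro sum.cong refl, clarsimp simp: Q_def dest!: adjD)
  then have "2 * ?A = (\<Sum>(x, y)\<in>Q. f x * (conduct q x y * (f x - f y)))
      + (\<Sum>(x, y)\<in>Q. f y * (conduct q x y * (f y - f x)))" by linarith
  also have "\<dots> = D"
    unfolding D_def sum.distrib[symmetric]
    by (intro sum.cong) (auto simp: power2_eq_square algebra_simps)
  finally have D: "D \<le> 2 * (exp (log_ratio q \<bullet> real_site z) * f z)" using half1 by linarith
  from simple_path_exists[OF inf T] obtain v r where v: "v 0 = y" "v r \<notin> T" "inj_on v {..r}"
      "\<And>k. k < r \<Longrightarrow> (v k, v (Suc k)) \<in> adj E" by blast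
  define g where "g k = f (v k) - f (v (Suc k))" for k
  define c where "c k = conduct q (v k) (v (Suc k))" for k
  have c: "c k > 0" if "k < r" for k using cpos v(4) that by (simp add: c_def)
  have "f y = (\<Sum>k<r. g k)"
    using v sum_lessThan_telescope'[of "\<lambda>k. f (v k)" r] by (simp add: g_def T_def)
  also have "\<dots> = (\<Sum>k<r. sqrt (1 / c k) * (sqrt (c k) * g k))"
    by (intro sum.cong refl) (use c in \<open>simp add: real_sqrt_divide\<close>, metis c less_irrefl)
  finally have "(f y)\<^sup>2 \<le> (\<Sum>k<r. (sqrt (1 / c k))\<^sup>2) * (\<Sum>k<r. (sqrt (c k) * g k)\<^sup>2)"
    using Cauchy_Schwarz_ineq_sum[of "\<lambda>k. sqrt (1 / c k)" "\<lambda>k. sqrt (c k) * g k" "{..<r}"] by simp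
  also have "(\<Sum>k<r. (sqrt (1 / c k))\<^sup>2) = (\<Sum>k<r. 1 / c k)"
    using c by (intro sum.cong refl) (auto simp: less_imp_le)
  also have "(\<Sum>k<r. (sqrt (c k) * g k)\<^sup>2) = (\<Sum>k<r. c k * (g k)\<^sup>2)"
    using c by (intro sum.cong refl) (auto simp: power_mult_distrib less_imp_le)
  finally have CS: "(f y)\<^sup>2 \<le> (\<Sum>k<r. 1 / c k) * (\<Sum>k<r. c k * (g k)\<^sup>2)" .
  have R: "(\<Sum>k<r. 1 / c k) \<le> C / a"
  proof -
    have "1 / c k \<le> exp (- (log_ratio q \<bullet> real_site (v k))) / a" if "k < r" for k
    proof -
      have "pmf q (v (Suc k) - v k) \<ge> a"
        using v(4)[OF that] avail_subset a(2) by (auto simp: adj_def)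
      then have "exp (log_ratio q \<bullet> real_site (v k)) * a \<le> c k"
        by (simp add: c_def conduct_def)
      then have "1 / c k \<le> 1 / (exp (log_ratio q \<bullet> real_site (v k)) * a)"
        using a by (intro divide_left_mono) (auto simp: c that)
      then show ?thesis by (simp add: exp_minus field_simps)
    qed
    moreover have lt: "{..<r} \<subseteq> {..r}" by auto
    ultimately have "(\<Sum>k<r. 1 / c k) \<le> (\<Sum>k<r. exp (- (log_ratio q \<bullet> real_site (v k))) / a)"
      by (intro sum_mono) auto
    also have "\<dots> = (\<Sum>x\<in>v ` {..<r}. exp (- (log_ratio q \<bullet> real_site x))) / a"
      using inj_on_subset[OF v(3) lt]
      by (subst sum.reindex) (simp_all add: sum_divide_distrib)
    also have "\<dots> \<le> C / a"
      using a v(4) by (intro divide_right_mono res) (auto simp: adj_def)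
    finally show ?thesis .
  qed
  \<comment> \<open>The path may run outside \<open>Q\<close> where \<open>f\<close> vanishes, so
    only its edges with a nonzero difference are compared with \<open>D\<close>. They are counted in
    both orientations, which cancels the factor 2 in the bound on \<open>D\<close>.\<close>
  define K where "K = {k. k < r \<and> g k \<noteq> 0}"
  define A where "A = (\<lambda>k. (v k, v (Suc k))) ` K"
  have inj: "v i = v j \<longleftrightarrow> i = j" if "i \<le> r" "j \<le> r" for i j
    using v(3) that by (auto simp: inj_on_def)
  have injA: "inj_on (\<lambda>k. (v k, v (Suc k))) K" "inj_on (\<lambda>k. (v (Suc k), v k)) K"
    by (auto simp: inj_on_def K_def inj)
  have AQ: "A \<subseteq> Q"
  proof
    fix w assume "w \<in> A"
    then obtain k where k: "w = (v k, v (Suc k))" "k < r" "g k \<noteq> 0" by (auto simp: A_def K_def)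
    have e: "v (Suc k) - v k \<in> unit_steps" using v(4)[OF k(2)] avail_subset by (auto simp: adj_def)
    from k(3) have "v k \<in> T \<or> v (Suc k) \<in> T" by (auto simp: T_def g_def)
    then have "v k \<in> S \<and> v (Suc k) \<in> S"
    proof
      assume "v k \<in> T"
      then show ?thesis using e
        by (auto simp: S_def intro!: image_eqI[of _ _ "(v k, v (Suc k) - v k)"])
    next
      assume "v (Suc k) \<in> T"
      then show ?thesis using uminus_unit_steps[OF e]
        by (auto simp: S_def intro!: image_eqI[of _ _ "(v (Suc k), v k - v (Suc k))"])
    qed
    then show "w \<in> Q" using k v(4) by (auto simp: Q_def)
  qed
  have BQ: "prod.swap ` A \<subseteq> Q" using AQ bij_betw_imp_surj_on[OF swapQ] by blast
  have disj: "A \<inter> prod.swap ` A = {}"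
    by (auto simp: A_def K_def inj)
  have sA: "(\<Sum>(x, y)\<in>A. conduct q x y * (f x - f y)\<^sup>2) = (\<Sum>k\<in>K. c k * (g k)\<^sup>2)"
    unfolding A_def by (subst sum.reindex[OF injA(1)]) (simp add: c_def g_def)
  have sB: "(\<Sum>(x, y)\<in>prod.swap ` A. conduct q x y * (f x - f y)\<^sup>2) = (\<Sum>k\<in>K. c k * (g k)\<^sup>2)"
  proof -
    have "prod.swap ` A = (\<lambda>k. (v (Suc k), v k)) ` K" by (auto simp: A_def)
    moreover have "conduct q (v (Suc k)) (v k) = c k" if "k \<in> K" for k
      using adjD[OF v(4)[of k]] that by (simp add: K_def c_def)
    ultimately show ?thesis
      by (simp add: sum.reindex[OF injA(2)]) (simp add: g_def power2_commute)
  qed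
  have "2 * (\<Sum>k\<in>K. c k * (g k)\<^sup>2)
      = (\<Sum>(x, y)\<in>A \<union> prod.swap ` A. conduct q x y * (f x - f y)\<^sup>2)"
    using disj Q AQ BQ finite_subset by (subst sum.union_disjoint) (auto simp: sA sB)
  also have "\<dots> \<le> D"
    unfolding D_def using AQ BQ Q cpos
    by (intro sum_mono2) (auto simp: Q_def less_imp_le)
  also have "(\<Sum>k\<in>K. c k * (g k)\<^sup>2) = (\<Sum>k<r. c k * (g k)\<^sup>2)"
    by (intro sum.mono_neutral_left) (auto simp: K_def)
  finally have G: "(\<Sum>k<r. c k * (g k)\<^sup>2) \<le> exp (log_ratio q \<bullet> real_site z) * f z"
    using D by linarith
  have "(f y)\<^sup>2 \<le> C / a * (exp (log_ratio q \<bullet> real_site z) * f z)"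
  proof (rule order_trans[OF CS])
    have "0 \<le> (\<Sum>k<r. 1 / c k)" "0 \<le> (\<Sum>k<r. c k * (g k)\<^sup>2)"
      using c by (auto intro!: sum_nonneg simp: less_imp_le)
    then show "(\<Sum>k<r. 1 / c k) * (\<Sum>k<r. c k * (g k)\<^sup>2)
        \<le> C / a * (exp (log_ratio q \<bullet> real_site z) * f z)"
      using R G by (intro mult_mono) auto
  qed
  then show ?thesis by (simp add: f_def)
qed

lemma cluster_eq:
  assumes "z \<in> cluster E y" shows "cluster E z = cluster E y"
proof -
  have "(z, y) \<in> (adj E)\<^sup>*" using assms sym_rtrancl[OF sym_adj[of E]] by (auto simp: cluster_def dest: symD)
  with assms show ?thesis by (auto simp: cluster_def intro: rtrancl_trans)
qed

text \<open>On the diagonal, \<open>green_sq_bound\<close> has the value itself on the right, and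
  one factor cancels. The diagonal bound is then inserted on the right for a general start.\<close>

lemma green_bounded:
  assumes pos: "\<And>e. e \<in> unit_steps \<Longrightarrow> pmf q e > 0"
    and inf: "infinite (cluster E y)" and z: "z \<in> cluster E y"
    and res: "\<And>F. finite F \<Longrightarrow> F \<subseteq> {x. avail E x \<noteq> {}} \<Longrightarrow>
                (\<Sum>x\<in>F. exp (- (log_ratio q \<bullet> real_site x))) \<le> C"
  shows "\<exists>B. \<forall>N. green E q z N y \<le> B"
proof -
  define a where "a = Min (pmf q ` unit_steps)"
  have ne: "(unit_steps :: 'a site set) \<noteq> {}" by (auto simp: unit_steps_def)
  have a: "a > 0" "\<And>e. e \<in> unit_steps \<Longrightarrow> pmf q e \<ge> a"
    using pos ne by (auto simp: a_def)
  define b where "b = C / a * exp (log_ratio q \<bullet> real_site z)"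
  have b0: "b \<ge> 0" using res[of "{}"] a by (simp add: b_def)
  have 1: "green E q z N z \<le> b" for N
  proof -
    have "(green E q z N z)\<^sup>2 \<le> b * green E q z N z"
      using green_sq_bound[OF pos a, of E z C z N] inf res cluster_eq[OF z] by (simp add: b_def)
    then show ?thesis
      using green_nonneg[of E q z N z] b0 by (cases "green E q z N z = 0") (auto simp: power2_eq_square)
  qed
  have "green E q z N y \<le> b" for N
  proof -
    have "(green E q z N y)\<^sup>2 \<le> b * green E q z N z"
      using green_sq_bound[OF pos a inf res, of z N] by (simp add: b_def)
    also have "\<dots> \<le> b * b" by (intro mult_left_mono 1 b0)
    also have "\<dots> = b\<^sup>2" by (simp add: power2_eq_square)
    finally show ?thesis using b0 by (rule power2_le_imp_le)
  qed
  then show ?thesis by blast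
qed

section \<open>A walk driven by independent choices\<close>

abbreviation path_space :: "(nat \<Rightarrow> ('d::finite) site) measure" where
  "path_space \<equiv> PiM UNIV (\<lambda>_. count_space UNIV)"

text \<open>A choice function picks a step out of every set of available steps. Driving all walks by
  the same sequence of choice functions couples the walks on graphs that locally agree.\<close>

definition choice_pmf :: "('d::finite) site pmf \<Rightarrow> ('d site set \<Rightarrow> 'd site) pmf" where
  "choice_pmf q = Pi_pmf (Pow unit_steps) 0 (\<lambda>S. if S = {} then return_pmf 0 else cond_pmf q S)"

definition choices :: "('d::finite) site pmf \<Rightarrow> (nat \<Rightarrow> 'd site set \<Rightarrow> 'd site) measure" where
  "choices q = PiM UNIV (\<lambda>_. measure_pmf (choice_pmf q))"

primrec walk :: "('d::finite) site set set \<Rightarrow> 'd site \<Rightarrow> (nat \<Rightarrow> 'd site set \<Rightarrow> 'd site) \<Rightarrow> nat \<Rightarrow> 'd site" where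
  "walk E x u 0 = x"
| "walk E x u (Suc n) = walk E x u n + u n (avail E (walk E x u n))"

definition elliptic :: "('d::finite) site pmf \<Rightarrow> bool" where
  "elliptic q \<longleftrightarrow> set_pmf q = unit_steps"

definition valid_choices :: "(nat \<Rightarrow> ('d::finite) site set \<Rightarrow> 'd site) \<Rightarrow> bool" where
  "valid_choices u \<longleftrightarrow> (\<forall>n S. S \<subseteq> unit_steps \<longrightarrow> S \<noteq> {} \<longrightarrow> u n S \<in> S)"

lemma space_path_space [simp]: "space path_space = UNIV"
  by (simp add: space_PiM)

lemma space_choices [simp]: "space (choices q) = UNIV"
  by (simp add: choices_def space_PiM)

lemma UNIV_in_sets_choices [simp]: "UNIV \<in> sets (choices q)"
  using sets.top[of "choices q"] by simp

lemma valid_choicesD: "valid_choices u \<Longrightarrow> avail E x \<noteq> {} \<Longrightarrow> u n (avail E x) \<in> avail E x"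
  using avail_subset[of E x] by (simp add: valid_choices_def)

lemma sequence_space_choices: "sequence_space (measure_pmf (choice_pmf q))"
  by (unfold_locales)

lemma prob_space_choices: "prob_space (choices q)"
  unfolding choices_def by (intro prob_space_PiM prob_space_measure_pmf)

lemma elliptic_pos: "elliptic q \<Longrightarrow> e \<in> unit_steps \<Longrightarrow> pmf q e > 0"
  by (simp add: elliptic_def pmf_positive)

lemma elliptic_zero: "elliptic q \<Longrightarrow> e \<notin> unit_steps \<Longrightarrow> pmf q e = 0"
  by (simp add: elliptic_def pmf_eq_0_set_pmf)

lemma elliptic_sum_pos:
  "elliptic q \<Longrightarrow> S \<subseteq> unit_steps \<Longrightarrow> S \<noteq> {} \<Longrightarrow> (\<Sum>e\<in>S. pmf q e) > 0"
  by (intro sum_pos) (auto intro: finite_subset elliptic_pos)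

lemma prob_choice:
  assumes q: "elliptic q" and S: "S \<subseteq> unit_steps" "S \<noteq> {}"
  shows "measure (measure_pmf (choice_pmf q)) {f. f S = e}
           = (if e \<in> S then pmf q e / (\<Sum>e\<in>S. pmf q e) else 0)"
proof -
  have "map_pmf (\<lambda>f. f S) (choice_pmf q) = cond_pmf q S"
    unfolding choice_pmf_def by (subst Pi_pmf_component) (use S in auto)
  moreover have "measure (measure_pmf (map_pmf (\<lambda>f. f S) (choice_pmf q))) {e}
      = measure (measure_pmf (choice_pmf q)) {f. f S = e}"
    by (subst measure_map_pmf) (auto intro!: arg_cong2[where f = measure])
  ultimately have "measure (measure_pmf (choice_pmf q)) {f. f S = e} = pmf (cond_pmf q S) e"
    by (simp add: measure_pmf_single)
  also have "\<dots> = (if e \<in> S then pmf q e / measure_pmf.prob q S else 0)"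
    by (rule pmf_cond) (use q S in \<open>auto simp: elliptic_def\<close>)
  also have "measure_pmf.prob q S = (\<Sum>e\<in>S. pmf q e)"
    using S by (intro measure_measure_pmf_finite) (auto intro: finite_subset)
  finally show ?thesis .
qed

lemma measurable_choice:
  assumes "u \<in> measurable N (choices q)"
  shows "(\<lambda>x. u x n S) \<in> measurable N (count_space UNIV)"
proof -
  have "(\<lambda>x. u x n) \<in> measurable N (measure_pmf (choice_pmf q))"
    using assms unfolding choices_def by measurable
  then show ?thesis
    by (rule measurable_compose) simp
qed

lemma AE_valid_choices:
  assumes q: "elliptic q" shows "AE u in choices q. valid_choices u"
proof -
  have "AE u in choices q. u n S \<in> S" if S: "S \<in> Pow unit_steps - {{}}" for n S
  proof -
    have "AE f in measure_pmf (choice_pmf q). f S \<in> S"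
    proof (rule AE_pmfI)
      fix f assume "f \<in> set_pmf (choice_pmf q)"
      then have "f S \<in> set_pmf (map_pmf (\<lambda>f. f S) (choice_pmf q))" by simp
      also have "map_pmf (\<lambda>f. f S) (choice_pmf q) = cond_pmf q S"
        unfolding choice_pmf_def by (subst Pi_pmf_component) (use S in auto)
      also have "set_pmf (cond_pmf q S) = S"
        by (subst set_cond_pmf) (use q S in \<open>auto simp: elliptic_def\<close>)
      finally show "f S \<in> S" .
    qed
    then show ?thesis
      unfolding choices_def by (intro AE_PiM_component prob_space_measure_pmf) auto
  qed
  then have "AE u in choices q. \<forall>S\<in>Pow unit_steps - {{}}. \<forall>n. u n S \<in> S"
    by (simp add: AE_finite_all AE_all_countable)
  then show ?thesis
    by eventually_elim (auto simp: valid_choices_def)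
qed

text \<open>The Markov property at a fixed time: a sequence of choices has the law of two
  independent sequences spliced at time \<open>t\<close>. The event sees only the first part, the
  shifted sequence only the second.\<close>

lemma choices_shift:
  assumes A: "A \<in> sets (choices q)" "\<And>u u'. (\<And>k. k < t \<Longrightarrow> u k = u' k) \<Longrightarrow> u \<in> A \<longleftrightarrow> u' \<in> A"
    and F [measurable]: "F \<in> borel_measurable (choices q)"
  shows "(\<integral>\<^sup>+u. indicator A u * F (\<lambda>k. u (t + k)) \<partial>choices q)
       = emeasure (choices q) A * (\<integral>\<^sup>+u. F u \<partial>choices q)"
proof -
  interpret sequence_space "measure_pmf (choice_pmf q)" by (rule sequence_space_choices)
  interpret Ch: prob_space "choices q" by (rule prob_space_choices)
  have U: "choices q = S" by (simp add: choices_def)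
  note [measurable] = A(1)
  have m: "(\<lambda>u k. u (t + k)) \<in> measurable (choices q) (choices q)"
    unfolding choices_def by (intro measurable_abs_UNIV measurable_component_singleton UNIV_I)
  have "(\<integral>\<^sup>+u. indicator A u * F (\<lambda>k. u (t + k)) \<partial>choices q)
      = (\<integral>\<^sup>+u. indicator A u * F (\<lambda>k. u (t + k))
           \<partial>distr (choices q \<Otimes>\<^sub>M choices q) (choices q) (\<lambda>(\<omega>, \<omega>'). comb_seq t \<omega> \<omega>'))"
    using PiM_comb_seq[of t] by (simp add: U)
  also have "\<dots> = (\<integral>\<^sup>+w. indicator A (case w of (\<omega>, \<omega>') \<Rightarrow> comb_seq t \<omega> \<omega>')
         * F (\<lambda>k. (case w of (\<omega>, \<omega>') \<Rightarrow> comb_seq t \<omega> \<omega>') (t + k)) \<partial>(choices q \<Otimes>\<^sub>M choices q))"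
    by (rule nn_integral_distr)
       (use measurable_comb_seq[of t "measure_pmf (choice_pmf q)"] in \<open>simp add: U\<close>,
        use A(1) measurable_compose[OF m F] in simp)
  also have "\<dots> = (\<integral>\<^sup>+w. indicator A (fst w) * F (snd w) \<partial>(choices q \<Otimes>\<^sub>M choices q))"
  proof (rule nn_integral_cong)
    fix w :: "(nat \<Rightarrow> 'a site set \<Rightarrow> 'a site) \<times> (nat \<Rightarrow> 'a site set \<Rightarrow> 'a site)"
    obtain a b where w: "w = (a, b)" by (cases w)
    have "comb_seq t a b \<in> A \<longleftrightarrow> a \<in> A"
      by (rule A(2)) (simp add: comb_seq_less)
    moreover have "(\<lambda>k. comb_seq t a b (t + k)) = b"
      using comb_seq_add[of t a b] by (simp add: add.commute)
    ultimately show "indicator A (case w of (\<omega>, \<omega>') \<Rightarrow> comb_seq t \<omega> \<omega>')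
         * F (\<lambda>k. (case w of (\<omega>, \<omega>') \<Rightarrow> comb_seq t \<omega> \<omega>') (t + k)) = indicator A (fst w) * F (snd w)"
      by (simp add: w indicator_def)
  qed
  also have "\<dots> = (\<integral>\<^sup>+a. \<integral>\<^sup>+b. indicator A a * F b \<partial>choices q \<partial>choices q)"
    by (subst Ch.nn_integral_fst[symmetric]) auto
  also have "\<dots> = (\<integral>\<^sup>+a. indicator A a * (\<integral>\<^sup>+b. F b \<partial>choices q) \<partial>choices q)"
    by (simp add: nn_integral_cmult)
  also have "\<dots> = emeasure (choices q) A * (\<integral>\<^sup>+u. F u \<partial>choices q)"
    by (subst nn_integral_multc) (simp_all add: A(1))
  finally show ?thesis .
qed

lemma measurable_shift_choices [measurable]:
  "(\<lambda>u k. u (t + k)) \<in> measurable (choices q) (choices q)"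
  unfolding choices_def by (intro measurable_abs_UNIV measurable_component_singleton UNIV_I)

text \<open>The available set has finitely many possible values, and each is decided by the presence
  of finitely many edges. This is what allows the graph of a measurable walk to be random.\<close>

lemma measurable_avail:
  assumes "\<And>e. {x \<in> space N. e \<in> E x} \<in> sets N"
  shows "(\<lambda>x. avail (E x) y) \<in> measurable N (count_space (Pow unit_steps))"
proof (subst measurable_count_space_eq2)
  have "(\<lambda>x. avail (E x) y) -` {S} \<inter> space N \<in> sets N" if "S \<subseteq> unit_steps" for S
  proof -
    have "(\<lambda>x. avail (E x) y) -` {S} \<inter> space N
        = {x \<in> space N. \<forall>e\<in>unit_steps. {y, y + e} \<in> E x \<longleftrightarrow> e \<in> S}"
      using that by (auto simp: avail_def)
    also have "\<dots> \<in> sets N"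
      using assms by (intro sets.sets_Collect_finite_All sets.sets_Collect) auto
    finally show ?thesis .
  qed
  then show "(\<lambda>x. avail (E x) y) \<in> space N \<rightarrow> Pow unit_steps \<and>
      (\<forall>S\<in>Pow unit_steps. (\<lambda>x. avail (E x) y) -` {S} \<inter> space N \<in> sets N)"
    by (auto simp: avail_def)
qed auto

lemma measurable_walk_at:
  assumes E: "\<And>e. {x \<in> space N. e \<in> E x} \<in> sets N"
    and u: "u \<in> measurable N (choices q)"
  shows "(\<lambda>x. walk (E x) z (u x) n) \<in> measurable N (count_space UNIV)"
proof (induction n)
  case (Suc n)
  have "(\<lambda>x. y + u x n (avail (E x) y)) \<in> measurable N (count_space UNIV)" for y
  proof (rule measurable_compose_countable'[OF _ measurable_avail[OF E]])
    fix S show "(\<lambda>x. y + u x n S) \<in> measurable N (count_space UNIV)"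
      using measurable_choice[OF u] by (rule measurable_compose) simp
  qed (auto simp: countable_finite)
  note * = measurable_compose_countable[where f = "\<lambda>y x. y + u x n (avail (E x) y)"
      and g = "\<lambda>x. walk (E x) z (u x) n" and M = N and N = "count_space UNIV", OF this Suc]
  show ?case unfolding walk.simps by (rule *)
qed simp

lemma measurable_walk:
  assumes "\<And>e. {x \<in> space N. e \<in> E x} \<in> sets N" and "u \<in> measurable N (choices q)"
  shows "(\<lambda>x. walk (E x) z (u x)) \<in> measurable N path_space"
  using measurable_walk_at[OF assms] by (rule measurable_abs_UNIV)

lemma measurable_walk_choices [measurable]: "walk E z \<in> measurable (choices q) path_space"
  by (rule measurable_walk[where u = "\<lambda>u. u" and q = q]) auto

lemma sets_walk_at [measurable]: "{u. walk E x u n = z} \<in> sets (choices q)"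
proof -
  have "(\<lambda>u. walk E x u n) \<in> measurable (choices q) (count_space UNIV)"
    by (rule measurable_walk_at[where u = "\<lambda>u. u" and q = q]) auto
  from measurable_sets[OF this, of "{z}"] show ?thesis by (simp add: vimage_def)
qed

lemma walk_add: "walk E x u (t + k) = walk E (walk E x u t) (\<lambda>j. u (t + j)) k"
  by (induction k) auto

lemma walk_cong: "(\<And>j. j < n \<Longrightarrow> u j = u' j) \<Longrightarrow> k \<le> n \<Longrightarrow> walk E x u k = walk E x u' k"
  by (induction k) auto

lemma walk_adj:
  assumes "valid_choices u" "avail E x \<noteq> {}"
  shows "avail E (walk E x u n) \<noteq> {} \<and> walk E x u (Suc n) - walk E x u n \<in> avail E (walk E x u n)"
proof (induction n)
  case 0
  then show ?case using valid_choicesD[OF assms] assms by simp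
next
  case (Suc n)
  then have "avail E (walk E x u (Suc n)) \<noteq> {}"
    using avail_uminus[of _ E "walk E x u n"] by auto
  then show ?case using valid_choicesD[OF assms(1)] by simp
qed

lemma walk_in_cluster:
  assumes "valid_choices u" "avail E x \<noteq> {}"
  shows "walk E x u n \<in> cluster E x"
proof (induction n)
  case (Suc n)
  then show ?case
    using walk_adj[OF assms, of n] by (auto simp: cluster_def adj_def intro: rtrancl_into_rtrancl)
qed (simp add: cluster_def)

text \<open>The walk after its first step is driven by the shifted choices, which are independent of
  the first one, and this is the recursion of \<open>ret\<close>.\<close>

lemma prob_walk_at:
  assumes q: "elliptic q" and "avail E x \<noteq> {}"
  shows "measure (choices q) {u. walk E x u n = z} = ret E q z n x"
  using assms(2)
proof (induction n arbitrary: x)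
  case 0
  then show ?case using prob_space.prob_space[OF prob_space_choices, of q] by auto
next
  case (Suc n)
  interpret Ch: prob_space "choices q" by (rule prob_space_choices)
  let ?A = "\<lambda>e. {u. u 0 (avail E x) = e}"
  let ?B = "\<lambda>e. {u. walk E (x + e) (\<lambda>j. u (1 + j)) n = z}"
  have A [measurable]: "?A e \<in> sets (choices q)" for e
    using measurable_sets[OF measurable_choice[of "\<lambda>u. u" "choices q" q 0 "avail E x"], of "{e}"]
    by (simp add: vimage_def)
  have B [measurable]: "?B e \<in> sets (choices q)" for e
    using measurable_sets[OF measurable_shift_choices[of 1 q] sets_walk_at[of E "x + e" n z q]]
    by (simp add: vimage_def)
  have pA: "measure (choices q) (?A e) = measure (measure_pmf (choice_pmf q)) {f. f (avail E x) = e}"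
    for e
  proof -
    interpret sequence_space "measure_pmf (choice_pmf q)" by (rule sequence_space_choices)
    have "measure (choices q) (prod_emb UNIV (\<lambda>_. measure_pmf (choice_pmf q)) {0::nat}
        (Pi\<^sub>E {0} (\<lambda>_. {f. f (avail E x) = e}))) = measure (measure_pmf (choice_pmf q)) {f. f (avail E x) = e}"
      unfolding choices_def by (subst measure_PiM_emb) auto
    also have "prod_emb UNIV (\<lambda>_. measure_pmf (choice_pmf q)) {0::nat}
        (Pi\<^sub>E {0} (\<lambda>_. {f. f (avail E x) = e})) = ?A e"
      by (rule set_eqI) (simp add: prod_emb_def PiE_iff)
    finally show ?thesis .
  qed
  have split: "AE u in choices q. u \<in> {u. walk E x u (Suc n) = z} \<longleftrightarrow> u \<in> (\<Union>e\<in>avail E x. ?A e \<inter> ?B e)"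
    using AE_valid_choices[OF q]
  proof eventually_elim
    case (elim u)
    have "u 0 (avail E x) \<in> avail E x"
      using elim Suc.prems by (rule valid_choicesD)
    then show ?case using walk_add[of E x u 1 n] by auto
  qed
  have "measure (choices q) {u. walk E x u (Suc n) = z}
      = measure (choices q) (\<Union>e\<in>avail E x. ?A e \<inter> ?B e)"
  proof (rule Ch.finite_measure_eq_AE[OF split sets_walk_at])
    show "(\<Union>e\<in>avail E x. ?A e \<inter> ?B e) \<in> sets (choices q)"
      by (intro sets.finite_UN finite_avail sets.Int A B)
  qed
  also have "\<dots> = (\<Sum>e\<in>avail E x. measure (choices q) (?A e \<inter> ?B e))"
  proof (rule Ch.finite_measure_finite_Union)
    show "disjoint_family_on (\<lambda>e. ?A e \<inter> ?B e) (avail E x)"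
      by (auto simp: disjoint_family_on_def)
  qed (use A B in blast)+
  also have "\<dots> = (\<Sum>e\<in>avail E x. measure (choices q) (?A e) * ret E q z n (x + e))"
  proof (rule sum.cong)
    fix e assume e: "e \<in> avail E x"
    have "emeasure (choices q) (?A e \<inter> ?B e) = (\<integral>\<^sup>+u. indicator (?A e \<inter> ?B e) u \<partial>choices q)"
      by (rule nn_integral_indicator[symmetric, OF sets.Int[OF A B]])
    also have "\<dots> = (\<integral>\<^sup>+u. indicator (?A e) u
        * indicator {u. walk E (x + e) u n = z} (\<lambda>k. u (1 + k)) \<partial>choices q)"
      by (intro nn_integral_cong) (simp add: indicator_def)
    also have "\<dots> = emeasure (choices q) (?A e) * (\<integral>\<^sup>+u. indicator {u. walk E (x + e) u n = z} u \<partial>choices q)"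
      by (rule choices_shift[OF A _ borel_measurable_indicator[OF sets_walk_at]]) simp
    also have "(\<integral>\<^sup>+u. indicator {u. walk E (x + e) u n = z} u \<partial>choices q)
        = emeasure (choices q) {u. walk E (x + e) u n = z}"
      by (rule nn_integral_indicator[OF sets_walk_at])
    finally have "measure (choices q) (?A e \<inter> ?B e)
        = measure (choices q) (?A e) * measure (choices q) {u. walk E (x + e) u n = z}"
      by (simp add: measure_def enn2real_mult)
    also have "measure (choices q) {u. walk E (x + e) u n = z} = ret E q z n (x + e)"
      by (rule Suc.IH) (use avail_uminus[OF e] in auto)
    finally show "measure (choices q) (?A e \<inter> ?B e) = measure (choices q) (?A e) * ret E q z n (x + e)" .
  qed simp
  also have "\<dots> = ret E q z (Suc n) x"
    unfolding pA ret.simps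
    by (intro sum.cong refl) (subst prob_choice[OF q avail_subset Suc.prems], auto)
  finally show ?case .
qed

lemma step_prob_elliptic:
  assumes "elliptic q"
  shows "step_prob G q x y
    = (if y - x \<in> avail (snd G) x then pmf q (y - x) / (\<Sum>e\<in>avail (snd G) x. pmf q e) else 0)"
  using assms by (auto simp: step_prob_def avail_def elliptic_zero)

text \<open>As long as the walk has followed \<open>w\<close>, its next choice is made from the set
  available at the known vertex \<open>w k\<close>. The event is thus a cylinder of the product
  measure.\<close>

lemma prob_walk_prefix:
  assumes q: "elliptic q" and "avail (snd G) 0 \<noteq> {}"
  shows "measure (choices q) {u. \<forall>k\<le>n. walk (snd G) 0 u k = w k} = path_prob G q n w"
proof (cases "w 0 = 0")
  case False
  then have "{u. \<forall>k\<le>n. walk (snd G) 0 u k = w k} = {}" by fastforce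
  then show ?thesis using False by (simp only: path_prob_def measure_empty if_False)
next
  case True
  let ?X = "\<lambda>k. {f. f (avail (snd G) (w k)) = w (Suc k) - w k}"
  interpret sequence_space "measure_pmf (choice_pmf q)" by (rule sequence_space_choices)
  have iff: "(\<forall>k\<le>n. walk (snd G) 0 u k = w k)
      \<longleftrightarrow> (\<forall>k<n. u k (avail (snd G) (w k)) = w (Suc k) - w k)" for u
  proof (induction n)
    case (Suc n)
    have "(\<forall>k\<le>Suc n. walk (snd G) 0 u k = w k) \<longleftrightarrow>
        (\<forall>k\<le>n. walk (snd G) 0 u k = w k) \<and> walk (snd G) 0 u (Suc n) = w (Suc n)"
      by (auto simp: le_Suc_eq)
    also have "\<dots> \<longleftrightarrow> (\<forall>k\<le>n. walk (snd G) 0 u k = w k)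
        \<and> u n (avail (snd G) (w n)) = w (Suc n) - w n"
      by (auto simp: algebra_simps)
    also have "\<dots> \<longleftrightarrow> (\<forall>k<Suc n. u k (avail (snd G) (w k)) = w (Suc k) - w k)"
      unfolding Suc by (auto simp: less_Suc_eq)
    finally show ?case .
  qed (simp add: True)
  have "{u. \<forall>k\<le>n. walk (snd G) 0 u k = w k}
      = prod_emb UNIV (\<lambda>_. measure_pmf (choice_pmf q)) {..<n} (Pi\<^sub>E {..<n} ?X)"
  proof (rule set_eqI)
    fix u
    show "u \<in> {u. \<forall>k\<le>n. walk (snd G) 0 u k = w k} \<longleftrightarrow>
        u \<in> prod_emb UNIV (\<lambda>_. measure_pmf (choice_pmf q)) {..<n} (Pi\<^sub>E {..<n} ?X)"
      unfolding mem_Collect_eq iff by (simp add: prod_emb_def PiE_iff Ball_def)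
  qed
  then have "measure (choices q) {u. \<forall>k\<le>n. walk (snd G) 0 u k = w k}
      = (\<Prod>k<n. measure (measure_pmf (choice_pmf q)) (?X k))"
    unfolding choices_def by (simp add: measure_PiM_emb)
  \<comment> \<open>The second conjunct strengthens the induction: \<open>prob_choice\<close>
    requires a nonempty set, and the available sets along \<open>w\<close> are nonempty as long as
    the product has not vanished.\<close>
  also have "\<dots> = (\<Prod>k<n. step_prob G q (w k) (w (Suc k))) \<and>
      ((\<Prod>k<n. step_prob G q (w k) (w (Suc k))) \<noteq> 0 \<longrightarrow> avail (snd G) (w n) \<noteq> {})"
  proof (induction n)
    case 0
    then show ?case using assms(2) True by simp
  next
    case (Suc n)
    show ?case
    proof (cases "(\<Prod>k<n. step_prob G q (w k) (w (Suc k))) = 0")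
      case False
      then have "avail (snd G) (w n) \<noteq> {}" using Suc by blast
      then have "measure (measure_pmf (choice_pmf q)) (?X n) = step_prob G q (w n) (w (Suc n))"
        by (simp add: prob_choice[OF q avail_subset] step_prob_elliptic[OF q])
      moreover have "avail (snd G) (w (Suc n)) \<noteq> {}"
        if "step_prob G q (w n) (w (Suc n)) \<noteq> 0"
        using that avail_uminus[of "w (Suc n) - w n" "snd G" "w n"]
        by (auto simp: step_prob_elliptic[OF q] split: if_splits)
      ultimately show ?thesis using Suc by auto
    qed (use Suc in auto)
  qed
  finally show ?thesis using True by (simp add: path_prob_def)
qed

section \<open>Levels and regenerations\<close>

definition lattice_path :: "(nat \<Rightarrow> ('d::finite) site) \<Rightarrow> bool" where
  "lattice_path y \<longleftrightarrow> y 0 = 0 \<and> (\<forall>n. y (Suc n) - y n \<in> unit_steps)"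

definition hit :: "'d \<Rightarrow> nat \<Rightarrow> (nat \<Rightarrow> ('d::finite) site) \<Rightarrow> nat" where
  "hit j L y = (LEAST n. int L \<le> y n $ j)"

text \<open>Existence of a hit is demanded explicitly because \<open>hit\<close> is arbitrary when
  the level is never reached.\<close>

definition reg :: "'d \<Rightarrow> nat \<Rightarrow> (nat \<Rightarrow> ('d::finite) site) \<Rightarrow> bool" where
  "reg j L y \<longleftrightarrow> (\<exists>n. int L \<le> y n $ j) \<and> (\<forall>k\<ge>hit j L y. int L \<le> y k $ j)"

definition post :: "'d \<Rightarrow> nat \<Rightarrow> (nat \<Rightarrow> ('d::finite) site) \<Rightarrow> nat \<Rightarrow> 'd site" where
  "post j L y = (\<lambda>k. y (hit j L y + k) - y (hit j L y))"

abbreviation stays :: "'d \<Rightarrow> (nat \<Rightarrow> ('d::finite) site) set" where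
  "stays j \<equiv> {y. \<forall>k. 0 \<le> y k $ j}"

definition trace_edges :: "(nat \<Rightarrow> ('d::finite) site) \<Rightarrow> 'd site set set" where
  "trace_edges y = range (\<lambda>n. {y n, y (Suc n)})"

text \<open>What a walk on the trace of a path sees after crossing a regeneration level of the path:
  the trace of the later part of the path and the edge that leads back.\<close>

definition half_trace :: "'d \<Rightarrow> (nat \<Rightarrow> ('d::finite) site) \<Rightarrow> 'd site set set" where
  "half_trace j y = insert {0, - axis j 1} (trace_edges y)"

definition weight :: "('d::finite) site pmf \<Rightarrow> 'd site \<Rightarrow> real" where
  "weight q x = exp (- (log_ratio q \<bullet> real_site x))"

text \<open>The properties of a path that make a walk on its trace transient. The bound on sums over
  images expresses summability of the weights over the range, each vertex counted once, in a form
  that can be shown measurable.\<close>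

definition nice :: "('d::finite) site pmf \<Rightarrow> 'd \<Rightarrow> (nat \<Rightarrow> 'd site) \<Rightarrow> bool" where
  "nice q j y \<longleftrightarrow> lattice_path y \<and> filterlim (\<lambda>n. y n $ j) at_top sequentially
     \<and> (\<exists>C. \<forall>n. (\<Sum>x\<in>y ` {..<n}. weight q x) \<le> C)"

lemma unit_step_height:
  assumes "e \<in> unit_steps" shows "\<bar>e $ j\<bar> \<le> 1" "e $ j = 1 \<Longrightarrow> e = axis j 1"
  using assms by (auto simp: unit_steps_def axis_def vec_eq_iff split: if_splits)

lemma lattice_pathD: "lattice_path y \<Longrightarrow> \<bar>y (Suc n) $ j - y n $ j\<bar> \<le> 1"
  using unit_step_height(1)[of "y (Suc n) - y n" j] by (simp add: lattice_path_def)

lemma lattice_path_height_le: "lattice_path y \<Longrightarrow> y n $ j \<le> int n"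
proof (induction n)
  case (Suc n)
  then show ?case using lattice_pathD[of y n j] by simp
qed (simp add: lattice_path_def)

lemma hit_ge: "\<exists>n. int L \<le> y n $ j \<Longrightarrow> int L \<le> y (hit j L y) $ j"
  unfolding hit_def by (rule LeastI_ex)

lemma hit_less: "k < hit j L y \<Longrightarrow> y k $ j < int L"
  unfolding hit_def using not_less_Least by fastforce

lemma hit_le: "int L \<le> y n $ j \<Longrightarrow> hit j L y \<le> n"
  unfolding hit_def by (rule Least_le)

lemma hit_height:
  assumes y: "lattice_path y" and ex: "\<exists>n. int L \<le> y n $ j"
  shows "y (hit j L y) $ j = int L"
proof (cases "hit j L y")
  case 0
  then show ?thesis using hit_ge[OF ex] y by (simp add: lattice_path_def)
next
  case (Suc k)
  then show ?thesis
    using hit_ge[OF ex] hit_less[of k j L y] lattice_pathD[OF y, of k j] by simp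
qed

lemma hit_pos:
  assumes "lattice_path y" "L \<ge> 1" "\<exists>n. int L \<le> y n $ j"
  shows "\<exists>k. hit j L y = Suc k"
  using hit_height[OF assms(1,3)] assms(1,2) by (cases "hit j L y") (auto simp: lattice_path_def)

lemma hit_ge_level:
  assumes "lattice_path y" "\<exists>n. int L \<le> y n $ j" shows "L \<le> hit j L y"
  using hit_height[OF assms] lattice_path_height_le[OF assms(1), of "hit j L y" j] by simp

text \<open>Heights change by at most 1, so a level can be entered only by the step
  \<open>axis j 1\<close>. This is why the edge leading back in \<open>half_trace\<close> is always
  the same one.\<close>

lemma hit_step:
  assumes y: "lattice_path y" and "\<exists>n. int L \<le> y n $ j" "hit j L y = Suc k"
  shows "y (hit j L y) = y k + axis j 1"
proof -
  have "y (Suc k) $ j - y k $ j = 1"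
    using hit_height[OF assms(1,2)] hit_less[of k j L y] lattice_pathD[OF y, of k j] assms(3) by simp
  then have "y (Suc k) - y k = axis j 1"
    using y by (intro unit_step_height) (auto simp: lattice_path_def)
  then show ?thesis using assms(3) by (simp add: algebra_simps)
qed

lemma lattice_path_post: "lattice_path y \<Longrightarrow> lattice_path (post j L y)"
  by (simp add: lattice_path_def post_def)

text \<open>Before level \<open>L\<close> is hit the path is also below \<open>L + m\<close>, so the
  search for \<open>L + m\<close> may start at the hitting time of \<open>L\<close>.\<close>

lemma hit_add:
  assumes y: "lattice_path y" and ex: "\<exists>n. int (L + m) \<le> y n $ j"
  shows "\<exists>k. int m \<le> post j L y k $ j"
    and "hit j (L + m) y = hit j L y + hit j m (post j L y)"
proof -
  obtain n where n: "int (L + m) \<le> y n $ j" using ex by blast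
  have exL: "\<exists>n. int L \<le> y n $ j" using n by (auto intro: exI[of _ n])
  have h: "y (hit j L y) $ j = int L" by (rule hit_height[OF y exL])
  have conv: "int (L + m) \<le> y k $ j \<longleftrightarrow> k \<ge> hit j L y \<and> int m \<le> post j L y (k - hit j L y) $ j" for k
    using hit_less[of k j L y] h by (cases "k < hit j L y") (auto simp: post_def)
  show ex': "\<exists>k. int m \<le> post j L y k $ j" using n conv by blast
  show "hit j (L + m) y = hit j L y + hit j m (post j L y)"
    unfolding hit_def[of j "L + m"]
  proof (rule Least_equality)
    show "int (L + m) \<le> y (hit j L y + hit j m (post j L y)) $ j"
      using conv hit_ge[OF ex'] by simp
  next
    fix k assume "int (L + m) \<le> y k $ j"
    then show "hit j L y + hit j m (post j L y) \<le> k"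
      using conv[of k] hit_le[of m "post j L y" "k - hit j L y" j] by linarith
  qed
qed

lemma post_post:
  assumes "lattice_path y" "\<exists>n. int (L + m) \<le> y n $ j"
  shows "post j m (post j L y) = post j (L + m) y"
  using hit_add(2)[OF assms] by (simp add: post_def fun_eq_iff add.assoc)

lemma reg_post:
  assumes y: "lattice_path y" and r: "\<exists>n. int L \<le> y n $ j"
  shows "reg j m (post j L y) \<longleftrightarrow> reg j (L + m) y"
proof -
  have h: "y (hit j L y) $ j = int L" by (rule hit_height[OF y r])
  have ex: "(\<exists>k. int m \<le> post j L y k $ j) \<longleftrightarrow> (\<exists>n. int (L + m) \<le> y n $ j)"
  proof
    assume "\<exists>k. int m \<le> post j L y k $ j"
    then obtain k where "int m \<le> post j L y k $ j" ..
    then show "\<exists>n. int (L + m) \<le> y n $ j"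
      using h by (intro exI[of _ "hit j L y + k"]) (simp add: post_def)
  qed (rule hit_add(1)[OF y])
  show ?thesis
  proof (cases "\<exists>n. int (L + m) \<le> y n $ j")
    case True
    have "(\<forall>k\<ge>hit j m (post j L y). int m \<le> post j L y k $ j)
        \<longleftrightarrow> (\<forall>k\<ge>hit j (L + m) y. int (L + m) \<le> y k $ j)"
    proof (intro iffI allI impI)
      fix k assume a: "\<forall>k\<ge>hit j m (post j L y). int m \<le> post j L y k $ j"
        and k: "hit j (L + m) y \<le> k"
      then have k': "k = hit j L y + (k - hit j L y)" "hit j m (post j L y) \<le> k - hit j L y"
        using hit_add(2)[OF y True] by auto
      with a have "int m \<le> post j L y (k - hit j L y) $ j" by blast
      then show "int (L + m) \<le> y k $ j" using h k'(1) by (simp add: post_def)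
    next
      fix k assume a: "\<forall>k\<ge>hit j (L + m) y. int (L + m) \<le> y k $ j"
        and k: "hit j m (post j L y) \<le> k"
      then have "int (L + m) \<le> y (hit j L y + k) $ j"
        using hit_add(2)[OF y True] by auto
      then show "int m \<le> post j L y k $ j" using h by (simp add: post_def)
    qed
    then show ?thesis using True ex by (simp add: reg_def)
  qed (use ex in \<open>simp add: reg_def\<close>)
qed

lemma pred_path: "Measurable.pred path_space (\<lambda>y. P (y k))"
proof -
  have "(\<lambda>y. y k) \<in> measurable path_space (count_space UNIV)"
    by (rule measurable_component_singleton) simp
  then show ?thesis by (rule measurable_compose) simp
qed

lemma measurable_hit [measurable]: "hit j L \<in> measurable path_space (count_space UNIV)"
  supply pred_path [measurable] unfolding hit_def by measurable

lemma pred_reg [measurable]: "Measurable.pred path_space (reg j L)"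
  supply pred_path [measurable] unfolding reg_def by measurable

lemma sets_stays [measurable]: "stays j \<in> sets path_space"
proof -
  have "Measurable.pred path_space (\<lambda>y. \<forall>k. 0 \<le> y k $ j)" supply pred_path [measurable] by measurable
  then show ?thesis by (simp add: pred_def)
qed

lemma measurable_post [measurable]:
  fixes j :: "'d::finite" shows "post j L \<in> measurable path_space path_space"
proof -
  have a: "(\<lambda>y. f (y n)) \<in> measurable path_space (count_space UNIV)" for f :: "'d site \<Rightarrow> 'd site" and n
  proof -
    have "(\<lambda>y. y n) \<in> measurable path_space (count_space UNIV)"
      by (rule measurable_component_singleton) simp
    then show ?thesis by (rule measurable_compose) simp
  qed
  have "(\<lambda>y::nat \<Rightarrow> 'd site. y (n + k) - y n) \<in> measurable path_space (count_space UNIV)" for n k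
  proof (rule measurable_compose_countable[where f = "\<lambda>z y. y (n + k) - z" and g = "\<lambda>y. y n"])
    fix z show "(\<lambda>y::nat \<Rightarrow> 'd site. y (n + k) - z) \<in> measurable path_space (count_space UNIV)"
      by (rule a[of "\<lambda>x. x - z"])
  qed (rule a[of "\<lambda>x. x"])
  then have "(\<lambda>y. y (hit j L y + k) - y (hit j L y)) \<in> measurable path_space (count_space UNIV)" for k
    by (rule measurable_compose_countable[where f = "\<lambda>n y. y (n + k) - y n" and g = "hit j L"])
       (rule measurable_hit)
  then have "(\<lambda>y k. y (hit j L y + k) - y (hit j L y)) \<in> measurable path_space path_space"
    by (rule measurable_abs_UNIV)
  then show ?thesis by (simp add: post_def[abs_def])
qed

section \<open>Coupling above a level and the strong Markov property\<close>

lemma lattice_path_walk: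
  "valid_choices u \<Longrightarrow> avail E 0 \<noteq> {} \<Longrightarrow> lattice_path (walk E 0 u)"
  using walk_adj[of u E 0] avail_subset unfolding lattice_path_def by (meson subsetD walk.simps(1))

text \<open>With common choices, two walks at corresponding vertices above the level read the same
  available set and take the same step. It is enough that one of the two stays up, since the
  induction shows that the other is at the corresponding vertex; both versions are needed to compare
  regeneration with \<open>stays\<close>.\<close>

lemma walk_couple:
  assumes "\<And>z. 0 \<le> z $ j \<Longrightarrow> avail E (c + z) = avail E' z"
    and "(\<forall>k. 0 \<le> walk E' 0 u k $ j) \<or> (\<forall>k. 0 \<le> (walk E c u k - c) $ j)"
  shows "walk E c u k = c + walk E' 0 u k"
proof (induction k)
  case (Suc k)
  have "walk E c u k - c = walk E' 0 u k" using Suc by simp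
  then have "0 \<le> walk E' 0 u k $ j"
    using assms(2) by metis
  with assms(1) Suc show ?case by simp
qed simp

text \<open>The strong Markov property at the hitting time of a level \<open>L\<close>; the walk on \<open>E'\<close> is the walk
  on \<open>E\<close> as seen from the point where the level is hit, as long as it does not go back.\<close>

lemma strong_markov:
  fixes F :: "(nat \<Rightarrow> ('d::finite) site) \<Rightarrow> ennreal"
  assumes q: "elliptic q" and E: "avail E 0 \<noteq> {}"
    and hits: "AE u in choices q. \<exists>n. int L \<le> walk E 0 u n $ j"
    and loc: "\<And>u z. valid_choices u \<Longrightarrow> \<exists>n. int L \<le> walk E 0 u n $ j \<Longrightarrow> 0 \<le> z $ j \<Longrightarrow>
                avail E (walk E 0 u (hit j L (walk E 0 u)) + z) = avail E' z"
    and F [measurable]: "F \<in> borel_measurable path_space"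
    and A [measurable]: "A \<in> sets (choices q)"
    and dep: "\<And>u u'. (\<And>k. k < n \<Longrightarrow> u k = u' k) \<Longrightarrow> u \<in> A \<longleftrightarrow> u' \<in> A"
    and nL: "n \<le> L"
  shows "(\<integral>\<^sup>+u. indicator A u * indicator {y. reg j L y} (walk E 0 u) * F (post j L (walk E 0 u)) \<partial>choices q)
       = emeasure (choices q) A
         * (\<integral>\<^sup>+u. indicator (stays j) (walk E' 0 u) * F (walk E' 0 u) \<partial>choices q)"
proof -
  define \<Phi> where "\<Phi> u = indicator (stays j) (walk E' 0 u) * F (walk E' 0 u)" for u
  \<comment> \<open>The event that the level is hit at time \<open>t\<close>. It is decided by the
    first \<open>t\<close> choices, so that \<open>choices_shift\<close> applies to each
    \<open>t\<close> separately.\<close>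
  define B where "B t = {u. (\<forall>k<t. walk E 0 u k $ j < int L) \<and> int L \<le> walk E 0 u t $ j}" for t
  \<comment> \<open>Nothing is lost by demanding \<open>n \<le> t\<close>: reaching level
    \<open>L\<close> takes at least \<open>L\<close> steps, and \<open>n \<le> L\<close>. The demand
    makes the event depend on the first \<open>t\<close> choices only.\<close>
  define At where "At t = (if n \<le> t then A \<inter> B t else {})" for t
  have \<Phi> [measurable]: "\<Phi> \<in> borel_measurable (choices q)"
    unfolding \<Phi>_def
    by (intro borel_measurable_times_ennreal measurable_compose[OF measurable_walk_choices]
        borel_measurable_indicator F sets_stays)
  have Bs: "B t \<in> sets (choices q)" for t
  proof -
    have "{y. (\<forall>k<t. y k $ j < int L) \<and> int L \<le> y t $ j} \<in> sets path_space"
    proof -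
      have "Measurable.pred path_space (\<lambda>y. (\<forall>k<t. y k $ j < int L) \<and> int L \<le> y t $ j)" supply pred_path [measurable] by measurable
      then show ?thesis by (simp add: pred_def)
    qed
    from measurable_sets[OF measurable_walk_choices[of E 0 q] this] show ?thesis
      by (simp add: B_def vimage_def)
  qed
  then have Ats: "At t \<in> sets (choices q)" for t by (simp add: At_def A sets.Int)
  have Bdep: "u \<in> B t \<longleftrightarrow> u' \<in> B t" if "\<And>k. k < t \<Longrightarrow> u k = u' k" for u u' t
  proof -
    have "walk E 0 u k = walk E 0 u' k" if "k \<le> t" for k
      by (rule walk_cong[of t]) (use \<open>\<And>k. k < t \<Longrightarrow> u k = u' k\<close> that in auto)
    then show ?thesis by (simp add: B_def)
  qed
  have Atdep: "u \<in> At t \<longleftrightarrow> u' \<in> At t" if "\<And>k. k < t \<Longrightarrow> u k = u' k" for u u' t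
  proof (cases "n \<le> t")
    case True
    then have "u \<in> A \<longleftrightarrow> u' \<in> A" by (intro dep) (use that in auto)
    then show ?thesis using Bdep[of t u u'] that by (simp add: At_def)
  qed (simp add: At_def)
  have Bhit: "u \<in> B t \<longleftrightarrow> t = hit j L (walk E 0 u)" if ex: "\<exists>n. int L \<le> walk E 0 u n $ j" for u t
  proof
    assume "u \<in> B t"
    then show "t = hit j L (walk E 0 u)"
      using hit_ge[OF ex] hit_le[of L "walk E 0 u" t j]
      by (auto simp: B_def not_le[symmetric] intro!: antisym)
  next
    assume "t = hit j L (walk E 0 u)"
    then show "u \<in> B t" using hit_ge[OF ex] hit_less[of _ j L "walk E 0 u"] by (simp add: B_def)
  qed
  have ev: "AE u in choices q. valid_choices u \<and> (\<exists>n. int L \<le> walk E 0 u n $ j)"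
    using AE_valid_choices[OF q] hits by eventually_elim simp
  have At_iff: "u \<in> At t \<longleftrightarrow> u \<in> A \<and> t = hit j L (walk E 0 u)"
    if "valid_choices u" "\<exists>n. int L \<le> walk E 0 u n $ j" for u t
    using Bhit[OF that(2)] hit_ge_level[OF lattice_path_walk[OF that(1) E] that(2)] nL
    by (auto simp: At_def)
  have "(\<integral>\<^sup>+u. indicator A u * indicator {y. reg j L y} (walk E 0 u) * F (post j L (walk E 0 u)) \<partial>choices q)
      = (\<integral>\<^sup>+u. (\<Sum>t. indicator (At t) u * \<Phi> (\<lambda>k. u (t + k))) \<partial>choices q)"
  proof (rule nn_integral_cong_AE, use ev in eventually_elim)
    case (elim u)
    define y where "y = walk E 0 u"
    define t where "t = hit j L y"
    define u' where "u' = (\<lambda>k. u (t + k))"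
    have ly: "lattice_path y" unfolding y_def by (rule lattice_path_walk[OF _ E]) (use elim in simp)
    have ex: "\<exists>n. int L \<le> y n $ j" using elim by (simp add: y_def)
    have h: "y t $ j = int L" unfolding t_def by (rule hit_height[OF ly ex])
    have shift: "y (t + k) = walk E (y t) u' k" for k
      by (simp add: y_def u'_def walk_add)
    have loc': "avail E (y t + z) = avail E' z" if "0 \<le> z $ j" for z
      using loc[of u z] elim that by (simp add: y_def t_def)
    have reg: "reg j L y \<longleftrightarrow> (\<forall>k. 0 \<le> (walk E (y t) u' k - y t) $ j)"
    proof -
      have "reg j L y \<longleftrightarrow> (\<forall>k. int L \<le> y (t + k) $ j)"
        using ex unfolding reg_def t_def[symmetric] by (metis le_add1 le_add_diff_inverse)
      then show ?thesis using h by (simp add: shift)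
    qed
    \<comment> \<open>The coupling works in both directions: the walk on \<open>E\<close> stays
      above the level exactly if the walk on \<open>E'\<close> with the shifted choices stays above
      its start.\<close>
    have reg': "reg j L y \<longleftrightarrow> walk E' 0 u' \<in> stays j"
    proof
      assume "reg j L y"
      then have *: "\<forall>k. 0 \<le> (walk E (y t) u' k - y t) $ j" using reg by simp
      show "walk E' 0 u' \<in> stays j"
        using * walk_couple[OF loc', where u = u' and j = j] by simp
    next
      assume "walk E' 0 u' \<in> stays j"
      then show "reg j L y"
        unfolding reg using walk_couple[OF loc', where u = u' and j = j] by simp
    qed
    have p: "post j L y = walk E' 0 u'" if "reg j L y"
    proof
      fix k
      have "walk E (y t) u' k = y t + walk E' 0 u' k"
        using that by (intro walk_couple[OF loc']) (auto simp: reg)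
      then show "post j L y k = walk E' 0 u' k"
        by (simp add: post_def t_def[symmetric] shift)
    qed
    have "(\<lambda>t'. indicator (At t') u * \<Phi> (\<lambda>k. u (t' + k)))
        = (\<lambda>t'. if t' = t then indicator A u * \<Phi> u' else 0)"
      using At_iff[of u] elim by (auto simp: fun_eq_iff indicator_def t_def y_def u'_def)
    then have "(\<Sum>t'. indicator (At t') u * \<Phi> (\<lambda>k. u (t' + k))) = indicator A u * \<Phi> u'"
      using sums_unique[OF sums_single[of t "\<lambda>_. indicator A u * \<Phi> u'"]] by simp
    also have "\<dots> = indicator A u * indicator {y. reg j L y} y * F (post j L y)"
      using reg' p by (auto simp: \<Phi>_def indicator_def)
    finally show ?case by (simp add: y_def)
  qed
  \<comment> \<open>Every value of the hitting time contributes the same second factor, so the first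
    factors add up to the probability of \<open>A\<close>.\<close>
  also have "\<dots> = (\<Sum>t. \<integral>\<^sup>+u. indicator (At t) u * \<Phi> (\<lambda>k. u (t + k)) \<partial>choices q)"
    by (intro nn_integral_suminf borel_measurable_times_ennreal borel_measurable_indicator Ats
        measurable_compose[OF measurable_shift_choices \<Phi>])
  also have "\<dots> = (\<Sum>t. emeasure (choices q) (At t) * (\<integral>\<^sup>+u. \<Phi> u \<partial>choices q))"
    by (intro suminf_cong choices_shift Ats \<Phi> Atdep)
  also have "\<dots> = (\<Sum>t. emeasure (choices q) (At t)) * (\<integral>\<^sup>+u. \<Phi> u \<partial>choices q)"
    by simp
  also have "(\<Sum>t. emeasure (choices q) (At t)) = emeasure (choices q) (\<Union>t. At t)"
  proof (rule suminf_emeasure)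
    show "disjoint_family At"
      unfolding disjoint_family_on_def
    proof (intro ballI impI)
      fix s t :: nat assume "s \<noteq> t"
      show "At s \<inter> At t = {}"
      proof (rule ccontr)
        assume "At s \<inter> At t \<noteq> {}"
        then obtain u where u: "u \<in> B s" "u \<in> B t" by (auto simp: At_def split: if_splits)
        then have "\<exists>n. int L \<le> walk E 0 u n $ j" by (auto simp: B_def)
        with u Bhit \<open>s \<noteq> t\<close> show False by metis
      qed
    qed
  qed (use Ats in auto)
  also have "emeasure (choices q) (\<Union>t. At t) = emeasure (choices q) A"
  proof (rule emeasure_eq_AE)
    show "AE u in choices q. u \<in> (\<Union>t. At t) \<longleftrightarrow> u \<in> A"
      using ev by eventually_elim (simp add: At_iff)
  qed (use Ats A in auto)
  finally show ?thesis by (simp add: \<Phi>_def)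
qed

section \<open>Transience\<close>

text \<open>The expected number of visits to \<open>z\<close> is the limit of the truncated Green
  functions, finite by \<open>green_bounded\<close>, and the Borel-Cantelli lemma applies. Vertices
  outside the cluster of 0 are never visited.\<close>

lemma AE_visits_finite:
  assumes q: "elliptic q" and inf: "infinite (cluster E 0)"
    and res: "\<And>F. finite F \<Longrightarrow> F \<subseteq> {x. avail E x \<noteq> {}} \<Longrightarrow> (\<Sum>x\<in>F. weight q x) \<le> C"
  shows "avail E 0 \<noteq> {}" and "AE u in choices q. \<forall>z. finite {n. walk E 0 u n = z}"
proof -
  interpret Ch: prob_space "choices q" by (rule prob_space_choices)
  show av: "avail E 0 \<noteq> {}"
  proof
    assume a: "avail E 0 = {}"
    have "y = 0" if "(0, y) \<in> (adj E)\<^sup>*" for y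
      using that by (induction rule: rtrancl_induct) (use a in \<open>auto simp: adj_def\<close>)
    then have "cluster E 0 \<subseteq> {0}" by (auto simp: cluster_def)
    with inf show False using finite_subset by blast
  qed
  have "AE u in choices q. finite {n. walk E 0 u n = z}" if z: "z \<in> cluster E 0" for z
  proof -
    obtain B where B: "\<And>N. green E q z N 0 \<le> B"
      using green_bounded[OF elliptic_pos[OF q] inf z, of C] res by (auto simp: weight_def)
    have "summable (\<lambda>n. ret E q z n 0)"
      by (rule summableI_nonneg_bounded[of _ B]) (use B ret_nonneg in \<open>auto simp: green_def\<close>)
    then have "summable (\<lambda>n. measure (choices q) {u. walk E 0 u n = z})"
      by (simp only: prob_walk_at[OF q av])
    then have "AE u in choices q. eventually (\<lambda>n. u \<in> space (choices q) - {u. walk E 0 u n = z}) sequentially"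
      by (intro borel_cantelli_AE1 sets_walk_at) (auto simp: Ch.emeasure_eq_measure)
    then show ?thesis
    proof eventually_elim
      case (elim u)
      then obtain N where "\<And>n. n \<ge> N \<Longrightarrow> walk E 0 u n \<noteq> z" by (auto simp: eventually_sequentially)
      then have "{n. walk E 0 u n = z} \<subseteq> {..<N}" using not_le by blast
      then show ?case by (rule finite_subset) simp
    qed
  qed
  then have "AE u in choices q. z \<in> cluster E 0 \<longrightarrow> finite {n. walk E 0 u n = z}" for z
    by (cases "z \<in> cluster E 0") auto
  then have "AE u in choices q. \<forall>z. z \<in> cluster E 0 \<longrightarrow> finite {n. walk E 0 u n = z}"
    by (simp add: AE_all_countable)
  then show "AE u in choices q. \<forall>z. finite {n. walk E 0 u n = z}"
    using AE_valid_choices[OF q]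
  proof eventually_elim
    case (elim u)
    have "finite {n. walk E 0 u n = z}" if "z \<notin> cluster E 0" for z
    proof -
      have "{n. walk E 0 u n = z} = {}" using walk_in_cluster[OF elim(2) av] that by auto
      then show ?thesis by simp
    qed
    with elim(1) show ?case by blast
  qed
qed

lemma finite_sublevel:
  fixes y :: "nat \<Rightarrow> ('d::finite) site"
  assumes "filterlim (\<lambda>n. y n $ j) at_top sequentially"
  shows "finite {x \<in> range y. x $ j \<le> K}"
proof -
  have "eventually (\<lambda>n. K + 1 \<le> y n $ j) sequentially"
    using assms by (simp add: filterlim_at_top)
  then obtain N where N: "\<And>n. n \<ge> N \<Longrightarrow> K + 1 \<le> y n $ j" by (auto simp: eventually_sequentially)
  have "{x \<in> range y. x $ j \<le> K} \<subseteq> y ` {..<N}"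
  proof
    fix x assume "x \<in> {x \<in> range y. x $ j \<le> K}"
    then obtain n where "x = y n" "y n $ j \<le> K" by auto
    with N[of n] show "x \<in> y ` {..<N}" by (cases "n < N") auto
  qed
  then show ?thesis by (rule finite_subset) simp
qed

text \<open>Up to any height there are finitely many vertices of \<open>V\<close>, and each of them
  is left for good.\<close>

lemma filterlim_height:
  fixes x :: "nat \<Rightarrow> ('d::finite) site"
  assumes V: "\<And>n. x n \<in> V" and fin: "\<And>K. finite {z \<in> V. z $ j \<le> K}"
    and vis: "\<And>z. finite {n. x n = z}"
  shows "filterlim (\<lambda>n. x n $ j) at_top sequentially"
  unfolding filterlim_at_top
proof
  fix K
  have "{n. \<not> K \<le> x n $ j} \<subseteq> (\<Union>z\<in>{z \<in> V. z $ j \<le> K}. {n. x n = z})" using V by auto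
  then have "finite {n. \<not> K \<le> x n $ j}" by (rule finite_subset) (use fin vis in auto)
  then show "eventually (\<lambda>n. K \<le> x n $ j) sequentially"
    by (simp add: cofinite_eq_sequentially[symmetric] eventually_cofinite)
qed

lemma infinite_range_nice:
  fixes y :: "nat \<Rightarrow> ('d::finite) site"
  assumes "filterlim (\<lambda>n. y n $ j) at_top sequentially" shows "infinite (range y)"
proof
  assume fin: "finite (range y)"
  obtain n where "Max ((\<lambda>x. x $ j) ` range y) + 1 \<le> y n $ j"
    using assms by (auto simp: filterlim_at_top eventually_sequentially)
  moreover have "y n $ j \<le> Max ((\<lambda>x. x $ j) ` range y)" using fin by (intro Max_ge) auto
  ultimately show False by simp
qed

lemma range_subset_cluster:
  assumes "lattice_path y" "trace_edges y \<subseteq> E" shows "range y \<subseteq> cluster E 0"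
proof -
  have "y n \<in> cluster E 0" for n
  proof (induction n)
    case (Suc n)
    have "(y n, y (Suc n)) \<in> adj E"
      using assms by (auto simp: adj_def avail_def lattice_path_def trace_edges_def)
    with Suc show ?case by (auto simp: cluster_def intro: rtrancl_into_rtrancl)
  qed (use assms in \<open>auto simp: cluster_def lattice_path_def\<close>)
  then show ?thesis by auto
qed

lemma weight_sum_le:
  fixes y :: "nat \<Rightarrow> ('d::finite) site"
  assumes C: "\<And>n. (\<Sum>x\<in>y ` {..<n}. weight q x) \<le> C" and F: "finite F" "F \<subseteq> range y"
  shows "(\<Sum>x\<in>F. weight q x) \<le> C"
proof -
  from finite_subset_image[OF F] obtain I where I: "finite I" "F = y ` I" by blast
  from finite_nat_bounded[OF I(1)] obtain n where "I \<subseteq> {..<n}" ..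
  then have "(\<Sum>x\<in>F. weight q x) \<le> (\<Sum>x\<in>y ` {..<n}. weight q x)"
    using I by (intro sum_mono2) (auto simp: weight_def)
  with C[of n] show ?thesis by linarith
qed

text \<open>The trace provides an infinite cluster and the range of \<open>y\<close> provides
  summable weights. The extra vertex \<open>b\<close> makes room for the edge of
  \<open>half_trace\<close> that leads out of the path; a single vertex changes neither summability
  nor the finiteness of sublevel sets.\<close>

lemma nice_transient:
  assumes q: "elliptic q" and y: "nice q j y" and E: "trace_edges y \<subseteq> E"
    and V: "{x. avail E x \<noteq> {}} \<subseteq> insert b (range y)"
  shows "avail E 0 \<noteq> {}"
    and "AE u in choices q. \<forall>z. finite {n. walk E 0 u n = z}"
    and "AE u in choices q. filterlim (\<lambda>n. walk E 0 u n $ j) at_top sequentially"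
proof -
  obtain C where C: "\<And>n. (\<Sum>x\<in>y ` {..<n}. weight q x) \<le> C"
    and ly: "lattice_path y" and lim: "filterlim (\<lambda>n. y n $ j) at_top sequentially"
    using y by (auto simp: nice_def)
  have inf: "infinite (cluster E 0)"
    using range_subset_cluster[OF ly E] infinite_range_nice[OF lim] finite_subset by blast
  have res: "(\<Sum>x\<in>F. weight q x) \<le> weight q b + C" if F: "finite F" "F \<subseteq> {x. avail E x \<noteq> {}}" for F
  proof -
    have "(\<Sum>x\<in>F. weight q x) \<le> (\<Sum>x\<in>insert b (F - {b}). weight q x)"
      using F by (intro sum_mono2) (auto simp: weight_def)
    also have "\<dots> = weight q b + (\<Sum>x\<in>F - {b}. weight q x)" using F by (subst sum.insert) auto
    also have "(\<Sum>x\<in>F - {b}. weight q x) \<le> C"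
      by (rule weight_sum_le[OF C]) (use F V in auto)
    finally show ?thesis by simp
  qed
  show av: "avail E 0 \<noteq> {}" by (rule AE_visits_finite(1)[OF q inf res])
  show vis: "AE u in choices q. \<forall>z. finite {n. walk E 0 u n = z}"
    by (rule AE_visits_finite(2)[OF q inf res])
  have fin: "finite {z \<in> insert b (range y). z $ j \<le> K}" for K
    by (rule finite_subset[of _ "insert b {z \<in> range y. z $ j \<le> K}"])
       (use finite_sublevel[OF lim, of K] in auto)
  show "AE u in choices q. filterlim (\<lambda>n. walk E 0 u n $ j) at_top sequentially"
    using vis AE_valid_choices[OF q]
  proof eventually_elim
    case (elim u)
    then show ?case
      using walk_adj[OF elim(2) av] V fin
      by (intro filterlim_height[of _ "insert b (range y)"]) auto
  qed
qed

lemma avail_trace_edges: "avail (trace_edges y) x \<noteq> {} \<Longrightarrow> x \<in> range y"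
  by (auto simp: avail_def trace_edges_def doubleton_eq_iff)

lemma avail_half_trace:
  assumes "lattice_path y" "avail (half_trace j y) x \<noteq> {}" shows "x \<in> insert (- axis j 1) (range y)"
proof -
  have "0 \<in> range y" using assms(1) by (auto simp: lattice_path_def intro: range_eqI[of _ _ 0])
  then show ?thesis
    using assms(2) by (auto simp: avail_def half_trace_def trace_edges_def doubleton_eq_iff)
qed

text \<open>Before the hitting time the path is below the level and afterwards it never is, so the
  only edge of the trace that joins the two sides is the entering step. For \<open>L \<ge> 1\<close>
  there is such a step.\<close>

lemma avail_post:
  assumes y: "lattice_path y" and r: "reg j L y" and L: "L \<ge> 1" and z: "0 \<le> z $ j"
  shows "avail (trace_edges y) (y (hit j L y) + z) = avail (half_trace j (post j L y)) z"
proof -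
  have ex: "\<exists>n. int L \<le> y n $ j" using r by (simp add: reg_def)
  define t where "t = hit j L y"
  obtain t' where t': "t = Suc t'" using hit_pos[OF y L ex] by (auto simp: t_def)
  have st: "y t = y t' + axis j 1" using hit_step[OF y ex, of t'] t' by (simp add: t_def)
  have h: "y t $ j = int L" unfolding t_def by (rule hit_height[OF y ex])
  have lt: "y k $ j < int L" if "k < t" for k using hit_less that by (simp add: t_def)
  have "{y t + z, y t + z + e} \<in> trace_edges y \<longleftrightarrow> {z, z + e} \<in> half_trace j (post j L y)" for e
  proof
    assume "{y t + z, y t + z + e} \<in> trace_edges y"
    then obtain n where n: "{y t + z, y t + z + e} = {y n, y (Suc n)}" by (auto simp: trace_edges_def)
    consider "n \<ge> t" | "n = t'" | "Suc n < t" using t' by linarith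
    then show "{z, z + e} \<in> half_trace j (post j L y)"
    proof cases
      case 1
      have "{z, z + e} = (\<lambda>x. x - y t) ` {y t + z, y t + z + e}" by (simp add: add.commute)
      also have "\<dots> = {post j L y (n - t), post j L y (Suc (n - t))}"
        unfolding n using 1 by (simp add: post_def t_def[symmetric])
      finally show ?thesis by (auto simp: half_trace_def trace_edges_def)
    next
      case 2
      have "{z, z + e} = (\<lambda>x. x - y t) ` {y t + z, y t + z + e}" by (simp add: add.commute)
      also have "\<dots> = {0, - axis j 1}"
        unfolding n using 2 t' st by auto
      finally show ?thesis by (simp add: half_trace_def)
    next
      case 3
      have "y t + z \<in> {y n, y (Suc n)}" using n by blast
      moreover have "int L \<le> (y t + z) $ j" using h z by simp
      moreover have "y n $ j < int L" "y (Suc n) $ j < int L" using lt 3 by auto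
      ultimately have False by (auto simp del: vector_add_component)
      then show ?thesis ..
    qed
  next
    assume "{z, z + e} \<in> half_trace j (post j L y)"
    then have "{z, z + e} = {- axis j 1, 0} \<or> (\<exists>k. {z, z + e} = {post j L y k, post j L y (Suc k)})"
      by (auto simp: half_trace_def trace_edges_def)
    moreover have im: "{y t + z, y t + z + e} = (\<lambda>x. y t + x) ` {z, z + e}" by (simp add: add.assoc)
    ultimately show "{y t + z, y t + z + e} \<in> trace_edges y"
    proof (elim disjE exE)
      assume "{z, z + e} = {- axis j 1, 0}"
      then have "{y t + z, y t + z + e} = {y t', y (Suc t')}"
        unfolding im using st t' by simp
      then show ?thesis by (auto simp: trace_edges_def)
    next
      fix k assume "{z, z + e} = {post j L y k, post j L y (Suc k)}"
      then have "{y t + z, y t + z + e} = {y (t + k), y (Suc (t + k))}"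
        unfolding im by (simp add: post_def t_def[symmetric])
      then show ?thesis by (auto simp: trace_edges_def)
    qed
  qed
  then show ?thesis by (simp add: avail_def t_def)
qed

text \<open>At a regeneration level the trace has a single edge leading up to the level from below,
  so every walk on the trace enters where the path itself did. The graph seen from there is then the
  same for all choices, as \<open>strong_markov\<close> demands.\<close>

lemma walk_trace_hit:
  assumes y: "lattice_path y" and r: "reg j L y" and L: "L \<ge> 1"
    and x: "lattice_path x" "\<And>n. {x n, x (Suc n)} \<in> trace_edges y" and ex: "\<exists>n. int L \<le> x n $ j"
  shows "x (hit j L x) = y (hit j L y)"
proof -
  obtain s where s: "hit j L x = Suc s" using hit_pos[OF x(1) L ex] by auto
  have hx: "x (Suc s) $ j = int L" using hit_height[OF x(1) ex] s by simp
  have hx': "x s $ j < int L" using hit_less[of s j L x] s by simp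
  have exy: "\<exists>n. int L \<le> y n $ j" using r by (simp add: reg_def)
  obtain k where k: "{x s, x (Suc s)} = {y k, y (Suc k)}" using x(2)[of s] by (auto simp: trace_edges_def)
  then have k': "x s = y k \<and> x (Suc s) = y (Suc k) \<or> x s = y (Suc k) \<and> x (Suc s) = y k"
    by (auto simp: doubleton_eq_iff)
  have ge: "int L \<le> y m $ j" if "m \<ge> hit j L y" for m using r that by (simp add: reg_def)
  have "\<not> k \<ge> hit j L y" using ge[of k] ge[of "Suc k"] k' hx' by auto
  moreover have "\<not> Suc k < hit j L y"
    using hit_less[of k j L y] hit_less[of "Suc k" j L y] k' hx by auto
  ultimately have "hit j L y = Suc k" by simp
  then show ?thesis using k' s hx hit_less[of k j L y] by auto
qed

section \<open>The law of a walk on a random graph\<close>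

abbreviation cylinder :: "nat \<Rightarrow> (nat \<Rightarrow> ('d::finite) site) \<Rightarrow> (nat \<Rightarrow> 'd site) set" where
  "cylinder n w \<equiv> {x. \<forall>k\<le>n. x k = w k}"

lemma sets_cylinder [measurable]: "cylinder n w \<in> sets path_space"
proof -
  have "Measurable.pred path_space (\<lambda>x. \<forall>k\<le>n. x k = w k)" supply pred_path [measurable] by measurable
  then show ?thesis by (simp add: pred_def)
qed

lemma sets_path_space:
  "sets (path_space :: (nat \<Rightarrow> ('d::finite) site) measure) = sigma_sets UNIV {cylinder n w | n w. True}"
proof
  let ?G = "{cylinder n w | n w. True} :: (nat \<Rightarrow> 'd site) set set"
  interpret S: sigma_algebra UNIV "sigma_sets UNIV ?G" by (rule sigma_algebra_sigma_sets) auto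
  have "{f. f i \<in> A} \<in> sigma_sets UNIV ?G" for i and A :: "'d site set"
  proof -
    let ?I = "{xs. length xs = Suc i \<and> xs ! i \<in> A}"
    have "{f. f i \<in> A} = (\<Union>xs\<in>?I. cylinder i (\<lambda>k. xs ! k))"
    proof (intro set_eqI iffI)
      fix f :: "nat \<Rightarrow> 'd site" assume "f \<in> {f. f i \<in> A}"
      then have "map f [0..<Suc i] \<in> ?I \<and> f \<in> cylinder i (\<lambda>k. map f [0..<Suc i] ! k)"
        by (simp del: upt_Suc)
      then show "f \<in> (\<Union>xs\<in>?I. cylinder i (\<lambda>k. xs ! k))" by blast
    qed auto
    also have "\<dots> \<in> sigma_sets UNIV ?G"
      by (intro S.countable_UN') (auto intro: sigma_sets.Basic)
    finally show ?thesis .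
  qed
  then have "sigma_sets UNIV {{f :: nat \<Rightarrow> 'd site. f i \<in> A} | i A. True} \<subseteq> sigma_sets UNIV ?G"
    by (intro S.sigma_sets_subset) auto
  moreover have "sets path_space = sigma_sets UNIV {{f :: nat \<Rightarrow> 'd site. f i \<in> A} | i A. True}"
    unfolding sets_PiM_single by (simp add: PiE_UNIV_domain)
  ultimately show "sets path_space \<subseteq> sigma_sets UNIV ?G" by simp
  have "sigma_sets (space path_space) ?G \<subseteq> sets path_space"
    by (rule sets.sigma_sets_subset) (auto simp: sets_cylinder)
  then show "sigma_sets UNIV ?G \<subseteq> sets path_space" by simp
qed

lemma Union_cylinder: "(\<Union>i::nat. cylinder 0 (\<lambda>_. from_nat i)) = UNIV"
proof -
  have "x \<in> (\<Union>i::nat. cylinder 0 (\<lambda>_. from_nat i))" for x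
    by (rule UN_I[of "to_nat (x 0)"]) auto
  then show ?thesis by blast
qed

lemma sets_pair_path_space:
  "sets (F \<Otimes>\<^sub>M path_space)
     = sigma_sets (space F \<times> UNIV) {A \<times> cylinder n w | A n w. A \<in> sets F}" (is "_ = sigma_sets ?\<Omega> ?G")
proof
  have GO: "?G \<subseteq> Pow ?\<Omega>" by (auto dest: sets.sets_into_space)
  interpret S: sigma_algebra ?\<Omega> "sigma_sets ?\<Omega> ?G" by (rule sigma_algebra_sigma_sets[OF GO])
  \<comment> \<open>The path space is a countable union of cylinders that prescribe only the
    starting point.\<close>
  have top: "a \<times> UNIV \<in> sigma_sets ?\<Omega> ?G" if "a \<in> sets F" for a
  proof -
    have "a \<times> UNIV = a \<times> (\<Union>i::nat. cylinder 0 (\<lambda>_. from_nat i))" by (simp only: Union_cylinder)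
    also have "\<dots> = (\<Union>i::nat. a \<times> cylinder 0 (\<lambda>_. from_nat i))" by blast
    also have "\<dots> \<in> sigma_sets ?\<Omega> ?G"     proof -
      have "a \<times> cylinder 0 (\<lambda>_. from_nat i) \<in> ?G" for i :: nat
        by (rule CollectI, rule exI[of _ a], rule exI[of _ 0], rule exI, rule conjI, rule refl, rule that)
      then show ?thesis by (intro S.countable_UN) (auto simp del: mem_Collect_eq intro: sigma_sets.Basic)
    qed
    finally show ?thesis .
  qed
  have "a \<times> b \<in> sigma_sets ?\<Omega> ?G" if a: "a \<in> sets F" and b: "b \<in> sets path_space" for a b
    using b[unfolded sets_path_space]
  proof induction
    case (Basic b)
    then show ?case using a by (auto intro!: sigma_sets.Basic)
  next
    case (Compl b)
    have "a \<times> (UNIV - b) = a \<times> UNIV - a \<times> b" by auto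
    moreover have "a \<times> UNIV - a \<times> b \<in> sigma_sets ?\<Omega> ?G"
      by (rule S.Diff[OF top[OF a] Compl.IH])
    ultimately show ?case by (simp only:)
  next
    case (Union b)
    have "a \<times> \<Union> (range b) = (\<Union>i. a \<times> b i)" by auto
    moreover have "(\<Union>i. a \<times> b i) \<in> sigma_sets ?\<Omega> ?G"
      using Union.IH by (intro S.countable_UN) (simp add: image_subset_iff)
    ultimately show ?case by (simp only:)
  qed (simp add: sigma_sets.Empty)
  then have "{a \<times> b | a b. a \<in> sets F \<and> b \<in> sets path_space} \<subseteq> sigma_sets ?\<Omega> ?G" by auto
  then show "sets (F \<Otimes>\<^sub>M path_space) \<subseteq> sigma_sets ?\<Omega> ?G"
    unfolding sets_pair_measure space_path_space by (rule S.sigma_sets_subset)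
  have "sigma_sets (space (F \<Otimes>\<^sub>M path_space)) ?G \<subseteq> sets (F \<Otimes>\<^sub>M path_space)"
    by (rule sets.sigma_sets_subset) (auto intro!: pair_measureI sets_cylinder)
  then show "sigma_sets ?\<Omega> ?G \<subseteq> sets (F \<Otimes>\<^sub>M path_space)" by (simp add: space_pair_measure)
qed

lemma measurable_pair_subalgebra:
  assumes "subalgebra M F" "f \<in> measurable (F \<Otimes>\<^sub>M N) K" shows "f \<in> measurable (M \<Otimes>\<^sub>M N) K"
proof -
  have "(\<lambda>x. x) \<in> measurable M F"
    using assms(1) by (intro measurableI) (auto simp: subalgebra_def)
  then have "(\<lambda>z. (fst z, snd z)) \<in> measurable (M \<Otimes>\<^sub>M N) (F \<Otimes>\<^sub>M N)"
    by (intro measurable_Pair measurable_compose[OF measurable_fst] measurable_snd)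
  from measurable_compose[OF this assms(2)] show ?thesis by simp
qed

lemma measurable_walk_pair:
  assumes "\<And>e. {\<omega> \<in> space F. e \<in> E \<omega>} \<in> sets F"
  shows "(\<lambda>(\<omega>, u). walk (E \<omega>) z u) \<in> measurable (F \<Otimes>\<^sub>M choices q) path_space"
proof -
  have "{z \<in> space (F \<Otimes>\<^sub>M choices q). e \<in> E (fst z)} \<in> sets (F \<Otimes>\<^sub>M choices q)" for e
  proof -
    have "{z \<in> space (F \<Otimes>\<^sub>M choices q). e \<in> E (fst z)}
        = fst -` {\<omega> \<in> space F. e \<in> E \<omega>} \<inter> space (F \<Otimes>\<^sub>M choices q)"
      by (auto simp: space_pair_measure)
    then show ?thesis using measurable_sets[OF measurable_fst assms] by simp
  qed
  then have "(\<lambda>z'. walk (E (fst z')) z (snd z')) \<in> measurable (F \<Otimes>\<^sub>M choices q) path_space"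
    by (intro measurable_walk[where q = q] measurable_snd)
  then show ?thesis by (simp add: case_prod_beta')
qed

text \<open>The pair of an event of the past and the walk has the law of a two-stage experiment: the
  choices are independent of the past, and the walk is driven by them on the given graph.\<close>

lemma joint_law:
  fixes E :: "'w \<Rightarrow> ('d::finite) site set set" and Y :: "'w \<Rightarrow> nat \<Rightarrow> 'd site"
  assumes M: "prob_space M" and sub: "subalgebra M F"
    and E: "\<And>e. {\<omega> \<in> space F. e \<in> E \<omega>} \<in> sets F"
    and Y [measurable]: "Y \<in> measurable M path_space"
    and law: "\<And>A n w. A \<in> sets F \<Longrightarrow> measure M (A \<inter> {\<omega> \<in> space M. \<forall>k\<le>n. Y \<omega> k = w k})
               = (\<integral>\<omega>. indicator A \<omega> * measure (choices q) {u. \<forall>k\<le>n. walk (E \<omega>) 0 u k = w k} \<partial>M)"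
    and f: "f \<in> borel_measurable (F \<Otimes>\<^sub>M path_space)"
  shows "(\<integral>\<^sup>+\<omega>. f (\<omega>, Y \<omega>) \<partial>M) = (\<integral>\<^sup>+\<omega>. \<integral>\<^sup>+u. f (\<omega>, walk (E \<omega>) 0 u) \<partial>choices q \<partial>M)"
proof -
  interpret M: prob_space M by (rule M)
  interpret Ch: prob_space "choices q" by (rule prob_space_choices)
  have sp: "space F = space M" using sub by (simp add: subalgebra_def)
  have id: "(\<lambda>x. x) \<in> measurable M F"
    using sub by (intro measurableI) (auto simp: subalgebra_def)
  have m1 [measurable]: "(\<lambda>\<omega>. (\<omega>, Y \<omega>)) \<in> measurable M (F \<Otimes>\<^sub>M path_space)"
    by (intro measurable_Pair id Y)
  have w: "(\<lambda>(\<omega>, u). walk (E \<omega>) 0 u) \<in> measurable (M \<Otimes>\<^sub>M choices q) path_space"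
    by (rule measurable_pair_subalgebra[OF sub measurable_walk_pair[OF E]])
  have m2 [measurable]: "(\<lambda>(\<omega>, u). (\<omega>, walk (E \<omega>) 0 u)) \<in> measurable (M \<Otimes>\<^sub>M choices q) (F \<Otimes>\<^sub>M path_space)"
  proof -
    have "(\<lambda>z. (fst z, (\<lambda>(\<omega>, u). walk (E \<omega>) 0 u) z)) \<in> measurable (M \<Otimes>\<^sub>M choices q) (F \<Otimes>\<^sub>M path_space)"
      by (intro measurable_Pair measurable_compose[OF measurable_fst id] w)
    then show ?thesis by (simp only: case_prod_unfold)
  qed
  let ?G = "{A \<times> cylinder n w | A n (w :: nat \<Rightarrow> 'd site). A \<in> sets F}"
  have eq: "distr M (F \<Otimes>\<^sub>M path_space) (\<lambda>\<omega>. (\<omega>, Y \<omega>))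
      = distr (M \<Otimes>\<^sub>M choices q) (F \<Otimes>\<^sub>M path_space) (\<lambda>(\<omega>, u). (\<omega>, walk (E \<omega>) 0 u))" (is "?D1 = ?D2")
  proof (rule measure_eqI_generator_eq)
    show "Int_stable ?G"
      unfolding Int_stable_def
    proof (intro ballI)
      fix a b assume "a \<in> ?G" "b \<in> ?G"
      then obtain A B n m w v where AB: "A \<in> sets F" "B \<in> sets F"
        and ab: "a = A \<times> cylinder n w" "b = B \<times> cylinder m v" by blast
      \<comment> \<open>Two cylinders are disjoint or nested, which makes the generator stable under
        intersection.\<close>
      have "cylinder n w \<inter> cylinder m v = {} \<or> cylinder n w \<inter> cylinder m v = cylinder m v
          \<or> cylinder n w \<inter> cylinder m v = cylinder n w"
        using nat_le_linear[of n m] by (auto dest: order_trans)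
      then have "\<exists>A' n' w'. a \<inter> b = A' \<times> cylinder n' w' \<and> A' \<in> sets F"
      proof (elim disjE)
        assume "cylinder n w \<inter> cylinder m v = {}"
        then show ?thesis by (intro exI[of _ "{}"]) (auto simp: ab)
      next
        assume "cylinder n w \<inter> cylinder m v = cylinder m v"
        then show ?thesis using AB by (intro exI[of _ "A \<inter> B"] exI[of _ m] exI[of _ v]) (simp add: ab Times_Int_Times sets.Int)
      next
        assume "cylinder n w \<inter> cylinder m v = cylinder n w"
        then show ?thesis using AB by (intro exI[of _ "A \<inter> B"] exI[of _ n] exI[of _ w]) (simp add: ab Times_Int_Times sets.Int)
      qed
      then show "a \<inter> b \<in> ?G" by blast
    qed
    show "?G \<subseteq> Pow (space F \<times> UNIV)" by (auto dest: sets.sets_into_space)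
    show "sets ?D1 = sigma_sets (space F \<times> UNIV) ?G" by (simp add: sets_pair_path_space)
    show "sets ?D2 = sigma_sets (space F \<times> UNIV) ?G" by (simp add: sets_pair_path_space)
    have "space F \<times> cylinder 0 (\<lambda>_. from_nat i) \<in> ?G" for i :: nat
      by (rule CollectI, rule exI[of _ "space F"], rule exI[of _ 0], rule exI, rule conjI, rule refl) simp
    then show "range (\<lambda>i::nat. space F \<times> cylinder 0 (\<lambda>_. from_nat i)) \<subseteq> ?G" by blast
    have "(\<Union>i::nat. space F \<times> cylinder 0 (\<lambda>_. from_nat i))
        = space F \<times> (\<Union>i::nat. cylinder 0 (\<lambda>_. from_nat i))" by blast
    then show "(\<Union>i::nat. space F \<times> cylinder 0 (\<lambda>_. from_nat i)) = space F \<times> UNIV"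
      by (simp only: Union_cylinder)
    show "emeasure ?D1 (space F \<times> cylinder 0 (\<lambda>_. from_nat i)) \<noteq> \<infinity>" for i :: nat
    proof -
      interpret D: prob_space ?D1 by (rule M.prob_space_distr[OF m1])
      show ?thesis by (simp add: D.emeasure_eq_measure)
    qed
    fix X assume "X \<in> ?G"
    then obtain A n w where X: "X = A \<times> cylinder n w" and A: "A \<in> sets F" by blast
    have XS: "X \<in> sets (F \<Otimes>\<^sub>M path_space)" unfolding X by (intro pair_measureI A sets_cylinder)
    have AM: "A \<in> sets M" using A sub by (auto simp: subalgebra_def)
    let ?p = "\<lambda>\<omega>. measure (choices q) {u. \<forall>k\<le>n. walk (E \<omega>) 0 u k = w k}"
    have cm: "{u. \<forall>k\<le>n. walk (E \<omega>) 0 u k = w k} \<in> sets (choices q)" for \<omega>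
      using measurable_sets[OF measurable_walk_choices[of "E \<omega>" 0 q] sets_cylinder[of n w]]
      by (simp add: vimage_def)
    have "emeasure ?D2 X = (\<integral>\<^sup>+\<omega>. \<integral>\<^sup>+u. indicator X (\<omega>, walk (E \<omega>) 0 u) \<partial>choices q \<partial>M)"
    proof -
      have "emeasure ?D2 X = (\<integral>\<^sup>+z. indicator X z \<partial>?D2)" using XS by simp
      also have "\<dots> = (\<integral>\<^sup>+z. indicator X ((\<lambda>(\<omega>, u). (\<omega>, walk (E \<omega>) 0 u)) z) \<partial>(M \<Otimes>\<^sub>M choices q))"
        by (rule nn_integral_distr[OF m2]) (use XS in simp)
      also have "\<dots> = (\<integral>\<^sup>+\<omega>. \<integral>\<^sup>+u. indicator X (\<omega>, walk (E \<omega>) 0 u) \<partial>choices q \<partial>M)"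
        using borel_measurable_indicator[OF measurable_sets[OF m2 XS]]
        by (subst Ch.nn_integral_fst[symmetric])
           (auto intro!: measurable_compose[OF m2] borel_measurable_indicator XS)
      finally show ?thesis .
    qed
    also have "\<dots> = (\<integral>\<^sup>+\<omega>. indicator A \<omega> * emeasure (choices q) {u. \<forall>k\<le>n. walk (E \<omega>) 0 u k = w k} \<partial>M)"
    proof (rule nn_integral_cong)
      fix \<omega>
      have "(\<integral>\<^sup>+u. indicator X (\<omega>, walk (E \<omega>) 0 u) \<partial>choices q)
          = (\<integral>\<^sup>+u. indicator A \<omega> * indicator {u. \<forall>k\<le>n. walk (E \<omega>) 0 u k = w k} u \<partial>choices q)"
        by (intro nn_integral_cong) (simp add: X indicator_def)
      also have "\<dots> = indicator A \<omega> * emeasure (choices q) {u. \<forall>k\<le>n. walk (E \<omega>) 0 u k = w k}"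
        using cm by (simp add: nn_integral_cmult)
      finally show "(\<integral>\<^sup>+u. indicator X (\<omega>, walk (E \<omega>) 0 u) \<partial>choices q)
          = indicator A \<omega> * emeasure (choices q) {u. \<forall>k\<le>n. walk (E \<omega>) 0 u k = w k}" .
    qed
    also have "\<dots> = (\<integral>\<^sup>+\<omega>. ennreal (indicator A \<omega> * ?p \<omega>) \<partial>M)"
      by (intro nn_integral_cong) (simp add: Ch.emeasure_eq_measure indicator_def)
    also have "\<dots> = ennreal (\<integral>\<omega>. indicator A \<omega> * ?p \<omega> \<partial>M)"
    proof (rule nn_integral_eq_integral)
      have "(\<lambda>\<omega>. emeasure (choices q) {u. \<forall>k\<le>n. walk (E \<omega>) 0 u k = w k}) \<in> borel_measurable M"
      proof -
        have "(\<lambda>z. indicator (cylinder n w) ((\<lambda>(\<omega>, u). walk (E \<omega>) 0 u) z) :: ennreal) \<in> borel_measurable (M \<Otimes>\<^sub>M choices q)"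
          by (rule measurable_compose[OF w borel_measurable_indicator[OF sets_cylinder]])
        from Ch.borel_measurable_nn_integral_fst[OF this]
        have "(\<lambda>\<omega>. \<integral>\<^sup>+u. indicator (cylinder n w) (walk (E \<omega>) 0 u) \<partial>choices q) \<in> borel_measurable M"
          by (simp only: prod.case)
        moreover have "(\<integral>\<^sup>+u. indicator (cylinder n w) (walk (E \<omega>) 0 u) \<partial>choices q)
            = emeasure (choices q) {u. \<forall>k\<le>n. walk (E \<omega>) 0 u k = w k}" for \<omega>
        proof -
          have "(\<integral>\<^sup>+u. indicator (cylinder n w) (walk (E \<omega>) 0 u) \<partial>choices q)
              = (\<integral>\<^sup>+u. indicator {u. \<forall>k\<le>n. walk (E \<omega>) 0 u k = w k} u \<partial>choices q)"
            by (intro nn_integral_cong) (simp add: indicator_def)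
          with cm show ?thesis by simp
        qed
        ultimately show ?thesis by (simp only:)
      qed
      then have "?p \<in> borel_measurable M"
        unfolding measure_def by (rule borel_measurable_enn2real)
      then have "(\<lambda>\<omega>. indicator A \<omega> * ?p \<omega>) \<in> borel_measurable M"
        by (intro borel_measurable_times borel_measurable_indicator AM)
      moreover have "norm (indicator A \<omega> * ?p \<omega>) \<le> 1" for \<omega>
        using Ch.prob_le_1[of "{u. \<forall>k\<le>n. walk (E \<omega>) 0 u k = w k}"]
        by (simp add: indicator_def)
      ultimately show "integrable M (\<lambda>\<omega>. indicator A \<omega> * ?p \<omega>)"
        by (intro M.integrable_const_bound[where B = 1] AE_I2)
      show "AE \<omega> in M. 0 \<le> indicator A \<omega> * ?p \<omega>"
        by (intro AE_I2 mult_nonneg_nonneg measure_nonneg) simp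
    qed
    also have "\<dots> = ennreal (measure M (A \<inter> {\<omega> \<in> space M. \<forall>k\<le>n. Y \<omega> k = w k}))"
      by (simp add: law[OF A])
    also have "\<dots> = emeasure ?D1 X"
    proof -
      have "(\<lambda>\<omega>. (\<omega>, Y \<omega>)) -` X \<inter> space M = A \<inter> {\<omega> \<in> space M. \<forall>k\<le>n. Y \<omega> k = w k}"
        using sets.sets_into_space[OF AM] by (auto simp: X)
      then show ?thesis using XS by (simp add: emeasure_distr[OF m1] M.emeasure_eq_measure)
    qed
    finally show "emeasure ?D1 X = emeasure ?D2 X" ..
  qed
  have "(\<integral>\<^sup>+\<omega>. f (\<omega>, Y \<omega>) \<partial>M) = (\<integral>\<^sup>+z. f z \<partial>?D1)"
    by (rule nn_integral_distr[OF m1, symmetric]) (use f in simp)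
  also have "\<dots> = (\<integral>\<^sup>+z. f ((\<lambda>(\<omega>, u). (\<omega>, walk (E \<omega>) 0 u)) z) \<partial>(M \<Otimes>\<^sub>M choices q))"
    unfolding eq by (rule nn_integral_distr[OF m2]) (use f in simp)
  also have "\<dots> = (\<integral>\<^sup>+\<omega>. \<integral>\<^sup>+u. f (\<omega>, walk (E \<omega>) 0 u) \<partial>choices q \<partial>M)"
    using measurable_compose[OF m2 f] by (subst Ch.nn_integral_fst[symmetric]) auto
  finally show ?thesis .
qed

text \<open>Apply \<open>joint_law\<close> to the indicator of the exceptional set. An almost sure
  property of the process is thereby reduced to the walk on a frozen graph.\<close>

lemma joint_law_AE:
  assumes M: "prob_space M" and sub: "subalgebra M F"
    and E: "\<And>e. {\<omega> \<in> space F. e \<in> E \<omega>} \<in> sets F"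
    and Y: "Y \<in> measurable M path_space"
    and law: "\<And>A n w. A \<in> sets F \<Longrightarrow> measure M (A \<inter> {\<omega> \<in> space M. \<forall>k\<le>n. Y \<omega> k = w k})
               = (\<integral>\<omega>. indicator A \<omega> * measure (choices q) {u. \<forall>k\<le>n. walk (E \<omega>) 0 u k = w k} \<partial>M)"
    and P: "Measurable.pred (F \<Otimes>\<^sub>M path_space) (\<lambda>z. P (fst z) (snd z))"
    and ae: "AE \<omega> in M. AE u in choices q. P \<omega> (walk (E \<omega>) 0 u)"
  shows "AE \<omega> in M. P \<omega> (Y \<omega>)"
proof -
  have sp: "space F = space M" using sub by (simp add: subalgebra_def)
  define B where "B = {z \<in> space (F \<Otimes>\<^sub>M path_space). \<not> P (fst z) (snd z)}"
  have B: "B \<in> sets (F \<Otimes>\<^sub>M path_space)" unfolding B_def using P by measurable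
  have id: "(\<lambda>x. x) \<in> measurable M F"
    using sub by (intro measurableI) (auto simp: subalgebra_def)
  have "(\<integral>\<^sup>+\<omega>. indicator B (\<omega>, Y \<omega>) \<partial>M)
      = (\<integral>\<^sup>+\<omega>. \<integral>\<^sup>+u. indicator B (\<omega>, walk (E \<omega>) 0 u) \<partial>choices q \<partial>M)"
    by (rule joint_law[OF M sub E Y law]) (use B in simp_all)
  also have "\<dots> = (\<integral>\<^sup>+\<omega>. 0 \<partial>M)"
  proof (rule nn_integral_cong_AE, use ae in eventually_elim)
    case (elim \<omega>)
    have "(\<integral>\<^sup>+u. indicator B (\<omega>, walk (E \<omega>) 0 u) \<partial>choices q) = (\<integral>\<^sup>+u. 0 \<partial>choices q)"
      by (rule nn_integral_cong_AE, use elim in eventually_elim) (simp add: B_def)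
    then show ?case by simp
  qed
  finally have "(\<integral>\<^sup>+\<omega>. indicator B (\<omega>, Y \<omega>) \<partial>M) = 0" by simp
  moreover have "(\<lambda>\<omega>. indicator B (\<omega>, Y \<omega>) :: ennreal) \<in> borel_measurable M"
    by (rule measurable_compose[OF measurable_Pair[OF id Y]]) (use B in simp)
  ultimately have "AE \<omega> in M. indicator B (\<omega>, Y \<omega>) = (0 :: ennreal)"
    by (simp add: nn_integral_0_iff_AE)
  then show ?thesis
    using AE_space by eventually_elim (auto simp: B_def space_pair_measure sp indicator_def split: if_splits)
qed

section \<open>The law of large numbers on the lattice\<close>

lemma avail_lattice [simp]: "avail (snd lattice) x = unit_steps"
  by (auto simp: avail_def lattice_def)

lemma unit_steps_nonempty [simp]: "(unit_steps :: ('d::finite) site set) \<noteq> {}"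
  by (auto simp: unit_steps_def)

lemma walk_lattice: "walk (snd lattice) x u n = x + (\<Sum>k<n. u k unit_steps)"
  by (induction n) (auto simp: add.assoc)

lemma expectation_step:
  fixes q :: "('d::finite) site pmf"
  assumes q: "elliptic q"
  shows "(\<integral>u. real_of_int (u k unit_steps $ i) \<partial>choices q) = drift q $ i"
proof -
  have "(\<integral>u. real_of_int (u k unit_steps $ i) \<partial>choices q)
      = (\<integral>f. real_of_int (f unit_steps $ i) \<partial>distr (choices q) (measure_pmf (choice_pmf q)) (\<lambda>u. u k))"
    by (rule integral_distr[symmetric]) (auto simp: choices_def)
  also have "distr (choices q) (measure_pmf (choice_pmf q)) (\<lambda>u. u k) = measure_pmf (choice_pmf q)"
    unfolding choices_def by (rule distr_PiM_component) (auto intro: prob_space_measure_pmf)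
  also have "(\<integral>f. real_of_int (f unit_steps $ i) \<partial>measure_pmf (choice_pmf q))
      = (\<integral>e. real_of_int (e $ i) \<partial>measure_pmf (map_pmf (\<lambda>f. f unit_steps) (choice_pmf q)))"
    by (simp add: integral_map_pmf)
  also have "map_pmf (\<lambda>f. f unit_steps) (choice_pmf q) = cond_pmf q unit_steps"
    unfolding choice_pmf_def by (subst Pi_pmf_component) auto
  also have "cond_pmf q unit_steps = q"
  proof (rule pmf_eqI)
    fix e
    have "measure_pmf.prob q unit_steps = 1"
      using q by (simp add: elliptic_def measure_pmf.prob_eq_1 AE_measure_pmf_iff)
    then show "pmf (cond_pmf q unit_steps) e = pmf q e"
      using q by (subst pmf_cond) (auto simp: elliptic_def pmf_eq_0_set_pmf)
  qed
  also have "(\<integral>e. real_of_int (e $ i) \<partial>measure_pmf q) = (\<Sum>e\<in>unit_steps. pmf q e * real_of_int (e $ i))"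
    by (subst integral_measure_pmf_real[of unit_steps]) (use q in \<open>auto simp: elliptic_def mult.commute\<close>)
  also have "\<dots> = (\<Sum>e\<in>{axis i 1, - axis i 1}. pmf q e * real_of_int (e $ i))"
  proof (rule sum.mono_neutral_right)
    show "\<forall>e\<in>unit_steps - {axis i 1, - axis i 1}. pmf q e * real_of_int (e $ i) = 0"
    proof
      fix e :: "'d site" assume e: "e \<in> unit_steps - {axis i 1, - axis i 1}"
      then obtain k where k: "e = axis k 1 \<or> e = - axis k 1" by (auto simp: unit_steps_def)
      with e have "k \<noteq> i" by auto
      with k have "e $ i = 0" by (auto simp: axis_def)
      then show "pmf q e * real_of_int (e $ i) = 0" by simp
    qed
  qed (auto simp: unit_steps_def)
  also have "\<dots> = drift q $ i"
  proof -
    have "axis i 1 \<noteq> (- axis i 1 :: 'd site)" by (simp add: vec_eq_iff axis_def)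
    then show ?thesis by (simp add: drift_def)
  qed
  finally show ?thesis .
qed

text \<open>The increments are independent with values between -1 and 1, so Hoeffding's inequality
  makes deviations of order \<open>n\<close> exponentially unlikely, and the Borel-Cantelli lemma
  gives the limit.\<close>

lemma AE_lattice_coordinate:
  fixes q :: "('d::finite) site pmf"
  assumes q: "elliptic q"
  shows "AE u in choices q. (\<lambda>n. real_of_int (walk (snd lattice) 0 u n $ i) / real n) \<longlonglongrightarrow> drift q $ i"
proof -
  interpret Ch: prob_space "choices q" by (rule prob_space_choices)
  define \<xi> where "\<xi> k u = real_of_int (u k unit_steps $ i)" for k and u :: "nat \<Rightarrow> 'd site set \<Rightarrow> 'd site"
  have \<xi>m [measurable]: "\<xi> k \<in> borel_measurable (choices q)" for k
    unfolding \<xi>_def by (rule measurable_compose[OF measurable_choice[of "\<lambda>u. u" _ q]]) auto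
  have indep: "Ch.indep_vars (\<lambda>_. borel) \<xi> UNIV"
  proof -
    have c: "(\<lambda>u. u k) \<in> measurable (choices q) (measure_pmf (choice_pmf q))" for k
      unfolding choices_def by (rule measurable_component_singleton) simp
    have d: "distr (choices q) (measure_pmf (choice_pmf q)) (\<lambda>u. u k) = measure_pmf (choice_pmf q)" for k
      unfolding choices_def by (rule distr_PiM_component) (auto intro: prob_space_measure_pmf)
    have "Ch.indep_vars (\<lambda>_. measure_pmf (choice_pmf q)) (\<lambda>k u. u k) UNIV"
    proof (subst Ch.indep_vars_iff_distr_eq_PiM)
      show "distr (choices q) (Pi\<^sub>M UNIV (\<lambda>_. measure_pmf (choice_pmf q))) (\<lambda>u. \<lambda>k\<in>UNIV. u k)
          = Pi\<^sub>M UNIV (\<lambda>k. distr (choices q) (measure_pmf (choice_pmf q)) (\<lambda>u. u k))"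
        unfolding d by (simp add: choices_def[symmetric] restrict_def distr_id)
    qed (use c in auto)
    from Ch.indep_vars_compose2[OF this, of "\<lambda>_ f. real_of_int (f unit_steps $ i)" "\<lambda>_. borel"]
    show ?thesis by (simp add: \<xi>_def[abs_def])
  qed
  have bound: "AE u in choices q. \<xi> k u \<in> {-1..1}" for k
    using AE_valid_choices[OF q]
  proof eventually_elim
    case (elim u)
    then have "u k unit_steps \<in> unit_steps" by (auto simp: valid_choices_def)
    from unit_step_height(1)[OF this, of i] show ?case by (simp add: \<xi>_def abs_le_iff)
  qed
  have S: "real_of_int (walk (snd lattice) 0 u n $ i) = (\<Sum>k<n. \<xi> k u)" for u n
    by (simp add: walk_lattice \<xi>_def sum_component)
  have ev: "AE u in choices q. eventually (\<lambda>n. \<bar>(\<Sum>k<n. \<xi> k u) - real n * drift q $ i\<bar> < \<epsilon> * real n) sequentially"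
    if \<epsilon>: "\<epsilon> > 0" for \<epsilon> :: real
  proof -
    let ?A = "\<lambda>n. {u \<in> space (choices q). \<bar>(\<Sum>k<Suc n. \<xi> k u) - real (Suc n) * drift q $ i\<bar> \<ge> \<epsilon> * real (Suc n)}"
    have le: "measure (choices q) (?A n) \<le> 2 * exp (- (\<epsilon>\<^sup>2 / 2)) ^ Suc n" for n
    proof -
      interpret H: Hoeffding_ineq "choices q" "{..<Suc n}" \<xi> "\<lambda>_. -1" "\<lambda>_. 1" "\<Sum>k<Suc n. Ch.expectation (\<xi> k)"
        by unfold_locales (use bound Ch.indep_vars_subset[OF indep] in auto)
      have mu: "(\<Sum>k<Suc n. Ch.expectation (\<xi> k)) = real (Suc n) * drift q $ i"
      proof -
        have "Ch.expectation (\<xi> k) = drift q $ i" for k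
          using expectation_step[OF q] by (simp add: \<xi>_def[abs_def])
        then show ?thesis by (simp only: sum_constant card_lessThan)
      qed
      have "measure (choices q) (?A n) \<le> 2 * exp (- 2 * (\<epsilon> * real (Suc n))\<^sup>2 / (\<Sum>k<Suc n. (1 - (-1::real))\<^sup>2))"
        using H.Hoeffding_ineq_abs_ge[of "\<epsilon> * real (Suc n)"] \<epsilon> unfolding mu by simp
      also have "- 2 * (\<epsilon> * real (Suc n))\<^sup>2 / (\<Sum>k<Suc n. (1 - (-1::real))\<^sup>2) = real (Suc n) * (- (\<epsilon>\<^sup>2 / 2))"
        by (simp only: sum_constant card_lessThan) (simp add: power2_eq_square field_simps del: of_nat_Suc)
      also have "2 * exp (real (Suc n) * (- (\<epsilon>\<^sup>2 / 2))) = 2 * exp (- (\<epsilon>\<^sup>2 / 2)) ^ Suc n"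
        by (simp only: exp_of_nat_mult)
      finally show ?thesis .
    qed
    have "summable (\<lambda>n. 2 * exp (- (\<epsilon>\<^sup>2 / 2)) ^ Suc n)"
      using \<epsilon> by (intro summable_mult summable_mult summable_geometric iffD2[OF summable_Suc_iff]) auto
    then have "summable (\<lambda>n. measure (choices q) (?A n))"
      by (rule summable_comparison_test') (use le in auto)
    moreover have "?A n \<in> sets (choices q)" for n by measurable
    ultimately have "AE u in choices q. eventually (\<lambda>n. u \<in> space (choices q) - ?A n) sequentially"
      by (intro borel_cantelli_AE1) (simp_all only: Ch.emeasure_eq_measure ennreal_less_top infinity_ennreal_def)
    then show ?thesis
    proof eventually_elim
      case (elim u)
      then have "eventually (\<lambda>n. \<bar>(\<Sum>k<Suc n. \<xi> k u) - real (Suc n) * drift q $ i\<bar> < \<epsilon> * real (Suc n)) sequentially"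
        by eventually_elim auto
      then show ?case by (subst (asm) eventually_sequentially_Suc)
    qed
  qed
  have "AE u in choices q. \<forall>m::nat. eventually (\<lambda>n. \<bar>(\<Sum>k<n. \<xi> k u) - real n * drift q $ i\<bar> < 1 / real (Suc m) * real n) sequentially"
    unfolding AE_all_countable by (intro allI ev) simp
  then show ?thesis
  proof eventually_elim
    case (elim u)
    show ?case unfolding S
    proof (rule LIMSEQ_I)
      fix r :: real assume "r > 0"
      then obtain m :: nat where m: "1 / real (Suc m) < r" using reals_Archimedean[of r] by (auto simp: inverse_eq_divide)
      have "eventually (\<lambda>n. norm ((\<Sum>k<n. \<xi> k u) / real n - drift q $ i) < r) sequentially"
        using elim[rule_format, of m] eventually_gt_at_top[of 0]
      proof eventually_elim
        case (elim n)
        have "(\<Sum>k<n. \<xi> k u) / real n - drift q $ i = ((\<Sum>k<n. \<xi> k u) - real n * drift q $ i) / real n"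
          using elim(2) by (simp add: field_simps)
        then have "norm ((\<Sum>k<n. \<xi> k u) / real n - drift q $ i) = \<bar>(\<Sum>k<n. \<xi> k u) - real n * drift q $ i\<bar> / real n"
          by simp
        also have "\<dots> < 1 / real (Suc m)" using elim by (simp add: divide_less_eq)
        finally show ?case using m by linarith
      qed
      then show "\<exists>no. \<forall>n\<ge>no. norm ((\<Sum>k<n. \<xi> k u) / real n - drift q $ i) < r"
        by (simp add: eventually_sequentially)
    qed
  qed
qed

section \<open>Setwise convergence\<close>

text \<open>A Dynkin class argument. Since \<open>\<Phi> L\<close> is at most 1, the measures with
  these densities are all dominated by \<open>M\<close>, and this supplies the dominating series for
  exchanging the limit with countable disjoint unions.\<close>

lemma setwise_convergence_sigma:
  fixes \<Phi> :: "nat \<Rightarrow> 'w \<Rightarrow> real"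
  assumes M: "prob_space M" and \<Phi> [measurable]: "\<And>L. \<Phi> L \<in> borel_measurable M"
    and bd: "\<And>L \<omega>. 0 \<le> \<Phi> L \<omega> \<and> \<Phi> L \<omega> \<le> 1"
    and G: "Int_stable G" "G \<subseteq> sets M" "space M \<in> G"
    and conv: "\<And>A. A \<in> G \<Longrightarrow> (\<lambda>L. \<integral>\<omega>. indicator A \<omega> * \<Phi> L \<omega> \<partial>M) \<longlonglongrightarrow> measure M A * c"
    and A: "A \<in> sigma_sets (space M) G"
  shows "(\<lambda>L. \<integral>\<omega>. indicator A \<omega> * \<Phi> L \<omega> \<partial>M) \<longlonglongrightarrow> measure M A * c"
proof -
  interpret M: prob_space M by (rule M)
  have GP: "G \<subseteq> Pow (space M)" using G(2) sets.sets_into_space by blast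
  have sM: "B \<in> sets M" if "B \<in> sigma_sets (space M) G" for B
    using sets.sigma_sets_subset[OF G(2)] that by blast
  define N where "N L = density M (\<lambda>\<omega>. ennreal (\<Phi> L \<omega>))" for L
  have sN: "sets (N L) = sets M" "space (N L) = space M" for L by (simp_all add: N_def)
  have eN: "emeasure (N L) B \<le> emeasure M B" if "B \<in> sets M" for L B
  proof -
    have "emeasure (N L) B = (\<integral>\<^sup>+\<omega>. ennreal (\<Phi> L \<omega>) * indicator B \<omega> \<partial>M)"
      unfolding N_def using that by (intro emeasure_density) auto
    also have "\<dots> \<le> (\<integral>\<^sup>+\<omega>. indicator B \<omega> \<partial>M)"
      using bd by (intro nn_integral_mono) (auto simp: indicator_def ennreal_le_1)
    finally show ?thesis using that by simp
  qed
  have fN: "finite_measure (N L)" for L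
    using eN[of "space M" L] M.emeasure_space_1 by (intro finite_measureI) (auto simp: sN top_unique)
  have mN: "measure (N L) B \<le> measure M B" if "B \<in> sets M" for L B
    using eN[OF that, of L] finite_measure.emeasure_eq_measure[OF fN, of L B]
    by (simp add: M.emeasure_eq_measure)
  have int: "(\<integral>\<omega>. indicator B \<omega> * \<Phi> L \<omega> \<partial>M) = measure (N L) B" if "B \<in> sets M" for L B
  proof -
    have "(\<integral>\<omega>. indicator B \<omega> * \<Phi> L \<omega> \<partial>M) = enn2real (\<integral>\<^sup>+\<omega>. ennreal (indicator B \<omega> * \<Phi> L \<omega>) \<partial>M)"
      using that bd by (intro integral_eq_nn_integral) auto
    also have "(\<integral>\<^sup>+\<omega>. ennreal (indicator B \<omega> * \<Phi> L \<omega>) \<partial>M) = (\<integral>\<^sup>+\<omega>. ennreal (\<Phi> L \<omega>) * indicator B \<omega> \<partial>M)"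
      by (intro nn_integral_cong) (simp add: indicator_def)
    also have "\<dots> = emeasure (N L) B"
      unfolding N_def using that by (intro emeasure_density[symmetric]) auto
    finally show ?thesis by (simp add: measure_def)
  qed
  have "(\<lambda>L. measure (N L) A) \<longlonglongrightarrow> measure M A * c"
    using G(1) GP A
  proof (induction rule: sigma_sets_induct_disjoint)
    case (basic B)
    then show ?case using conv[OF basic] G(2) by (simp add: int subset_eq)
  next
    case empty
    then show ?case by simp
  next
    case (compl B)
    have B: "B \<in> sets M" by (rule sM[OF compl(1)])
    have "(\<lambda>L. measure (N L) (space M) - measure (N L) B) \<longlonglongrightarrow> measure M (space M) * c - measure M B * c"
      using conv[OF G(3)] by (intro tendsto_diff compl(2)) (simp add: int)
    moreover have "measure (N L) (space M - B) = measure (N L) (space M) - measure (N L) B" for L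
      using finite_measure.finite_measure_compl[OF fN, of B L] B by (simp add: sN)
    moreover have "measure M (space M - B) = measure M (space M) - measure M B"
      using M.finite_measure_compl[OF B] by simp
    ultimately show ?case by (simp add: left_diff_distrib)
  next
    case (union B)
    have B: "range B \<subseteq> sets M" using union(2) sM by blast
    have sums: "(\<lambda>k. measure (N L) (B k)) sums measure (N L) (\<Union>k. B k)" for L
      using finite_measure.finite_measure_UNION[OF fN, of B L] B union(1) by (simp add: sN)
    have sumsM: "(\<lambda>k. measure M (B k)) sums measure M (\<Union>k. B k)"
      by (rule M.finite_measure_UNION[OF B union(1)])
    have "(\<lambda>L. suminf (\<lambda>k. measure (N L) (B k))) \<longlonglongrightarrow> suminf (\<lambda>k. measure M (B k) * c)"
    proof (rule tannerys_theorem[THEN conjunct2, THEN conjunct2])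
      show "(\<lambda>L. measure (N L) (B k)) \<longlonglongrightarrow> measure M (B k) * c" for k by (rule union(3))
      show "\<forall>\<^sub>F (k, L) in sequentially \<times>\<^sub>F sequentially. norm (measure (N L) (B k)) \<le> measure M (B k)"
        using mN B by (intro always_eventually) (auto simp: image_subset_iff)
      show "summable (\<lambda>k. measure M (B k))" using sumsM by (rule sums_summable)
    qed simp
    moreover have "suminf (\<lambda>k. measure M (B k) * c) = measure M (\<Union>k. B k) * c"
      using sums_unique[OF sums_mult2[OF sumsM, of c]] by simp
    ultimately show ?case using sums_unique[OF sums] by simp
  qed
  then show ?thesis using int[OF sM[OF A]] by simp
qed

text \<open>Events are replaced by a bounded function through uniform approximation by step
  functions; the error does not depend on \<open>L\<close>.\<close>

lemma setwise_convergence_function: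
  fixes \<Phi> :: "nat \<Rightarrow> 'w \<Rightarrow> real"
  assumes M: "prob_space M" and sub: "subalgebra M F"
    and \<Phi> [measurable]: "\<And>L. \<Phi> L \<in> borel_measurable M"
    and bd: "\<And>L \<omega>. 0 \<le> \<Phi> L \<omega> \<and> \<Phi> L \<omega> \<le> 1"
    and conv: "\<And>A. A \<in> sets F \<Longrightarrow> (\<lambda>L. \<integral>\<omega>. indicator A \<omega> * \<Phi> L \<omega> \<partial>M) \<longlonglongrightarrow> measure M A * c"
    and f: "f \<in> borel_measurable F" "\<And>\<omega>. 0 \<le> f \<omega> \<and> f \<omega> \<le> 1"
  shows "(\<lambda>L. \<integral>\<omega>. f \<omega> * \<Phi> L \<omega> \<partial>M) \<longlonglongrightarrow> (\<integral>\<omega>. f \<omega> \<partial>M) * c"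
proof -
  interpret M: prob_space M by (rule M)
  have sp: "space F = space M" "sets F \<subseteq> sets M" using sub by (auto simp: subalgebra_def)
  have fM [measurable]: "f \<in> borel_measurable M" by (rule measurable_from_subalg[OF sub f(1)])
  define A where "A N k = {\<omega> \<in> space F. real k / real N \<le> f \<omega>}" for N k :: nat
  have AF: "A N k \<in> sets F" for N k unfolding A_def using f(1) by measurable
  then have AM [measurable]: "A N k \<in> sets M" for N k using sp by auto
  \<comment> \<open>The average of the indicators of the level sets rounds \<open>f\<close> down to
    a multiple of \<open>1 / N\<close>, so it is within \<open>1 / N\<close> of \<open>f\<close>
    everywhere.\<close>
  define g where "g N \<omega> = (\<Sum>k\<in>{1..N}. indicator (A N k) \<omega> / real N)" for N :: nat and \<omega>
  have gm [measurable]: "g N \<in> borel_measurable M" for N unfolding g_def by measurable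
  have gf: "\<bar>f \<omega> - g N \<omega>\<bar> \<le> 1 / real N" if "\<omega> \<in> space M" "N > 0" for N \<omega>
  proof -
    have "g N \<omega> = real (card {k\<in>{1..N}. \<omega> \<in> A N k}) / real N"
      unfolding g_def by (simp add: sum_divide_distrib[symmetric] indicator_def sum.If_cases Int_def)
    also have "{k\<in>{1..N}. \<omega> \<in> A N k} = {1..nat \<lfloor>real N * f \<omega>\<rfloor>}"
    proof (intro set_eqI)
      fix k
      have "real N * f \<omega> \<le> real N" using f(2)[of \<omega>] that by (simp add: mult_left_le)
      then have "nat \<lfloor>real N * f \<omega>\<rfloor> \<le> N" by linarith
      moreover have "real k / real N \<le> f \<omega> \<longleftrightarrow> k \<le> nat \<lfloor>real N * f \<omega>\<rfloor>"
        using that f(2)[of \<omega>] by (simp add: le_nat_iff le_floor_iff divide_le_eq mult.commute)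
      ultimately show "k \<in> {k\<in>{1..N}. \<omega> \<in> A N k} \<longleftrightarrow> k \<in> {1..nat \<lfloor>real N * f \<omega>\<rfloor>}"
        using that by (auto simp: A_def sp)
    qed
    finally have g: "g N \<omega> * real N = of_int \<lfloor>real N * f \<omega>\<rfloor>" using that f(2)[of \<omega>] by simp
    then have "\<bar>real N * f \<omega> - g N \<omega> * real N\<bar> \<le> 1" by linarith
    then have "\<bar>(f \<omega> - g N \<omega>) * real N\<bar> \<le> 1" by (simp add: algebra_simps)
    then show ?thesis using that by (simp add: abs_mult le_divide_eq)
  qed
  have bint: "integrable M h" if "h \<in> borel_measurable M" "\<And>\<omega>. \<omega> \<in> space M \<Longrightarrow> \<bar>h \<omega>\<bar> \<le> b"
    for h :: "'w \<Rightarrow> real" and b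
    using that by (intro M.integrable_const_bound[where B = b]) auto
  have if1: "integrable M (\<lambda>\<omega>. f \<omega> * \<Phi> L \<omega>)" for L
    by (rule bint[of _ 1]) (use bd f(2) in \<open>auto simp: abs_mult intro!: mult_le_one\<close>)
  have g2: "\<bar>g N \<omega>\<bar> \<le> 2" if "\<omega> \<in> space M" "N > 0" for N \<omega>
  proof -
    have "\<bar>g N \<omega>\<bar> \<le> 1 + 1 / real N" using gf[OF that] f(2)[of \<omega>] by linarith
    also have "\<dots> \<le> 2" using that by (simp add: divide_le_eq)
    finally show ?thesis .
  qed
  have ig: "integrable M (g N)" if "N > 0" for N
    by (rule bint[of _ 2]) (use g2[OF _ that] in auto)
  have ig1: "integrable M (\<lambda>\<omega>. g N \<omega> * \<Phi> L \<omega>)" if "N > 0" for N L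
  proof (rule bint[of _ "2 * 1"])
    fix \<omega> assume "\<omega> \<in> space M"
    then have "\<bar>g N \<omega>\<bar> \<le> 2" by (rule g2[OF _ that])
    then show "\<bar>g N \<omega> * \<Phi> L \<omega>\<bar> \<le> 2 * 1"
      unfolding abs_mult using bd[of L \<omega>] by (intro mult_mono) auto
  qed measurable
  have d1: "\<bar>(\<integral>\<omega>. f \<omega> * \<Phi> L \<omega> \<partial>M) - (\<integral>\<omega>. g N \<omega> * \<Phi> L \<omega> \<partial>M)\<bar> \<le> 1 / real N" if "N > 0" for N L
  proof -
    have "\<bar>(\<integral>\<omega>. f \<omega> * \<Phi> L \<omega> - g N \<omega> * \<Phi> L \<omega> \<partial>M)\<bar> \<le> (\<integral>\<omega>. \<bar>f \<omega> * \<Phi> L \<omega> - g N \<omega> * \<Phi> L \<omega>\<bar> \<partial>M)"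
      by (rule integral_abs_bound)
    also have "\<dots> \<le> (\<integral>\<omega>. 1 / real N \<partial>M)"
    proof (intro integral_mono integrable_abs Bochner_Integration.integrable_diff if1 ig1 that)
      fix \<omega> assume "\<omega> \<in> space M"
      have "\<bar>f \<omega> * \<Phi> L \<omega> - g N \<omega> * \<Phi> L \<omega>\<bar> = \<bar>f \<omega> - g N \<omega>\<bar> * \<Phi> L \<omega>"
        using bd[of L \<omega>] by (simp add: left_diff_distrib[symmetric] abs_mult)
      also have "\<dots> \<le> \<bar>f \<omega> - g N \<omega>\<bar> * 1" using bd[of L \<omega>] by (intro mult_left_mono) auto
      also have "\<dots> \<le> 1 / real N" using gf[OF \<open>\<omega> \<in> space M\<close> that] by simp
      finally show "\<bar>f \<omega> * \<Phi> L \<omega> - g N \<omega> * \<Phi> L \<omega>\<bar> \<le> 1 / real N" .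
    qed simp
    finally show ?thesis using M.prob_space by (simp add: Bochner_Integration.integral_diff if1 ig1 that)
  qed
  have if0: "integrable M f" by (rule bint[of _ 1]) (use f(2) in auto)
  have d2: "\<bar>(\<integral>\<omega>. f \<omega> \<partial>M) - (\<integral>\<omega>. g N \<omega> \<partial>M)\<bar> \<le> 1 / real N" if "N > 0" for N
  proof -
    have "\<bar>(\<integral>\<omega>. f \<omega> - g N \<omega> \<partial>M)\<bar> \<le> (\<integral>\<omega>. \<bar>f \<omega> - g N \<omega>\<bar> \<partial>M)" by (rule integral_abs_bound)
    also have "\<dots> \<le> (\<integral>\<omega>. 1 / real N \<partial>M)"
      by (intro integral_mono integrable_abs Bochner_Integration.integrable_diff if0 ig that gf) auto
    finally show ?thesis using M.prob_space by (simp add: Bochner_Integration.integral_diff if0 ig that)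
  qed
  have convg: "(\<lambda>L. \<integral>\<omega>. g N \<omega> * \<Phi> L \<omega> \<partial>M) \<longlonglongrightarrow> (\<integral>\<omega>. g N \<omega> \<partial>M) * c" if "N > 0" for N
  proof -
    have i1: "integrable M (\<lambda>\<omega>. indicator (A N k) \<omega> * \<Phi> L \<omega>)" for k L
      by (rule bint[of _ 1]) (use bd in \<open>auto simp: indicator_def\<close>)
    have "(\<integral>\<omega>. g N \<omega> * \<Phi> L \<omega> \<partial>M) = (\<Sum>k\<in>{1..N}. (\<integral>\<omega>. indicator (A N k) \<omega> * \<Phi> L \<omega> \<partial>M) / real N)" for L
    proof -
      have "(\<integral>\<omega>. g N \<omega> * \<Phi> L \<omega> \<partial>M) = (\<integral>\<omega>. (\<Sum>k\<in>{1..N}. (indicator (A N k) \<omega> * \<Phi> L \<omega>) / real N) \<partial>M)"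
        unfolding g_def by (simp add: sum_distrib_right)
      also have "\<dots> = (\<Sum>k\<in>{1..N}. (\<integral>\<omega>. (indicator (A N k) \<omega> * \<Phi> L \<omega>) / real N \<partial>M))"
        by (rule Bochner_Integration.integral_sum) (intro integrable_divide_zero i1)
      finally show ?thesis by simp
    qed
    moreover have "(\<integral>\<omega>. g N \<omega> \<partial>M) = (\<Sum>k\<in>{1..N}. measure M (A N k) / real N)"
    proof -
      have "integrable M (indicat_real (A N k))" for k by (rule bint[of _ 1]) (auto simp: indicator_def)
      then have "(\<integral>\<omega>. g N \<omega> \<partial>M) = (\<Sum>k\<in>{1..N}. \<integral>\<omega>. indicator (A N k) \<omega> / real N \<partial>M)"
        unfolding g_def by (intro Bochner_Integration.integral_sum integrable_divide_zero)
      then show ?thesis by simp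
    qed
    moreover have "(\<lambda>L. \<Sum>k\<in>{1..N}. (\<integral>\<omega>. indicator (A N k) \<omega> * \<Phi> L \<omega> \<partial>M) / real N)
        \<longlonglongrightarrow> (\<Sum>k\<in>{1..N}. (measure M (A N k) * c) / real N)"
      by (intro tendsto_sum tendsto_divide conv AF tendsto_const) (use that in auto)
    ultimately show ?thesis by (simp add: sum_distrib_right)
  qed
  show ?thesis
  proof (rule LIMSEQ_I)
    fix r :: real assume r: "r > 0"
    \<comment> \<open>Three errors add up to \<open>(2 + \<bar>c\<bar>) / N\<close>: one
      \<open>1 / N\<close> for replacing \<open>f\<close> by \<open>g N\<close> under
      \<open>\<Phi> L\<close>, another for the distance to the limit for \<open>g N\<close>, and
      \<open>\<bar>c\<bar> / N\<close> for replacing the integral of \<open>f\<close> in the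
      limit.\<close>
    obtain N :: nat where N: "(2 + \<bar>c\<bar>) / r < real N" using reals_Archimedean2 by blast
    have "0 < (2 + \<bar>c\<bar>) / r" using r by simp
    with N have N0: "N > 0" by (metis of_nat_0_less_iff order_less_trans)
    have N1: "(1 + \<bar>c\<bar>) / real N + 1 / real N < r"
      using N r N0 by (simp add: field_simps)
    obtain L0 where L0: "\<And>L. L \<ge> L0 \<Longrightarrow> \<bar>(\<integral>\<omega>. g N \<omega> * \<Phi> L \<omega> \<partial>M) - (\<integral>\<omega>. g N \<omega> \<partial>M) * c\<bar> < 1 / real N"
      using LIMSEQ_D[OF convg[OF N0], of "1 / real N"] N0 by auto
    show "\<exists>L0. \<forall>L\<ge>L0. norm ((\<integral>\<omega>. f \<omega> * \<Phi> L \<omega> \<partial>M) - (\<integral>\<omega>. f \<omega> \<partial>M) * c) < r"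
    proof (intro exI allI impI)
      fix L assume L: "L \<ge> L0"
      have "\<bar>(\<integral>\<omega>. f \<omega> \<partial>M) * c - (\<integral>\<omega>. g N \<omega> \<partial>M) * c\<bar> \<le> 1 / real N * \<bar>c\<bar>"
        unfolding left_diff_distrib[symmetric] abs_mult by (intro mult_right_mono d2 N0) simp
      then have "\<bar>(\<integral>\<omega>. f \<omega> * \<Phi> L \<omega> \<partial>M) - (\<integral>\<omega>. f \<omega> \<partial>M) * c\<bar> < 1 / real N + 1 / real N + 1 / real N * \<bar>c\<bar>"
        using d1[OF N0, of L] L0[OF L] by linarith
      also have "\<dots> < r" using N1 by (simp add: add_divide_distrib)
      finally show "norm ((\<integral>\<omega>. f \<omega> * \<Phi> L \<omega> \<partial>M) - (\<integral>\<omega>. f \<omega> \<partial>M) * c) < r" by simp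
    qed
  qed
qed

section \<open>Marked paths and mixing\<close>

text \<open>A marked path is a path together with a set of marked levels, which will be regeneration
  levels of the path.\<close>

type_synonym 'd marked_path = "(nat \<Rightarrow> 'd site) \<times> (nat \<Rightarrow> bool)"

abbreviation mark_space :: "('d::finite) marked_path measure" where
  "mark_space \<equiv> path_space \<Otimes>\<^sub>M PiM UNIV (\<lambda>_. count_space UNIV)"

definition mpost :: "'d \<Rightarrow> nat \<Rightarrow> ('d::finite) marked_path \<Rightarrow> 'd marked_path" where
  "mpost j L v = (post j L (fst v), \<lambda>m. snd v (L + m))"

definition at_mark :: "'d \<Rightarrow> (('d::finite) marked_path \<Rightarrow> real) \<Rightarrow> nat \<Rightarrow> 'd marked_path \<Rightarrow> real" where
  "at_mark j g L v = (if snd v L then g (mpost j L v) else 0)"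

text \<open>In the limit \<open>L \<rightarrow> \<infinity>\<close>, the event that \<open>L\<close> is marked together with the path after \<open>L\<close> is
  independent of the past. Both the stationarity of the sequence of excursions between marks and
  its ergodicity follow from this property alone.\<close>

definition mixing ::
    "'w measure \<Rightarrow> 'w measure \<Rightarrow> 'd \<Rightarrow> ('w \<Rightarrow> ('d::finite) marked_path) \<Rightarrow> 'd marked_path measure \<Rightarrow> bool" where
  "mixing M F j \<zeta> \<nu> \<longleftrightarrow>
     (\<forall>A\<in>sets F. \<forall>g\<in>borel_measurable mark_space. (\<forall>v. 0 \<le> g v \<and> g v \<le> 1) \<longrightarrow>
        (\<lambda>L. \<integral>\<omega>. indicator A \<omega> * at_mark j g L (\<zeta> \<omega>) \<partial>M) \<longlonglongrightarrow> measure M A * (\<integral>v. g v \<partial>\<nu>))"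

lemma space_mark_space [simp]: "space mark_space = UNIV"
  by (simp add: space_pair_measure space_PiM)

lemma measurable_fst_mark [measurable]: "fst \<in> measurable mark_space path_space"
  by (rule measurable_fst)

lemma pred_mark [measurable]: "Measurable.pred mark_space (\<lambda>v. snd v m)"
proof -
  have "(\<lambda>v. snd v m) \<in> measurable mark_space (count_space UNIV)"
    by (rule measurable_compose[OF measurable_snd measurable_component_singleton]) simp
  then show ?thesis .
qed

lemma measurable_mpost [measurable]: "mpost j L \<in> measurable mark_space mark_space"
proof -
  have "(\<lambda>v m. snd v (L + m)) \<in> measurable mark_space (PiM UNIV (\<lambda>_. count_space UNIV))"
    by (rule measurable_abs_UNIV) (rule pred_mark)
  then have "(\<lambda>v. (post j L (fst v), \<lambda>m. snd v (L + m))) \<in> measurable mark_space mark_space"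
    by (intro measurable_Pair measurable_compose[OF measurable_fst_mark measurable_post])
  then show ?thesis by (simp add: mpost_def[abs_def])
qed

lemma measurable_at_mark:
  "g \<in> borel_measurable mark_space \<Longrightarrow> at_mark j g L \<in> borel_measurable mark_space"
  unfolding at_mark_def[abs_def]
proof (rule measurable_If)
  assume g: "g \<in> borel_measurable mark_space"
  show "(\<lambda>v. g (mpost j L v)) \<in> borel_measurable mark_space"
    by (rule measurable_compose[OF measurable_mpost g])
  show "{v \<in> space mark_space. snd v L} \<in> sets mark_space"
    using pred_mark[of L] by (simp add: pred_def)
qed simp

lemma at_mark_bounds: "(\<And>v. 0 \<le> g v \<and> g v \<le> 1) \<Longrightarrow> 0 \<le> at_mark j g L v \<and> at_mark j g L v \<le> 1"
  by (simp add: at_mark_def)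

text \<open>The complement of \<open>P\<close> is almost surely never seen beyond a mark, so the
  integrals of its indicator vanish for all positive levels, and hence in the limit.\<close>

lemma mixing_AE:
  assumes M: "prob_space M" and mix: "mixing M F j \<zeta> \<nu>"
    and \<nu>: "finite_measure \<nu>" "sets \<nu> = sets mark_space" and spF: "space M \<in> sets F"
    and P: "Measurable.pred mark_space P"
    and ae: "AE \<omega> in M. \<forall>L\<ge>1. snd (\<zeta> \<omega>) L \<longrightarrow> P (mpost j L (\<zeta> \<omega>))"
  shows "AE v in \<nu>. P v"
proof -
  interpret M: prob_space M by (rule M)
  interpret N: finite_measure \<nu> by (rule \<nu>(1))
  define B where "B = {v. \<not> P v}"
  have B: "B \<in> sets mark_space"
  proof -
    have "B = space mark_space - {v \<in> space mark_space. P v}" by (auto simp: B_def)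
    also have "\<dots> \<in> sets mark_space" using P by (intro sets.compl_sets) (simp add: pred_def)
    finally show ?thesis .
  qed
  have "(\<lambda>L. \<integral>\<omega>. indicator (space M) \<omega> * at_mark j (indicator B) L (\<zeta> \<omega>) \<partial>M)
      \<longlonglongrightarrow> measure M (space M) * (\<integral>v. indicator B v \<partial>\<nu>)"
    by (rule mix[unfolded mixing_def, rule_format, OF spF borel_measurable_indicator[OF B]]) simp
  moreover have "eventually (\<lambda>L. (\<integral>\<omega>. indicator (space M) \<omega> * at_mark j (indicator B) L (\<zeta> \<omega>) \<partial>M) = 0) sequentially"
    using eventually_ge_at_top[of 1]
  proof eventually_elim
    case (elim L)
    have "AE \<omega> in M. indicator (space M) \<omega> * at_mark j (indicator B) L (\<zeta> \<omega>) = (0::real)"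
      using ae by eventually_elim (use elim in \<open>auto simp: at_mark_def B_def\<close>)
    then show ?case by (rule integral_eq_zero_AE)
  qed
  ultimately have "measure M (space M) * (\<integral>v. indicator B v \<partial>\<nu>) = 0"
    by (rule LIMSEQ_unique[OF _ tendsto_eventually])
  then have "(\<integral>v. indicator B v \<partial>\<nu>) = (0::real)" by (simp only: M.prob_space mult_1)
  moreover have "B \<inter> space \<nu> = B"
    using sets_eq_imp_space_eq[OF \<nu>(2)] by (simp only: space_mark_space Int_UNIV_right)
  ultimately have "measure \<nu> B = 0" using Bochner_Integration.integral_indicator[of \<nu> B] by (simp only:)
  then have "emeasure \<nu> B = 0" by (simp add: N.emeasure_eq_measure)
  moreover have "{v \<in> space \<nu>. \<not> P v} \<subseteq> B" by (auto simp: B_def)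
  moreover have "B \<in> sets \<nu>" by (simp only: \<nu>(2) B)
  ultimately show ?thesis by (intro AE_I)
qed

section \<open>Paths along which a walk is transient\<close>

lemma pred_path2: "Measurable.pred path_space (\<lambda>y. P (y k) (y l))"
  by (rule measurable_compose_countable[where f = "\<lambda>z y. P z (y l)" and g = "\<lambda>y. y k"])
     (rule pred_path, rule measurable_component_singleton, simp)

text \<open>Charging every vertex to its first visit turns a sum over a set that depends on the path
  into a sum over indices with measurable terms.\<close>

lemma weight_sum_eq:
  fixes y :: "nat \<Rightarrow> ('d::finite) site"
  shows "(\<Sum>x\<in>y ` {..<n}. weight q x) = (\<Sum>k<n. if \<exists>i<k. y i = y k then 0 else weight q (y k))"
proof (induction n)
  case (Suc n)
  have "y ` {..<Suc n} = insert (y n) (y ` {..<n})" by (simp add: lessThan_Suc)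
  moreover have "y n \<in> y ` {..<n} \<longleftrightarrow> (\<exists>i<n. y i = y n)" by (auto simp: image_iff Bex_def eq_commute)
  ultimately show ?case using Suc by (auto simp: sum.insert_if)
qed simp

lemma pred_nice [measurable]:
  fixes q :: "('d::finite) site pmf"
  shows "Measurable.pred path_space (nice q j)"
proof -
  have m: "(\<lambda>y. if \<exists>i<k. y i = y k then 0 else weight q (y k)) \<in> borel_measurable path_space"
    for k :: nat
  proof (rule measurable_If)
    have "(\<lambda>y::nat \<Rightarrow> 'd site. y k) \<in> measurable path_space (count_space UNIV)"
      by (rule measurable_component_singleton) simp
    then show "(\<lambda>y::nat \<Rightarrow> 'd site. weight q (y k)) \<in> borel_measurable path_space"
      by (rule measurable_compose) simp
    have "Measurable.pred path_space (\<lambda>y::nat \<Rightarrow> 'd site. \<exists>i<k. y i = y k)"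
      supply pred_path2 [measurable] by measurable
    then show "{y \<in> space path_space. \<exists>i<k. y i = (y k :: 'd site)} \<in> sets path_space"
      by (simp add: pred_def)
  qed simp
  \<comment> \<open>An integer bound makes the quantifier countable.\<close>
  have C: "(\<exists>C. \<forall>n. (\<Sum>x\<in>y ` {..<n}. weight q x) \<le> C)
      \<longleftrightarrow> (\<exists>C::nat. \<forall>n. (\<Sum>x\<in>y ` {..<n}. weight q x) \<le> real C)" for y :: "nat \<Rightarrow> 'd site"
  proof
    assume "\<exists>C. \<forall>n. (\<Sum>x\<in>y ` {..<n}. weight q x) \<le> C"
    then obtain C where C: "\<And>n. (\<Sum>x\<in>y ` {..<n}. weight q x) \<le> C" by blast
    obtain N :: nat where "C < real N" using reals_Archimedean2 by blast
    then show "\<exists>C::nat. \<forall>n. (\<Sum>x\<in>y ` {..<n}. weight q x) \<le> real C"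
      using C by (intro exI[of _ N] allI) (meson order_trans less_imp_le)
  qed blast
  have sm: "Measurable.pred path_space (\<lambda>y::nat \<Rightarrow> 'd site. (\<Sum>x\<in>y ` {..<n}. weight q x) \<le> real C)" for n C
  proof -
    have "(\<lambda>y. \<Sum>x\<in>y ` {..<n}. weight q x) \<in> borel_measurable path_space"
      unfolding weight_sum_eq by (intro borel_measurable_sum m)
    then show ?thesis by measurable
  qed
  have l: "Measurable.pred path_space (\<lambda>y::nat \<Rightarrow> 'd site. lattice_path y)"
    supply pred_path2 [measurable] pred_path [measurable] unfolding lattice_path_def by measurable
  have "Measurable.pred path_space (\<lambda>y::nat \<Rightarrow> 'd site. lattice_path y
      \<and> (\<forall>K. \<exists>N. \<forall>n\<ge>N. K \<le> y n $ j) \<and> (\<exists>C::nat. \<forall>n. (\<Sum>x\<in>y ` {..<n}. weight q x) \<le> real C))"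
    supply pred_path [measurable] using l sm by measurable
  then show ?thesis
    unfolding nice_def[abs_def] C filterlim_at_top eventually_sequentially .
qed

text \<open>Recentring multiplies all weights by the same constant, so summability is preserved;
  regeneration keeps the rest of the path above its start.\<close>

lemma nice_post:
  assumes y: "nice q j y" and r: "reg j L y"
  shows "nice q j (post j L y)" and "post j L y \<in> stays j"
proof -
  define t where "t = hit j L y"
  define c where "c = y t"
  have p: "post j L y k = y (t + k) - c" for k by (simp add: post_def t_def c_def)
  obtain C where C: "\<And>n. (\<Sum>x\<in>y ` {..<n}. weight q x) \<le> C"
    and ly: "lattice_path y" and lim: "filterlim (\<lambda>n. y n $ j) at_top sequentially"
    using y by (auto simp: nice_def)
  have "c $ j = int L" unfolding c_def t_def by (rule hit_height[OF ly]) (use r in \<open>simp add: reg_def\<close>)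
  then show "post j L y \<in> stays j" using r by (simp add: p reg_def t_def)
  have "filterlim (\<lambda>k. y (k + t) $ j) at_top sequentially"
    by (rule filterlim_compose[OF lim filterlim_add_const_nat_at_top])
  then have "eventually (\<lambda>k. K + c $ j \<le> y (k + t) $ j) sequentially" for K
    by (simp add: filterlim_at_top)
  then have lim': "filterlim (\<lambda>k. post j L y k $ j) at_top sequentially"
    by (simp add: filterlim_at_top p add.commute le_diff_eq)
  have w: "weight q (x - c) = exp (log_ratio q \<bullet> real_site c) * weight q x" for x
    by (simp add: weight_def real_site_diff inner_diff_right exp_add[symmetric])
  have "(\<Sum>x\<in>post j L y ` {..<n}. weight q x) \<le> exp (log_ratio q \<bullet> real_site c) * C" for n
  proof -
    have eq: "post j L y ` {..<n} = (\<lambda>x. x - c) ` (\<lambda>k. y (t + k)) ` {..<n}"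
      by (auto simp: p image_image)
    have "(\<Sum>x\<in>post j L y ` {..<n}. weight q x) = (\<Sum>x\<in>(\<lambda>k. y (t + k)) ` {..<n}. weight q (x - c))"
      unfolding eq by (subst sum.reindex) (auto simp: inj_on_def)
    also have "\<dots> = exp (log_ratio q \<bullet> real_site c) * (\<Sum>x\<in>(\<lambda>k. y (t + k)) ` {..<n}. weight q x)"
      by (simp add: w sum_distrib_left)
    also have "\<dots> \<le> exp (log_ratio q \<bullet> real_site c) * C"
      by (intro mult_left_mono weight_sum_le[OF C]) auto
    finally show ?thesis .
  qed
  then show "nice q j (post j L y)"
    using lattice_path_post[OF ly] lim' unfolding nice_def by blast
qed

section \<open>Mixing is inherited by the walk on the trace\<close>

text \<open>\<open>B\<close> carries the marks inherited from the earlier walks; a level keeps its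
  mark only if the new walk regenerates there as well.\<close>

definition wmark ::
  "'d \<Rightarrow> ('d::finite) site set set \<Rightarrow> (nat \<Rightarrow> bool) \<Rightarrow> (nat \<Rightarrow> 'd site set \<Rightarrow> 'd site) \<Rightarrow> 'd marked_path" where
  "wmark j E B u = (walk E 0 u, \<lambda>m. B m \<and> reg j m (walk E 0 u))"

text \<open>Only values before time \<open>n\<close> are prescribed, so that
  \<open>prefix 0 w\<close> is the whole space and, for a walk, the event is decided by the choices
  before time \<open>n\<close>.\<close>

abbreviation prefix :: "nat \<Rightarrow> (nat \<Rightarrow> ('d::finite) site) \<Rightarrow> (nat \<Rightarrow> 'd site) set" where
  "prefix n w \<equiv> {x. \<forall>k<n. x k = w k}"

lemma sets_prefix [measurable]: "prefix n w \<in> sets path_space"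
proof -
  have "Measurable.pred path_space (\<lambda>x. \<forall>k<n. x k = w k)" supply pred_path [measurable] by measurable
  then show ?thesis by (simp add: pred_def)
qed

lemma sets_walk_vimage: "S \<in> sets path_space \<Longrightarrow> {u. walk E z u \<in> S} \<in> sets (choices q)"
  using measurable_sets[OF measurable_walk_choices[of E z q], of S] by (simp add: vimage_def)

lemma measurable_marks:
  assumes Y: "Y \<in> measurable N path_space"
    and B: "\<And>m. Measurable.pred N (\<lambda>x. B x m)"
  shows "(\<lambda>x. (Y x, \<lambda>m. B x m \<and> reg j m (Y x))) \<in> measurable N mark_space"
proof (intro measurable_Pair Y measurable_abs_UNIV)
  fix m
  have "Measurable.pred N (\<lambda>x. reg j m (Y x))"
    by (rule measurable_compose[OF Y pred_reg])
  with B[of m] show "Measurable.pred N (\<lambda>x. B x m \<and> reg j m (Y x))" by (rule pred_intros_logic)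
qed

lemma pred_fst:
  assumes "Measurable.pred N P" shows "Measurable.pred (N \<Otimes>\<^sub>M K) (\<lambda>z. P (fst z))"
  by (rule measurable_compose[OF measurable_fst assms])

lemma measurable_wmark_pair:
  assumes E: "\<And>e. {x \<in> space N. e \<in> E x} \<in> sets N" and B: "\<And>m. Measurable.pred N (\<lambda>x. B x m)"
  shows "(\<lambda>z. wmark j (E (fst z)) (B (fst z)) (snd z)) \<in> measurable (N \<Otimes>\<^sub>M choices q) mark_space"
proof -
  have "(\<lambda>z. walk (E (fst z)) 0 (snd z)) \<in> measurable (N \<Otimes>\<^sub>M choices q) path_space"
    using measurable_walk_pair[OF E] by (simp only: case_prod_unfold)
  then show ?thesis
    unfolding wmark_def by (intro measurable_marks pred_fst B)
qed

lemma measurable_wmark: "wmark j E B \<in> measurable (choices q) mark_space"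
  unfolding wmark_def[abs_def] by (intro measurable_marks measurable_walk_choices) simp

text \<open>The mean of \<open>g\<close> over the marked walk on \<open>E\<close>, restricted to
  (not conditioned on) never going below its start. With \<open>E\<close> the half trace of a
  future, it describes what a new walk does beyond a common mark.\<close>

definition escape_kernel ::
  "('d::finite) site pmf \<Rightarrow> 'd \<Rightarrow> ('d marked_path \<Rightarrow> real) \<Rightarrow> 'd site set set \<Rightarrow> (nat \<Rightarrow> bool) \<Rightarrow> ennreal" where
  "escape_kernel q j g E B
     = (\<integral>\<^sup>+u. indicator (stays j) (walk E 0 u) * ennreal (g (wmark j E B u)) \<partial>choices q)"

lemma escape_kernel_le_1:
  assumes "\<And>v. 0 \<le> g v \<and> g v \<le> 1" shows "escape_kernel q j g E B \<le> 1"
proof -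
  interpret Ch: prob_space "choices q" by (rule prob_space_choices)
  have "escape_kernel q j g E B \<le> (\<integral>\<^sup>+u. 1 \<partial>choices q)"
    unfolding escape_kernel_def using assms
    by (intro nn_integral_mono) (auto simp: indicator_def ennreal_le_1)
  also have "\<dots> = 1" using Ch.emeasure_space_1 by simp
  finally show ?thesis .
qed

text \<open>On a frozen graph the past of the walk and its marked future at \<open>L\<close>
  factorise exactly, by \<open>strong_markov\<close>. By \<open>reg_post\<close>, the marks of the
  future are the inherited ones shifted by \<open>L\<close> at which the recentred walk
  regenerates.\<close>

lemma quenched_mark:
  assumes q: "elliptic q" and E: "avail E 0 \<noteq> {}"
    and hits: "AE u in choices q. \<exists>n. int L \<le> walk E 0 u n $ j"
    and loc: "\<And>u z. valid_choices u \<Longrightarrow> \<exists>n. int L \<le> walk E 0 u n $ j \<Longrightarrow> 0 \<le> z $ j \<Longrightarrow>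
                avail E (walk E 0 u (hit j L (walk E 0 u)) + z) = avail E' z"
    and g: "g \<in> borel_measurable mark_space" and nL: "n \<le> L" and BL: "B L"
  shows "(\<integral>\<^sup>+u. indicator (prefix n w) (walk E 0 u) * ennreal (at_mark j g L (wmark j E B u)) \<partial>choices q)
       = emeasure (choices q) {u. walk E 0 u \<in> prefix n w} * escape_kernel q j g E' (\<lambda>m. B (L + m))"
proof -
  define F where "F y = ennreal (g (y, \<lambda>m. B (L + m) \<and> reg j m y))" for y
  have "(\<lambda>y. (y, \<lambda>m. B (L + m) \<and> reg j m y)) \<in> measurable path_space mark_space"
    by (rule measurable_marks[where Y = "\<lambda>y. y" and B = "\<lambda>_ m. B (L + m)"]) auto
  from measurable_compose[OF measurable_compose[OF this g] measurable_ennreal]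
  have F: "F \<in> borel_measurable path_space" by (simp only: F_def[abs_def])
  let ?A = "{u. walk E 0 u \<in> prefix n w}"
  have A: "?A \<in> sets (choices q)" by (rule sets_walk_vimage[OF sets_prefix])
  have dep: "u \<in> ?A \<longleftrightarrow> u' \<in> ?A" if "\<And>k. k < n \<Longrightarrow> u k = u' k" for u u'
    using walk_cong[of n u u' _ E 0] that by simp
  have "(\<integral>\<^sup>+u. indicator (prefix n w) (walk E 0 u) * ennreal (at_mark j g L (wmark j E B u)) \<partial>choices q)
      = (\<integral>\<^sup>+u. indicator ?A u * indicator {y. reg j L y} (walk E 0 u) * F (post j L (walk E 0 u)) \<partial>choices q)"
  proof (rule nn_integral_cong_AE, use AE_valid_choices[OF q] in eventually_elim)
    case (elim u)
    have ly: "lattice_path (walk E 0 u)" by (rule lattice_path_walk[OF elim E])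
    have "ennreal (at_mark j g L (wmark j E B u))
        = indicator {y. reg j L y} (walk E 0 u) * F (post j L (walk E 0 u))"
    proof (cases "reg j L (walk E 0 u)")
      case True
      then have "\<exists>n. int L \<le> walk E 0 u n $ j" by (simp add: reg_def)
      then have "(\<lambda>m. B (L + m) \<and> reg j (L + m) (walk E 0 u))
          = (\<lambda>m. B (L + m) \<and> reg j m (post j L (walk E 0 u)))"
        using reg_post[OF ly] by auto
      with True BL show ?thesis by (simp add: at_mark_def wmark_def mpost_def F_def)
    qed (simp add: at_mark_def wmark_def)
    then show ?case by (simp add: indicator_def)
  qed
  also have "\<dots> = emeasure (choices q) ?A
      * (\<integral>\<^sup>+u. indicator (stays j) (walk E' 0 u) * F (walk E' 0 u) \<partial>choices q)"
    by (rule strong_markov[OF q E hits loc F A dep nL])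
  also have "(\<integral>\<^sup>+u. indicator (stays j) (walk E' 0 u) * F (walk E' 0 u) \<partial>choices q)
      = escape_kernel q j g E' (\<lambda>m. B (L + m))"
    by (simp add: escape_kernel_def F_def wmark_def)
  finally show ?thesis .
qed

text \<open>Given the graph, the prefix of the walk contributes a factor measurable in the old past,
  and the future contributes \<open>\<kappa> L\<close>. The convergence assumed on the old past,
  extended from events to this bounded factor, gives the limit on intersections of old events with
  prefixes; these generate the new past.\<close>

lemma mixing_core:
  fixes Y :: "'w \<Rightarrow> nat \<Rightarrow> ('d::finite) site"
  assumes M: "prob_space M" and sub: "subalgebra M F"
    and E: "\<And>e. {\<omega> \<in> space F. e \<in> E \<omega>} \<in> sets F"
    and Y: "Y \<in> measurable M path_space"
    and law: "\<And>A n w. A \<in> sets F \<Longrightarrow> measure M (A \<inter> {\<omega> \<in> space M. \<forall>k\<le>n. Y \<omega> k = w k})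
               = (\<integral>\<omega>. indicator A \<omega> * measure (choices q) {u. \<forall>k\<le>n. walk (E \<omega>) 0 u k = w k} \<partial>M)"
    and B: "\<And>m. Measurable.pred F (\<lambda>\<omega>. B \<omega> m)"
    and g: "g \<in> borel_measurable mark_space" "\<And>v. 0 \<le> g v \<and> g v \<le> 1"
    and \<kappa>: "\<And>L. \<kappa> L \<in> borel_measurable M" "\<And>L \<omega>. 0 \<le> \<kappa> L \<omega> \<and> \<kappa> L \<omega> \<le> 1"
    and quenched: "AE \<omega> in M. \<forall>L\<ge>1. B \<omega> L \<longrightarrow> (\<forall>n\<le>L. \<forall>w.
        (\<integral>\<^sup>+u. indicator (prefix n w) (walk (E \<omega>) 0 u) * ennreal (at_mark j g L (wmark j (E \<omega>) (B \<omega>) u)) \<partial>choices q)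
          = emeasure (choices q) {u. walk (E \<omega>) 0 u \<in> prefix n w} * ennreal (\<kappa> L \<omega>))"
    and conv: "\<And>A. A \<in> sets F \<Longrightarrow>
        (\<lambda>L. \<integral>\<omega>. indicator A \<omega> * (if B \<omega> L then \<kappa> L \<omega> else 0) \<partial>M) \<longlonglongrightarrow> measure M A * c"
    and A': "A' \<in> sigma_sets (space M) {A \<inter> {\<omega> \<in> space M. \<forall>k<n. Y \<omega> k = w k} | A n w. A \<in> sets F}"
  shows "(\<lambda>L. \<integral>\<omega>. indicator A' \<omega> * at_mark j g L (Y \<omega>, \<lambda>m. B \<omega> m \<and> reg j m (Y \<omega>)) \<partial>M)
           \<longlonglongrightarrow> measure M A' * c"
proof (rule setwise_convergence_sigma[OF M _ _ _ _ _ _ A'])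
  interpret M: prob_space M by (rule M)
  interpret Ch: prob_space "choices q" by (rule prob_space_choices)
  let ?Y = "\<lambda>n w. {\<omega> \<in> space M. \<forall>k<n. Y \<omega> k = w k}"
  let ?G = "{A \<inter> ?Y n w | A n w. A \<in> sets F}"
  have sp: "space F = space M" "sets F \<subseteq> sets M" using sub by (auto simp: subalgebra_def)
  have BM: "Measurable.pred M (\<lambda>\<omega>. B \<omega> m)" for m by (rule measurable_from_subalg[OF sub B])
  have YS: "?Y n w \<in> sets M" for n w
  proof -
    have "?Y n w = Y -` prefix n w \<inter> space M" by auto
    then show ?thesis using measurable_sets[OF Y sets_prefix[of n w]] by (simp only:)
  qed
  have atm: "(\<lambda>\<omega>. at_mark j g L (Y \<omega>, \<lambda>m. B \<omega> m \<and> reg j m (Y \<omega>))) \<in> borel_measurable M" for L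
    by (rule measurable_compose[OF measurable_marks[OF Y BM] measurable_at_mark[OF g(1)]])
  show "(\<lambda>\<omega>. at_mark j g L (Y \<omega>, \<lambda>m. B \<omega> m \<and> reg j m (Y \<omega>))) \<in> borel_measurable M" for L
    by (rule atm)
  show "0 \<le> at_mark j g L (Y \<omega>, \<lambda>m. B \<omega> m \<and> reg j m (Y \<omega>))
      \<and> at_mark j g L (Y \<omega>, \<lambda>m. B \<omega> m \<and> reg j m (Y \<omega>)) \<le> 1" for L \<omega>
    by (rule at_mark_bounds[OF g(2)])
  show "?G \<subseteq> sets M"
  proof
    fix D assume "D \<in> ?G"
    then obtain A n w where D: "D = A \<inter> ?Y n w" and A: "A \<in> sets F" by blast
    show "D \<in> sets M" unfolding D by (intro sets.Int YS subsetD[OF sp(2) A])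
  qed
  show "space M \<in> ?G"
  proof -
    have "space M = space F \<inter> ?Y 0 (\<lambda>_. 0)" using sp by auto
    with sets.top[of F] show ?thesis by (intro CollectI exI conjI)
  qed
  show "Int_stable ?G"
    unfolding Int_stable_def
  proof (intro ballI)
    fix a b assume "a \<in> ?G" "b \<in> ?G"
    then obtain A A' n m w v where AA: "A \<in> sets F" "A' \<in> sets F"
      and ab: "a = A \<inter> ?Y n w" "b = A' \<inter> ?Y m v" by blast
    have "?Y n w \<inter> ?Y m v = {} \<or> ?Y n w \<inter> ?Y m v = ?Y m v \<or> ?Y n w \<inter> ?Y m v = ?Y n w"
    proof (cases "n \<le> m")
      case True
      then show ?thesis by (cases "\<forall>k<n. w k = v k") (auto dest: less_le_trans)
    next
      case False
      then show ?thesis by (cases "\<forall>k<m. w k = v k") (auto dest: less_le_trans)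
    qed
    then have "\<exists>D n' w'. a \<inter> b = D \<inter> ?Y n' w' \<and> D \<in> sets F"
    proof (elim disjE)
      assume "?Y n w \<inter> ?Y m v = {}"
      then have "a \<inter> b = {} \<inter> ?Y n w" unfolding ab by blast
      then show ?thesis by blast
    next
      assume "?Y n w \<inter> ?Y m v = ?Y m v"
      then have "a \<inter> b = (A \<inter> A') \<inter> ?Y m v" unfolding ab by blast
      then show ?thesis using sets.Int[OF AA] by blast
    next
      assume "?Y n w \<inter> ?Y m v = ?Y n w"
      then have "a \<inter> b = (A \<inter> A') \<inter> ?Y n w" unfolding ab by blast
      then show ?thesis using sets.Int[OF AA] by blast
    qed
    then show "a \<inter> b \<in> ?G" by blast
  qed
  fix D assume "D \<in> ?G"
  then obtain A n w where D: "D = A \<inter> ?Y n w" and A: "A \<in> sets F" by blast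
  define pr where "pr \<omega> = measure (choices q) {u. walk (E \<omega>) 0 u \<in> prefix n w}" for \<omega>
  have em: "emeasure (choices q) {u. walk (E \<omega>) 0 u \<in> prefix n w} = ennreal (pr \<omega>)" for \<omega>
    by (simp only: pr_def Ch.emeasure_eq_measure)
  have pr01: "0 \<le> pr \<omega> \<and> pr \<omega> \<le> 1" for \<omega>
    unfolding pr_def using Ch.prob_le_1 by simp
  have prF: "pr \<in> borel_measurable F"
  proof -
    have "(\<lambda>z. indicator (prefix n w) ((\<lambda>(\<omega>, u). walk (E \<omega>) 0 u) z) :: ennreal) \<in> borel_measurable (F \<Otimes>\<^sub>M choices q)"
      by (rule measurable_compose[OF measurable_walk_pair[OF E] borel_measurable_indicator[OF sets_prefix]])
    from Ch.borel_measurable_nn_integral_fst[OF this]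
    have "(\<lambda>\<omega>. \<integral>\<^sup>+u. indicator (prefix n w) (walk (E \<omega>) 0 u) \<partial>choices q) \<in> borel_measurable F"
      by (simp only: prod.case)
    moreover have "(\<integral>\<^sup>+u. indicator (prefix n w) (walk (E \<omega>) 0 u) \<partial>choices q) = ennreal (pr \<omega>)" for \<omega>
    proof -
      have "(\<integral>\<^sup>+u. indicator (prefix n w) (walk (E \<omega>) 0 u) \<partial>choices q)
          = (\<integral>\<^sup>+u. indicator {u. walk (E \<omega>) 0 u \<in> prefix n w} u \<partial>choices q)"
        by (intro nn_integral_cong) (simp add: indicator_def)
      also have "\<dots> = emeasure (choices q) {u. walk (E \<omega>) 0 u \<in> prefix n w}"
        by (rule nn_integral_indicator[OF sets_walk_vimage[OF sets_prefix]])
      finally show ?thesis by (simp only: em)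
    qed
    ultimately have "(\<lambda>\<omega>. ennreal (pr \<omega>)) \<in> borel_measurable F" by (simp only:)
    from borel_measurable_enn2real[OF this] show ?thesis using pr01 by (simp cong: measurable_cong)
  qed
  have fF: "(\<lambda>\<omega>. indicator A \<omega> * pr \<omega>) \<in> borel_measurable F"
    by (intro borel_measurable_times borel_measurable_indicator A prF)
  have fM: "(\<lambda>\<omega>. indicator A \<omega> * pr \<omega>) \<in> borel_measurable M" by (rule measurable_from_subalg[OF sub fF])
  have f01: "0 \<le> indicator A \<omega> * pr \<omega> \<and> indicator A \<omega> * pr \<omega> \<le> 1" for \<omega>
    using pr01[of \<omega>] by (simp add: indicator_def)
  have \<kappa>m: "(\<lambda>\<omega>. if B \<omega> L then \<kappa> L \<omega> else 0) \<in> borel_measurable M" for L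
    by (rule measurable_If[OF \<kappa>(1)]) (use BM[of L] in \<open>simp_all add: pred_def\<close>)
  have \<kappa>01: "0 \<le> (if B \<omega> L then \<kappa> L \<omega> else 0) \<and> (if B \<omega> L then \<kappa> L \<omega> else 0) \<le> 1" for L \<omega>
    using \<kappa>(2) by simp
  have lim: "(\<lambda>L. \<integral>\<omega>. (indicator A \<omega> * pr \<omega>) * (if B \<omega> L then \<kappa> L \<omega> else 0) \<partial>M)
      \<longlonglongrightarrow> (\<integral>\<omega>. indicator A \<omega> * pr \<omega> \<partial>M) * c"
    by (rule setwise_convergence_function[OF M sub \<kappa>m \<kappa>01 conv fF f01])
  have mDA: "measure M D = (\<integral>\<omega>. indicator A \<omega> * pr \<omega> \<partial>M)"
  proof -
    have "emeasure M D = (\<integral>\<^sup>+\<omega>. indicator (A \<times> prefix n w) (\<omega>, Y \<omega>) \<partial>M)"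
    proof -
      have "D \<in> sets M" using \<open>D \<in> ?G\<close> \<open>?G \<subseteq> sets M\<close> by blast
      then have "emeasure M D = (\<integral>\<^sup>+\<omega>. indicator D \<omega> \<partial>M)" by simp
      also have "\<dots> = (\<integral>\<^sup>+\<omega>. indicator (A \<times> prefix n w) (\<omega>, Y \<omega>) \<partial>M)"
        by (intro nn_integral_cong) (auto simp: D indicator_def)
      finally show ?thesis .
    qed
    also have "\<dots> = (\<integral>\<^sup>+\<omega>. \<integral>\<^sup>+u. indicator (A \<times> prefix n w) (\<omega>, walk (E \<omega>) 0 u) \<partial>choices q \<partial>M)"
      by (rule joint_law[OF M sub E Y law], assumption)
         (intro borel_measurable_indicator pair_measureI A sets_prefix)
    also have "\<dots> = (\<integral>\<^sup>+\<omega>. ennreal (indicator A \<omega> * pr \<omega>) \<partial>M)"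
    proof (rule nn_integral_cong)
      fix \<omega>
      have "(\<integral>\<^sup>+u. indicator (A \<times> prefix n w) (\<omega>, walk (E \<omega>) 0 u) \<partial>choices q)
          = (\<integral>\<^sup>+u. indicator A \<omega> * indicator {u. walk (E \<omega>) 0 u \<in> prefix n w} u \<partial>choices q)"
        by (intro nn_integral_cong) (simp add: indicator_def)
      also have "\<dots> = indicator A \<omega> * emeasure (choices q) {u. walk (E \<omega>) 0 u \<in> prefix n w}"
        by (rule nn_integral_cmult_indicator[OF sets_walk_vimage[OF sets_prefix]])
      also have "\<dots> = ennreal (indicator A \<omega> * pr \<omega>)" unfolding em by (simp add: indicator_def)
      finally show "(\<integral>\<^sup>+u. indicator (A \<times> prefix n w) (\<omega>, walk (E \<omega>) 0 u) \<partial>choices q) = \<dots>" .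
    qed
    finally have "measure M D = enn2real (\<integral>\<^sup>+\<omega>. ennreal (indicator A \<omega> * pr \<omega>) \<partial>M)"
      by (simp only: measure_def)
    also have "\<dots> = (\<integral>\<omega>. indicator A \<omega> * pr \<omega> \<partial>M)"
      by (rule integral_eq_nn_integral[symmetric, OF fM]) (use f01 in blast)
    finally show ?thesis .
  qed
  \<comment> \<open>From \<open>L \<ge> n\<close> on the prefix is decided before the level is hit,
    and the identity is exact. Level 0 is left out because no step enters it.\<close>
  have "(\<integral>\<omega>. indicator D \<omega> * at_mark j g L (Y \<omega>, \<lambda>m. B \<omega> m \<and> reg j m (Y \<omega>)) \<partial>M)
      = (\<integral>\<omega>. (indicator A \<omega> * pr \<omega>) * (if B \<omega> L then \<kappa> L \<omega> else 0) \<partial>M)" (is "?l L = ?r L")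
    if L: "L \<ge> max n 1" for L
  proof -
    let ?f = "\<lambda>z. indicator (A \<times> prefix n w) z * ennreal (at_mark j g L (snd z, \<lambda>m. B (fst z) m \<and> reg j m (snd z)))"
    have fm: "?f \<in> borel_measurable (F \<Otimes>\<^sub>M path_space)"
    proof (intro borel_measurable_times_ennreal borel_measurable_indicator pair_measureI A sets_prefix
        measurable_compose[OF _ measurable_ennreal])
      show "(\<lambda>z. at_mark j g L (snd z, \<lambda>m. B (fst z) m \<and> reg j m (snd z))) \<in> borel_measurable (F \<Otimes>\<^sub>M path_space)"
        by (rule measurable_compose[OF measurable_marks[OF measurable_snd pred_fst[OF B]] measurable_at_mark[OF g(1)]])
    qed
    have "(\<integral>\<omega>. indicator D \<omega> * at_mark j g L (Y \<omega>, \<lambda>m. B \<omega> m \<and> reg j m (Y \<omega>)) \<partial>M)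
        = enn2real (\<integral>\<^sup>+\<omega>. ennreal (indicator D \<omega> * at_mark j g L (Y \<omega>, \<lambda>m. B \<omega> m \<and> reg j m (Y \<omega>))) \<partial>M)"
    proof (rule integral_eq_nn_integral)
      show "(\<lambda>\<omega>. indicator D \<omega> * at_mark j g L (Y \<omega>, \<lambda>m. B \<omega> m \<and> reg j m (Y \<omega>))) \<in> borel_measurable M"
        using \<open>D \<in> ?G\<close> \<open>?G \<subseteq> sets M\<close> by (intro borel_measurable_times borel_measurable_indicator atm) blast
      show "AE \<omega> in M. 0 \<le> indicator D \<omega> * at_mark j g L (Y \<omega>, \<lambda>m. B \<omega> m \<and> reg j m (Y \<omega>))"
        by (intro AE_I2 mult_nonneg_nonneg conjunct1[OF at_mark_bounds[OF g(2)]]) simp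
    qed
    also have "(\<integral>\<^sup>+\<omega>. ennreal (indicator D \<omega> * at_mark j g L (Y \<omega>, \<lambda>m. B \<omega> m \<and> reg j m (Y \<omega>))) \<partial>M)
        = (\<integral>\<^sup>+\<omega>. ?f (\<omega>, Y \<omega>) \<partial>M)"
      by (intro nn_integral_cong) (auto simp: D indicator_def)
    also have "\<dots> = (\<integral>\<^sup>+\<omega>. \<integral>\<^sup>+u. ?f (\<omega>, walk (E \<omega>) 0 u) \<partial>choices q \<partial>M)"
      by (rule joint_law[OF M sub E Y law fm], assumption)
    also have "\<dots> = (\<integral>\<^sup>+\<omega>. ennreal ((indicator A \<omega> * pr \<omega>) * (if B \<omega> L then \<kappa> L \<omega> else 0)) \<partial>M)"
    proof (rule nn_integral_cong_AE, use quenched in eventually_elim)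
      case (elim \<omega>)
      show ?case
      proof (cases "B \<omega> L \<and> \<omega> \<in> A")
        case True
        have "(\<integral>\<^sup>+u. ?f (\<omega>, walk (E \<omega>) 0 u) \<partial>choices q)
            = (\<integral>\<^sup>+u. indicator (prefix n w) (walk (E \<omega>) 0 u) * ennreal (at_mark j g L (wmark j (E \<omega>) (B \<omega>) u)) \<partial>choices q)"
          using True by (intro nn_integral_cong) (simp add: indicator_def wmark_def)
        also have "\<dots> = ennreal (pr \<omega>) * ennreal (\<kappa> L \<omega>)"
          using elim True L by (simp add: em[simplified])
        also have "\<dots> = ennreal ((indicator A \<omega> * pr \<omega>) * (if B \<omega> L then \<kappa> L \<omega> else 0))"
          using True pr01 by (simp add: ennreal_mult')
        finally show ?thesis .
      next
        case False
        then have "?f (\<omega>, walk (E \<omega>) 0 u) = 0" for u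
          by (auto simp: indicator_def at_mark_def)
        then have "(\<integral>\<^sup>+u. ?f (\<omega>, walk (E \<omega>) 0 u) \<partial>choices q) = 0" by (simp only: nn_integral_const) simp
        then show ?thesis using False by (auto simp: indicator_def)
      qed
    qed
    also have "enn2real \<dots> = (\<integral>\<omega>. (indicator A \<omega> * pr \<omega>) * (if B \<omega> L then \<kappa> L \<omega> else 0) \<partial>M)"
    proof (rule integral_eq_nn_integral[symmetric])
      show "(\<lambda>\<omega>. indicator A \<omega> * pr \<omega> * (if B \<omega> L then \<kappa> L \<omega> else 0)) \<in> borel_measurable M"
        by (intro borel_measurable_times fM \<kappa>m)
      show "AE \<omega> in M. 0 \<le> indicator A \<omega> * pr \<omega> * (if B \<omega> L then \<kappa> L \<omega> else 0)"
        by (intro AE_I2) (rule mult_nonneg_nonneg[OF conjunct1[OF f01] conjunct1[OF \<kappa>01]])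
    qed
    finally show ?thesis .
  qed
  then have "eventually (\<lambda>L. (\<integral>\<omega>. (indicator A \<omega> * pr \<omega>) * (if B \<omega> L then \<kappa> L \<omega> else 0) \<partial>M)
      = (\<integral>\<omega>. indicator D \<omega> * at_mark j g L (Y \<omega>, \<lambda>m. B \<omega> m \<and> reg j m (Y \<omega>)) \<partial>M)) sequentially"
    by (intro eventually_sequentiallyI[of "max n 1"]) (rule sym)
  from Lim_transform_eventually[OF lim this]
  show "(\<lambda>L. \<integral>\<omega>. indicator D \<omega> * at_mark j g L (Y \<omega>, \<lambda>m. B \<omega> m \<and> reg j m (Y \<omega>)) \<partial>M)
      \<longlonglongrightarrow> measure M D * c"
    by (simp only: mDA)
qed


text \<open>Beyond every level the walk sees the lattice again, so the kernel is a constant and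
  independence is exact once \<open>L\<close> is at least the length of the prefix. The witness is
  the law of the marked walk restricted to never going below its start.\<close>

lemma mixing_base:
  fixes Y :: "'w \<Rightarrow> nat \<Rightarrow> ('d::finite) site"
  assumes M: "prob_space M" and sub: "subalgebra M F" and q: "elliptic q"
    and Y: "Y \<in> measurable M path_space"
    and law: "\<And>A n w. A \<in> sets F \<Longrightarrow> measure M (A \<inter> {\<omega> \<in> space M. \<forall>k\<le>n. Y \<omega> k = w k})
               = (\<integral>\<omega>. indicator A \<omega> * measure (choices q) {u. \<forall>k\<le>n. walk (snd lattice) 0 u k = w k} \<partial>M)"
    and F': "sets F' = sigma_sets (space M) {A \<inter> {\<omega> \<in> space M. \<forall>k<n. Y \<omega> k = w k} | A n w. A \<in> sets F}"
    and \<delta>: "AE u in choices q. filterlim (\<lambda>n. walk (snd lattice) 0 u n $ j) at_top sequentially"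
  shows "\<exists>\<nu>. finite_measure \<nu> \<and> sets \<nu> = sets mark_space \<and> 0 < measure \<nu> (space \<nu>)
           \<and> mixing M F' j (\<lambda>\<omega>. (Y \<omega>, \<lambda>m. reg j m (Y \<omega>))) \<nu>"
proof -
  interpret M: prob_space M by (rule M)
  interpret Ch: prob_space "choices q" by (rule prob_space_choices)
  let ?E = "snd lattice :: 'd site set set"
  let ?S = "{u. walk ?E 0 u \<in> stays j}"
  let ?W = "wmark j ?E (\<lambda>_. True)"
  have S: "?S \<in> sets (choices q)" by (rule sets_walk_vimage[OF sets_stays])
  define \<nu> where "\<nu> = distr (density (choices q) (indicator ?S)) mark_space ?W"
  have W: "?W \<in> measurable (density (choices q) (indicator ?S)) mark_space"
    using measurable_wmark[of j ?E "\<lambda>_. True" q] by (simp only: measurable_cong_sets[OF sets_density refl])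
  have nn: "(\<integral>\<^sup>+v. ennreal (g v) \<partial>\<nu>) = escape_kernel q j g ?E (\<lambda>_. True)"
    if g: "g \<in> borel_measurable mark_space" for g
  proof -
    have "(\<integral>\<^sup>+v. ennreal (g v) \<partial>\<nu>) = (\<integral>\<^sup>+u. ennreal (g (?W u)) \<partial>density (choices q) (indicator ?S))"
      unfolding \<nu>_def by (rule nn_integral_distr[OF W measurable_compose[OF _ measurable_ennreal]]) (use g in simp)
    also have "\<dots> = (\<integral>\<^sup>+u. indicator ?S u * ennreal (g (?W u)) \<partial>choices q)"
      by (rule nn_integral_density)
         (intro borel_measurable_indicator S, rule measurable_compose[OF measurable_compose[OF measurable_wmark g] measurable_ennreal])
    also have "\<dots> = escape_kernel q j g ?E (\<lambda>_. True)"
      unfolding escape_kernel_def by (intro nn_integral_cong) (simp add: indicator_def)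
    finally show ?thesis .
  qed
  have s\<nu>: "sets \<nu> = sets mark_space" by (simp add: \<nu>_def)
  have sp\<nu>: "space \<nu> = UNIV" using sets_eq_imp_space_eq[OF s\<nu>] by simp
  have em\<nu>: "emeasure \<nu> (space \<nu>) = emeasure (choices q) ?S"
  proof -
    have "emeasure \<nu> (space \<nu>) = (\<integral>\<^sup>+v. ennreal 1 \<partial>\<nu>)" by simp
    also have "\<dots> = escape_kernel q j (\<lambda>_. 1) ?E (\<lambda>_. True)" by (rule nn) simp
    also have "\<dots> = (\<integral>\<^sup>+u. indicator ?S u \<partial>choices q)"
      unfolding escape_kernel_def by (intro nn_integral_cong) (simp add: indicator_def)
    also have "\<dots> = emeasure (choices q) ?S" by (rule nn_integral_indicator[OF S])
    finally show ?thesis .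
  qed
  have fin: "finite_measure \<nu>" using em\<nu> by (intro finite_measureI) (simp add: Ch.emeasure_eq_measure)
  interpret N: finite_measure \<nu> by (rule fin)
  \<comment> \<open>A walk whose height tends to infinity attains its minimal height, and from such
    a time on it stays above. If staying above had probability 0, stationarity of the choices would
    exclude it almost surely from all times at once.\<close>
  have pos: "0 < measure \<nu> (space \<nu>)"
  proof (rule ccontr)
    assume "\<not> 0 < measure \<nu> (space \<nu>)"
    then have "emeasure \<nu> (space \<nu>) = 0" using N.emeasure_eq_measure by (simp add: not_less measure_le_0_iff)
    then have z: "emeasure (choices q) ?S = 0" using em\<nu> by simp
    have shift: "walk ?E 0 u (n + k) - walk ?E 0 u n = walk ?E 0 (\<lambda>i. u (n + i)) k" for u n k
      unfolding walk_add walk_lattice by simp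
    have "emeasure (choices q) {u. (\<lambda>i. u (n + i)) \<in> ?S} = 0" for n
    proof -
      have "(\<integral>\<^sup>+u. indicator UNIV u * indicator ?S (\<lambda>i. u (n + i)) \<partial>choices q)
          = emeasure (choices q) UNIV * (\<integral>\<^sup>+u. indicator ?S u \<partial>choices q)"
        by (rule choices_shift[OF _ _ borel_measurable_indicator[OF S]]) auto
      also have "\<dots> = 0" using z by (simp only: nn_integral_indicator[OF S] mult_zero_right)
      also have "(\<integral>\<^sup>+u. indicator UNIV u * indicator ?S (\<lambda>i. u (n + i)) \<partial>choices q)
          = (\<integral>\<^sup>+u. indicator {u. (\<lambda>i. u (n + i)) \<in> ?S} u \<partial>choices q)"
        by (intro nn_integral_cong) (simp add: indicator_def)
      also have "\<dots> = emeasure (choices q) {u. (\<lambda>i. u (n + i)) \<in> ?S}"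
      proof (rule nn_integral_indicator)
        show "{u. (\<lambda>i. u (n + i)) \<in> ?S} \<in> sets (choices q)"
          using measurable_sets[OF measurable_shift_choices[of n q] S] by (simp add: vimage_def)
      qed
      finally show ?thesis .
    qed
    moreover have "{u. (\<lambda>i. u (n + i)) \<in> ?S} \<in> sets (choices q)" for n
      using measurable_sets[OF measurable_shift_choices[of n q] S] by (simp add: vimage_def)
    ultimately have "AE u in choices q. u \<notin> {u. (\<lambda>i. u (n + i)) \<in> ?S}" for n
      by (intro AE_not_in null_setsI) auto
    then have "AE u in choices q. \<forall>n. (\<lambda>i. u (n + i)) \<notin> ?S" by (simp add: AE_all_countable)
    then have "AE u in choices q. False"
      using \<delta>
    proof eventually_elim
      case (elim u)
      define h where "h n = walk ?E 0 u n $ j" for n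
      have "filterlim h at_top sequentially" using elim(2) by (simp add: h_def[abs_def])
      then obtain N where N: "\<And>n. n \<ge> N \<Longrightarrow> h 0 \<le> h n"
        by (auto simp: filterlim_at_top eventually_sequentially)
      define m where "m = Min (h ` {..N})"
      have "m \<in> h ` {..N}" unfolding m_def by (rule Min_in) auto
      then obtain n where n: "h n = m" by auto
      have m: "m \<le> h k" for k
      proof (cases "k \<le> N")
        case False
        have "m \<le> h 0" unfolding m_def by (rule Min_le) auto
        with N[of k] False show ?thesis by simp
      qed (auto simp: m_def intro!: Min_le)
      have "0 \<le> (walk ?E 0 u (n + k) - walk ?E 0 u n) $ j" for k
        using m[of "n + k"] n by (simp add: h_def)
      then have "(\<lambda>i. u (n + i)) \<in> ?S" unfolding shift by simp
      with elim(1) show False by blast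
    qed
    then show False by (simp only: Ch.AE_const)
  qed
  have av: "avail ?E 0 \<noteq> {}" by simp
  have hits: "AE u in choices q. \<exists>n. int L \<le> walk ?E 0 u n $ j" for L
    using \<delta>
  proof eventually_elim
    case (elim u)
    then show ?case by (auto simp: filterlim_at_top eventually_sequentially)
  qed
  have "mixing M F' j (\<lambda>\<omega>. (Y \<omega>, \<lambda>m. reg j m (Y \<omega>))) \<nu>"
    unfolding mixing_def
  proof (intro ballI impI)
    fix A' and g :: "'d marked_path \<Rightarrow> real"
    assume A': "A' \<in> sets F'" and g: "g \<in> borel_measurable mark_space" "\<forall>v. 0 \<le> g v \<and> g v \<le> 1"
    define c where "c = enn2real (escape_kernel q j g ?E (\<lambda>_. True))"
    have le1: "escape_kernel q j g ?E (\<lambda>_. True) \<le> 1" by (rule escape_kernel_le_1) (use g(2) in blast)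
    have c: "escape_kernel q j g ?E (\<lambda>_. True) = ennreal c"
      unfolding c_def by (rule ennreal_enn2real[symmetric], rule le_less_trans[OF le1]) simp
    have c01: "0 \<le> c \<and> c \<le> 1" using le1 unfolding c by (simp add: c_def)
    have int: "(\<integral>v. g v \<partial>\<nu>) = c"
    proof -
      have "(\<integral>v. g v \<partial>\<nu>) = enn2real (\<integral>\<^sup>+v. ennreal (g v) \<partial>\<nu>)"
      proof (rule integral_eq_nn_integral)
        show "g \<in> borel_measurable \<nu>" using g(1) measurable_cong_sets[OF s\<nu> refl] by blast
      qed (intro AE_I2, use g(2) in blast)
      then show ?thesis by (simp only: nn[OF g(1)] c_def)
    qed
    have "(\<lambda>L. \<integral>\<omega>. indicator A' \<omega> * at_mark j g L (Y \<omega>, \<lambda>m. True \<and> reg j m (Y \<omega>)) \<partial>M)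
        \<longlonglongrightarrow> measure M A' * c"
    proof (rule mixing_core[where \<kappa> = "\<lambda>_ _. c" and E = "\<lambda>_. ?E", OF M sub _ Y law])
      show "{\<omega> \<in> space F. e \<in> ?E} \<in> sets F" for e by simp
      show "AE \<omega> in M. \<forall>L\<ge>1. True \<longrightarrow> (\<forall>n\<le>L. \<forall>w.
          (\<integral>\<^sup>+u. indicator (prefix n w) (walk ?E 0 u) * ennreal (at_mark j g L (wmark j ?E (\<lambda>_. True) u)) \<partial>choices q)
            = emeasure (choices q) {u. walk ?E 0 u \<in> prefix n w} * ennreal c)"
      proof (intro AE_I2 allI impI)
        fix L n :: nat and w :: "nat \<Rightarrow> 'd site" assume "n \<le> L"
        show "(\<integral>\<^sup>+u. indicator (prefix n w) (walk ?E 0 u) * ennreal (at_mark j g L (wmark j ?E (\<lambda>_. True) u)) \<partial>choices q)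
            = emeasure (choices q) {u. walk ?E 0 u \<in> prefix n w} * ennreal c"
          unfolding c[symmetric]
          by (rule quenched_mark[OF q av hits _ g(1) \<open>n \<le> L\<close>, where B = "\<lambda>_. True"]) auto
      qed
      show "(\<lambda>L. \<integral>\<omega>. indicator A \<omega> * (if True then c else 0) \<partial>M) \<longlonglongrightarrow> measure M A * c"
        if "A \<in> sets F" for A
      proof -
        have "A \<in> sets M" using sub that by (auto simp: subalgebra_def)
        then have "A \<inter> space M = A" using sets.sets_into_space by blast
        then show ?thesis by simp
      qed
      show "A' \<in> sigma_sets (space M) {A \<inter> {\<omega> \<in> space M. \<forall>k<n. Y \<omega> k = w k} | A n w. A \<in> sets F}"
        using A' by (simp only: F')
    qed (use g c01 in \<open>blast | simp\<close>)+
    then show "(\<lambda>L. \<integral>\<omega>. indicator A' \<omega> * at_mark j g L (Y \<omega>, \<lambda>m. reg j m (Y \<omega>)) \<partial>M)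
        \<longlonglongrightarrow> measure M A' * (\<integral>v. g v \<partial>\<nu>)" by (simp only: int simp_thms)
  qed
  then show ?thesis using fin s\<nu> pos by blast
qed

text \<open>From 0 the walk can follow \<open>y\<close> to any \<open>y m\<close> without going
  below height 0. If escape from 0 had probability 0, it would have probability 0 from every vertex
  of \<open>y\<close>. But by transience the walk is eventually above height 0 forever, and then it
  is at a vertex of \<open>y\<close>.\<close>

lemma escape_positive:
  fixes y :: "nat \<Rightarrow> ('d::finite) site"
  assumes q: "elliptic q" and y: "nice q j y" "y \<in> stays j"
  shows "0 < emeasure (choices q) {u. walk (half_trace j y) 0 u \<in> stays j}"
proof (rule ccontr)
  assume "\<not> 0 < emeasure (choices q) {u. walk (half_trace j y) 0 u \<in> stays j}"
  then have z: "emeasure (choices q) {u. walk (half_trace j y) 0 u \<in> stays j} = 0" by (simp add: not_gr_zero)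
  interpret Ch: prob_space "choices q" by (rule prob_space_choices)
  let ?E = "half_trace j y"
  have ly: "lattice_path y" using y by (simp add: nice_def)
  have tr: "trace_edges y \<subseteq> ?E" by (auto simp: half_trace_def)
  have V: "{x. avail ?E x \<noteq> {}} \<subseteq> insert (- axis j 1) (range y)"
    using avail_half_trace[OF ly, of j] by blast
  note T = nice_transient[OF q y(1) tr V]
  let ?S = "\<lambda>v. {u. walk ?E v u \<in> stays j}"
  have S: "?S v \<in> sets (choices q)" for v by (rule sets_walk_vimage[OF sets_stays])
  have shS: "{u. (\<lambda>i. u (n + i)) \<in> ?S v} \<in> sets (choices q)" for n v
    using measurable_sets[OF measurable_shift_choices[of n q] S[of v]] by (simp add: vimage_def)
  have sm: "emeasure (choices q) (A \<inter> {u. (\<lambda>i. u (n + i)) \<in> ?S v})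
      = emeasure (choices q) A * emeasure (choices q) (?S v)"
    if A: "A \<in> sets (choices q)" and dep: "\<And>u u'. (\<And>k. k < n \<Longrightarrow> u k = u' k) \<Longrightarrow> u \<in> A \<longleftrightarrow> u' \<in> A" for A and n :: nat and v :: "'d site"
  proof -
    have "emeasure (choices q) (A \<inter> {u. (\<lambda>i. u (n + i)) \<in> ?S v})
        = (\<integral>\<^sup>+u. indicator (A \<inter> {u. (\<lambda>i. u (n + i)) \<in> ?S v}) u \<partial>choices q)"
      by (rule nn_integral_indicator[symmetric, OF sets.Int[OF A shS]])
    also have "\<dots> = (\<integral>\<^sup>+u. indicator A u * indicator (?S v) (\<lambda>i. u (n + i)) \<partial>choices q)"
      by (intro nn_integral_cong) (simp add: indicator_def)
    also have "\<dots> = emeasure (choices q) A * (\<integral>\<^sup>+u. indicator (?S v) u \<partial>choices q)"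
      by (rule choices_shift[OF A dep borel_measurable_indicator[OF S]])
    finally show ?thesis by (simp only: nn_integral_indicator[OF S])
  qed
  have zero: "emeasure (choices q) (?S (y m)) = 0" for m
  proof -
    \<comment> \<open>The prefix of length \<open>Suc m\<close> includes the position at time
      \<open>m\<close>, yet it is decided by the first \<open>m\<close> choices.\<close>
    let ?A = "{u. walk ?E 0 u \<in> prefix (Suc m) y}"
    have A: "?A \<in> sets (choices q)" by (rule sets_walk_vimage[OF sets_prefix])
    have dep: "u \<in> ?A \<longleftrightarrow> u' \<in> ?A" if "\<And>k. k < m \<Longrightarrow> u k = u' k" for u u'
    proof -
      have "walk ?E 0 u k = walk ?E 0 u' k" if "k \<le> m" for k
        by (rule walk_cong[of m]) (use \<open>\<And>k. k < m \<Longrightarrow> u k = u' k\<close> that in auto)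
      then show ?thesis by simp
    qed
    have "?A \<inter> {u. (\<lambda>i. u (m + i)) \<in> ?S (y m)} \<subseteq> ?S 0"
    proof
      fix u assume u: "u \<in> ?A \<inter> {u. (\<lambda>i. u (m + i)) \<in> ?S (y m)}"
      have "0 \<le> walk ?E 0 u k $ j" for k
      proof (cases "k \<le> m")
        case True
        then have "walk ?E 0 u k = y k" using u by simp
        then show ?thesis using y(2) by simp
      next
        case False
        have "walk ?E 0 u m = y m" using u by simp
        then have "walk ?E 0 u k = walk ?E (y m) (\<lambda>i. u (m + i)) (k - m)"
          using walk_add[of ?E 0 u m "k - m"] False by simp
        then show ?thesis using u by simp
      qed
      then show "u \<in> ?S 0" by simp
    qed
    from emeasure_mono[OF this S[of 0]] z
    have "emeasure (choices q) ?A * emeasure (choices q) (?S (y m)) = 0"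
      using sm[of ?A m "y m", OF A dep] by (simp only: le_zero_eq)
    moreover have "emeasure (choices q) ?A \<noteq> 0"
    proof -
      have "measure (choices q) {u. \<forall>k\<le>m. walk (snd (UNIV :: 'd site set, ?E)) 0 u k = y k}
          = path_prob (UNIV, ?E) q m y"
        by (rule prob_walk_prefix[OF q]) (use T(1) in simp)
      moreover have "path_prob (UNIV, ?E) q m y > 0"
      proof -
        have "step_prob (UNIV, ?E) q (y k) (y (Suc k)) > 0" for k
        proof -
          have e: "y (Suc k) - y k \<in> avail ?E (y k)"
            using ly tr by (auto simp: avail_def lattice_path_def trace_edges_def)
          then have "(\<Sum>e\<in>avail ?E (y k). pmf q e) > 0"
            by (intro elliptic_sum_pos[OF q avail_subset]) blast
          moreover have "pmf q (y (Suc k) - y k) > 0"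
            using e avail_subset by (intro elliptic_pos[OF q]) blast
          ultimately show ?thesis using e by (simp add: step_prob_elliptic[OF q])
        qed
        then show ?thesis using ly by (simp add: path_prob_def lattice_path_def prod_pos)
      qed
      moreover have "?A = {u. \<forall>k\<le>m. walk (snd (UNIV :: 'd site set, ?E)) 0 u k = y k}"
        by (simp add: less_Suc_eq_le)
      ultimately show ?thesis by (simp add: Ch.emeasure_eq_measure)
    qed
    ultimately show ?thesis by simp
  qed
  have "AE u in choices q. \<not> (walk ?E 0 u n = v \<and> (\<lambda>i. u (n + i)) \<in> ?S v)" if v: "v \<in> range y" for n v
  proof -
    let ?A = "{u. walk ?E 0 u n = v}"
    have dep: "u \<in> ?A \<longleftrightarrow> u' \<in> ?A" if "\<And>k. k < n \<Longrightarrow> u k = u' k" for u u'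
      using walk_cong[of n u u' n ?E 0] that by simp
    have "emeasure (choices q) (?S v) = 0" using v zero by (elim rangeE) (simp only:)
    moreover have "emeasure (choices q) (?A \<inter> {u. (\<lambda>i. u (n + i)) \<in> ?S v})
        = emeasure (choices q) ?A * emeasure (choices q) (?S v)"
      by (rule sm[OF sets_walk_at dep])
    ultimately have "emeasure (choices q) (?A \<inter> {u. (\<lambda>i. u (n + i)) \<in> ?S v}) = 0"
      by (simp only: mult_zero_right)
    then have "AE u in choices q. u \<notin> ?A \<inter> {u. (\<lambda>i. u (n + i)) \<in> ?S v}"
      by (intro AE_not_in null_setsI sets.Int[OF sets_walk_at shS])
    then show ?thesis by eventually_elim simp
  qed
  then have "AE u in choices q. \<forall>v\<in>range y. \<forall>n. \<not> (walk ?E 0 u n = v \<and> (\<lambda>i. u (n + i)) \<in> ?S v)"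
    by (intro AE_ball_countable' iffD2[OF AE_all_countable] allI) auto
  then have "AE u in choices q. False"
    using T(3) AE_valid_choices[OF q]
  proof eventually_elim
    case (elim u)
    obtain n where n: "\<And>k. k \<ge> n \<Longrightarrow> 0 \<le> walk ?E 0 u k $ j"
      using elim(2) by (auto simp: filterlim_at_top eventually_sequentially)
    define v where "v = walk ?E 0 u n"
    have "v \<in> insert (- axis j 1) (range y)"
      using walk_adj[OF elim(3) T(1), of n] V by (auto simp: v_def)
    \<comment> \<open>The far end of the edge leading back has height -1.\<close>
    moreover have "v \<noteq> - axis j 1" using n[of n] by (auto simp: v_def[symmetric])
    ultimately have r: "v \<in> range y" by simp
    have "(\<lambda>i. u (n + i)) \<in> ?S v"
      using n by (simp add: v_def walk_add[symmetric])
    moreover have "\<not> (walk ?E 0 u n = v \<and> (\<lambda>i. u (n + i)) \<in> ?S v)" by (rule elim(1)[rule_format, OF r])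
    ultimately show False by (simp only: v_def simp_thms)
  qed
  then show False by (simp only: Ch.AE_const)
qed

lemma sets_trace_edges: "{y \<in> space path_space. e \<in> trace_edges y} \<in> sets path_space"
proof -
  have "Measurable.pred path_space (\<lambda>y. \<exists>n. e = {y n, y (Suc n)})"
    supply pred_path2 [measurable] by measurable
  then show ?thesis by (simp add: trace_edges_def pred_def image_iff)
qed

lemma sets_half_trace: "{v \<in> space mark_space. e \<in> half_trace j (fst v)} \<in> sets mark_space"
proof -
  have "{y. e \<in> half_trace j y} = (if e = {0, - axis j 1} then UNIV else {y \<in> space path_space. e \<in> trace_edges y})"
    by (auto simp: half_trace_def)
  also have "\<dots> \<in> sets path_space"
    using sets_trace_edges[of e] sets.top[of path_space] unfolding space_path_space
    by (cases "e = {0, - axis j 1}") (simp_all only: if_True if_False simp_thms)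
  finally have "{y. e \<in> half_trace j y} \<in> sets path_space" .
  from measurable_sets[OF measurable_fst_mark this] show ?thesis by (simp add: vimage_def)
qed

text \<open>From a marked level on, the graph of the new walk is the half trace of the marked future
  of the old path. The escape kernel is thus a function of that future, and the mixing of
  \<open>\<zeta>\<close> applies to it. The new limit measure is the law of the marked walk on the
  half trace of a path drawn from the old one, restricted to never going below its start.\<close>

lemma mixing_step:
  fixes Y :: "'w \<Rightarrow> nat \<Rightarrow> ('d::finite) site"
  assumes M: "prob_space M" and sub: "subalgebra M F" and q: "elliptic q"
    and \<zeta>: "\<zeta> \<in> measurable F mark_space"
    and Y: "Y \<in> measurable M path_space"
    and law: "\<And>A n w. A \<in> sets F \<Longrightarrow> measure M (A \<inter> {\<omega> \<in> space M. \<forall>k\<le>n. Y \<omega> k = w k})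
               = (\<integral>\<omega>. indicator A \<omega> * measure (choices q)
                    {u. \<forall>k\<le>n. walk (trace_edges (fst (\<zeta> \<omega>))) 0 u k = w k} \<partial>M)"
    and good: "AE \<omega> in M. nice q j (fst (\<zeta> \<omega>)) \<and> (\<forall>L\<ge>1. snd (\<zeta> \<omega>) L \<longrightarrow> reg j L (fst (\<zeta> \<omega>)))"
    and F': "sets F' = sigma_sets (space M) {A \<inter> {\<omega> \<in> space M. \<forall>k<n. Y \<omega> k = w k} | A n w. A \<in> sets F}"
    and mix: "mixing M F j \<zeta> \<nu>" and \<nu>: "finite_measure \<nu>" "sets \<nu> = sets mark_space" "0 < measure \<nu> (space \<nu>)"
  shows "\<exists>\<nu>. finite_measure \<nu> \<and> sets \<nu> = sets mark_space \<and> 0 < measure \<nu> (space \<nu>)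
           \<and> mixing M F' j (\<lambda>\<omega>. (Y \<omega>, \<lambda>m. snd (\<zeta> \<omega>) m \<and> reg j m (Y \<omega>))) \<nu>"
proof -
  interpret M: prob_space M by (rule M)
  interpret Ch: prob_space "choices q" by (rule prob_space_choices)
  interpret N: finite_measure \<nu> by (rule \<nu>(1))
  have spF: "space M \<in> sets F" using sub sets.top[of F] by (simp add: subalgebra_def)
  define H where "H v = half_trace j (fst v)" for v :: "'d marked_path"
  define W where "W z = wmark j (H (fst z)) (snd (fst z)) (snd z)"
    for z :: "'d marked_path \<times> (nat \<Rightarrow> 'd site set \<Rightarrow> 'd site)"
  define S where "S = {z. walk (H (fst z)) 0 (snd z) \<in> stays j}"
  have sH: "{v \<in> space mark_space. e \<in> H v} \<in> sets mark_space" for e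
    unfolding H_def by (rule sets_half_trace)
  have cong: "sets (\<nu> \<Otimes>\<^sub>M choices q) = sets (mark_space \<Otimes>\<^sub>M choices q)"
    by (rule sets_pair_measure_cong[OF \<nu>(2) refl])
  have W0: "W \<in> measurable (mark_space \<Otimes>\<^sub>M choices q) mark_space"
    unfolding W_def[abs_def] by (rule measurable_wmark_pair[OF sH pred_mark])
  then have W: "W \<in> measurable (\<nu> \<Otimes>\<^sub>M choices q) mark_space"
    by (simp only: measurable_cong_sets[OF cong refl])

  have S: "S \<in> sets (\<nu> \<Otimes>\<^sub>M choices q)"
  proof -
    have w: "(\<lambda>(v, u). walk (H v) 0 u) \<in> measurable (mark_space \<Otimes>\<^sub>M choices q) path_space"
      by (rule measurable_walk_pair[OF sH])
    have "S = (\<lambda>(v, u). walk (H v) 0 u) -` stays j \<inter> space (mark_space \<Otimes>\<^sub>M choices q)"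
      by (auto simp: S_def space_pair_measure space_PiM)
    with measurable_sets[OF w sets_stays] show ?thesis by (simp only: cong)
  qed
  define \<nu>' where "\<nu>' = distr (density (\<nu> \<Otimes>\<^sub>M choices q) (indicator S)) mark_space W"
  have W': "W \<in> measurable (density (\<nu> \<Otimes>\<^sub>M choices q) (indicator S)) mark_space"
    using W by (simp only: measurable_cong_sets[OF sets_density refl])
  have gm: "(\<lambda>z. indicator S z * ennreal (g (W z))) \<in> borel_measurable (\<nu> \<Otimes>\<^sub>M choices q)"
    if g: "g \<in> borel_measurable mark_space" for g
    by (intro borel_measurable_times_ennreal borel_measurable_indicator S
        measurable_compose[OF measurable_compose[OF W g] measurable_ennreal])
  have ek: "escape_kernel q j g (H v) (snd v) = (\<integral>\<^sup>+u. indicator S (v, u) * ennreal (g (W (v, u))) \<partial>choices q)" for g v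
    unfolding escape_kernel_def by (intro nn_integral_cong) (simp add: S_def W_def indicator_def)
  have nn: "(\<integral>\<^sup>+v. ennreal (g v) \<partial>\<nu>') = (\<integral>\<^sup>+v. escape_kernel q j g (H v) (snd v) \<partial>\<nu>)"
    if g: "g \<in> borel_measurable mark_space" for g
  proof -
    have "(\<integral>\<^sup>+v. ennreal (g v) \<partial>\<nu>') = (\<integral>\<^sup>+z. ennreal (g (W z)) \<partial>density (\<nu> \<Otimes>\<^sub>M choices q) (indicator S))"
      unfolding \<nu>'_def by (rule nn_integral_distr[OF W' measurable_compose[OF _ measurable_ennreal]]) (use g in simp)
    also have "\<dots> = (\<integral>\<^sup>+z. indicator S z * ennreal (g (W z)) \<partial>(\<nu> \<Otimes>\<^sub>M choices q))"
      by (rule nn_integral_density)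
         (intro borel_measurable_indicator S, rule measurable_compose[OF measurable_compose[OF W g] measurable_ennreal])
    also have "\<dots> = (\<integral>\<^sup>+v. \<integral>\<^sup>+u. indicator S (v, u) * ennreal (g (W (v, u))) \<partial>choices q \<partial>\<nu>)"
      by (rule Ch.nn_integral_fst[OF gm[OF g], symmetric])
    finally show ?thesis by (simp only: ek)
  qed
  have s\<nu>': "sets \<nu>' = sets mark_space" by (simp add: \<nu>'_def)
  have em\<nu>': "emeasure \<nu>' (space \<nu>') = (\<integral>\<^sup>+v. emeasure (choices q) {u. walk (H v) 0 u \<in> stays j} \<partial>\<nu>)"
  proof -
    have "emeasure \<nu>' (space \<nu>') = (\<integral>\<^sup>+v. ennreal 1 \<partial>\<nu>')" by simp
    also have "\<dots> = (\<integral>\<^sup>+v. escape_kernel q j (\<lambda>_. 1) (H v) (snd v) \<partial>\<nu>)" by (rule nn) simp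
    also have "\<dots> = (\<integral>\<^sup>+v. emeasure (choices q) {u. walk (H v) 0 u \<in> stays j} \<partial>\<nu>)"
    proof (rule nn_integral_cong)
      fix v
      have "escape_kernel q j (\<lambda>_. 1) (H v) (snd v) = (\<integral>\<^sup>+u. indicator {u. walk (H v) 0 u \<in> stays j} u \<partial>choices q)"
        unfolding escape_kernel_def by (intro nn_integral_cong) (simp add: indicator_def)
      also have "\<dots> = emeasure (choices q) {u. walk (H v) 0 u \<in> stays j}"
        by (rule nn_integral_indicator[OF sets_walk_vimage[OF sets_stays]])
      finally show "escape_kernel q j (\<lambda>_. 1) (H v) (snd v) = emeasure (choices q) {u. walk (H v) 0 u \<in> stays j}" .
    qed
    finally show ?thesis .
  qed
  have fin: "finite_measure \<nu>'"
  proof (rule finite_measureI)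
    have "emeasure \<nu>' (space \<nu>') \<le> (\<integral>\<^sup>+v. 1 \<partial>\<nu>)"
      unfolding em\<nu>' by (intro nn_integral_mono Ch.emeasure_le_1)
    also have "\<dots> < \<infinity>" by (simp add: N.emeasure_eq_measure)
    finally show "emeasure \<nu>' (space \<nu>') \<noteq> \<infinity>" by simp
  qed
  interpret N': finite_measure \<nu>' by (rule fin)
  \<comment> \<open>Beyond every mark the path is nice and stays above its start, so the same holds
    almost everywhere under \<open>\<nu>\<close>. By \<open>escape_positive\<close> the new mass is
    then the integral of a positive function.\<close>
  have pos: "0 < measure \<nu>' (space \<nu>')"
  proof (rule ccontr)
    assume "\<not> 0 < measure \<nu>' (space \<nu>')"
    then have "emeasure \<nu>' (space \<nu>') = 0" using N'.emeasure_eq_measure by (simp add: not_less measure_le_0_iff)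
    then have z: "(\<integral>\<^sup>+v. emeasure (choices q) {u. walk (H v) 0 u \<in> stays j} \<partial>\<nu>) = 0" by (simp only: em\<nu>')
    have m: "(\<lambda>v. emeasure (choices q) {u. walk (H v) 0 u \<in> stays j}) \<in> borel_measurable \<nu>"
    proof -
      have "(\<lambda>v. emeasure (choices q) (Pair v -` S)) \<in> borel_measurable \<nu>"
        by (rule Ch.measurable_emeasure_Pair[OF S])
      moreover have "Pair v -` S = {u. walk (H v) 0 u \<in> stays j}" for v by (auto simp: S_def)
      ultimately show ?thesis by (simp only:)
    qed
    have "AE v in \<nu>. nice q j (fst v) \<and> fst v \<in> stays j"
    proof (rule mixing_AE[OF M mix \<nu>(1,2) spF])
      show "Measurable.pred mark_space (\<lambda>v. nice q j (fst v) \<and> fst v \<in> stays j)"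
      proof (rule pred_intros_logic)
        show "Measurable.pred mark_space (\<lambda>v. nice q j (fst v))"
          by (rule measurable_compose[OF measurable_fst_mark pred_nice])
        show "Measurable.pred mark_space (\<lambda>v. fst v \<in> stays j)"
        proof (rule measurable_compose[OF measurable_fst_mark])
          show "Measurable.pred path_space (\<lambda>y. y \<in> stays j)"
            using sets_stays[of j] by (simp add: pred_def)
        qed
      qed
      show "AE \<omega> in M. \<forall>L\<ge>1. snd (\<zeta> \<omega>) L \<longrightarrow>
          nice q j (fst (mpost j L (\<zeta> \<omega>))) \<and> fst (mpost j L (\<zeta> \<omega>)) \<in> stays j"
        using good
      proof eventually_elim
        case (elim \<omega>)
        then show ?case unfolding mpost_def fst_conv using nice_post by blast
      qed
    qed
    moreover have "AE v in \<nu>. emeasure (choices q) {u. walk (H v) 0 u \<in> stays j} = 0"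
      using z nn_integral_0_iff_AE[OF m] by simp
    ultimately have "AE v in \<nu>. False"
    proof eventually_elim
      case (elim v)
      then show False using escape_positive[OF q, of j "fst v"] unfolding H_def by simp
    qed
    then have "emeasure \<nu> (space \<nu>) = 0" by (simp add: AE_iff_measurable[OF sets.top])
    then show False using \<nu>(3) by (simp add: measure_def)
  qed
  have "mixing M F' j (\<lambda>\<omega>. (Y \<omega>, \<lambda>m. snd (\<zeta> \<omega>) m \<and> reg j m (Y \<omega>))) \<nu>'"
    unfolding mixing_def
  proof (intro ballI impI)
    fix A' and g :: "'d marked_path \<Rightarrow> real"
    assume A': "A' \<in> sets F'" and g: "g \<in> borel_measurable mark_space" "\<forall>v. 0 \<le> g v \<and> g v \<le> 1"
    define h where "h v = enn2real (escape_kernel q j g (H v) (snd v))" for v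
    have le1: "escape_kernel q j g (H v) (snd v) \<le> 1" for v by (rule escape_kernel_le_1) (use g(2) in blast)
    have eh: "escape_kernel q j g (H v) (snd v) = ennreal (h v)" for v
      unfolding h_def by (rule ennreal_enn2real[symmetric], rule le_less_trans[OF le1]) simp
    have h01: "0 \<le> h v \<and> h v \<le> 1" for v
      using le1[of v] unfolding eh by (simp add: h_def)
    have gm0: "(\<lambda>z. indicator S z * ennreal (g (W z))) \<in> borel_measurable (mark_space \<Otimes>\<^sub>M choices q)"
      using gm[OF g(1)] by (simp only: measurable_cong_sets[OF cong refl])
    have hm: "h \<in> borel_measurable mark_space"
    proof -
      have "(\<lambda>v. escape_kernel q j g (H v) (snd v)) \<in> borel_measurable mark_space"
        unfolding ek by (rule Ch.borel_measurable_nn_integral_fst[OF gm0])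
      then show ?thesis unfolding h_def[abs_def] by (rule borel_measurable_enn2real)
    qed
    have hm\<nu>: "h \<in> borel_measurable \<nu>" using hm measurable_cong_sets[OF \<nu>(2) refl] by blast
    have int: "(\<integral>v. g v \<partial>\<nu>') = (\<integral>v. h v \<partial>\<nu>)"
    proof -
      have "(\<integral>v. g v \<partial>\<nu>') = enn2real (\<integral>\<^sup>+v. ennreal (g v) \<partial>\<nu>')"
      proof (rule integral_eq_nn_integral)
        show "g \<in> borel_measurable \<nu>'" using g(1) measurable_cong_sets[OF s\<nu>' refl] by blast
      qed (intro AE_I2, use g(2) in blast)
      also have "\<dots> = enn2real (\<integral>\<^sup>+v. ennreal (h v) \<partial>\<nu>)" by (simp only: nn[OF g(1)] eh)
      also have "\<dots> = (\<integral>v. h v \<partial>\<nu>)"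
        by (rule integral_eq_nn_integral[symmetric, OF hm\<nu>]) (intro AE_I2, use h01 in blast)
      finally show ?thesis .
    qed
    have \<zeta>M: "\<zeta> \<in> measurable M mark_space" by (rule measurable_from_subalg[OF sub \<zeta>])
    have "(\<lambda>L. \<integral>\<omega>. indicator A' \<omega> * at_mark j g L (Y \<omega>, \<lambda>m. snd (\<zeta> \<omega>) m \<and> reg j m (Y \<omega>)) \<partial>M)
        \<longlonglongrightarrow> measure M A' * (\<integral>v. h v \<partial>\<nu>)"
    proof (rule mixing_core[where \<kappa> = "\<lambda>L \<omega>. h (mpost j L (\<zeta> \<omega>))"
          and E = "\<lambda>\<omega>. trace_edges (fst (\<zeta> \<omega>))", OF M sub _ Y law])
      show "{\<omega> \<in> space F. e \<in> trace_edges (fst (\<zeta> \<omega>))} \<in> sets F" for e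
        using measurable_sets[OF measurable_compose[OF \<zeta> measurable_fst_mark] sets_trace_edges[of e]]
        by (simp add: vimage_def Int_def conj_commute)
      show "Measurable.pred F (\<lambda>\<omega>. snd (\<zeta> \<omega>) m)" for m by (rule measurable_compose[OF \<zeta> pred_mark])
      show "(\<lambda>\<omega>. h (mpost j L (\<zeta> \<omega>))) \<in> borel_measurable M" for L
        by (rule measurable_compose[OF measurable_compose[OF \<zeta>M measurable_mpost] hm])
      show "0 \<le> h (mpost j L (\<zeta> \<omega>)) \<and> h (mpost j L (\<zeta> \<omega>)) \<le> 1" for L \<omega> by (rule h01)
      show "(\<lambda>L. \<integral>\<omega>. indicator A \<omega> * (if snd (\<zeta> \<omega>) L then h (mpost j L (\<zeta> \<omega>)) else 0) \<partial>M)
          \<longlonglongrightarrow> measure M A * (\<integral>v. h v \<partial>\<nu>)" if "A \<in> sets F" for A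
        using mix[unfolded mixing_def, rule_format, OF that hm h01] by (simp only: at_mark_def)
      show "A' \<in> sigma_sets (space M) {A \<inter> {\<omega> \<in> space M. \<forall>k<n. Y \<omega> k = w k} | A n w. A \<in> sets F}"
        using A' by (simp only: F')
      show "AE \<omega> in M. \<forall>L\<ge>1. snd (\<zeta> \<omega>) L \<longrightarrow> (\<forall>n\<le>L. \<forall>w.
          (\<integral>\<^sup>+u. indicator (prefix n w) (walk (trace_edges (fst (\<zeta> \<omega>))) 0 u)
              * ennreal (at_mark j g L (wmark j (trace_edges (fst (\<zeta> \<omega>))) (snd (\<zeta> \<omega>)) u)) \<partial>choices q)
            = emeasure (choices q) {u. walk (trace_edges (fst (\<zeta> \<omega>))) 0 u \<in> prefix n w}
              * ennreal (h (mpost j L (\<zeta> \<omega>))))"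
        using good
      proof eventually_elim
        case (elim \<omega>)
        define y where "y = fst (\<zeta> \<omega>)"
        define b where "b = snd (\<zeta> \<omega>)"
        have ny: "nice q j y" and rg: "\<And>L. L \<ge> 1 \<Longrightarrow> b L \<Longrightarrow> reg j L y"
          using elim by (auto simp: y_def b_def)
        have ly: "lattice_path y" using ny by (simp add: nice_def)
        have "{x. avail (trace_edges y) x \<noteq> {}} \<subseteq> insert 0 (range y)"
          using avail_trace_edges[of y] by blast
        note T = nice_transient[OF q ny subset_refl this]
        have hits: "AE u in choices q. \<exists>n. int L \<le> walk (trace_edges y) 0 u n $ j" for L
          using T(3)
        proof eventually_elim
          case (elim u)
          then show ?case by (auto simp: filterlim_at_top eventually_sequentially)
        qed
        show ?case
          unfolding y_def[symmetric] b_def[symmetric]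
        proof (intro allI impI)
          fix L n :: nat and w :: "nat \<Rightarrow> 'd site" assume L: "1 \<le> L" "b L" and n: "n \<le> L"
          \<comment> \<open>The new walk enters the level where the old path did, whatever the
            choices, and from there it sees the half trace.\<close>
          have loc: "avail (trace_edges y) (walk (trace_edges y) 0 u (hit j L (walk (trace_edges y) 0 u)) + z)
              = avail (half_trace j (post j L y)) z"
            if u: "valid_choices u" "\<exists>n. int L \<le> walk (trace_edges y) 0 u n $ j" "0 \<le> z $ j" for u z
          proof -
            have "{walk (trace_edges y) 0 u n, walk (trace_edges y) 0 u (Suc n)} \<in> trace_edges y" for n
              using walk_adj[OF u(1) T(1), of n] by (simp add: avail_def)
            then have "walk (trace_edges y) 0 u (hit j L (walk (trace_edges y) 0 u)) = y (hit j L y)"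
              by (intro walk_trace_hit[OF ly rg[OF L] L(1)] lattice_path_walk[OF u(1) T(1)] u(2))
            then show ?thesis by (simp only: avail_post[OF ly rg[OF L] L(1) u(3)])
          qed
          have "escape_kernel q j g (half_trace j (post j L y)) (\<lambda>m. b (L + m)) = ennreal (h (mpost j L (\<zeta> \<omega>)))"
            unfolding eh[symmetric] by (simp only: H_def mpost_def fst_conv snd_conv y_def b_def)
          then show "(\<integral>\<^sup>+u. indicator (prefix n w) (walk (trace_edges y) 0 u)
              * ennreal (at_mark j g L (wmark j (trace_edges y) b u)) \<partial>choices q)
            = emeasure (choices q) {u. walk (trace_edges y) 0 u \<in> prefix n w} * ennreal (h (mpost j L (\<zeta> \<omega>)))"
            using quenched_mark[where B = b and w = w, OF q T(1) hits loc g(1) n L(2)] by (simp only:)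
        qed
      qed
    qed (use g in blast)+
    then show "(\<lambda>L. \<integral>\<omega>. indicator A' \<omega> * at_mark j g L (Y \<omega>, \<lambda>m. snd (\<zeta> \<omega>) m \<and> reg j m (Y \<omega>)) \<partial>M)
        \<longlonglongrightarrow> measure M A' * (\<integral>v. g v \<partial>\<nu>')" by (simp only: int)
  qed
  then show ?thesis using fin s\<nu>' pos by blast
qed

section \<open>A pointwise ergodic theorem\<close>

text \<open>The maximum of the orbit sums over all lengths up to \<open>n\<close>, the empty sum
  included. The recursion is the form needed in Garsia's proof of the maximal ergodic
  theorem.\<close>

primrec max_sum :: "('a \<Rightarrow> 'a) \<Rightarrow> ('a \<Rightarrow> real) \<Rightarrow> nat \<Rightarrow> 'a \<Rightarrow> real" where
  "max_sum \<Theta> g 0 x = 0"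
| "max_sum \<Theta> g (Suc n) x = max 0 (g x + max_sum \<Theta> g n (\<Theta> x))"

definition orbit_sum :: "('a \<Rightarrow> 'a) \<Rightarrow> ('a \<Rightarrow> real) \<Rightarrow> nat \<Rightarrow> 'a \<Rightarrow> real" where
  "orbit_sum \<Theta> f n x = (\<Sum>i<n. f ((\<Theta> ^^ i) x))"

lemma orbit_sum_Suc: "orbit_sum \<Theta> f (Suc n) x = f x + orbit_sum \<Theta> f n (\<Theta> x)"
  by (simp add: orbit_sum_def sum.lessThan_Suc_shift funpow_Suc_right del: funpow.simps(2) sum.lessThan_Suc)

lemma max_sum_nonneg: "0 \<le> max_sum \<Theta> g n x"
  by (cases n) auto

lemma max_sum_mono: "max_sum \<Theta> g n x \<le> max_sum \<Theta> g (Suc n) x"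
proof (induction n arbitrary: x)
  case (Suc n)
  from Suc[of "\<Theta> x"] show ?case by (simp only: max_sum.simps(2)[of _ _ n] max_sum.simps(2)[of _ _ "Suc n"])
qed simp

lemma orbit_sum_le_max_sum: "orbit_sum \<Theta> g n x \<le> max_sum \<Theta> g n x"
proof (induction n arbitrary: x)
  case (Suc n)
  from Suc[of "\<Theta> x"] show ?case by (simp add: orbit_sum_Suc)
qed (simp add: orbit_sum_def)

lemma orbit_sum_linear: "orbit_sum \<Theta> (\<lambda>x. f x - a) n x = orbit_sum \<Theta> f n x - a * real n"
  by (simp add: orbit_sum_def sum_subtractf)

text \<open>Monotone convergence carries the bound from the truncations to \<open>f\<close>.\<close>

lemma (in finite_measure) integrable_if_truncations_bounded:
  assumes f: "f \<in> borel_measurable M" "\<And>x. 0 \<le> f x"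
    and B: "\<And>K::nat. (\<integral>x. min (f x) (real K) \<partial>M) \<le> B"
  shows "integrable M f"
proof -
  have int: "integrable M (\<lambda>x. min (f x) (real K))" for K :: nat
    by (rule integrable_const_bound[where B = "real K"]) (use f in \<open>auto simp: abs_le_iff intro!: AE_I2\<close>)
  have "(\<lambda>K. \<integral>\<^sup>+x. ennreal (min (f x) (real K)) \<partial>M) \<longlonglongrightarrow> (\<integral>\<^sup>+x. ennreal (f x) \<partial>M)"
  proof (rule nn_integral_LIMSEQ)
    show "incseq (\<lambda>K x. ennreal (min (f x) (real K)))"
      by (intro incseq_SucI le_funI ennreal_leI) auto
    show "(\<lambda>K. ennreal (min (f x) (real K))) \<longlonglongrightarrow> ennreal (f x)" for x
    proof (rule tendsto_eventually)
      obtain K0 :: nat where "f x < real K0" using reals_Archimedean2 by blast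
      then show "eventually (\<lambda>K. ennreal (min (f x) (real K)) = ennreal (f x)) sequentially"
        by (intro eventually_sequentiallyI[of K0]) (simp add: min_def)
    qed
  qed (use f in auto)
  moreover have "(\<integral>\<^sup>+x. ennreal (min (f x) (real K)) \<partial>M) \<le> ennreal B" for K
    using B[of K] int[of K] f(2) by (subst nn_integral_eq_integral) (auto intro: ennreal_leI)
  ultimately have "(\<integral>\<^sup>+x. ennreal (f x) \<partial>M) \<le> ennreal B"
    by (intro LIMSEQ_le_const2) auto
  then show ?thesis
    using f by (intro integrableI_nonneg) (auto simp: le_less_trans)
qed

locale measure_preserving = finite_measure N for N :: "'a measure" +
  fixes \<Theta> :: "'a \<Rightarrow> 'a"
  assumes space_N: "space N = UNIV"
    and meas: "\<Theta> \<in> measurable N N" and pres: "distr N N \<Theta> = N"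
begin

lemma integral_shift:
  assumes "integrable N f"
  shows "integrable N (\<lambda>x. f (\<Theta> x))" and "(\<integral>x. f (\<Theta> x) \<partial>N) = (\<integral>x. f x \<partial>N :: real)"
proof -
  have f: "f \<in> borel_measurable N" using assms by auto
  show "integrable N (\<lambda>x. f (\<Theta> x))"
    using integrable_distr[OF meas, of f] assms by (simp add: pres)
  show "(\<integral>x. f (\<Theta> x) \<partial>N) = (\<integral>x. f x \<partial>N)"
    using integral_distr[OF meas f] by (simp add: pres)
qed

lemma integrable_max_sum: "integrable N g \<Longrightarrow> integrable N (max_sum \<Theta> g n)"
proof (induction n)
  case (Suc n)
  then have "integrable N (\<lambda>x. max 0 (g x + max_sum \<Theta> g n (\<Theta> x)))"
    by (intro integrable_max integrable_zero Bochner_Integration.integrable_add integral_shift(1))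
  then show ?case by (simp add: max_sum.simps(2)[abs_def])
qed (simp add: max_sum.simps(1)[abs_def])

text \<open>Garsia's argument: where \<open>max_sum\<close> is positive, \<open>g\<close> is at
  least the decrease of \<open>max_sum\<close> along the shift, and elsewhere this decrease is at
  most 0. By invariance the decrease has integral 0. The sets of positivity increase to almost the
  whole space.\<close>

lemma maximal_ergodic:
  assumes g: "integrable N g" and sup: "AE x in N. \<exists>n. 0 < orbit_sum \<Theta> g n x"
  shows "0 \<le> (\<integral>x. g x \<partial>N)"
proof -
  let ?P = "\<lambda>n. {x. 0 < max_sum \<Theta> g n x}"
  have mm: "max_sum \<Theta> g n \<in> borel_measurable N" for n using integrable_max_sum[OF g] by auto
  have P: "?P n \<in> sets N" for n
  proof -
    have "{x \<in> space N. 0 < max_sum \<Theta> g n x} \<in> sets N" using mm[of n] by measurable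
    then show ?thesis by (simp add: space_N)
  qed
  have nonneg: "0 \<le> (\<integral>x. indicator (?P (Suc n)) x * g x \<partial>N)" for n
  proof -
    have "(\<integral>x. max_sum \<Theta> g (Suc n) x - max_sum \<Theta> g (Suc n) (\<Theta> x) \<partial>N) = 0"
      using integral_shift[OF integrable_max_sum[OF g, of "Suc n"]] integrable_max_sum[OF g, of "Suc n"]
      by (subst Bochner_Integration.integral_diff) (auto simp del: max_sum.simps)
    moreover have "(\<integral>x. max_sum \<Theta> g (Suc n) x - max_sum \<Theta> g (Suc n) (\<Theta> x) \<partial>N)
        \<le> (\<integral>x. indicator (?P (Suc n)) x * g x \<partial>N)"
    proof (rule integral_mono)
      show "integrable N (\<lambda>x. max_sum \<Theta> g (Suc n) x - max_sum \<Theta> g (Suc n) (\<Theta> x))"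
        by (intro Bochner_Integration.integrable_diff integrable_max_sum g integral_shift(1))
      show "integrable N (\<lambda>x. indicator (?P (Suc n)) x * g x)"
        using integrable_mult_indicator[OF P g, of "Suc n"] by simp
      fix x
      show "max_sum \<Theta> g (Suc n) x - max_sum \<Theta> g (Suc n) (\<Theta> x) \<le> indicator (?P (Suc n)) x * g x"
      proof (cases "0 < max_sum \<Theta> g (Suc n) x")
        case True
        then have "max_sum \<Theta> g (Suc n) x = g x + max_sum \<Theta> g n (\<Theta> x)" by (simp add: max_def split: if_splits)
        moreover have "max_sum \<Theta> g n (\<Theta> x) \<le> max_sum \<Theta> g (Suc n) (\<Theta> x)" by (rule max_sum_mono)
        moreover have ind: "indicator (?P (Suc n)) x = (1::real)" using True by (simp del: max_sum.simps)
        ultimately show ?thesis unfolding ind by linarith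
      next
        case False
        then have ind: "indicator (?P (Suc n)) x = (0::real)" by (simp del: max_sum.simps)
        show ?thesis unfolding ind using False max_sum_nonneg[of \<Theta> g "Suc n" "\<Theta> x"] by linarith
      qed
    qed
    ultimately show ?thesis by linarith
  qed
  have "(\<lambda>n. \<integral>x. indicator (?P (Suc n)) x * g x \<partial>N) \<longlonglongrightarrow> (\<integral>x. g x \<partial>N)"
  proof (rule integral_dominated_convergence[where w = "\<lambda>x. \<bar>g x\<bar>"])
    show "AE x in N. (\<lambda>n. indicator (?P (Suc n)) x * g x) \<longlonglongrightarrow> g x"
      using sup
    proof eventually_elim
      case (elim x)
      then obtain n where n: "0 < max_sum \<Theta> g n x" using orbit_sum_le_max_sum by (meson less_le_trans)
      have "0 < max_sum \<Theta> g m x" if "m \<ge> n" for m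
        using that
      proof (induction rule: dec_induct)
        case (step m)
        then show ?case using max_sum_mono[of \<Theta> g m x] by linarith
      qed (rule n)
      then have "eventually (\<lambda>m. indicator (?P (Suc m)) x * g x = g x) sequentially"
        by (intro eventually_sequentiallyI[of n]) (simp add: indicator_def del: max_sum.simps)
      then show ?case by (rule tendsto_eventually)
    qed
    have gb: "g \<in> borel_measurable N" using g by (rule borel_measurable_integrable)
    then show "g \<in> borel_measurable N" .
    show "(\<lambda>x. indicator (?P (Suc n)) x * g x) \<in> borel_measurable N" for n
      by (intro borel_measurable_times borel_measurable_indicator P gb)
    show "integrable N (\<lambda>x. \<bar>g x\<bar>)" by (rule integrable_abs[OF g])
    show "AE x in N. norm (indicator (?P (Suc n)) x * g x) \<le> \<bar>g x\<bar>" for n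
      by (intro AE_I2) (simp add: indicator_def del: max_sum.simps)
  qed
  then show ?thesis by (rule LIMSEQ_le_const) (use nonneg in auto)
qed

text \<open>The event that the upper limit of the averages exceeds \<open>a\<close>. The slack
  \<open>1 / real (Suc k)\<close> leaves room for bounded changes, so the set is invariant at every
  point and not merely almost everywhere.\<close>

definition exceeds :: "('a \<Rightarrow> real) \<Rightarrow> real \<Rightarrow> 'a set" where
  "exceeds f a = {x. \<exists>k::nat. \<exists>\<^sub>\<infinity>n. (a + 1 / real (Suc k)) * real n < orbit_sum \<Theta> f n x}"

lemma measurable_orbit_sum:
  assumes "f \<in> borel_measurable N" shows "orbit_sum \<Theta> f n \<in> borel_measurable N"
proof -
  have "(\<Theta> ^^ i) \<in> measurable N N" for i
    by (induction i) (auto intro: measurable_compose[OF _ meas])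
  then show ?thesis unfolding orbit_sum_def[abs_def]
    by (intro borel_measurable_sum measurable_compose[OF _ assms])
qed

lemma sets_exceeds: assumes f: "f \<in> borel_measurable N" shows "exceeds f a \<in> sets N"
proof -
  note [measurable] = measurable_orbit_sum[OF f]
  have "{x \<in> space N. \<exists>k::nat. \<forall>m. \<exists>n\<ge>m. (a + 1 / real (Suc k)) * real n < orbit_sum \<Theta> f n x} \<in> sets N"
    by measurable
  then show ?thesis by (simp add: exceeds_def INFM_nat_le space_N)
qed

text \<open>A constant error is beaten by the difference of the slopes times \<open>n\<close> once
  \<open>n\<close> is large.\<close>

lemma exceeds_mono:
  assumes inf: "\<exists>\<^sub>\<infinity>n. b * real n < s n" and bb': "b' < b" and cmp: "\<And>n. s n - c \<le> s' n"
  shows "\<exists>\<^sub>\<infinity>n. b' * real n < (s' n :: real)"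
  unfolding INFM_nat_le
proof
  fix m
  obtain k :: nat where k: "\<bar>c\<bar> / (b - b') < real k" using reals_Archimedean2 by blast
  obtain n where n: "n \<ge> max m k" "b * real n < s n" using inf unfolding INFM_nat_le by blast
  have "\<bar>c\<bar> < real k * (b - b')" using k bb' by (simp add: divide_less_eq)
  also have "\<dots> \<le> real n * (b - b')" using n bb' by (intro mult_right_mono) auto
  finally have "b' * real n < s n - c" using n(2) by (simp add: algebra_simps)
  then show "\<exists>n\<ge>m. b' * real n < s' n" using n cmp[of n] by (intro exI[of _ n]) auto
qed

lemma exceeds_invariant: "\<Theta> x \<in> exceeds f a \<longleftrightarrow> x \<in> exceeds f a"
proof
  assume "\<Theta> x \<in> exceeds f a"
  then obtain k :: nat where k: "\<exists>\<^sub>\<infinity>n. (a + 1 / real (Suc k)) * real n < orbit_sum \<Theta> f n (\<Theta> x)"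
    by (auto simp: exceeds_def)
  have "\<exists>\<^sub>\<infinity>n. (a + 1 / real (Suc (Suc k))) * real n < orbit_sum \<Theta> f (Suc n) x - \<bar>a + 1 / real (Suc (Suc k))\<bar>"
  proof (rule exceeds_mono[OF k])
    show "a + 1 / real (Suc (Suc k)) < a + 1 / real (Suc k)" by (simp add: frac_less2)
    show "orbit_sum \<Theta> f n (\<Theta> x) - (\<bar>a + 1 / real (Suc (Suc k))\<bar> - f x)
        \<le> orbit_sum \<Theta> f (Suc n) x - \<bar>a + 1 / real (Suc (Suc k))\<bar>" for n
      by (simp add: orbit_sum_Suc)
  qed
  then have "\<exists>\<^sub>\<infinity>n. (a + 1 / real (Suc (Suc k))) * real (Suc n) < orbit_sum \<Theta> f (Suc n) x"
  proof (rule INFM_mono)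
    fix n
    define b where "b = a + 1 / real (Suc (Suc k))"
    assume "(a + 1 / real (Suc (Suc k))) * real n < orbit_sum \<Theta> f (Suc n) x - \<bar>a + 1 / real (Suc (Suc k))\<bar>"
    then have "b * real n + \<bar>b\<bar> < orbit_sum \<Theta> f (Suc n) x" by (simp only: b_def[symmetric])
    moreover have "b * real (Suc n) \<le> b * real n + \<bar>b\<bar>" by (simp add: distrib_left)
    ultimately show "(a + 1 / real (Suc (Suc k))) * real (Suc n) < orbit_sum \<Theta> f (Suc n) x"
      unfolding b_def by linarith
  qed
  then have "\<exists>\<^sub>\<infinity>n. (a + 1 / real (Suc (Suc k))) * real n < orbit_sum \<Theta> f n x"
    unfolding INFM_nat_le by (meson Suc_le_mono le_Suc_eq order_trans)
  then show "x \<in> exceeds f a" by (auto simp: exceeds_def simp del: of_nat_Suc)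
next
  assume "x \<in> exceeds f a"
  then obtain k :: nat where k: "\<exists>\<^sub>\<infinity>n. (a + 1 / real (Suc k)) * real n < orbit_sum \<Theta> f n x"
    by (auto simp: exceeds_def)
  let ?b = "a + 1 / real (Suc k)"
  have k': "\<exists>\<^sub>\<infinity>n. ?b * real n < orbit_sum \<Theta> f (Suc n) x + \<bar>?b\<bar>"
    unfolding INFM_nat_le
  proof
    fix m
    obtain n where n: "n \<ge> Suc m" "?b * real n < orbit_sum \<Theta> f n x" using k unfolding INFM_nat_le by blast
    then obtain n' where n': "n = Suc n'" by (cases n) auto
    have "?b * real n' < orbit_sum \<Theta> f (Suc n') x + \<bar>?b\<bar>"
      using n(2) unfolding n' of_nat_Suc[of n'] by (simp add: distrib_left del: of_nat_Suc)
    then show "\<exists>n\<ge>m. ?b * real n < orbit_sum \<Theta> f (Suc n) x + \<bar>?b\<bar>" using n n' by (intro exI[of _ n']) auto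
  qed
  have "\<exists>\<^sub>\<infinity>n. (a + 1 / real (Suc (Suc k))) * real n < orbit_sum \<Theta> f n (\<Theta> x)"
  proof (rule exceeds_mono[OF k'])
    show "a + 1 / real (Suc (Suc k)) < a + 1 / real (Suc k)" by (simp add: frac_less2)
    show "orbit_sum \<Theta> f (Suc n) x + \<bar>?b\<bar> - (\<bar>?b\<bar> + f x) \<le> orbit_sum \<Theta> f n (\<Theta> x)" for n
      by (simp add: orbit_sum_Suc)
  qed
  then show "\<Theta> x \<in> exceeds f a" by (auto simp: exceeds_def simp del: of_nat_Suc)
qed

end

locale ergodic_measure = measure_preserving +
  assumes zero_one: "\<And>A. A \<in> sets N \<Longrightarrow> (\<And>x. \<Theta> x \<in> A \<longleftrightarrow> x \<in> A) \<Longrightarrow> measure N A = 0 \<or> measure N A = measure N (space N)"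
    and nontrivial: "0 < measure N (space N)"
begin

text \<open>If \<open>exceeds f a\<close> had full measure, the maximal theorem for
  \<open>f - a\<close> would make its integral nonnegative, against the hypothesis. The zero-one law
  leaves only measure 0.\<close>

lemma ergodic_upper:
  assumes f: "integrable N f" and a: "(\<integral>x. f x \<partial>N) < a * measure N (space N)"
  shows "AE x in N. \<forall>k::nat. eventually (\<lambda>n. orbit_sum \<Theta> f n x \<le> (a + 1 / real (Suc k)) * real n) sequentially"
proof -
  have fm: "f \<in> borel_measurable N" using f by auto
  have A: "exceeds f a \<in> sets N" by (rule sets_exceeds[OF fm])
  have "measure N (exceeds f a) \<noteq> measure N (space N)"
  proof
    assume eq: "measure N (exceeds f a) = measure N (space N)"
    have "AE x in N. x \<in> exceeds f a"
    proof -
      have "measure N (space N - exceeds f a) = 0" using finite_measure_compl[OF A] eq by simp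
      then have "space N - exceeds f a \<in> null_sets N" using A by (simp add: null_sets_def emeasure_eq_measure)
      from AE_not_in[OF this] AE_space show ?thesis by eventually_elim auto
    qed
    then have "AE x in N. \<exists>n. 0 < orbit_sum \<Theta> (\<lambda>x. f x - a) n x"
    proof eventually_elim
      case (elim x)
      then obtain k :: nat where "\<exists>\<^sub>\<infinity>n. (a + 1 / real (Suc k)) * real n < orbit_sum \<Theta> f n x" by (auto simp: exceeds_def)
      then obtain n where n: "(a + 1 / real (Suc k)) * real n < orbit_sum \<Theta> f n x" unfolding INFM_nat_le by blast
      have "a * real n \<le> (a + 1 / real (Suc k)) * real n" by (intro mult_right_mono) auto
      with n have "0 < orbit_sum \<Theta> (\<lambda>x. f x - a) n x" unfolding orbit_sum_linear by linarith
      then show ?case by blast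
    qed
    then have "0 \<le> (\<integral>x. f x - a \<partial>N)" by (intro maximal_ergodic Bochner_Integration.integrable_diff f) auto
    also have "\<dots> = (\<integral>x. f x \<partial>N) - a * measure N (space N)"
      using f by (subst Bochner_Integration.integral_diff) auto
    finally show False using a by simp
  qed
  then have "measure N (exceeds f a) = 0" using zero_one[OF A exceeds_invariant] by blast
  then have "exceeds f a \<in> null_sets N" using A by (simp add: null_sets_def emeasure_eq_measure)
  from AE_not_in[OF this] show ?thesis
  proof eventually_elim
    case (elim x)
    show ?case
    proof
      fix k :: nat
      have "\<not> (\<exists>\<^sub>\<infinity>n. (a + 1 / real (Suc k)) * real n < orbit_sum \<Theta> f n x)" using elim by (auto simp: exceeds_def)
      then show "eventually (\<lambda>n. orbit_sum \<Theta> f n x \<le> (a + 1 / real (Suc k)) * real n) sequentially"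
        by (simp add: INFM_nat_le eventually_sequentially not_less del: of_nat_Suc)
    qed
  qed
qed

theorem ergodic_LLN:
  assumes f: "integrable N f"
  shows "AE x in N. (\<lambda>n. orbit_sum \<Theta> f n x / real n) \<longlonglongrightarrow> (\<integral>x. f x \<partial>N) / measure N (space N)"
proof -
  define c where "c = (\<integral>x. f x \<partial>N) / measure N (space N)"
  have c: "(\<integral>x. f x \<partial>N) = c * measure N (space N)" using nontrivial by (simp add: c_def)
  have neg: "orbit_sum \<Theta> (\<lambda>x. - f x) n x = - orbit_sum \<Theta> f n x" for n x by (simp add: orbit_sum_def sum_negf)
  have up: "AE x in N. \<forall>k::nat. eventually (\<lambda>n. orbit_sum \<Theta> f n x \<le> (c + 1 / real (Suc m) + 1 / real (Suc k)) * real n) sequentially"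
    for m :: nat
  proof (rule ergodic_upper[OF f])
    show "(\<integral>x. f x \<partial>N) < (c + 1 / real (Suc m)) * measure N (space N)"
      unfolding c using nontrivial by (simp add: distrib_right)
  qed
  have lo: "AE x in N. \<forall>k::nat. eventually (\<lambda>n. orbit_sum \<Theta> (\<lambda>x. - f x) n x \<le> (- c + 1 / real (Suc m) + 1 / real (Suc k)) * real n) sequentially"
    for m :: nat
  proof (rule ergodic_upper)
    show "(\<integral>x. - f x \<partial>N) < (- c + 1 / real (Suc m)) * measure N (space N)"
    proof -
      have "0 < 1 / real (Suc m) * measure N (space N)" using nontrivial by (intro mult_pos_pos) auto
      moreover have "(\<integral>x. - f x \<partial>N) = - c * measure N (space N)" by (simp add: c)
      ultimately show ?thesis unfolding distrib_right by linarith
    qed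
  qed (use f in simp)
  have "AE x in N. (\<forall>m k::nat. eventually (\<lambda>n. orbit_sum \<Theta> f n x \<le> (c + 1 / real (Suc m) + 1 / real (Suc k)) * real n) sequentially)
      \<and> (\<forall>m k::nat. eventually (\<lambda>n. orbit_sum \<Theta> (\<lambda>x. - f x) n x \<le> (- c + 1 / real (Suc m) + 1 / real (Suc k)) * real n) sequentially)"
    by (intro AE_conjI iffD2[OF AE_all_countable] allI) (use up lo in \<open>simp_all only: AE_all_countable\<close>)
  then show ?thesis
  proof eventually_elim
    case (elim x)
    show ?case unfolding c_def[symmetric]
    proof (rule LIMSEQ_I)
      fix r :: real assume r: "r > 0"
      then obtain m :: nat where m: "1 / real (Suc m) < r / 2" using reals_Archimedean[of "r / 2"] by (auto simp: inverse_eq_divide)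
      have "eventually (\<lambda>n. norm (orbit_sum \<Theta> f n x / real n - c) < r) sequentially"
        using elim[THEN conjunct1, rule_format, of m m] elim[THEN conjunct2, rule_format, of m m] eventually_gt_at_top[of 0]
      proof eventually_elim
        case (elim n)
        have "orbit_sum \<Theta> f n x / real n \<le> c + 1 / real (Suc m) + 1 / real (Suc m)"
          using elim(1,3) by (simp add: divide_le_eq del: of_nat_Suc)
        moreover have "c - 1 / real (Suc m) - 1 / real (Suc m) \<le> orbit_sum \<Theta> f n x / real n"
        proof -
          define d where "d = 1 / real (Suc m)"
          have "- orbit_sum \<Theta> f n x \<le> - ((c - d - d) * real n)"
            using elim(2) unfolding neg d_def[symmetric] by (simp add: algebra_simps)
          then show ?thesis using elim(3) unfolding d_def[symmetric] by (simp add: le_divide_eq)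
        qed
        ultimately show ?case using m unfolding real_norm_def abs_less_iff by linarith
      qed
      then show "\<exists>no. \<forall>n\<ge>no. norm (orbit_sum \<Theta> f n x / real n - c) < r" by (simp add: eventually_sequentially)
    qed
  qed
qed

text \<open>The averages of the truncations bound those of \<open>f\<close> from below, and their
  limits are unbounded because \<open>f\<close> is not integrable.\<close>

theorem ergodic_LLN_infinite:
  assumes f: "f \<in> borel_measurable N" "\<And>x. 0 \<le> f x" and ni: "\<not> integrable N f"
  shows "AE x in N. filterlim (\<lambda>n. orbit_sum \<Theta> f n x / real n) at_top sequentially"
proof -
  define c where "c K = (\<integral>x. min (f x) (real K) \<partial>N) / measure N (space N)" for K :: nat
  have int: "integrable N (\<lambda>x. min (f x) (real K))" for K :: nat
    by (rule integrable_const_bound[where B = "real K"]) (use f in \<open>auto simp: min_def\<close>)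
  have unb: "\<exists>K. B < c K" for B
  proof (rule ccontr)
    assume "\<not> (\<exists>K. B < c K)"
    then have B: "(\<integral>x. min (f x) (real K) \<partial>N) \<le> B * measure N (space N)" for K
      using nontrivial by (simp add: c_def not_less divide_le_eq)
    have "integrable N f" by (rule integrable_if_truncations_bounded[OF f B])
    with ni show False ..
  qed
  have "AE x in N. \<forall>K. (\<lambda>n. orbit_sum \<Theta> (\<lambda>x. min (f x) (real K)) n x / real n) \<longlonglongrightarrow> c K"
    unfolding AE_all_countable c_def by (intro allI ergodic_LLN int)
  then show ?thesis
  proof eventually_elim
    case (elim x)
    show ?case unfolding filterlim_at_top
    proof
      fix B :: real
      obtain K where K: "B < c K" using unb by blast
      from order_tendstoD(1)[OF elim[rule_format, of K] K]
      show "eventually (\<lambda>n. B \<le> orbit_sum \<Theta> f n x / real n) sequentially"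
      proof eventually_elim
        case (elim n)
        have "orbit_sum \<Theta> (\<lambda>x. min (f x) (real K)) n x \<le> orbit_sum \<Theta> f n x"
          unfolding orbit_sum_def by (intro sum_mono) simp
        then have "orbit_sum \<Theta> (\<lambda>x. min (f x) (real K)) n x / real n \<le> orbit_sum \<Theta> f n x / real n"
          by (intro divide_right_mono) auto
        with elim show ?case by linarith
      qed
    qed
  qed
qed

end

section \<open>The speed of a mixing marked path\<close>

definition nxt :: "'d marked_path \<Rightarrow> nat \<Rightarrow> nat" where
  "nxt v n = (LEAST m. n < m \<and> snd v m)"

text \<open>Removes one excursion: the path restarts, recentred, at its next mark.\<close>

definition shift_mark :: "'d \<Rightarrow> ('d::finite) marked_path \<Rightarrow> 'd marked_path" where
  "shift_mark j v = mpost j (nxt v 0) v"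

definition consistent :: "'d \<Rightarrow> ('d::finite) marked_path \<Rightarrow> bool" where
  "consistent j v \<longleftrightarrow> lattice_path (fst v) \<and> (\<forall>L\<ge>1. snd v L \<longrightarrow> reg j L (fst v))"

definition inf_marks :: "'d marked_path \<Rightarrow> bool" where
  "inf_marks v \<longleftrightarrow> (\<forall>n. \<exists>m. n < m \<and> snd v m)"

lemma nxt_gt: "inf_marks v \<Longrightarrow> n < nxt v n" and nxt_marked: "inf_marks v \<Longrightarrow> snd v (nxt v n)"
  using LeastI_ex[of "\<lambda>m. n < m \<and> snd v m"] by (auto simp: inf_marks_def nxt_def)

lemma nxt_le: "n < m \<Longrightarrow> snd v m \<Longrightarrow> nxt v n \<le> m"
  unfolding nxt_def by (rule Least_le) simp

lemma nxt_Suc_marked: "snd v (Suc k) \<Longrightarrow> nxt v k = Suc k"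
  unfolding nxt_def by (rule Least_equality) auto

lemma nxt_Suc_unmarked: "\<not> snd v (Suc k) \<Longrightarrow> nxt v (Suc k) = nxt v k"
proof -
  assume "\<not> snd v (Suc k)"
  then have "(\<lambda>m. Suc k < m \<and> snd v m) = (\<lambda>m. k < m \<and> snd v m)"
    by (intro ext) (metis Suc_lessI Suc_lessD)
  then show ?thesis by (simp add: nxt_def)
qed

lemma mpost_0: "lattice_path (fst v) \<Longrightarrow> mpost j 0 v = v"
proof -
  assume "lattice_path (fst v)"
  then have "fst v 0 = 0" by (simp add: lattice_path_def)
  moreover from this have "hit j 0 (fst v) = 0" unfolding hit_def by (intro Least_equality) auto
  ultimately show ?thesis by (simp add: mpost_def post_def prod_eq_iff)
qed

lemma consistent_reaches: "consistent j v \<Longrightarrow> L \<ge> 1 \<Longrightarrow> snd v L \<Longrightarrow> \<exists>n. int L \<le> fst v n $ j"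
  by (simp add: consistent_def reg_def)

lemma mpost_mpost:
  assumes v: "consistent j v" and m: "m \<ge> 1" "snd v (L + m)"
  shows "mpost j m (mpost j L v) = mpost j (L + m) v"
  using post_post[of "fst v" L m j] consistent_reaches[OF v _ m(2)] v m(1)
  by (simp add: mpost_def consistent_def add.assoc)

lemma consistent_mpost:
  assumes v: "consistent j v" and L: "L \<ge> 1" "snd v L"
  shows "consistent j (mpost j L v)"
proof -
  have y: "lattice_path (fst v)" using v by (simp add: consistent_def)
  show ?thesis
    unfolding consistent_def mpost_def fst_conv snd_conv reg_post[OF y consistent_reaches[OF v L]]
    using v by (auto simp: consistent_def lattice_path_post)
qed

lemma inf_marks_mpost: "inf_marks v \<Longrightarrow> inf_marks (mpost j L v)"
  unfolding inf_marks_def mpost_def snd_conv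
proof
  fix n assume a: "\<forall>n. \<exists>m. n < m \<and> snd v m"
  then obtain m where "L + n < m" "snd v m" by blast
  then show "\<exists>m. n < m \<and> snd v (L + m)" by (intro exI[of _ "m - L"]) auto
qed

lemma nxt_mpost:
  assumes "inf_marks v" shows "nxt (mpost j L v) n = nxt v (L + n) - L"
  unfolding nxt_def[of "mpost j L v"]
proof (rule Least_equality)
  show "n < nxt v (L + n) - L \<and> snd (mpost j L v) (nxt v (L + n) - L)"
    using nxt_gt[OF assms, of "L + n"] nxt_marked[OF assms, of "L + n"] by (simp add: mpost_def)
  fix m assume "n < m \<and> snd (mpost j L v) m"
  then show "nxt v (L + n) - L \<le> m" using nxt_le[of "L + n" "L + m" v] by (simp add: mpost_def)
qed

lemma shift_mark_mpost:
  assumes "consistent j v" "inf_marks v"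
  shows "shift_mark j (mpost j L v) = mpost j (nxt v L) v"
proof -
  have e: "nxt (mpost j L v) 0 = nxt v L - L" using nxt_mpost[OF assms(2), of j L 0] by simp
  have "mpost j (nxt v L - L) (mpost j L v) = mpost j (L + (nxt v L - L)) v"
    using nxt_gt[OF assms(2), of L] nxt_marked[OF assms(2), of L] by (intro mpost_mpost[OF assms(1)]) auto
  then show ?thesis using nxt_gt[OF assms(2), of L] by (simp add: shift_mark_def e)
qed

lemma funpow_shift_mark:
  assumes v: "consistent j v" "inf_marks v"
  shows "(shift_mark j ^^ k) v = mpost j ((nxt v ^^ k) 0) v"
proof (induction k)
  case 0
  then show ?case using v mpost_0[of v j] by (simp add: consistent_def)
qed (simp add: shift_mark_mpost[OF v])

text \<open>The orbit of the shift runs through the marks one after the other, so the gaps add up to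
  the position of the \<open>k\<close>-th mark; in \<open>orbit_sum_time\<close> the durations add
  up to its hitting time.\<close>

lemma orbit_sum_gap:
  assumes v: "consistent j v" "inf_marks v"
  shows "orbit_sum (shift_mark j) (\<lambda>w. real (nxt w 0)) k v = real ((nxt v ^^ k) 0)"
proof (induction k)
  case (Suc k)
  have "orbit_sum (shift_mark j) (\<lambda>w. real (nxt w 0)) (Suc k) v
      = orbit_sum (shift_mark j) (\<lambda>w. real (nxt w 0)) k v + real (nxt ((shift_mark j ^^ k) v) 0)"
    by (simp add: orbit_sum_def)
  then show ?case
    using Suc nxt_gt[OF v(2), of "(nxt v ^^ k) 0"] by (simp add: funpow_shift_mark[OF v] nxt_mpost[OF v(2)])
qed (simp add: orbit_sum_def)

lemma orbit_sum_time:
  assumes v: "consistent j v" "inf_marks v"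
  shows "orbit_sum (shift_mark j) (\<lambda>w. real (hit j (nxt w 0) (fst w))) k v = real (hit j ((nxt v ^^ k) 0) (fst v))"
proof (induction k)
  case 0
  have "fst v 0 = 0" using v(1) by (simp add: consistent_def lattice_path_def)
  then have "hit j 0 (fst v) = 0" unfolding hit_def by (intro Least_equality) auto
  then show ?case by (simp add: orbit_sum_def)
next
  case (Suc k)
  define l where "l = (nxt v ^^ k) 0"
  have gt: "l < nxt v l" and mk: "snd v (nxt v l)" using nxt_gt[OF v(2)] nxt_marked[OF v(2)] by auto
  have y: "lattice_path (fst v)" using v by (simp add: consistent_def)
  have "\<exists>n. int (l + (nxt v l - l)) \<le> fst v n $ j"
    using consistent_reaches[OF v(1) _ mk] gt by simp
  from hit_add(2)[OF y this]
  have "hit j (nxt v l) (fst v) = hit j l (fst v) + hit j (nxt v l - l) (post j l (fst v))" using gt by simp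
  moreover have "orbit_sum (shift_mark j) (\<lambda>w. real (hit j (nxt w 0) (fst w))) (Suc k) v
      = orbit_sum (shift_mark j) (\<lambda>w. real (hit j (nxt w 0) (fst w))) k v
        + real (hit j (nxt v l - l) (post j l (fst v)))"
    by (simp add: orbit_sum_def funpow_shift_mark[OF v] nxt_mpost[OF v(2)] l_def)
      (simp add: mpost_def)
  ultimately show ?case using Suc by (simp add: l_def)
qed

text \<open>Between the hitting times of two consecutive marks the height is at least the lower
  mark, as the path does not return below it, and less than the upper one, which is not yet hit.
  These opposite comparisons explain the index shifts in the two limits.\<close>

lemma speed_of_marks:
  fixes v :: "('d::finite) marked_path"
  assumes v: "consistent j v" "inf_marks v"
  defines "l \<equiv> \<lambda>k. (nxt v ^^ k) 0" and "t \<equiv> \<lambda>k. hit j ((nxt v ^^ k) 0) (fst v)"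
  assumes lim1: "(\<lambda>k. real (l k) / real (t (Suc k))) \<longlonglongrightarrow> \<kappa>"
    and lim2: "(\<lambda>k. real (l (Suc k)) / real (t k)) \<longlonglongrightarrow> \<kappa>"
  shows "(\<lambda>n. real_of_int (fst v n $ j) / real n) \<longlonglongrightarrow> \<kappa>"
proof -
  have y: "lattice_path (fst v)" using v by (simp add: consistent_def)
  have lS: "l (Suc k) = nxt v (l k)" for k by (simp add: l_def)
  have mk: "snd v (l (Suc k))" "l k < l (Suc k)" for k
    using nxt_gt[OF v(2)] nxt_marked[OF v(2)] by (auto simp: lS)
  have l1: "l (Suc k) \<ge> 1" for k using mk(2)[of k] by simp
  have ex: "\<exists>n. int (l k) \<le> fst v n $ j" for k
  proof (cases k)
    case 0
    then show ?thesis using y by (intro exI[of _ 0]) (simp add: l_def lattice_path_def)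
  next
    case (Suc k')
    then show ?thesis using consistent_reaches[OF v(1) l1 mk(1)] by simp
  qed
  have tmono: "t k < t (Suc k)" for k
  proof (rule ccontr)
    assume "\<not> t k < t (Suc k)"
    then have "fst v (t (Suc k)) $ j < int (l k) \<or> t (Suc k) = t k"
      using hit_less[of "t (Suc k)" j "l k" "fst v"] by (auto simp: t_def l_def)
    moreover have "fst v (t k) $ j = int (l k)" for k
      using hit_height[OF y ex[of k]] by (simp add: t_def l_def)
    from this[of k] this[of "Suc k"] calculation show False using mk(2)[of k] by auto
  qed
  have tge: "k \<le> t k" for k
  proof (induction k)
    case (Suc k)
    then show ?case using tmono[of k] by simp
  qed simp
  \<comment> \<open>The index of the last mark hit by time \<open>n\<close>. The set contains 0
    because \<open>t 0 = 0\<close>, and is finite because \<open>k \<le> t k\<close>.\<close>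
  define K where "K n = Max {k. t k \<le> n}" for n
  have fin: "finite {k. t k \<le> n}" for n
    by (rule finite_subset[of _ "{..n}"]) (use tge order_trans in auto)
  have t0: "t 0 = 0"
  proof -
    have "fst v 0 = 0" using y by (simp add: lattice_path_def)
    then show ?thesis unfolding t_def hit_def by (intro Least_equality) auto
  qed
  have K1: "t (K n) \<le> n" for n
  proof -
    have "K n \<in> {k. t k \<le> n}" unfolding K_def by (rule Max_in[OF fin]) (use t0 in \<open>auto intro: exI[of _ 0]\<close>)
    then show ?thesis by simp
  qed
  have K3: "k \<le> K n" if "t k \<le> n" for k n unfolding K_def using that by (intro Max_ge fin) simp
  have K2: "n < t (Suc (K n))" for n using K3[of "Suc (K n)" n] by fastforce
  have Klim: "filterlim K at_top sequentially"
    unfolding filterlim_at_top by (intro allI eventually_sequentiallyI[of "t _"] K3)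
  have b1: "real (l (K n)) / real (t (Suc (K n))) \<le> real_of_int (fst v n $ j) / real n" if n: "t 1 \<le> n" for n
  proof -
    obtain k where k: "K n = Suc k" using K3[OF n] by (cases "K n") auto
    have "reg j (l (K n)) (fst v)" using v(1) mk(1)[of k] l1[of k] by (simp add: consistent_def k)
    then have h: "int (l (K n)) \<le> fst v n $ j" using K1[of n] by (simp add: reg_def t_def l_def)
    have n0: "n > 0" using n tge[of 1] by simp
    have "real (l (K n)) / real (t (Suc (K n))) \<le> real (l (K n)) / real n"
      using K2[of n] n0 by (intro divide_left_mono mult_pos_pos) auto
    also have "\<dots> \<le> real_of_int (fst v n $ j) / real n"
      using h by (intro divide_right_mono) linarith+
    finally show ?thesis .
  qed
  have b2: "real_of_int (fst v n $ j) / real n \<le> real (l (Suc (K n))) / real (t (K n))" if n: "t 1 \<le> n" for n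
  proof -
    have h: "fst v n $ j < int (l (Suc (K n)))" using hit_less[of n j "l (Suc (K n))" "fst v"] K2[of n] by (simp add: t_def l_def)
    have tp: "0 < t (K n)" using K3[OF n] tge[of "K n"] by simp
    have n0: "n > 0" using n tge[of 1] by simp
    have "real_of_int (fst v n $ j) / real n \<le> real (l (Suc (K n))) / real n"
      using h by (intro divide_right_mono) linarith+
    also have "\<dots> \<le> real (l (Suc (K n))) / real (t (K n))"
      using K1[of n] tp n0 by (intro divide_left_mono mult_pos_pos) auto
    finally show ?thesis .
  qed
  show ?thesis
  proof (rule tendsto_sandwich)
    show "eventually (\<lambda>n. real (l (K n)) / real (t (Suc (K n))) \<le> real_of_int (fst v n $ j) / real n) sequentially"
      by (rule eventually_sequentiallyI[of "t 1"]) (rule b1)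
    show "eventually (\<lambda>n. real_of_int (fst v n $ j) / real n \<le> real (l (Suc (K n))) / real (t (K n))) sequentially"
      by (rule eventually_sequentiallyI[of "t 1"]) (rule b2)
    show "(\<lambda>n. real (l (K n)) / real (t (Suc (K n)))) \<longlonglongrightarrow> \<kappa>" by (rule filterlim_compose[OF lim1 Klim])
    show "(\<lambda>n. real (l (Suc (K n))) / real (t (K n))) \<longlonglongrightarrow> \<kappa>" by (rule filterlim_compose[OF lim2 Klim])
  qed
qed

text \<open>Meant for sums over levels that telescope up to a bounded error: mixing provides the
  limit of the terms, and boundedness of the sums settles its sign.\<close>

lemma bounded_sums_limit:
  fixes x :: "nat \<Rightarrow> real"
  assumes lim: "x \<longlonglongrightarrow> c" and B: "\<And>n. (\<Sum>k<n. x k) \<le> B"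
  shows "c \<le> 0"
proof (rule ccontr)
  assume "\<not> c \<le> 0"
  then have c: "c / 2 < c" "0 < c / 2" by auto
  from order_tendstoD(1)[OF lim c(1)] obtain N where N: "\<And>n. n \<ge> N \<Longrightarrow> c / 2 < x n"
    by (auto simp: eventually_sequentially)
  have S: "(\<Sum>k<N. x k) + real m * (c / 2) \<le> (\<Sum>k<N + m. x k)" for m
  proof (induction m)
    case (Suc m)
    then show ?case using N[of "N + m"] by (simp add: distrib_right add_divide_distrib)
  qed simp
  obtain m :: nat where m: "(B - (\<Sum>k<N. x k)) / (c / 2) < real m" using reals_Archimedean2 by blast
  then have "B - (\<Sum>k<N. x k) < real m * (c / 2)" using c by (simp add: divide_less_eq)
  with S[of m] B[of "N + m"] show False by linarith
qed

section \<open>Measurability of the excursion data\<close>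

lemma measurable_nxt: "(\<lambda>v. nxt v n) \<in> measurable mark_space (count_space UNIV)"
  unfolding nxt_def by measurable

lemma measurable_shift_mark: "shift_mark j \<in> measurable mark_space mark_space"
proof -
  have "(\<lambda>v. mpost j (nxt v 0) v) \<in> measurable mark_space mark_space"
    by (rule measurable_compose_countable[where f = "mpost j" and g = "\<lambda>v. nxt v 0"])
       (rule measurable_mpost, rule measurable_nxt)
  then show ?thesis by (simp only: shift_mark_def[abs_def])
qed

lemma measurable_gap: "(\<lambda>v. real (nxt v 0)) \<in> borel_measurable mark_space"
  by (rule measurable_compose[OF measurable_nxt]) simp

lemma measurable_time: "(\<lambda>v. real (hit j (nxt v 0) (fst v))) \<in> borel_measurable mark_space"
proof -
  have "(\<lambda>v. hit j (nxt v 0) (fst v)) \<in> measurable mark_space (count_space UNIV)"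
    by (rule measurable_compose_countable[where f = "\<lambda>m v. hit j m (fst v)" and g = "\<lambda>v. nxt v 0"])
       (rule measurable_compose[OF measurable_fst_mark measurable_hit], rule measurable_nxt)
  then show ?thesis by (rule measurable_compose) simp
qed

lemma pred_lattice_path: "Measurable.pred path_space lattice_path"
  unfolding lattice_path_def[abs_def] supply pred_path [measurable] pred_path2 [measurable] by measurable

lemma pred_consistent: "Measurable.pred mark_space (consistent j)"
proof -
  have [measurable]: "Measurable.pred mark_space (\<lambda>v. lattice_path (fst v))"
    "Measurable.pred mark_space (\<lambda>v. reg j L (fst v))" for L
    by (rule measurable_compose[OF measurable_fst_mark pred_lattice_path],
        rule measurable_compose[OF measurable_fst_mark pred_reg])
  show ?thesis unfolding consistent_def[abs_def] by measurable
qed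

lemma pred_inf_marks: "Measurable.pred mark_space inf_marks"
  unfolding inf_marks_def[abs_def] by measurable

lemma pred_speed:
  fixes j :: "'d::finite"
  shows "Measurable.pred path_space (\<lambda>y. (\<lambda>n. real_of_int (y n $ j) / real n) \<longlonglongrightarrow> \<kappa>)"
proof -
  have eq: "(X \<longlonglongrightarrow> \<kappa>) \<longleftrightarrow> (\<forall>k::nat. \<exists>N. \<forall>n\<ge>N. \<bar>X n - \<kappa>\<bar> < 1 / real (Suc k))" for X :: "nat \<Rightarrow> real"
  proof
    assume "X \<longlonglongrightarrow> \<kappa>"
    then show "\<forall>k::nat. \<exists>N. \<forall>n\<ge>N. \<bar>X n - \<kappa>\<bar> < 1 / real (Suc k)"
      unfolding LIMSEQ_iff real_norm_def by (intro allI) (drule spec, erule mp, simp)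
  next
    assume a: "\<forall>k::nat. \<exists>N. \<forall>n\<ge>N. \<bar>X n - \<kappa>\<bar> < 1 / real (Suc k)"
    show "X \<longlonglongrightarrow> \<kappa>"
    proof (rule LIMSEQ_I)
      fix r :: real assume "r > 0"
      then obtain k :: nat where k: "1 / real (Suc k) < r" using reals_Archimedean[of r] by (auto simp: inverse_eq_divide)
      from a obtain N where "\<forall>n\<ge>N. \<bar>X n - \<kappa>\<bar> < 1 / real (Suc k)" by blast
      with k show "\<exists>no. \<forall>n\<ge>no. norm (X n - \<kappa>) < r" by (intro exI[of _ N]) (auto intro: less_trans)
    qed
  qed
  show ?thesis unfolding eq supply pred_path [measurable] by measurable
qed


text \<open>The strength of mixing lies in that an event of \<open>F\<close> may look at the whole
  path \<open>\<zeta>\<close>, including its future. Suitable events then show that marks never end,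
  that \<open>\<nu>\<close> is ergodic, and that the speed found under \<open>\<nu>\<close> is the
  speed under \<open>M\<close>.\<close>

theorem mixing_speed:
  fixes \<zeta> :: "'w \<Rightarrow> ('d::finite) marked_path"
  assumes M: "prob_space M" and sub: "subalgebra M F" and \<zeta>: "\<zeta> \<in> measurable F mark_space"
    and mix: "mixing M F j \<zeta> \<nu>"
    and \<nu>: "finite_measure \<nu>" "sets \<nu> = sets mark_space" "0 < measure \<nu> (space \<nu>)"
    and good: "AE \<omega> in M. consistent j (\<zeta> \<omega>)"
  shows "\<exists>\<kappa>\<ge>0. AE \<omega> in M. (\<lambda>n. real_of_int (fst (\<zeta> \<omega>) n $ j) / real n) \<longlonglongrightarrow> \<kappa>"
proof -
  interpret M: prob_space M by (rule M)
  interpret N: finite_measure \<nu> by (rule \<nu>(1))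
  let ?\<Theta> = "shift_mark j"
  have spF: "space M \<in> sets F" using sub sets.top[of F] by (simp add: subalgebra_def)
  have sp: "space F = space M" "sets F \<subseteq> sets M" using sub by (auto simp: subalgebra_def)
  have sp\<nu>: "space \<nu> = UNIV" using sets_eq_imp_space_eq[OF \<nu>(2)] by (simp only: space_mark_space)
  have \<zeta>M: "\<zeta> \<in> measurable M mark_space" by (rule measurable_from_subalg[OF sub \<zeta>])
  have predF: "{\<omega> \<in> space M. P (\<zeta> \<omega>)} \<in> sets F" if P: "Measurable.pred mark_space P" for P
    using measurable_compose[OF \<zeta> P] sp(1) by (simp add: pred_def)
  have atm: "(\<lambda>\<omega>. at_mark j g L (\<zeta> \<omega>)) \<in> borel_measurable M" if "g \<in> borel_measurable mark_space" for g L
    by (rule measurable_compose[OF \<zeta>M measurable_at_mark[OF that]])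
  have ati: "integrable M (\<lambda>\<omega>. at_mark j g L (\<zeta> \<omega>))"
    if g: "g \<in> borel_measurable mark_space" "\<And>v. 0 \<le> g v \<and> g v \<le> 1" for g L
  proof (rule M.integrable_const_bound[where B = 1])
    have "0 \<le> at_mark j g L v \<and> at_mark j g L v \<le> 1" for v by (rule at_mark_bounds[OF g(2)])
    then show "AE \<omega> in M. norm (at_mark j g L (\<zeta> \<omega>)) \<le> 1" by (intro AE_I2) simp
  qed (rule atm[OF g(1)])
  have lim: "(\<lambda>L. \<integral>\<omega>. indicator A \<omega> * at_mark j g L (\<zeta> \<omega>) \<partial>M) \<longlonglongrightarrow> measure M A * (\<integral>v. g v \<partial>\<nu>)"
    if "A \<in> sets F" "g \<in> borel_measurable mark_space" "\<And>v. 0 \<le> g v \<and> g v \<le> 1" for A g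
    using mix that unfolding mixing_def by blast
  have lim1: "(\<lambda>L. \<integral>\<omega>. at_mark j g L (\<zeta> \<omega>) \<partial>M) \<longlonglongrightarrow> (\<integral>v. g v \<partial>\<nu>)"
    if g: "g \<in> borel_measurable mark_space" "\<And>v. 0 \<le> g v \<and> g v \<le> 1" for g
  proof -
    have "(\<integral>\<omega>. indicator (space M) \<omega> * at_mark j g L (\<zeta> \<omega>) \<partial>M) = (\<integral>\<omega>. at_mark j g L (\<zeta> \<omega>) \<partial>M)" for L
      by (intro Bochner_Integration.integral_cong) auto
    with lim[OF spF g] show ?thesis using M.prob_space by simp
  qed
  have one: "(\<lambda>_. 1 :: real) \<in> borel_measurable mark_space" by simp
  have indb: "0 \<le> indicat_real B v \<and> indicat_real B v \<le> 1" for B and v :: "'d marked_path" by (simp add: indicator_def)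
  \<comment> \<open>On the event of finitely many marks the integrands vanish for large
    \<open>L\<close>. Mixing gives the limit as the probability of this event times the positive
    mass of \<open>\<nu>\<close>.\<close>
  have AE_inf: "AE \<omega> in M. inf_marks (\<zeta> \<omega>)"
  proof -
    define A where "A = {\<omega> \<in> space M. \<not> inf_marks (\<zeta> \<omega>)}"
    have "Measurable.pred mark_space (\<lambda>v. \<not> inf_marks v)" by (rule pred_intros_logic(2)[OF pred_inf_marks])
    from predF[OF this] have A: "A \<in> sets F" by (simp only: A_def)
    have AM: "A \<in> sets M" using A sp by blast
    have "(\<lambda>L. \<integral>\<omega>. indicator A \<omega> * at_mark j (\<lambda>_. 1) L (\<zeta> \<omega>) \<partial>M) \<longlonglongrightarrow> (\<integral>\<omega>. 0 \<partial>M)"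
    proof (rule integral_dominated_convergence[where w = "\<lambda>_. 1"])
      show "(\<lambda>\<omega>. indicator A \<omega> * at_mark j (\<lambda>_. 1) L (\<zeta> \<omega>)) \<in> borel_measurable M" for L
        by (intro borel_measurable_times borel_measurable_indicator AM atm one)
      show "AE \<omega> in M. (\<lambda>L. indicator A \<omega> * at_mark j (\<lambda>_. 1) L (\<zeta> \<omega>)) \<longlonglongrightarrow> 0"
      proof (rule AE_I2)
        fix \<omega> assume "\<omega> \<in> space M"
        show "(\<lambda>L. indicator A \<omega> * at_mark j (\<lambda>_. 1) L (\<zeta> \<omega>)) \<longlonglongrightarrow> 0"
        proof (cases "\<omega> \<in> A")
          case True
          then obtain n where "\<And>m. n < m \<Longrightarrow> \<not> snd (\<zeta> \<omega>) m" by (auto simp: A_def inf_marks_def)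
          then have "eventually (\<lambda>L. indicator A \<omega> * at_mark j (\<lambda>_. 1) L (\<zeta> \<omega>) = 0) sequentially"
            by (intro eventually_sequentiallyI[of "Suc n"]) (simp add: at_mark_def)
          then show ?thesis by (rule tendsto_eventually)
        qed simp
      qed
      show "AE \<omega> in M. norm (indicator A \<omega> * at_mark j (\<lambda>_. 1) L (\<zeta> \<omega>)) \<le> 1" for L
        by (intro AE_I2) (simp add: indicator_def at_mark_def)
    qed simp_all
    from LIMSEQ_unique[OF this lim[OF A one]]
    have "measure M A * measure \<nu> (space \<nu>) = 0" by simp
    then have "measure M A = 0" using \<nu>(3) by simp
    then have "A \<in> null_sets M" using AM by (simp add: null_sets_def M.emeasure_eq_measure)
    from AE_not_in[OF this] AE_space show ?thesis by eventually_elim (simp add: A_def)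
  qed
  have AE_g: "AE \<omega> in M. consistent j (\<zeta> \<omega>) \<and> inf_marks (\<zeta> \<omega>)" using good AE_inf by eventually_elim simp
  have AE_\<nu>: "AE v in \<nu>. consistent j v \<and> inf_marks v"
  proof (rule mixing_AE[OF M mix \<nu>(1,2) spF])
    show "Measurable.pred mark_space (\<lambda>v. consistent j v \<and> inf_marks v)"
      by (rule pred_intros_logic(3)[OF pred_consistent pred_inf_marks])
    show "AE \<omega> in M. \<forall>L\<ge>1. snd (\<zeta> \<omega>) L \<longrightarrow> consistent j (mpost j L (\<zeta> \<omega>)) \<and> inf_marks (mpost j L (\<zeta> \<omega>))"
      using AE_g by eventually_elim (use consistent_mpost inf_marks_mpost in blast)
  qed
  \<comment> \<open>If level \<open>k + 1\<close> is marked, it is the next mark after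
    \<open>k\<close>; if not, the next marks after \<open>k\<close> and after \<open>k + 1\<close>
    coincide. In both cases the difference is the increment of one function of \<open>k\<close>, so
    sums over levels telescope.\<close>
  have step: "at_mark j (\<lambda>v. g (?\<Theta> v)) (Suc k) (\<zeta> \<omega>) - at_mark j g (Suc k) (\<zeta> \<omega>)
      = g (mpost j (nxt (\<zeta> \<omega>) (Suc k)) (\<zeta> \<omega>)) - g (mpost j (nxt (\<zeta> \<omega>) k) (\<zeta> \<omega>))"
    if "consistent j (\<zeta> \<omega>) \<and> inf_marks (\<zeta> \<omega>)" for g :: "'d marked_path \<Rightarrow> real" and \<omega> k
  proof (cases "snd (\<zeta> \<omega>) (Suc k)")
    case True
    with that show ?thesis by (simp add: at_mark_def shift_mark_mpost nxt_Suc_marked)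
  qed (simp add: at_mark_def nxt_Suc_unmarked)
  \<comment> \<open>The telescoping sums are bounded by 1, while the terms converge to the
    difference of the two integrals, which must then be 0.\<close>
  have inv: "(\<integral>v. g (?\<Theta> v) \<partial>\<nu>) \<le> (\<integral>v. g v \<partial>\<nu>) \<and> (\<integral>v. g v \<partial>\<nu>) \<le> (\<integral>v. g (?\<Theta> v) \<partial>\<nu>)"
    if g: "g \<in> borel_measurable mark_space" "\<And>v. 0 \<le> g v \<and> g v \<le> 1" for g :: "'d marked_path \<Rightarrow> real"
  proof -
    have g': "(\<lambda>v. g (?\<Theta> v)) \<in> borel_measurable mark_space"
      by (rule measurable_compose[OF measurable_shift_mark g(1)])
    define x where "x k = (\<integral>\<omega>. at_mark j (\<lambda>v. g (?\<Theta> v)) (Suc k) (\<zeta> \<omega>) \<partial>M) - (\<integral>\<omega>. at_mark j g (Suc k) (\<zeta> \<omega>) \<partial>M)" for k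
    have xl: "x \<longlonglongrightarrow> (\<integral>v. g (?\<Theta> v) \<partial>\<nu>) - (\<integral>v. g v \<partial>\<nu>)"
      unfolding x_def by (intro tendsto_diff LIMSEQ_Suc lim1 g g')
    have xs: "\<bar>\<Sum>k<n. x k\<bar> \<le> 1" for n
    proof -
      let ?h = "\<lambda>\<omega>. \<Sum>k<n. at_mark j (\<lambda>v. g (?\<Theta> v)) (Suc k) (\<zeta> \<omega>) - at_mark j g (Suc k) (\<zeta> \<omega>)"
      have i: "integrable M (\<lambda>\<omega>. at_mark j (\<lambda>v. g (?\<Theta> v)) (Suc k) (\<zeta> \<omega>) - at_mark j g (Suc k) (\<zeta> \<omega>))" for k
        by (intro Bochner_Integration.integrable_diff ati g g')
      have ih: "integrable M ?h" by (intro Bochner_Integration.integrable_sum i)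
      have xh: "(\<Sum>k<n. x k) = (\<integral>\<omega>. ?h \<omega> \<partial>M)"
        unfolding x_def using i ati[OF g] ati[OF g' g(2)]
        by (subst Bochner_Integration.integral_sum) (auto simp: Bochner_Integration.integral_diff)
      have b: "AE \<omega> in M. \<bar>?h \<omega>\<bar> \<le> 1"
        using AE_g
      proof eventually_elim
        case (elim \<omega>)
        have "?h \<omega> = g (mpost j (nxt (\<zeta> \<omega>) n) (\<zeta> \<omega>)) - g (mpost j (nxt (\<zeta> \<omega>) 0) (\<zeta> \<omega>))"
          unfolding step[OF elim] by (rule sum_lessThan_telescope)
        then show ?case using g(2)[of "mpost j (nxt (\<zeta> \<omega>) n) (\<zeta> \<omega>)"] g(2)[of "mpost j (nxt (\<zeta> \<omega>) 0) (\<zeta> \<omega>)"]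
          unfolding abs_le_iff by linarith
      qed
      have "\<bar>\<integral>\<omega>. ?h \<omega> \<partial>M\<bar> \<le> (\<integral>\<omega>. \<bar>?h \<omega>\<bar> \<partial>M)" by (rule integral_abs_bound)
      also have "\<dots> \<le> (\<integral>\<omega>. 1 \<partial>M)" by (rule integral_mono_AE[OF integrable_abs[OF ih] _ b]) simp
      finally show ?thesis unfolding xh using M.prob_space by simp
    qed
    have s1: "(\<Sum>k<n. x k) \<le> 1" and s2: "(\<Sum>k<n. - x k) \<le> 1" for n
      using xs[of n] by (auto simp: abs_le_iff sum_negf)
    from bounded_sums_limit[OF xl s1] bounded_sums_limit[OF tendsto_minus[OF xl] s2] show ?thesis by simp
  qed
  have Th: "?\<Theta> \<in> measurable \<nu> \<nu>"
    using measurable_shift_mark[of j] by (simp only: measurable_cong_sets[OF \<nu>(2) \<nu>(2)])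
  interpret E: measure_preserving \<nu> ?\<Theta>
  proof unfold_locales
    show "space \<nu> = UNIV" by (rule sp\<nu>)
    show "?\<Theta> \<in> measurable \<nu> \<nu>" by (rule Th)
    show "distr \<nu> \<nu> ?\<Theta> = \<nu>"
    proof (rule measure_eqI)
      fix B assume "B \<in> sets (distr \<nu> \<nu> ?\<Theta>)"
      then have B: "B \<in> sets \<nu>" "B \<in> sets mark_space" using \<nu>(2) by auto
      have Bp: "{v. ?\<Theta> v \<in> B} \<in> sets \<nu>" using measurable_sets[OF Th B(1)] by (simp add: sp\<nu> vimage_def)
      have i1: "(\<integral>v. indicat_real B (?\<Theta> v) \<partial>\<nu>) = measure \<nu> {v. ?\<Theta> v \<in> B}"
      proof -
        have "(\<integral>v. indicat_real B (?\<Theta> v) \<partial>\<nu>) = (\<integral>v. indicat_real {v. ?\<Theta> v \<in> B} v \<partial>\<nu>)"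
          by (intro Bochner_Integration.integral_cong) (auto simp: indicator_def)
        then show ?thesis by (simp add: sp\<nu>)
      qed
      have i2: "(\<integral>v. indicat_real B v \<partial>\<nu>) = measure \<nu> B" by (simp add: sp\<nu>)
      have "measure \<nu> {v. ?\<Theta> v \<in> B} = measure \<nu> B"
        using inv[OF borel_measurable_indicator[OF B(2)] indb] unfolding i1 i2 by linarith
      then show "emeasure (distr \<nu> \<nu> ?\<Theta>) B = emeasure \<nu> B"
        by (simp add: emeasure_distr[OF Th B(1)] sp\<nu> vimage_def N.emeasure_eq_measure)
    qed simp
  qed
  interpret E: ergodic_measure \<nu> ?\<Theta>
  proof unfold_locales
    show "0 < measure \<nu> (space \<nu>)" by (rule \<nu>(3))
    fix A assume A: "A \<in> sets \<nu>" and Ainv: "\<And>v. ?\<Theta> v \<in> A \<longleftrightarrow> v \<in> A"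
    have A': "A \<in> sets mark_space" using A \<nu>(2) by simp
    \<comment> \<open>For an invariant \<open>A\<close>, all marks of a path agree on whether the
      future lies in \<open>A\<close>, so this is a single event \<open>S\<close> of the path.
      Mixing with \<open>S\<close> as the past, once with the indicator of \<open>A\<close> and once
      with the constant 1, gives two expressions for \<open>measure \<nu> A\<close> that leave only
      0 and the full mass.\<close>
    define S where "S = {\<omega> \<in> space M. mpost j (nxt (\<zeta> \<omega>) 0) (\<zeta> \<omega>) \<in> A}"
    have S: "S \<in> sets F"
    proof -
      have "(\<lambda>\<omega>. ?\<Theta> (\<zeta> \<omega>)) \<in> measurable F mark_space" by (rule measurable_compose[OF \<zeta> measurable_shift_mark])
      from measurable_sets[OF this A'] show ?thesis
        by (simp add: S_def shift_mark_def vimage_def Int_def sp(1) conj_commute)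
    qed
    have SM: "S \<in> sets M" using S sp by blast
    have inS: "mpost j L (\<zeta> \<omega>) \<in> A \<longleftrightarrow> \<omega> \<in> S"
      if w: "consistent j (\<zeta> \<omega>) \<and> inf_marks (\<zeta> \<omega>)" "\<omega> \<in> space M" and L: "L \<ge> 1" "snd (\<zeta> \<omega>) L" for \<omega> L
    proof -
      have "mpost j (nxt (\<zeta> \<omega>) k) (\<zeta> \<omega>) \<in> A \<longleftrightarrow> \<omega> \<in> S" for k
      proof (induction k)
        case 0
        then show ?case using w by (simp add: S_def)
      next
        case (Suc k)
        show ?case
        proof (cases "snd (\<zeta> \<omega>) (Suc k)")
          case True
          have "mpost j (nxt (\<zeta> \<omega>) (Suc k)) (\<zeta> \<omega>) = ?\<Theta> (mpost j (Suc k) (\<zeta> \<omega>))"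
            using w shift_mark_mpost by metis
          then show ?thesis using Suc Ainv by (simp add: nxt_Suc_marked[OF True])
        qed (use Suc in \<open>simp add: nxt_Suc_unmarked\<close>)
      qed
      from this[of "L - 1"] nxt_Suc_marked[of "\<zeta> \<omega>" "L - 1"] L show ?thesis by simp
    qed
    let ?I = "indicat_real A"
    have eqA: "eventually (\<lambda>L. (\<integral>\<omega>. indicator S \<omega> * at_mark j ?I L (\<zeta> \<omega>) \<partial>M) = (\<integral>\<omega>. at_mark j ?I L (\<zeta> \<omega>) \<partial>M)) sequentially"
    proof (rule eventually_sequentiallyI[of 1])
      fix L :: nat assume "1 \<le> L"
      show "(\<integral>\<omega>. indicator S \<omega> * at_mark j ?I L (\<zeta> \<omega>) \<partial>M) = (\<integral>\<omega>. at_mark j ?I L (\<zeta> \<omega>) \<partial>M)"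
      proof (rule integral_cong_AE)
        show "AE \<omega> in M. indicator S \<omega> * at_mark j ?I L (\<zeta> \<omega>) = at_mark j ?I L (\<zeta> \<omega>)"
          using AE_g AE_space by eventually_elim (use inS \<open>1 \<le> L\<close> in \<open>auto simp: at_mark_def indicator_def\<close>)
      qed (intro borel_measurable_times borel_measurable_indicator SM atm A')+
    qed
    have eq1: "eventually (\<lambda>L. (\<integral>\<omega>. indicator S \<omega> * at_mark j (\<lambda>_. 1) L (\<zeta> \<omega>) \<partial>M) = (\<integral>\<omega>. at_mark j ?I L (\<zeta> \<omega>) \<partial>M)) sequentially"
    proof (rule eventually_sequentiallyI[of 1])
      fix L :: nat assume "1 \<le> L"
      show "(\<integral>\<omega>. indicator S \<omega> * at_mark j (\<lambda>_. 1) L (\<zeta> \<omega>) \<partial>M) = (\<integral>\<omega>. at_mark j ?I L (\<zeta> \<omega>) \<partial>M)"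
      proof (rule integral_cong_AE)
        show "AE \<omega> in M. indicator S \<omega> * at_mark j (\<lambda>_. 1) L (\<zeta> \<omega>) = at_mark j ?I L (\<zeta> \<omega>)"
          using AE_g AE_space by eventually_elim (use inS \<open>1 \<le> L\<close> in \<open>auto simp: at_mark_def indicator_def\<close>)
      qed (intro borel_measurable_times borel_measurable_indicator SM atm A' one)+
    qed
    have IA: "(\<integral>v. ?I v \<partial>\<nu>) = measure \<nu> A" by (simp add: sp\<nu>)
    have IM: "?I \<in> borel_measurable mark_space" by (rule borel_measurable_indicator[OF A'])
    have lA: "(\<lambda>L. \<integral>\<omega>. at_mark j ?I L (\<zeta> \<omega>) \<partial>M) \<longlonglongrightarrow> measure \<nu> A"
      using lim1[OF IM indb] by (simp only: IA)
    have "measure M S * measure \<nu> A = measure \<nu> A"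
      using Lim_transform_eventually[OF lim[OF S IM indb] eqA] lA LIMSEQ_unique by (simp only: IA) blast
    moreover have "measure M S * measure \<nu> (space \<nu>) = measure \<nu> A"
    proof -
      have "(\<lambda>L. \<integral>\<omega>. indicator S \<omega> * at_mark j (\<lambda>_. 1) L (\<zeta> \<omega>) \<partial>M) \<longlonglongrightarrow> measure M S * measure \<nu> (space \<nu>)"
        using lim[OF S one] by simp
      from LIMSEQ_unique[OF Lim_transform_eventually[OF this eq1] lA] show ?thesis .
    qed
    ultimately show "measure \<nu> A = 0 \<or> measure \<nu> A = measure \<nu> (space \<nu>)" by auto
  qed
  let ?\<rho> = "measure \<nu> (space \<nu>)"
  let ?D = "\<lambda>v::'d marked_path. real (nxt v 0)"
  let ?T = "\<lambda>v::'d marked_path. real (hit j (nxt v 0) (fst v))"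
  have Dm: "?D \<in> borel_measurable \<nu>" using measurable_gap by (simp only: measurable_cong_sets[OF \<nu>(2) refl])
  have Tm: "?T \<in> borel_measurable \<nu>" using measurable_time by (simp only: measurable_cong_sets[OF \<nu>(2) refl])
  \<comment> \<open>One half of Kac's formula. The truncated gaps at the marks up to level
    \<open>n\<close> cover disjoint stretches of levels below \<open>n + K\<close>, so their sum is
    at most \<open>n + K\<close>; on average this is 1 per level, whatever \<open>K\<close>.\<close>
  have Dtrunc: "(\<integral>v. min (?D v) (real K) \<partial>\<nu>) \<le> 1" if K: "K > 0" for K :: nat
  proof -
    define g where "g v = min (?D v) (real K) / real K" for v
    have g: "g \<in> borel_measurable mark_space" "\<And>v. 0 \<le> g v \<and> g v \<le> 1"
      unfolding g_def
      by (intro borel_measurable_divide borel_measurable_min measurable_gap borel_measurable_const)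
         (use K in \<open>simp add: divide_le_eq\<close>)
    have "(\<lambda>k. real K * (\<integral>\<omega>. at_mark j g (Suc k) (\<zeta> \<omega>) \<partial>M) - 1) \<longlonglongrightarrow> real K * (\<integral>v. g v \<partial>\<nu>) - 1"
      by (intro tendsto_diff tendsto_mult tendsto_const LIMSEQ_Suc lim1 g)
    then have "real K * (\<integral>v. g v \<partial>\<nu>) - 1 \<le> 0"
    proof (rule bounded_sums_limit)
      fix n
      let ?h = "\<lambda>\<omega>. \<Sum>k<n. real K * at_mark j g (Suc k) (\<zeta> \<omega>)"
      have "AE \<omega> in M. ?h \<omega> \<le> real n + real K"
        using AE_g
      proof eventually_elim
        case (elim \<omega>)
        \<comment> \<open>The next mark, capped at \<open>n + K\<close>. At a mark
          \<open>Suc k \<le> n\<close> the cap leaves room for at least \<open>K\<close> more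
          levels, so the increment dominates the gap truncated at \<open>K\<close>.\<close>
        define c where "c k = real (min (nxt (\<zeta> \<omega>) k) (n + K))" for k
        have "real K * at_mark j g (Suc k) (\<zeta> \<omega>) \<le> c (Suc k) - c k" if "k < n" for k
        proof (cases "snd (\<zeta> \<omega>) (Suc k)")
          case True
          have "Suc k < nxt (\<zeta> \<omega>) (Suc k)" using elim nxt_gt by blast
          moreover have "real K * at_mark j g (Suc k) (\<zeta> \<omega>) = min (real (nxt (\<zeta> \<omega>) (Suc k) - Suc k)) (real K)"
            using K elim True by (simp add: at_mark_def g_def nxt_mpost)
          ultimately show ?thesis using that by (auto simp: c_def nxt_Suc_marked[OF True] min_def of_nat_diff)
        qed (simp add: at_mark_def c_def nxt_Suc_unmarked)
        then have "?h \<omega> \<le> (\<Sum>k<n. c (Suc k) - c k)" by (intro sum_mono) simp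
        also have "\<dots> = c n - c 0" by (rule sum_lessThan_telescope)
        also have "\<dots> \<le> real n + real K" by (simp add: c_def)
        finally show ?case .
      qed
      then have "(\<integral>\<omega>. ?h \<omega> \<partial>M) \<le> (\<integral>\<omega>. real n + real K \<partial>M)"
        by (intro integral_mono_AE Bochner_Integration.integrable_sum integrable_mult_right ati g) auto
      moreover have "(\<integral>\<omega>. ?h \<omega> \<partial>M) = (\<Sum>k<n. real K * (\<integral>\<omega>. at_mark j g (Suc k) (\<zeta> \<omega>) \<partial>M))"
        using ati[OF g] by (subst Bochner_Integration.integral_sum) auto
      ultimately show "(\<Sum>k<n. real K * (\<integral>\<omega>. at_mark j g (Suc k) (\<zeta> \<omega>) \<partial>M) - 1) \<le> real K"
        using M.prob_space by (simp add: sum_subtractf)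
    qed
    moreover have "real K * (\<integral>v. g v \<partial>\<nu>) = (\<integral>v. min (?D v) (real K) \<partial>\<nu>)"
      unfolding g_def using K by simp
    ultimately show ?thesis by simp
  qed
  have Dint: "integrable \<nu> ?D"
  proof (rule N.integrable_if_truncations_bounded[OF Dm])
    show "(\<integral>v. min (?D v) (real K) \<partial>\<nu>) \<le> 1" for K :: nat
      using Dtrunc[of K] by (cases "K = 0") auto
  qed simp
  define d where "d = (\<integral>v. ?D v \<partial>\<nu>) / ?\<rho>"
  have D1: "AE v in \<nu>. 1 \<le> ?D v"
    using AE_\<nu> by eventually_elim (use nxt_gt[of _ 0] in force)
  have TD: "AE v in \<nu>. ?D v \<le> ?T v"
    using AE_\<nu>
  proof eventually_elim
    case (elim v)
    then have "\<exists>n. int (nxt v 0) \<le> fst v n $ j"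
      using consistent_reaches[of j v "nxt v 0"] nxt_gt[of v 0] nxt_marked[of v 0] by simp
    then show ?case using hit_ge_level[of "fst v" "nxt v 0" j] elim by (simp add: consistent_def)
  qed
  have d1: "1 \<le> d"
  proof -
    have "(\<integral>v. 1 \<partial>\<nu>) \<le> (\<integral>v. ?D v \<partial>\<nu>)" by (rule integral_mono_AE[OF _ Dint D1]) simp
    then show ?thesis using \<nu>(3) by (simp add: d_def le_divide_eq)
  qed
  have limD: "AE v in \<nu>. (\<lambda>k. real ((nxt v ^^ k) 0) / real k) \<longlonglongrightarrow> d"
    using E.ergodic_LLN[OF Dint] AE_\<nu> by eventually_elim (simp add: orbit_sum_gap d_def)
  \<comment> \<open>The reciprocal of the mean duration, or 0 if the duration is not integrable. The
    mean is positive because an excursion lasts at least as long as its gap.\<close>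
  obtain \<iota> where \<iota>0: "0 \<le> \<iota>" and limT: "AE v in \<nu>. (\<lambda>k. real k / real (hit j ((nxt v ^^ k) 0) (fst v))) \<longlonglongrightarrow> \<iota>"
  proof (cases "integrable \<nu> ?T")
    case True
    define \<tau> where "\<tau> = (\<integral>v. ?T v \<partial>\<nu>) / ?\<rho>"
    have "d \<le> \<tau>" unfolding d_def \<tau>_def using \<nu>(3)
      by (intro divide_right_mono integral_mono_AE[OF Dint True TD]) simp
    then have \<tau>: "0 < \<tau>" using d1 by simp
    have "AE v in \<nu>. (\<lambda>k. real k / real (hit j ((nxt v ^^ k) 0) (fst v))) \<longlonglongrightarrow> inverse \<tau>"
      using E.ergodic_LLN[OF True] AE_\<nu>
    proof eventually_elim
      case (elim v)
      then have "(\<lambda>k. real (hit j ((nxt v ^^ k) 0) (fst v)) / real k) \<longlonglongrightarrow> \<tau>" by (simp add: orbit_sum_time \<tau>_def)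
      from tendsto_inverse[OF this] \<tau> show ?case by (simp add: inverse_divide)
    qed
    then show thesis using that[of "inverse \<tau>"] \<tau> by simp
  next
    case False
    have inf: "AE v in \<nu>. filterlim (\<lambda>n. orbit_sum ?\<Theta> ?T n v / real n) at_top sequentially"
      by (rule E.ergodic_LLN_infinite[OF Tm _ False]) simp
    have "AE v in \<nu>. (\<lambda>k. real k / real (hit j ((nxt v ^^ k) 0) (fst v))) \<longlonglongrightarrow> 0"
      using inf AE_\<nu>
    proof eventually_elim
      case (elim v)
      then have "filterlim (\<lambda>k. real (hit j ((nxt v ^^ k) 0) (fst v)) / real k) at_top sequentially" by (simp add: orbit_sum_time)
      from tendsto_inverse_0_at_top[OF this] show ?case by (simp add: inverse_divide)
    qed
    then show thesis using that[of 0] by simp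
  qed
  define \<kappa> where "\<kappa> = d * \<iota>"
  have speed\<nu>: "AE v in \<nu>. (\<lambda>n. real_of_int (fst v n $ j) / real n) \<longlonglongrightarrow> \<kappa>"
    using limD limT AE_\<nu>
  proof eventually_elim
    case (elim v)
    define l where "l k = (nxt v ^^ k) 0" for k
    define t where "t k = hit j (l k) (fst v)" for k
    have l: "(\<lambda>k. real (l k) / real k) \<longlonglongrightarrow> d" and t: "(\<lambda>k. real k / real (t k)) \<longlonglongrightarrow> \<iota>"
      using elim(1,2) by (simp_all add: l_def t_def)
    have r1: "(\<lambda>k. real k / real (Suc k)) \<longlonglongrightarrow> 1" by (rule LIMSEQ_n_over_Suc_n)
    have r2: "(\<lambda>k. real (Suc k) / real k) \<longlonglongrightarrow> 1" by (rule LIMSEQ_Suc_n_over_n)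
    have "(\<lambda>k. real (l k) / real k * (real k / real (Suc k)) * (real (Suc k) / real (t (Suc k)))) \<longlonglongrightarrow> d * 1 * \<iota>"
      by (intro tendsto_mult l r1 LIMSEQ_Suc[OF t])
    moreover have "eventually (\<lambda>k. real (l k) / real k * (real k / real (Suc k)) * (real (Suc k) / real (t (Suc k)))
        = real (l k) / real (t (Suc k))) sequentially"
      by (rule eventually_sequentiallyI[of 1]) (simp del: of_nat_Suc)
    ultimately have a1: "(\<lambda>k. real (l k) / real (t (Suc k))) \<longlonglongrightarrow> \<kappa>"
      unfolding \<kappa>_def by (simp add: Lim_transform_eventually)
    have "(\<lambda>k. real (l (Suc k)) / real (Suc k) * (real (Suc k) / real k) * (real k / real (t k))) \<longlonglongrightarrow> d * 1 * \<iota>"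
      by (intro tendsto_mult LIMSEQ_Suc[OF l] r2 t)
    moreover have "eventually (\<lambda>k. real (l (Suc k)) / real (Suc k) * (real (Suc k) / real k) * (real k / real (t k))
        = real (l (Suc k)) / real (t k)) sequentially"
      by (rule eventually_sequentiallyI[of 1]) (simp del: of_nat_Suc)
    ultimately have a2: "(\<lambda>k. real (l (Suc k)) / real (t k)) \<longlonglongrightarrow> \<kappa>"
      unfolding \<kappa>_def by (simp add: Lim_transform_eventually)
    show ?case
      by (rule speed_of_marks) (use elim(3) a1 a2 in \<open>simp_all only: l_def t_def\<close>)
  qed
  \<comment> \<open>Removing an initial piece does not change the speed. Hence on the event
    \<open>A\<close> of a wrong speed no mark has a future in \<open>B\<close>, the integrals
    vanish, and mixing gives 0 as the product of the probability of \<open>A\<close> and the mass of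
    \<open>\<nu>\<close>.\<close>
  have "AE \<omega> in M. (\<lambda>n. real_of_int (fst (\<zeta> \<omega>) n $ j) / real n) \<longlonglongrightarrow> \<kappa>"
  proof -
    define Q where "Q v \<longleftrightarrow> (\<lambda>n. real_of_int (fst v n $ j) / real n) \<longlonglongrightarrow> \<kappa>" for v :: "'d marked_path"
    have Q: "Measurable.pred mark_space Q"
      unfolding Q_def[abs_def] by (rule measurable_compose[OF measurable_fst_mark pred_speed])
    define B where "B = {v. Q v}"
    have B: "B \<in> sets mark_space" using Q by (simp add: pred_def B_def)
    define A where "A = {\<omega> \<in> space M. \<not> Q (\<zeta> \<omega>)}"
    have A: "A \<in> sets F" unfolding A_def by (rule predF[OF pred_intros_logic(2)[OF Q]])
    have AM: "A \<in> sets M" using A sp by blast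
    have tail: "Q (\<zeta> \<omega>)" if c: "consistent j (\<zeta> \<omega>)" and L: "L \<ge> 1" "snd (\<zeta> \<omega>) L" and q: "Q (mpost j L (\<zeta> \<omega>))" for \<omega> L
    proof -
      define y where "y = fst (\<zeta> \<omega>)"
      define t where "t = hit j L y"
      define c where "c = real_of_int (y t $ j)"
      have "(\<lambda>n. (real_of_int (y (t + n) $ j) - c) / real n) \<longlonglongrightarrow> \<kappa>"
        using q by (simp add: Q_def mpost_def post_def y_def t_def c_def)
      moreover have "(\<lambda>n. c / real n) \<longlonglongrightarrow> 0" by (rule lim_const_over_n)
      ultimately have "(\<lambda>n. (real_of_int (y (t + n) $ j) - c) / real n + c / real n) \<longlonglongrightarrow> \<kappa> + 0" by (rule tendsto_add)
      then have a: "(\<lambda>n. real_of_int (y (n + t) $ j) / real n) \<longlonglongrightarrow> \<kappa>"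
        by (simp add: add_divide_distrib[symmetric] add.commute)
      have "(\<lambda>n. real n / (real n + real t)) \<longlonglongrightarrow> 1"
      proof -
        have "(\<lambda>n. 1 - real t / real (n + t)) \<longlonglongrightarrow> 1 - 0"
          by (intro tendsto_diff tendsto_const LIMSEQ_ignore_initial_segment[OF lim_const_over_n])
        moreover have "eventually (\<lambda>n. 1 - real t / real (n + t) = real n / (real n + real t)) sequentially"
          by (rule eventually_sequentiallyI[of 1]) (simp add: field_simps)
        ultimately show ?thesis by (simp add: Lim_transform_eventually)
      qed
      from tendsto_mult[OF a this]
      have "(\<lambda>n. real_of_int (y (n + t) $ j) / real n * (real n / (real n + real t))) \<longlonglongrightarrow> \<kappa>" by simp
      moreover have "eventually (\<lambda>n. real_of_int (y (n + t) $ j) / real n * (real n / (real n + real t))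
          = real_of_int (y (n + t) $ j) / real (n + t)) sequentially"
        by (rule eventually_sequentiallyI[of 1]) simp
      ultimately have "(\<lambda>n. real_of_int (y (n + t) $ j) / real (n + t)) \<longlonglongrightarrow> \<kappa>" by (rule Lim_transform_eventually)
      from LIMSEQ_offset[OF this] show ?thesis by (simp add: Q_def y_def)
    qed
    have "eventually (\<lambda>L. (\<integral>\<omega>. indicator A \<omega> * at_mark j (indicator B) L (\<zeta> \<omega>) \<partial>M) = 0) sequentially"
    proof (rule eventually_sequentiallyI[of 1])
      fix L :: nat assume L: "1 \<le> L"
      have "AE \<omega> in M. indicator A \<omega> * at_mark j (indicator B) L (\<zeta> \<omega>) = (0::real)"
        using AE_g
      proof eventually_elim
        case (elim \<omega>)
        then show ?case using tail[of \<omega> L] L by (auto simp: at_mark_def indicator_def A_def B_def)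
      qed
      then show "(\<integral>\<omega>. indicator A \<omega> * at_mark j (indicator B) L (\<zeta> \<omega>) \<partial>M) = 0" by (rule integral_eq_zero_AE)
    qed
    from LIMSEQ_unique[OF lim[OF A borel_measurable_indicator[OF B] indb] tendsto_eventually[OF this]]
    have "measure M A * measure \<nu> B = 0" by (simp add: sp\<nu>)
    moreover have "measure \<nu> B = measure \<nu> (space \<nu>)"
    proof (rule measure_eq_AE)
      show "AE v in \<nu>. v \<in> B \<longleftrightarrow> v \<in> space \<nu>" using speed\<nu> by eventually_elim (simp add: B_def Q_def sp\<nu>)
    qed (use B \<nu>(2) in auto)
    ultimately have "measure M A = 0" using \<nu>(3) by simp
    then have "A \<in> null_sets M" using AM by (simp add: null_sets_def M.emeasure_eq_measure)
    from AE_not_in[OF this] AE_space show ?thesis by eventually_elim (simp add: A_def Q_def)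
  qed
  moreover have "0 \<le> \<kappa>" using d1 \<iota>0 by (simp add: \<kappa>_def)
  ultimately show ?thesis by blast
qed

section \<open>Nested walks\<close>

text \<open>Vertices with \<open>h\<close> below a bound are of the form \<open>y k\<close> for
  finitely many \<open>k\<close>, and each is visited finitely often.\<close>

lemma filterlim_subrange:
  fixes h :: "'a \<Rightarrow> 'b::linorder"
  assumes lim: "filterlim (\<lambda>n. h (y n)) at_top sequentially"
    and x: "\<And>n::nat. x n \<in> range (y :: nat \<Rightarrow> 'a)" and vis: "\<And>z. finite {n. x n = z}"
  shows "filterlim (\<lambda>n. h (x n)) at_top sequentially"
  unfolding filterlim_at_top
proof
  fix Z
  from lim obtain N where N: "\<And>n. n \<ge> N \<Longrightarrow> Z \<le> h (y n)"
    by (auto simp: filterlim_at_top eventually_sequentially)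
  have "{n. \<not> Z \<le> h (x n)} \<subseteq> (\<Union>k\<in>{..<N}. {n. x n = y k})"
  proof
    fix n assume "n \<in> {n. \<not> Z \<le> h (x n)}"
    moreover obtain k where "x n = y k" using x[of n] by auto
    ultimately show "n \<in> (\<Union>k\<in>{..<N}. {n. x n = y k})" using N[of k] by (cases "k < N") auto
  qed
  then have "finite {n. \<not> Z \<le> h (x n)}" by (rule finite_subset) (use vis in auto)
  then show "eventually (\<lambda>n. Z \<le> h (x n)) sequentially"
    by (simp add: cofinite_eq_sequentially[symmetric] eventually_cofinite)
qed

text \<open>Write \<open>x n = y (m n)\<close>. Finite visits force \<open>m n\<close> to infinity,
  so \<open>x n\<close> divided by \<open>m n\<close> tends to \<open>\<delta>\<close>. Coordinate
  \<open>j\<close> then determines the limit of \<open>m n / n\<close>, and with it all the other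
  coordinates.\<close>

lemma speed_of_subrange:
  fixes x y :: "nat \<Rightarrow> ('d::finite) site"
  assumes y: "\<And>a. (\<lambda>n. real_of_int (y n $ a) / real n) \<longlonglongrightarrow> \<delta> $ a" and \<delta>: "\<delta> $ j > 0"
    and x: "\<And>n. x n \<in> range y" and vis: "\<And>z. finite {n. x n = z}"
    and sp: "(\<lambda>n. real_of_int (x n $ j) / real n) \<longlonglongrightarrow> \<kappa>"
  shows "(\<lambda>n. (1 / real n) *\<^sub>R real_site (x n)) \<longlonglongrightarrow> (\<kappa> / \<delta> $ j) *\<^sub>R \<delta>"
proof -
  have "\<forall>n. \<exists>k. x n = y k" using x by blast
  then obtain m where m: "\<And>n. x n = y (m n)" by metis
  have mlim: "filterlim m at_top sequentially"
    unfolding filterlim_at_top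
  proof
    fix K
    have "{n. \<not> K \<le> m n} \<subseteq> (\<Union>k\<in>{..<K}. {n. x n = y k})"
    proof
      fix n assume "n \<in> {n. \<not> K \<le> m n}"
      then show "n \<in> (\<Union>k\<in>{..<K}. {n. x n = y k})" using m by (intro UN_I[of "m n"]) auto
    qed
    then have "finite {n. \<not> K \<le> m n}" by (rule finite_subset) (use vis in auto)
    then show "eventually (\<lambda>n. K \<le> m n) sequentially"
      by (simp add: cofinite_eq_sequentially[symmetric] eventually_cofinite)
  qed
  have ym: "(\<lambda>n. real_of_int (x n $ a) / real (m n)) \<longlonglongrightarrow> \<delta> $ a" for a
    using filterlim_compose[OF y mlim] by (simp add: m)
  \<comment> \<open>Excludes \<open>m n = 0\<close> and height 0, for which the quotients would not
    cancel.\<close>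
  have pos: "eventually (\<lambda>n. 0 < real_of_int (x n $ j) / real (m n)) sequentially"
    using order_tendstoD(1)[OF ym \<delta>] .
  have "(\<lambda>n. (real_of_int (x n $ j) / real n) / (real_of_int (x n $ j) / real (m n))) \<longlonglongrightarrow> \<kappa> / \<delta> $ j"
    using \<delta> by (intro tendsto_divide sp ym) simp
  moreover have "eventually (\<lambda>n. (real_of_int (x n $ j) / real n) / (real_of_int (x n $ j) / real (m n)) = real (m n) / real n) sequentially"
    using pos by eventually_elim (auto simp: field_simps zero_less_divide_iff)
  ultimately have mn: "(\<lambda>n. real (m n) / real n) \<longlonglongrightarrow> \<kappa> / \<delta> $ j" by (rule Lim_transform_eventually)
  show ?thesis
  proof (rule vec_tendstoI)
    fix a
    have "(\<lambda>n. (real_of_int (x n $ a) / real (m n)) * (real (m n) / real n)) \<longlonglongrightarrow> \<delta> $ a * (\<kappa> / \<delta> $ j)"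
      by (intro tendsto_mult ym mn)
    moreover have "eventually (\<lambda>n. (real_of_int (x n $ a) / real (m n)) * (real (m n) / real n) = ((1 / real n) *\<^sub>R real_site (x n)) $ a) sequentially"
      using pos by eventually_elim (auto simp: real_site_def zero_less_divide_iff)
    ultimately have "(\<lambda>n. ((1 / real n) *\<^sub>R real_site (x n)) $ a) \<longlonglongrightarrow> \<delta> $ a * (\<kappa> / \<delta> $ j)"
      by (rule Lim_transform_eventually)
    then show "(\<lambda>n. ((1 / real n) *\<^sub>R real_site (x n)) $ a) \<longlonglongrightarrow> ((\<kappa> / \<delta> $ j) *\<^sub>R \<delta>) $ a"
      by (simp add: mult.commute)
  qed
qed

lemma inner_limit:
  fixes y :: "nat \<Rightarrow> ('d::finite) site"
  assumes "\<And>a. (\<lambda>n. real_of_int (y n $ a) / real n) \<longlonglongrightarrow> \<delta> $ a"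
  shows "(\<lambda>n. (real_site (y n) \<bullet> l) / real n) \<longlonglongrightarrow> l \<bullet> \<delta>"
proof -
  have "(\<lambda>n. \<Sum>a\<in>UNIV. l $ a * (real_of_int (y n $ a) / real n)) \<longlonglongrightarrow> (\<Sum>a\<in>UNIV. l $ a * \<delta> $ a)"
    by (intro tendsto_sum tendsto_mult tendsto_const assms)
  moreover have "(\<Sum>a\<in>UNIV. l $ a * (real_of_int (y n $ a) / real n)) = (real_site (y n) \<bullet> l) / real n" for n
    by (simp add: inner_vec_def real_site_def sum_divide_distrib mult.commute)
  ultimately show ?thesis by (simp add: inner_vec_def)
qed

lemma at_top_of_positive_speed:
  assumes "(\<lambda>n. f n / real n) \<longlonglongrightarrow> c" "0 < (c::real)" shows "filterlim f at_top sequentially"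
proof -
  have "filterlim (\<lambda>n. (f n / real n) * real n) at_top sequentially"
    by (rule filterlim_tendsto_pos_mult_at_top[OF assms filterlim_real_sequentially])
  moreover have "eventually (\<lambda>n. (f n / real n) * real n = f n) sequentially"
    by (rule eventually_sequentiallyI[of 1]) simp
  ultimately show ?thesis by (simp cong: filterlim_cong)
qed

text \<open>Along \<open>y\<close> the exponent grows at least at half its limiting rate, so the
  weights decay geometrically in time; a sum over times dominates the sum over vertices.\<close>

lemma weight_bounded:
  fixes y :: "nat \<Rightarrow> ('d::finite) site"
  assumes y: "\<And>a. (\<lambda>n. real_of_int (y n $ a) / real n) \<longlonglongrightarrow> \<delta> $ a" and c: "log_ratio q \<bullet> \<delta> > 0"
  shows "\<exists>C. \<forall>n. (\<Sum>x\<in>y ` {..<n}. weight q x) \<le> C"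
proof -
  define c where "c = log_ratio q \<bullet> \<delta>"
  have "c / 2 < c" using \<open>log_ratio q \<bullet> \<delta> > 0\<close> by (simp add: c_def)
  from order_tendstoD(1)[OF inner_limit[OF y] this[unfolded c_def]]
  obtain N where N: "\<And>n. n \<ge> N \<Longrightarrow> c / 2 < (real_site (y n) \<bullet> log_ratio q) / real n"
    by (auto simp: eventually_sequentially c_def)
  have le: "norm (weight q (y n)) \<le> exp (- (c / 2)) ^ n" if "n \<ge> max N 1" for n
  proof -
    have "c / 2 * real n \<le> log_ratio q \<bullet> real_site (y n)"
      using N[of n] that by (simp add: less_divide_eq inner_commute)
    then have "weight q (y n) \<le> exp (real n * (- (c / 2)))" by (simp add: weight_def mult.commute)
    then show ?thesis unfolding exp_of_nat_mult by (simp add: weight_def)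
  qed
  have "summable (\<lambda>n. exp (- (c / 2)) ^ n)"
    using c by (intro summable_geometric) (simp add: c_def)
  then have sm: "summable (\<lambda>n. weight q (y n))"
    by (rule summable_comparison_test'[OF _ le])
  have "(\<Sum>x\<in>y ` {..<n}. weight q x) \<le> (\<Sum>n. weight q (y n))" for n
  proof -
    have "(\<Sum>x\<in>y ` {..<n}. weight q x) \<le> (\<Sum>k<n. weight q (y k))"
      using sum_image_le[of "{..<n}" "weight q" y] by (simp add: weight_def)
    also have "\<dots> \<le> (\<Sum>n. weight q (y n))" by (intro sum_le_suminf sm) (auto simp: weight_def)
    finally show ?thesis .
  qed
  then show ?thesis by blast
qed

lemma infinite_cluster_Inter:
  fixes E :: "nat \<Rightarrow> ('d::finite) site set set"
  assumes dec: "\<And>k. E (Suc k) \<subseteq> E k" and inf: "\<And>k. infinite (cluster (E k) 0)"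
  shows "infinite (cluster (\<Inter>k. E k) 0)"
proof
  let ?I = "\<Inter>k. E k"
  assume fin: "finite (cluster ?I 0)"
  define P where "P = {(x, e) \<in> cluster ?I 0 \<times> unit_steps. e \<notin> avail ?I x}"
  have "finite P" unfolding P_def by (rule finite_subset[of _ "cluster ?I 0 \<times> unit_steps"]) (use fin in auto)
  have "\<forall>z\<in>P. \<exists>k. snd z \<notin> avail (E k) (fst z)" by (auto simp: P_def avail_def)
  then obtain k where k: "\<And>z. z \<in> P \<Longrightarrow> snd z \<notin> avail (E (k z)) (fst z)" by metis
  define K where "K = Max (insert 0 (k ` P))"
  have anti: "E n \<subseteq> E m" if "m \<le> n" for m n using that by (induction rule: dec_induct) (use dec in auto)
  have sub: "avail (E K) x \<subseteq> avail ?I x" if "x \<in> cluster ?I 0" for x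
  proof
    fix e assume e: "e \<in> avail (E K) x"
    show "e \<in> avail ?I x"
    proof (rule ccontr)
      assume "e \<notin> avail ?I x"
      then have z: "(x, e) \<in> P" using that e avail_subset by (auto simp: P_def)
      then have "k (x, e) \<le> K" unfolding K_def using \<open>finite P\<close> by (intro Max_ge) auto
      from anti[OF this] e have "e \<in> avail (E (k (x, e))) x" by (auto simp: avail_def)
      with k[OF z] show False by simp
    qed
  qed
  have "y \<in> cluster ?I 0" if "(0, y) \<in> (adj (E K))\<^sup>*" for y
    using that
  proof (induction rule: rtrancl_induct)
    case (step y z)
    then have "(y, z) \<in> adj ?I" using sub[OF step(3)] by (auto simp: adj_def)
    with step(3) show ?case by (auto simp: cluster_def intro: rtrancl_into_rtrancl)
  qed (simp add: cluster_def)
  then have "cluster (E K) 0 \<subseteq> cluster ?I 0" by (auto simp: cluster_def)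
  with fin inf[of K] show False using finite_subset by blast
qed

lemma measurable_prefix_prob:
  assumes E: "\<And>e. {\<omega> \<in> space M. e \<in> E \<omega>} \<in> sets M"
  shows "(\<lambda>\<omega>. measure (choices q) {u. \<forall>k\<le>n. walk (E \<omega>) 0 u k = w k}) \<in> borel_measurable M"
proof -
  interpret Ch: prob_space "choices q" by (rule prob_space_choices)
  have "(\<lambda>z. indicator (cylinder n w) ((\<lambda>(\<omega>, u). walk (E \<omega>) 0 u) z) :: ennreal) \<in> borel_measurable (M \<Otimes>\<^sub>M choices q)"
    by (rule measurable_compose[OF measurable_walk_pair[OF E] borel_measurable_indicator[OF sets_cylinder]])
  from Ch.borel_measurable_nn_integral_fst[OF this]
  have "(\<lambda>\<omega>. \<integral>\<^sup>+u. indicator (cylinder n w) (walk (E \<omega>) 0 u) \<partial>choices q) \<in> borel_measurable M"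
    by (simp only: prod.case)
  moreover have "(\<integral>\<^sup>+u. indicator (cylinder n w) (walk (E \<omega>) 0 u) \<partial>choices q)
      = emeasure (choices q) {u. walk (E \<omega>) 0 u \<in> cylinder n w}" for \<omega>
  proof -
    have "(\<integral>\<^sup>+u. indicator (cylinder n w) (walk (E \<omega>) 0 u) \<partial>choices q)
        = (\<integral>\<^sup>+u. indicator {u. walk (E \<omega>) 0 u \<in> cylinder n w} u \<partial>choices q)"
      by (intro nn_integral_cong) (simp add: indicator_def)
    also have "\<dots> = emeasure (choices q) {u. walk (E \<omega>) 0 u \<in> cylinder n w}"
      by (rule nn_integral_indicator[OF sets_walk_vimage[OF sets_cylinder]])
    finally show ?thesis .
  qed
  ultimately have "(\<lambda>\<omega>. emeasure (choices q) {u. walk (E \<omega>) 0 u \<in> cylinder n w}) \<in> borel_measurable M"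
    by (simp only:)
  from borel_measurable_enn2real[OF this] show ?thesis by (simp only: measure_def mem_Collect_eq)
qed

section \<open>The walks as random elements and their conditional laws\<close>

locale conditioned_walks = nested_random_walks M p X
  for M :: "'w measure" and p :: "enat \<Rightarrow> ('d::finite) site pmf" and X :: "enat \<Rightarrow> nat \<Rightarrow> 'w \<Rightarrow> 'd site" +
  fixes j :: 'd
  assumes cond: "condition1 p j"
begin

abbreviation W :: "enat \<Rightarrow> 'w \<Rightarrow> nat \<Rightarrow> 'd site" where
  "W i \<omega> \<equiv> \<lambda>n. X i n \<omega>"

abbreviation Z :: "enat \<Rightarrow> 'w \<Rightarrow> 'd site set set" where
  "Z i \<omega> \<equiv> snd (nested_graph X i \<omega>)"

lemma ell: "elliptic (p i)"
proof -
  have "\<forall>e\<in>unit_steps. pmf (p i) e > 0" using cond by (simp add: condition1_def)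
  then show ?thesis using steps[of i] unfolding elliptic_def by (auto simp: set_pmf_iff)
qed

lemma drift_j: "drift (p 0) $ j > 0"
  using cond by (simp add: condition1_def)

lemma log_ratio_drift:
  assumes "i \<noteq> 0" shows "log_ratio (p i) \<bullet> drift (p 0) > 0"
proof -
  have "drift (p 0) \<bullet> direction (p i) > 0" using cond assms by (simp add: condition1_def)
  then have "(1 / norm (log_ratio (p i))) * (drift (p 0) \<bullet> log_ratio (p i)) > 0"
    by (simp add: direction_def)
  then show ?thesis by (auto simp: zero_less_mult_iff inner_commute zero_less_divide_iff not_less dest: leD)
qed

lemma measurable_W: "W i \<in> measurable M path_space"
  by (rule measurable_abs_UNIV) (rule measurable_X)

lemma sets_X: "{\<omega> \<in> space M. X i n \<omega> = x} \<in> sets M"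
  using measurable_sets[OF measurable_X[of i n], of "{x}"] by (simp add: vimage_def Int_def conj_commute)

lemma Z_Suc: "Z (enat (Suc k)) \<omega> = trace_edges (W (enat k) \<omega>)"
  by (simp add: nested_graph_def trace_graph_def trace_edges_def)

lemma Z_0: "Z 0 \<omega> = snd lattice"
  by (simp add: nested_graph_def zero_enat_def)

lemma Z_infinity: "Z \<infinity> \<omega> = (\<Inter>k. Z (enat k) \<omega>)"
  by (simp add: nested_graph_def)

lemma sets_two: "{\<omega> \<in> space M. e = {X i n \<omega>, X i (Suc n) \<omega>}} \<in> sets M"
proof -
  have "Measurable.pred path_space (\<lambda>y. e = {y n, y (Suc n)})" by (rule pred_path2)
  from measurable_compose[OF measurable_W this] show ?thesis by (simp add: pred_def)
qed

lemma sets_Z: "{\<omega> \<in> space M. e \<in> Z i \<omega>} \<in> sets M"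
proof -
  have fin: "{\<omega> \<in> space M. e \<in> Z (enat k) \<omega>} \<in> sets M" for k
  proof (cases k)
    case 0
    then show ?thesis by (simp add: nested_graph_def)
  next
    case (Suc k')
    have "{\<omega> \<in> space M. e \<in> Z (enat k) \<omega>} = (\<Union>n. {\<omega> \<in> space M. e = {X (enat k') n \<omega>, X (enat k') (Suc n) \<omega>}})"
      unfolding Suc Z_Suc by (auto simp: trace_edges_def)
    also have "\<dots> \<in> sets M" by (intro sets.countable_UN) (use sets_two in auto)
    finally show ?thesis .
  qed
  show ?thesis
  proof (cases i)
    case infinity
    have "{\<omega> \<in> space M. e \<in> Z i \<omega>} = {\<omega> \<in> space M. \<forall>k. e \<in> Z (enat k) \<omega>}"
      unfolding infinity Z_infinity by auto
    also have "\<dots> \<in> sets M" by (rule sets.sets_Collect_countable_All) (rule fin)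
    finally show ?thesis .
  qed (use fin in simp)
qed

lemma sets_V: "{\<omega> \<in> space M. x \<in> fst (nested_graph X i \<omega>)} \<in> sets M"
proof -
  have fin: "{\<omega> \<in> space M. x \<in> fst (nested_graph X (enat k) \<omega>)} \<in> sets M" for k
  proof (cases k)
    case 0
    then show ?thesis by (simp add: nested_graph_def)
  next
    case (Suc k')
    have "{\<omega> \<in> space M. x \<in> fst (nested_graph X (enat k) \<omega>)} = (\<Union>n. {\<omega> \<in> space M. X (enat k') n \<omega> = x})"
      unfolding Suc by (auto simp: nested_graph_def trace_graph_def)
    also have "\<dots> \<in> sets M" by (intro sets.countable_UN) (use sets_X in auto)
    finally show ?thesis .
  qed
  show ?thesis
  proof (cases i)
    case infinity
    have "{\<omega> \<in> space M. x \<in> fst (nested_graph X i \<omega>)} = {\<omega> \<in> space M. \<forall>k. x \<in> fst (nested_graph X (enat k) \<omega>)}"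
      unfolding infinity by (auto simp: nested_graph_def)
    also have "\<dots> \<in> sets M" by (rule sets.sets_Collect_countable_All) (rule fin)
    finally show ?thesis .
  qed (use fin in simp)
qed

abbreviation GA :: "enat \<Rightarrow> 'w measure" where
  "GA i \<equiv> graph_algebra M (nested_graph X i)"

abbreviation PA :: "enat set \<Rightarrow> 'w measure" where
  "PA J \<equiv> process_algebra M X J"

lemma space_GA [simp]: "space (GA i) = space M"
  unfolding graph_algebra_def by (rule space_measure_of) auto

lemma space_PA [simp]: "space (PA J) = space M"
  unfolding process_algebra_def by (rule space_measure_of) auto

lemma sets_GA: "sets (GA i) = sigma_sets (space M)
    ({{\<omega> \<in> space M. x \<in> fst (nested_graph X i \<omega>)} | x. True} \<union> {{\<omega> \<in> space M. e \<in> Z i \<omega>} | e. True})"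
  unfolding graph_algebra_def by (rule sets_measure_of) auto

lemma sets_PA: "sets (PA J) = sigma_sets (space M) {{\<omega> \<in> space M. X i n \<omega> = x} | i n x. i \<in> J}"
  unfolding process_algebra_def by (rule sets_measure_of) auto

lemma sub_GA: "subalgebra M (GA i)"
  unfolding subalgebra_def space_GA sets_GA
  by (intro conjI refl sets.sigma_sets_subset) (use sets_V sets_Z in blast)

lemma sub_PA: "subalgebra M (PA J)"
  unfolding subalgebra_def space_PA sets_PA
  by (intro conjI refl sets.sigma_sets_subset) (use sets_X in blast)

lemma sets_Z_GA: "{\<omega> \<in> space (GA i). e \<in> Z i \<omega>} \<in> sets (GA i)"
  unfolding space_GA sets_GA by (rule sigma_sets.Basic) blast

lemma sets_X_PA: "i \<in> J \<Longrightarrow> {\<omega> \<in> space M. X i n \<omega> = x} \<in> sets (PA J)"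
  unfolding sets_PA by (rule sigma_sets.Basic) blast

lemma measurable_W_PA:
  assumes i: "i \<in> J" shows "W i \<in> measurable (PA J) path_space"
proof (rule measurable_abs_UNIV)
  fix n
  have "{\<omega> \<in> space (PA J). X i n \<omega> \<in> A} \<in> sets (PA J)" for A
  proof -
    have "{\<omega> \<in> space (PA J). X i n \<omega> \<in> A} = (\<Union>x\<in>A. {\<omega> \<in> space M. X i n \<omega> = x})" by auto
    also have "\<dots> \<in> sets (PA J)" by (intro sets.countable_UN') (use sets_X_PA[OF i] in auto)
    finally show ?thesis .
  qed
  then show "X i n \<in> measurable (PA J) (count_space UNIV)"
    by (intro measurableI) (auto simp: vimage_def Int_def conj_commute)
qed

lemma prefix_event: "{\<omega> \<in> space M. \<forall>k\<le>n. X i k \<omega> = w k} \<in> sets M"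
proof -
  have "{\<omega> \<in> space M. \<forall>k\<le>n. X i k \<omega> = w k} = W i -` cylinder n w \<inter> space M" by auto
  then show ?thesis using measurable_sets[OF measurable_W sets_cylinder[of n w]] by (simp only:)
qed

lemma integrable_ind: "A \<in> sets M \<Longrightarrow> integrable M (indicat_real A)"
  by (rule integrable_real_indicator) (simp_all add: emeasure_eq_measure)

lemma cond_exp_prefix:
  assumes av: "AE \<omega> in M. avail (Z i \<omega>) 0 \<noteq> {}"
  shows "AE \<omega> in M. real_cond_exp M (GA i) (indicator {\<omega> \<in> space M. \<forall>k\<le>n. X i k \<omega> = w k}) \<omega>
           = measure (choices (p i)) {u. \<forall>k\<le>n. walk (Z i \<omega>) 0 u k = w k}"
  using walk[of i, unfolded random_walk_on_def, rule_format, of n w] av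
  by eventually_elim (simp add: prob_walk_prefix[OF ell])

lemma law_GA:
  assumes av: "AE \<omega> in M. avail (Z i \<omega>) 0 \<noteq> {}" and A: "A \<in> sets (GA i)"
  shows "measure M (A \<inter> {\<omega> \<in> space M. \<forall>k\<le>n. X i k \<omega> = w k})
           = (\<integral>\<omega>. indicator A \<omega> * measure (choices (p i)) {u. \<forall>k\<le>n. walk (Z i \<omega>) 0 u k = w k} \<partial>M)"
proof -
  interpret finite_measure_subalgebra M "GA i" by unfold_locales (rule sub_GA)
  let ?B = "{\<omega> \<in> space M. \<forall>k\<le>n. X i k \<omega> = w k}"
  have AM: "A \<in> sets M" using A sub_GA by (auto simp: subalgebra_def)
  have iB: "integrable M (indicat_real ?B)" by (rule integrable_ind[OF prefix_event])
  have "measure M (A \<inter> ?B) = (\<integral>\<omega>. indicator A \<omega> * indicator ?B \<omega> \<partial>M)"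
  proof -
    have "(\<integral>\<omega>. indicator A \<omega> * indicator ?B \<omega> \<partial>M) = (\<integral>\<omega>. indicat_real (A \<inter> ?B) \<omega> \<partial>M)"
      by (intro Bochner_Integration.integral_cong) (auto simp: indicator_def)
    also have "\<dots> = measure M ((A \<inter> ?B) \<inter> space M)" by (rule Bochner_Integration.integral_indicator)
    also have "(A \<inter> ?B) \<inter> space M = A \<inter> ?B" by blast
    finally show ?thesis ..
  qed
  also have "\<dots> = (\<integral>\<omega>. indicator A \<omega> * real_cond_exp M (GA i) (indicator ?B) \<omega> \<partial>M)"
    using real_cond_exp_intA[OF iB A] by (simp add: set_lebesgue_integral_def)
  also have "\<dots> = (\<integral>\<omega>. indicator A \<omega> * measure (choices (p i)) {u. \<forall>k\<le>n. walk (Z i \<omega>) 0 u k = w k} \<partial>M)"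
  proof (rule integral_cong_AE)
    show "AE \<omega> in M. indicator A \<omega> * real_cond_exp M (GA i) (indicator ?B) \<omega>
        = indicator A \<omega> * measure (choices (p i)) {u. \<forall>k\<le>n. walk (Z i \<omega>) 0 u k = w k}"
      using cond_exp_prefix[OF av, of n w] by eventually_elim simp
  qed (intro borel_measurable_times borel_measurable_indicator AM borel_measurable_cond_exp2
      measurable_prefix_prob sets_Z)+
  finally show ?thesis .
qed

text \<open>Conditional independence lifts the law of the walk from the graph algebra to the whole
  past. The conditional probability of a prefix is measurable in the graph, so the conditional
  expectation of the indicator of \<open>A\<close> paired with it may be replaced by the indicator
  itself.\<close>

lemma law_PA:
  assumes av: "AE \<omega> in M. avail (Z (enat (Suc i)) \<omega>) 0 \<noteq> {}" and A: "A \<in> sets (PA (enat ` {..<Suc i}))"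
  shows "measure M (A \<inter> {\<omega> \<in> space M. \<forall>k\<le>n. X (enat (Suc i)) k \<omega> = w k})
           = (\<integral>\<omega>. indicator A \<omega> * measure (choices (p (enat (Suc i))))
                {u. \<forall>k\<le>n. walk (Z (enat (Suc i)) \<omega>) 0 u k = w k} \<partial>M)"
proof -
  let ?i = "enat (Suc i)"
  interpret finite_measure_subalgebra M "GA ?i" by unfold_locales (rule sub_GA)
  let ?B = "{\<omega> \<in> space M. \<forall>k\<le>n. X ?i k \<omega> = w k}"
  let ?a = "real_cond_exp M (GA ?i) (indicator A)" and ?b = "real_cond_exp M (GA ?i) (indicator ?B)"
  have AM: "A \<in> sets M" using A sub_PA by (auto simp: subalgebra_def)
  have BS: "?B \<in> sets (PA {?i})"
  proof -
    have "?B = W ?i -` cylinder n w \<inter> space (PA {?i})" by auto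
    then show ?thesis
      using measurable_sets[OF measurable_W_PA[OF singletonI[of ?i]] sets_cylinder[of n w]] by (simp only:)
  qed
  have BM: "?B \<in> sets M" by (rule prefix_event)
  have prod: "AE \<omega> in M. real_cond_exp M (GA ?i) (indicator (?B \<inter> A)) \<omega> = ?b \<omega> * ?a \<omega>"
    using cond_indep_X[of i, unfolded cond_indep_def] BS A by blast
  have iAB: "integrable M (indicat_real (?B \<inter> A))" by (rule integrable_ind[OF sets.Int[OF BM AM]])
  have "measure M (A \<inter> ?B) = (\<integral>\<omega>. indicat_real (?B \<inter> A) \<omega> \<partial>M)"
  proof -
    have "(\<integral>\<omega>. indicat_real (?B \<inter> A) \<omega> \<partial>M) = measure M ((?B \<inter> A) \<inter> space M)"
      by (rule Bochner_Integration.integral_indicator)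
    also have "(?B \<inter> A) \<inter> space M = A \<inter> ?B" by blast
    finally show ?thesis ..
  qed
  also have "\<dots> = (\<integral>\<omega>. real_cond_exp M (GA ?i) (indicator (?B \<inter> A)) \<omega> \<partial>M)"
    by (rule real_cond_exp_int(2)[OF iAB, symmetric])
  also have "\<dots> = (\<integral>\<omega>. ?b \<omega> * ?a \<omega> \<partial>M)"
    by (rule integral_cong_AE[OF _ _ prod])
       (intro borel_measurable_times borel_measurable_cond_exp2)+
  also have "\<dots> = (\<integral>\<omega>. ?b \<omega> * indicator A \<omega> \<partial>M)"
  proof (rule real_cond_exp_intg(2))
    have "integrable M ?b" by (rule real_cond_exp_int(1)[OF integrable_ind[OF BM]])
    moreover have "(\<lambda>\<omega>. indicator A \<omega> *\<^sub>R ?b \<omega>) = (\<lambda>\<omega>. ?b \<omega> * indicator A \<omega>)"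
      by (intro ext) (simp only: real_scaleR_def mult.commute)
    ultimately show "integrable M (\<lambda>\<omega>. ?b \<omega> * indicator A \<omega>)"
      using integrable_mult_indicator[OF AM, of ?b] by (simp only:)
    show "?b \<in> borel_measurable (GA ?i)" by (rule borel_measurable_cond_exp)
    show "indicat_real A \<in> borel_measurable M" using AM by simp
  qed
  also have "\<dots> = (\<integral>\<omega>. indicator A \<omega> * measure (choices (p ?i)) {u. \<forall>k\<le>n. walk (Z ?i \<omega>) 0 u k = w k} \<partial>M)"
  proof (rule integral_cong_AE)
    show "AE \<omega> in M. ?b \<omega> * indicator A \<omega>
        = indicator A \<omega> * measure (choices (p ?i)) {u. \<forall>k\<le>n. walk (Z ?i \<omega>) 0 u k = w k}"
      using cond_exp_prefix[OF av, of n w] by eventually_elim simp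
  qed (intro borel_measurable_times borel_measurable_indicator AM borel_measurable_cond_exp2
      measurable_prefix_prob sets_Z)+
  finally show ?thesis .
qed

end

section \<open>Transience of all the walks\<close>

definition fin_visits :: "(nat \<Rightarrow> 'a) \<Rightarrow> bool" where
  "fin_visits x \<longleftrightarrow> (\<forall>z. finite {n. x n = z})"

lemma pred_fin_visits: "Measurable.pred path_space (fin_visits :: (nat \<Rightarrow> ('d::finite) site) \<Rightarrow> bool)"
proof -
  have eq: "finite {n. x n = z} \<longleftrightarrow> (\<exists>N. \<forall>n\<ge>N. x n \<noteq> z)" for x :: "nat \<Rightarrow> 'd site" and z
    using eventually_cofinite[of "\<lambda>n. x n \<noteq> z"]
    by (simp add: cofinite_eq_sequentially eventually_sequentially)
  show ?thesis unfolding fin_visits_def[abs_def] eq supply pred_path [measurable] by measurable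
qed

lemma fin_visits_of_height:
  fixes y :: "nat \<Rightarrow> ('d::finite) site"
  assumes "filterlim (\<lambda>n. y n $ j) at_top sequentially" shows "fin_visits y"
  unfolding fin_visits_def
proof
  fix z
  have "eventually (\<lambda>n. z $ j + 1 \<le> y n $ j) sequentially" using assms by (simp add: filterlim_at_top)
  then have "eventually (\<lambda>n. y n \<noteq> z) sequentially" by eventually_elim auto
  then show "finite {n. y n = z}" by (simp add: cofinite_eq_sequentially[symmetric] eventually_cofinite)
qed

lemma height_at_top:
  fixes y :: "nat \<Rightarrow> ('d::finite) site"
  assumes "(\<lambda>n. real_of_int (y n $ j) / real n) \<longlonglongrightarrow> c" "0 < c"
  shows "filterlim (\<lambda>n. y n $ j) at_top sequentially"
  unfolding filterlim_at_top
proof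
  fix K :: int
  have "eventually (\<lambda>n. real_of_int K \<le> real_of_int (y n $ j)) sequentially"
    using at_top_of_positive_speed[OF assms] unfolding filterlim_at_top by blast
  then show "eventually (\<lambda>n. K \<le> y n $ j) sequentially" by eventually_elim (simp only: of_int_le_iff)
qed

lemma trace_edge_in_range: "{a, b} \<in> trace_edges y \<Longrightarrow> a \<in> range y"
proof -
  assume "{a, b} \<in> trace_edges y"
  then obtain n where "{a, b} = {y n, y (Suc n)}" unfolding trace_edges_def by (elim rangeE)
  then have "a \<in> {y n, y (Suc n)}" by (simp only: insertI1 flip: \<open>{a, b} = _\<close>)
  then show "a \<in> range y" by (elim insertE emptyE) simp_all
qed

context conditioned_walks begin

lemma pred_edges:
  "Measurable.pred (GA i \<Otimes>\<^sub>M path_space) (\<lambda>z. \<forall>n. {snd z n, snd z (Suc n)} \<in> Z i (fst z))"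
proof -
  have eq: "(\<forall>n. {snd z n, snd z (Suc n)} \<in> Z i (fst z))
      \<longleftrightarrow> (\<forall>n a b. snd z n = a \<and> snd z (Suc n) = b \<longrightarrow> {a, b} \<in> Z i (fst z))" for z
    by auto
  have 1: "Measurable.pred (GA i \<Otimes>\<^sub>M path_space) (\<lambda>z. {a, b} \<in> Z i (fst z))" for a b
  proof (rule pred_fst)
    show "Measurable.pred (GA i) (\<lambda>\<omega>. {a, b} \<in> Z i \<omega>)" using sets_Z_GA[of i "{a, b}"] by (simp add: pred_def)
  qed
  have 2: "Measurable.pred (GA i \<Otimes>\<^sub>M path_space) (\<lambda>z. snd z n = a \<and> snd z (Suc n) = b)" for n a b
    by (rule measurable_compose[OF measurable_snd pred_path2])
  show ?thesis unfolding eq by (intro pred_intros_countable pred_intros_logic 1 2)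
qed

definition good :: "enat \<Rightarrow> 'w \<Rightarrow> bool" where
  "good i \<omega> \<longleftrightarrow> lattice_path (W i \<omega>) \<and> (\<forall>n. {X i n \<omega>, X i (Suc n) \<omega>} \<in> Z i \<omega>) \<and> fin_visits (W i \<omega>)"

text \<open>The walk on a frozen graph has these properties for almost all choices, and
  \<open>joint_law_AE\<close> carries them over.\<close>

lemma AE_good:
  assumes av: "AE \<omega> in M. avail (Z i \<omega>) 0 \<noteq> {}"
    and vis: "AE \<omega> in M. AE u in choices (p i). fin_visits (walk (Z i \<omega>) 0 u)"
  shows "AE \<omega> in M. good i \<omega>"
proof -
  have "AE \<omega> in M. lattice_path (W i \<omega>) \<and> (\<forall>n. {W i \<omega> n, W i \<omega> (Suc n)} \<in> Z i \<omega>) \<and> fin_visits (W i \<omega>)"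
  proof (rule joint_law_AE[where F = "GA i" and q = "p i" and E = "Z i"
        and P = "\<lambda>\<omega> x. lattice_path x \<and> (\<forall>n. {x n, x (Suc n)} \<in> Z i \<omega>) \<and> fin_visits x"])
    show "prob_space M" by (rule prob_space_axioms)
    show "subalgebra M (GA i)" by (rule sub_GA)
    show "{\<omega> \<in> space (GA i). e \<in> Z i \<omega>} \<in> sets (GA i)" for e by (rule sets_Z_GA)
    show "W i \<in> measurable M path_space" by (rule measurable_W)
    show "measure M (A \<inter> {\<omega> \<in> space M. \<forall>k\<le>n. X i k \<omega> = w k})
        = (\<integral>\<omega>. indicator A \<omega> * measure (choices (p i)) {u. \<forall>k\<le>n. walk (Z i \<omega>) 0 u k = w k} \<partial>M)"
      if "A \<in> sets (GA i)" for A n w by (rule law_GA[OF av that])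
    show "Measurable.pred (GA i \<Otimes>\<^sub>M path_space) (\<lambda>z. lattice_path (snd z)
        \<and> (\<forall>n. {snd z n, snd z (Suc n)} \<in> Z i (fst z)) \<and> fin_visits (snd z))"
      by (intro pred_intros_logic pred_edges measurable_compose[OF measurable_snd pred_lattice_path]
          measurable_compose[OF measurable_snd pred_fin_visits])
    show "AE \<omega> in M. AE u in choices (p i). lattice_path (walk (Z i \<omega>) 0 u)
        \<and> (\<forall>n. {walk (Z i \<omega>) 0 u n, walk (Z i \<omega>) 0 u (Suc n)} \<in> Z i \<omega>) \<and> fin_visits (walk (Z i \<omega>) 0 u)"
      using av vis
    proof eventually_elim
      case (elim \<omega>)
      show ?case using elim(2) AE_valid_choices[OF ell, of i]
      proof eventually_elim
        case (elim u)
        have "{walk (Z i \<omega>) 0 u n, walk (Z i \<omega>) 0 u (Suc n)} \<in> Z i \<omega>" for n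
          using walk_adj[OF elim(2) \<open>avail (Z i \<omega>) 0 \<noteq> {}\<close>, of n] by (simp add: avail_def)
        then show ?case using lattice_path_walk[OF elim(2) \<open>avail (Z i \<omega>) 0 \<noteq> {}\<close>] elim(1) by blast
      qed
    qed
  qed
  then show ?thesis unfolding good_def by eventually_elim blast
qed

lemma AE_walk_lattice:
  "AE u in choices (p 0). \<forall>a. (\<lambda>n. real_of_int (walk (snd lattice) 0 u n $ a) / real n) \<longlonglongrightarrow> drift (p 0) $ a"
proof -
  have "AE u in choices (p 0). \<forall>a\<in>UNIV. (\<lambda>n. real_of_int (walk (snd lattice) 0 u n $ a) / real n) \<longlonglongrightarrow> drift (p 0) $ a"
    by (intro AE_finite_allI finite AE_lattice_coordinate ell)
  then show ?thesis by simp
qed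

lemma av_0: "AE \<omega> in M. avail (Z 0 \<omega>) 0 \<noteq> {}"
  unfolding Z_0 by simp

lemma AE_LLN_0: "AE \<omega> in M. \<forall>a. (\<lambda>n. real_of_int (X 0 n \<omega> $ a) / real n) \<longlonglongrightarrow> drift (p 0) $ a"
proof -
  have "AE \<omega> in M. (\<lambda>n. real_of_int (W 0 \<omega> n $ a) / real n) \<longlonglongrightarrow> drift (p 0) $ a" for a
  proof (rule joint_law_AE[where F = "GA 0" and q = "p 0" and E = "Z 0"
        and P = "\<lambda>\<omega> x. (\<lambda>n. real_of_int (x n $ a) / real n) \<longlonglongrightarrow> drift (p 0) $ a"])
    show "prob_space M" by (rule prob_space_axioms)
    show "subalgebra M (GA 0)" by (rule sub_GA)
    show "{\<omega> \<in> space (GA 0). e \<in> Z 0 \<omega>} \<in> sets (GA 0)" for e by (rule sets_Z_GA)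
    show "W 0 \<in> measurable M path_space" by (rule measurable_W)
    show "measure M (A \<inter> {\<omega> \<in> space M. \<forall>k\<le>n. X 0 k \<omega> = w k})
        = (\<integral>\<omega>. indicator A \<omega> * measure (choices (p 0)) {u. \<forall>k\<le>n. walk (Z 0 \<omega>) 0 u k = w k} \<partial>M)"
      if "A \<in> sets (GA 0)" for A n w by (rule law_GA[OF av_0 that])
    show "Measurable.pred (GA 0 \<Otimes>\<^sub>M path_space) (\<lambda>z. (\<lambda>n. real_of_int (snd z n $ a) / real n) \<longlonglongrightarrow> drift (p 0) $ a)"
      by (rule measurable_compose[OF measurable_snd pred_speed])
    show "AE \<omega> in M. AE u in choices (p 0). (\<lambda>n. real_of_int (walk (Z 0 \<omega>) 0 u n $ a) / real n) \<longlonglongrightarrow> drift (p 0) $ a"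
      unfolding Z_0 by (intro AE_I2 AE_lattice_coordinate ell)
  qed
  then have "AE \<omega> in M. \<forall>a\<in>UNIV. (\<lambda>n. real_of_int (W 0 \<omega> n $ a) / real n) \<longlonglongrightarrow> drift (p 0) $ a"
    by (intro AE_finite_allI finite)
  then show ?thesis by simp
qed

definition LLN0 :: "'w \<Rightarrow> bool" where
  "LLN0 \<omega> \<longleftrightarrow> (\<forall>a. (\<lambda>n. real_of_int (X 0 n \<omega> $ a) / real n) \<longlonglongrightarrow> drift (p 0) $ a)"

text \<open>A later walk visits only vertices of the first one, so the bound on the weights over the
  first range serves all later walks.\<close>

lemma nice_subrange:
  assumes L: "LLN0 \<omega>" and g: "good i \<omega>" "range (W i \<omega>) \<subseteq> range (W 0 \<omega>)"
    and q: "log_ratio q \<bullet> drift (p 0) > 0"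
  shows "nice q j (W i \<omega>)"
proof -
  have y: "(\<lambda>n. real_of_int (W 0 \<omega> n $ a) / real n) \<longlonglongrightarrow> drift (p 0) $ a" for a
    using L by (simp add: LLN0_def)
  obtain C where C: "\<And>n. (\<Sum>x\<in>W 0 \<omega> ` {..<n}. weight q x) \<le> C" using weight_bounded[OF y q] by blast
  have "(\<Sum>x\<in>W i \<omega> ` {..<n}. weight q x) \<le> C" for n
    by (rule weight_sum_le[OF C]) (use g(2) in auto)
  moreover have "filterlim (\<lambda>n. W i \<omega> n $ j) at_top sequentially"
    by (rule filterlim_subrange[where y = "W 0 \<omega>" and h = "\<lambda>x. x $ j", OF height_at_top[OF y drift_j]])
       (use g in \<open>auto simp: good_def fin_visits_def\<close>)
  ultimately show ?thesis using g(1) unfolding nice_def good_def by blast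
qed

lemma avail_Z_Suc: "avail (Z (enat (Suc k)) \<omega>) x \<noteq> {} \<Longrightarrow> x \<in> range (W (enat k) \<omega>)"
  unfolding Z_Suc by (rule avail_trace_edges)

lemma avail_Z_Suc_0:
  assumes "good (enat k) \<omega>" shows "avail (Z (enat (Suc k)) \<omega>) 0 \<noteq> {}"
proof -
  have y: "lattice_path (W (enat k) \<omega>)" using assms by (simp add: good_def)
  then have "W (enat k) \<omega> 1 \<in> avail (Z (enat (Suc k)) \<omega>) 0"
    unfolding Z_Suc avail_def trace_edges_def lattice_path_def
    by (auto intro: range_eqI[of _ _ 0] dest: spec[of _ 0])
  then show ?thesis by blast
qed

lemma good_in_range: "good (enat (Suc k)) \<omega> \<Longrightarrow> range (W (enat (Suc k)) \<omega>) \<subseteq> range (W (enat k) \<omega>)"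
proof
  fix x assume g: "good (enat (Suc k)) \<omega>" and "x \<in> range (W (enat (Suc k)) \<omega>)"
  then obtain n where x: "x = X (enat (Suc k)) n \<omega>" by blast
  have "{X (enat (Suc k)) n \<omega>, X (enat (Suc k)) (Suc n) \<omega>} \<in> Z (enat (Suc k)) \<omega>"
    using g unfolding good_def by blast
  then show "x \<in> range (W (enat k) \<omega>)" unfolding x Z_Suc by (rule trace_edge_in_range)
qed

text \<open>A good walk has a trace on which the next walk is transient, and therefore good in turn.
  Containment in the first range is kept in the induction because summability of the weights comes
  from there.\<close>

lemma AE_good_fin: "AE \<omega> in M. LLN0 \<omega> \<and> good (enat i) \<omega> \<and> range (W (enat i) \<omega>) \<subseteq> range (W 0 \<omega>)"
proof (induction i)
  case 0
  have "AE \<omega> in M. good 0 \<omega>"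
  proof (rule AE_good[OF av_0])
    show "AE \<omega> in M. AE u in choices (p 0). fin_visits (walk (Z 0 \<omega>) 0 u)"
      unfolding Z_0
    proof (rule AE_I2)
      show "AE u in choices (p 0). fin_visits (walk (snd lattice) 0 u)"
        using AE_walk_lattice
      proof eventually_elim
        case (elim u)
        show ?case by (rule fin_visits_of_height[OF height_at_top[OF elim[rule_format] drift_j]])
      qed
    qed
  qed
  with AE_LLN_0 show ?case by eventually_elim (simp add: LLN0_def zero_enat_def)
next
  case (Suc i)
  have av: "AE \<omega> in M. avail (Z (enat (Suc i)) \<omega>) 0 \<noteq> {}"
    using Suc by eventually_elim (use avail_Z_Suc_0 in blast)
  have "AE \<omega> in M. AE u in choices (p (enat (Suc i))). fin_visits (walk (Z (enat (Suc i)) \<omega>) 0 u)"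
    using Suc
  proof eventually_elim
    case (elim \<omega>)
    have "log_ratio (p (enat (Suc i))) \<bullet> drift (p 0) > 0" by (rule log_ratio_drift) (simp add: zero_enat_def)
    then have n: "nice (p (enat (Suc i))) j (W (enat i) \<omega>)" using elim nice_subrange by blast
    have "{x. avail (Z (enat (Suc i)) \<omega>) x \<noteq> {}} \<subseteq> insert 0 (range (W (enat i) \<omega>))" using avail_Z_Suc by blast
    from nice_transient(2)[OF ell n _ this] show ?case by (simp add: Z_Suc fin_visits_def)
  qed
  from AE_good[OF av this] Suc show ?case
    by eventually_elim (use good_in_range in blast)
qed

lemma AE_good_all: "AE \<omega> in M. LLN0 \<omega> \<and> (\<forall>i. good (enat i) \<omega> \<and> range (W (enat i) \<omega>) \<subseteq> range (W 0 \<omega>))"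
proof -
  have "AE \<omega> in M. \<forall>i. LLN0 \<omega> \<and> good (enat i) \<omega> \<and> range (W (enat i) \<omega>) \<subseteq> range (W 0 \<omega>)"
    unfolding AE_all_countable using AE_good_fin by blast
  then show ?thesis by eventually_elim blast
qed

text \<open>The limit graph is not known to contain the trace of a path, so
  \<open>AE_visits_finite\<close> is applied directly: an infinite cluster survives by
  \<open>infinite_cluster_Inter\<close>, and all vertices with edges lie in the range of the first
  walk.\<close>

lemma transient_infinity:
  assumes L: "LLN0 \<omega>" and g: "\<And>i. good (enat i) \<omega> \<and> range (W (enat i) \<omega>) \<subseteq> range (W 0 \<omega>)"
  shows "avail (Z \<infinity> \<omega>) 0 \<noteq> {}" and "AE u in choices (p \<infinity>). fin_visits (walk (Z \<infinity> \<omega>) 0 u)"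
proof -
  have q: "log_ratio (p \<infinity>) \<bullet> drift (p 0) > 0" by (rule log_ratio_drift) simp
  have n: "nice (p \<infinity>) j (W (enat i) \<omega>)" for i using nice_subrange[OF L _ _ q] g by blast
  have sub: "Z (enat (Suc k)) \<omega> \<subseteq> Z (enat k) \<omega>" for k
    unfolding Z_Suc using g[of k] by (auto simp: trace_edges_def good_def)
  have inf: "infinite (cluster (Z (enat (Suc k)) \<omega>) 0)" for k
  proof -
    have "range (W (enat k) \<omega>) \<subseteq> cluster (Z (enat (Suc k)) \<omega>) 0"
      using g[of k] by (intro range_subset_cluster) (auto simp: good_def Z_Suc)
    moreover have "infinite (range (W (enat k) \<omega>))"
      by (intro infinite_range_nice[where j = j]) (use n[of k] in \<open>simp add: nice_def\<close>)
    ultimately show ?thesis using finite_subset by blast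
  qed
  have eq: "Z \<infinity> \<omega> = (\<Inter>k. Z (enat (Suc k)) \<omega>)"
    unfolding Z_infinity using sub by blast
  have inf': "infinite (cluster (Z \<infinity> \<omega>) 0)"
    unfolding eq by (rule infinite_cluster_Inter[where E = "\<lambda>k. Z (enat (Suc k)) \<omega>", OF sub inf])
  obtain C where C: "\<And>n. (\<Sum>x\<in>W (enat 0) \<omega> ` {..<n}. weight (p \<infinity>) x) \<le> C"
    using n[of 0] by (auto simp: nice_def)
  have V: "{x. avail (Z \<infinity> \<omega>) x \<noteq> {}} \<subseteq> range (W (enat 0) \<omega>)"
  proof
    fix x assume "x \<in> {x. avail (Z \<infinity> \<omega>) x \<noteq> {}}"
    then have "avail (Z (enat (Suc 0)) \<omega>) x \<noteq> {}" unfolding eq avail_def by blast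
    then show "x \<in> range (W (enat 0) \<omega>)" by (rule avail_Z_Suc)
  qed
  have res: "(\<Sum>x\<in>F. weight (p \<infinity>) x) \<le> C" if "finite F" "F \<subseteq> {x. avail (Z \<infinity> \<omega>) x \<noteq> {}}" for F
    by (rule weight_sum_le[OF C that(1)]) (use that V in blast)
  show "avail (Z \<infinity> \<omega>) 0 \<noteq> {}" by (rule AE_visits_finite(1)[OF ell inf' res])
  show "AE u in choices (p \<infinity>). fin_visits (walk (Z \<infinity> \<omega>) 0 u)"
    unfolding fin_visits_def by (rule AE_visits_finite(2)[OF ell inf' res])
qed

lemma AE_subrange: "AE \<omega> in M. LLN0 \<omega> \<and> (\<forall>i. fin_visits (W i \<omega>) \<and> range (W i \<omega>) \<subseteq> range (W 0 \<omega>))"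
proof -
  have "AE \<omega> in M. good \<infinity> \<omega>"
  proof (rule AE_good)
    show "AE \<omega> in M. avail (Z \<infinity> \<omega>) 0 \<noteq> {}"
      using AE_good_all by eventually_elim (use transient_infinity(1) in blast)
    show "AE \<omega> in M. AE u in choices (p \<infinity>). fin_visits (walk (Z \<infinity> \<omega>) 0 u)"
      using AE_good_all by eventually_elim (use transient_infinity(2) in blast)
  qed
  with AE_good_all show ?thesis
  proof eventually_elim
    case (elim \<omega>)
    have "range (W \<infinity> \<omega>) \<subseteq> range (W (enat 0) \<omega>)"
    proof
      fix x assume "x \<in> range (W \<infinity> \<omega>)"
      then obtain n where x: "x = X \<infinity> n \<omega>" by auto
      have "{X \<infinity> n \<omega>, X \<infinity> (Suc n) \<omega>} \<in> Z (enat (Suc 0)) \<omega>"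
        using elim(2) unfolding good_def Z_infinity by blast
      then show "x \<in> range (W (enat 0) \<omega>)" unfolding Z_Suc x by (rule trace_edge_in_range)
    qed
    then have "fin_visits (W i \<omega>) \<and> range (W i \<omega>) \<subseteq> range (W 0 \<omega>)" for i
      using elim by (cases i) (auto simp: good_def zero_enat_def)
    with elim(1) show ?case by blast
  qed
qed

lemma transience:
  "AE \<omega> in M. \<forall>i. \<forall>l. l \<bullet> drift (p 0) > 0 \<longrightarrow>
     filterlim (\<lambda>n. real_site (X i n \<omega>) \<bullet> l) at_top sequentially"
  using AE_subrange
proof eventually_elim
  case (elim \<omega>)
  show ?case
  proof (intro allI impI)
    fix i and l :: "real ^ 'd" assume l: "l \<bullet> drift (p 0) > 0"
    have y: "(\<lambda>n. real_of_int (W 0 \<omega> n $ a) / real n) \<longlonglongrightarrow> drift (p 0) $ a" for a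
      using elim by (simp add: LLN0_def)
    have "filterlim (\<lambda>n. real_site (W 0 \<omega> n) \<bullet> l) at_top sequentially"
      by (rule at_top_of_positive_speed[OF inner_limit[OF y] l])
    then show "filterlim (\<lambda>n. real_site (X i n \<omega>) \<bullet> l) at_top sequentially"
    proof (rule filterlim_subrange[where y = "W 0 \<omega>" and h = "\<lambda>x. real_site x \<bullet> l"])
      show "X i n \<omega> \<in> range (W 0 \<omega>)" for n using elim by blast
      show "finite {n. X i n \<omega> = z}" for z using elim by (simp add: fin_visits_def)
    qed
  qed
qed

section \<open>Mixing along the sequence of walks and the speed\<close>

lemma sets_PA_insert:
  assumes F: "space F = space M" "sets F \<subseteq> sets (PA (insert i J))"
    and J: "\<And>i' n x. i' \<in> J \<Longrightarrow> {\<omega> \<in> space M. X i' n \<omega> = x} \<in> sets F"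
  shows "sets (PA (insert i J))
    = sigma_sets (space M) {A \<inter> {\<omega> \<in> space M. \<forall>k<n. X i k \<omega> = w k} | A n w. A \<in> sets F}"
    (is "_ = sigma_sets _ ?G")
proof
  have GP: "?G \<subseteq> Pow (space M)" by auto
  interpret S: sigma_algebra "space M" "sigma_sets (space M) ?G" by (rule sigma_algebra_sigma_sets[OF GP])
  have topF: "space M \<in> sets F" using sets.top[of F] F(1) by simp
  have "{\<omega> \<in> space M. X i' n \<omega> = x} \<in> sigma_sets (space M) ?G" if i': "i' \<in> insert i J" for i' n x
  proof (cases "i' \<in> J")
    case True
    have "{\<omega> \<in> space M. X i' n \<omega> = x}
        = {\<omega> \<in> space M. X i' n \<omega> = x} \<inter> {\<omega> \<in> space M. \<forall>k<(0::nat). X i k \<omega> = 0}" by auto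
    with J[OF True, of n x] show ?thesis by (intro sigma_sets.Basic CollectI exI conjI)
  next
    case False
    then have i: "i' = i" using i' by simp
    let ?I = "{xs. length xs = Suc n \<and> xs ! n = x}"
    have "{\<omega> \<in> space M. X i n \<omega> = x}
        = (\<Union>xs\<in>?I. space M \<inter> {\<omega> \<in> space M. \<forall>k<Suc n. X i k \<omega> = xs ! k})"
    proof (intro set_eqI iffI)
      fix \<omega> assume w: "\<omega> \<in> {\<omega> \<in> space M. X i n \<omega> = x}"
      let ?xs = "map (\<lambda>k. X i k \<omega>) [0..<Suc n]"
      have "?xs \<in> ?I" using w by (simp del: upt_Suc)
      moreover have "?xs ! k = X i k \<omega>" if "k < Suc n" for k
        using that nth_map_upt[of k "Suc n" 0 "\<lambda>k. X i k \<omega>"] by (simp only: diff_zero add_0)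
      then have "\<omega> \<in> space M \<inter> {\<omega> \<in> space M. \<forall>k<Suc n. X i k \<omega> = ?xs ! k}"
        using w by (intro IntI CollectI conjI allI impI) (auto simp del: upt_Suc)
      ultimately show "\<omega> \<in> (\<Union>xs\<in>?I. space M \<inter> {\<omega> \<in> space M. \<forall>k<Suc n. X i k \<omega> = xs ! k})" by (rule UN_I)
    next
      fix \<omega> assume "\<omega> \<in> (\<Union>xs\<in>?I. space M \<inter> {\<omega> \<in> space M. \<forall>k<Suc n. X i k \<omega> = xs ! k})"
      then obtain xs where "xs \<in> ?I" "\<omega> \<in> space M" "\<forall>k<Suc n. X i k \<omega> = xs ! k" by blast
      then show "\<omega> \<in> {\<omega> \<in> space M. X i n \<omega> = x}" by simp
    qed
    also have "\<dots> \<in> sigma_sets (space M) ?G"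
    proof (rule S.countable_UN'')
      show "countable ?I" by (rule countableI_type)
      have "space M \<inter> {\<omega> \<in> space M. \<forall>k<Suc n. X i k \<omega> = xs ! k} \<in> ?G" for xs :: "'d site list"
        using topF by (intro CollectI exI[of _ "space M"] exI[of _ "Suc n"] exI[of _ "\<lambda>k. xs ! k"] conjI refl)
      then show "space M \<inter> {\<omega> \<in> space M. \<forall>k<Suc n. X i k \<omega> = xs ! k} \<in> sigma_sets (space M) ?G" for xs :: "'d site list"
        by (rule sigma_sets.Basic)
    qed
    finally show ?thesis unfolding i .
  qed
  then show "sets (PA (insert i J)) \<subseteq> sigma_sets (space M) ?G"
    unfolding sets_PA by (intro S.sigma_sets_subset) blast
  have "A \<inter> {\<omega> \<in> space M. \<forall>k<n. X i k \<omega> = w k} \<in> sets (PA (insert i J))" if A: "A \<in> sets F" for A n w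
  proof -
    have "{\<omega> \<in> space M. \<forall>k<n. X i k \<omega> = w k} = W i -` prefix n w \<inter> space (PA (insert i J))" by auto
    with measurable_sets[OF measurable_W_PA[OF insertI1] sets_prefix[of n w]]
    have "{\<omega> \<in> space M. \<forall>k<n. X i k \<omega> = w k} \<in> sets (PA (insert i J))" by (simp only:)
    then show ?thesis by (intro sets.Int subsetD[OF F(2) A])
  qed
  then have "?G \<subseteq> sets (PA (insert i J))" by blast
  from sets.sigma_sets_subset[OF this] show "sigma_sets (space M) ?G \<subseteq> sets (PA (insert i J))" by simp
qed

text \<open>Levels must be regeneration levels of all the walks up to \<open>i\<close>: beyond a
  common level, the last walk depends on the earlier ones only through what they do beyond
  it.\<close>

definition marked :: "nat \<Rightarrow> 'w \<Rightarrow> 'd marked_path" where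
  "marked i \<omega> = (W (enat i) \<omega>, \<lambda>L. \<forall>k\<le>i. reg j L (W (enat k) \<omega>))"

abbreviation past :: "nat \<Rightarrow> 'w measure" where
  "past i \<equiv> PA (enat ` {..<Suc i})"

lemma measurable_marked: "marked i \<in> measurable (past i) mark_space"
proof -
  have W: "W (enat k) \<in> measurable (past i) path_space" if "k \<le> i" for k
    by (rule measurable_W_PA) (use that in auto)
  have P: "Measurable.pred (past i) (\<lambda>\<omega>. \<forall>k\<le>i. reg j L (W (enat k) \<omega>))" for L
  proof -
    have "Measurable.pred (past i) (\<lambda>\<omega>. \<forall>k\<in>{..i}. reg j L (W (enat k) \<omega>))"
      by (intro pred_intros_finite measurable_compose[OF W pred_reg]) auto
    then show ?thesis by (simp only: Ball_def atMost_iff)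
  qed
  have "(\<lambda>\<omega>. (W (enat i) \<omega>, \<lambda>L. \<forall>k\<le>i. reg j L (W (enat k) \<omega>))) \<in> measurable (past i) mark_space"
  proof (rule measurable_Pair)
    show "W (enat i) \<in> measurable (past i) path_space" by (rule W) (rule order_refl)
    show "(\<lambda>\<omega> L. \<forall>k\<le>i. reg j L (W (enat k) \<omega>)) \<in> measurable (past i) (PiM UNIV (\<lambda>_. count_space UNIV))"
      by (rule measurable_abs_UNIV) (rule P)
  qed
  then show ?thesis by (simp only: marked_def[abs_def])
qed

text \<open>The induction starts from the graph algebra of the lattice, which is trivial; each
  further past arises by adjoining the prefixes of the new walk.\<close>

lemma mixing_marked:
  "\<exists>\<nu>. finite_measure \<nu> \<and> sets \<nu> = sets mark_space \<and> 0 < measure \<nu> (space \<nu>) \<and> mixing M (past i) j (marked i) \<nu>"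
proof (induction i)
  case 0
  have eq: "marked 0 = (\<lambda>\<omega>. (W 0 \<omega>, \<lambda>m. reg j m (W 0 \<omega>)))"
    by (simp add: marked_def fun_eq_iff zero_enat_def)
  have im: "enat ` {..<Suc 0} = insert 0 {}" by (simp add: zero_enat_def lessThan_Suc)
  show ?case
    unfolding eq
  proof (rule mixing_base[OF prob_space_axioms sub_GA[of 0] ell[of 0] measurable_W])
    show "measure M (A \<inter> {\<omega> \<in> space M. \<forall>k\<le>n. X 0 k \<omega> = w k})
        = (\<integral>\<omega>. indicator A \<omega> * measure (choices (p 0)) {u. \<forall>k\<le>n. walk (snd lattice) 0 u k = w k} \<partial>M)"
      if "A \<in> sets (GA 0)" for A n w using law_GA[OF av_0 that] by (simp only: Z_0)
    show "sets (past 0) = sigma_sets (space M) {A \<inter> {\<omega> \<in> space M. \<forall>k<n. X 0 k \<omega> = w k} | A n w. A \<in> sets (GA 0)}"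
      unfolding im
    proof (rule sets_PA_insert)
      have "{\<omega> \<in> space M. P} \<in> sets (PA (insert 0 {}))" for P
        using sets.top[of "PA (insert 0 {})"] by (cases P) auto
      then have "{{\<omega> \<in> space M. x \<in> fst (nested_graph X 0 \<omega>)} | x. True} \<union> {{\<omega> \<in> space M. e \<in> Z 0 \<omega>} | e. True}
          \<subseteq> sets (PA (insert 0 {}))"
        by (auto simp: nested_graph_def zero_enat_def)
      from sets.sigma_sets_subset[OF this] show "sets (GA 0) \<subseteq> sets (PA (insert 0 {}))"
        by (simp add: sets_GA)
    qed auto
    show "AE u in choices (p 0). filterlim (\<lambda>n. walk (snd lattice) 0 u n $ j) at_top sequentially"
      using AE_walk_lattice
    proof eventually_elim
      case (elim u)
      show ?case by (rule height_at_top[OF elim[rule_format] drift_j])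
    qed
  qed
next
  case (Suc i)
  then obtain \<nu> where \<nu>: "finite_measure \<nu>" "sets \<nu> = sets mark_space" "0 < measure \<nu> (space \<nu>)"
    and mix: "mixing M (past i) j (marked i) \<nu>" by blast
  let ?i = "enat (Suc i)"
  have eq: "marked (Suc i) = (\<lambda>\<omega>. (W ?i \<omega>, \<lambda>m. snd (marked i \<omega>) m \<and> reg j m (W ?i \<omega>)))"
    by (auto simp: marked_def fun_eq_iff le_Suc_eq)
  have im: "enat ` {..<Suc (Suc i)} = insert ?i (enat ` {..<Suc i})" by (subst lessThan_Suc) simp
  have E: "trace_edges (fst (marked i \<omega>)) = Z ?i \<omega>" for \<omega> by (simp add: marked_def Z_Suc)
  have av: "AE \<omega> in M. avail (Z ?i \<omega>) 0 \<noteq> {}"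
    using AE_good_all by eventually_elim (use avail_Z_Suc_0 in blast)
  show ?case
    unfolding eq
  proof (rule mixing_step[OF prob_space_axioms sub_PA[of "enat ` {..<Suc i}"] ell[of ?i] measurable_marked measurable_W])
    show "measure M (A \<inter> {\<omega> \<in> space M. \<forall>k\<le>n. X ?i k \<omega> = w k})
        = (\<integral>\<omega>. indicator A \<omega> * measure (choices (p ?i)) {u. \<forall>k\<le>n. walk (trace_edges (fst (marked i \<omega>))) 0 u k = w k} \<partial>M)"
      if "A \<in> sets (past i)" for A n w unfolding E by (rule law_PA[OF av that])
    show "AE \<omega> in M. nice (p ?i) j (fst (marked i \<omega>)) \<and> (\<forall>L\<ge>1. snd (marked i \<omega>) L \<longrightarrow> reg j L (fst (marked i \<omega>)))"
      using AE_good_all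
    proof eventually_elim
      case (elim \<omega>)
      have "log_ratio (p ?i) \<bullet> drift (p 0) > 0" by (rule log_ratio_drift) (simp add: zero_enat_def)
      then have "nice (p ?i) j (W (enat i) \<omega>)" using elim nice_subrange by blast
      then show ?case by (simp add: marked_def)
    qed
    show "sets (past (Suc i)) = sigma_sets (space M) {A \<inter> {\<omega> \<in> space M. \<forall>k<n. X ?i k \<omega> = w k} | A n w. A \<in> sets (past i)}"
      unfolding im
    proof (rule sets_PA_insert)
      show "sets (past i) \<subseteq> sets (PA (insert ?i (enat ` {..<Suc i})))"
        unfolding sets_PA by (rule sigma_sets_mono') blast
      show "{\<omega> \<in> space M. X i' n \<omega> = x} \<in> sets (past i)" if "i' \<in> enat ` {..<Suc i}" for i' n x
        by (rule sets_X_PA[OF that])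
    qed simp
  qed (rule mix \<nu>)+
qed

lemma speed: "\<exists>\<kappa>\<ge>0. AE \<omega> in M. (\<lambda>n. real_of_int (X (enat i) n \<omega> $ j) / real n) \<longlonglongrightarrow> \<kappa>"
proof -
  obtain \<nu> where \<nu>: "finite_measure \<nu>" "sets \<nu> = sets mark_space" "0 < measure \<nu> (space \<nu>)"
    and mix: "mixing M (past i) j (marked i) \<nu>" using mixing_marked by blast
  have "AE \<omega> in M. consistent j (marked i \<omega>)"
    using AE_good_all by eventually_elim (simp add: consistent_def marked_def good_def)
  from mixing_speed[OF prob_space_axioms sub_PA measurable_marked mix \<nu> this]
  show ?thesis by (simp add: marked_def)
qed

lemma law_of_large_numbers:
  "\<exists>\<kappa> :: nat \<Rightarrow> real. (\<forall>i. \<kappa> i \<ge> 0) \<and>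
     (AE \<omega> in M. \<forall>i. (\<lambda>n. (1 / real n) *\<^sub>R real_site (X (enat i) n \<omega>)) \<longlonglongrightarrow> \<kappa> i *\<^sub>R drift (p 0))"
proof -
  have "\<forall>i. \<exists>\<kappa>. \<kappa> \<ge> 0 \<and> (AE \<omega> in M. (\<lambda>n. real_of_int (X (enat i) n \<omega> $ j) / real n) \<longlonglongrightarrow> \<kappa>)"
    using speed by blast
  from choice[OF this] obtain \<kappa>' :: "nat \<Rightarrow> real" where \<kappa>': "\<And>i. \<kappa>' i \<ge> 0"
    "\<And>i. AE \<omega> in M. (\<lambda>n. real_of_int (X (enat i) n \<omega> $ j) / real n) \<longlonglongrightarrow> \<kappa>' i"
    by blast
  have "AE \<omega> in M. \<forall>i. (\<lambda>n. real_of_int (X (enat i) n \<omega> $ j) / real n) \<longlonglongrightarrow> \<kappa>' i"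
    unfolding AE_all_countable using \<kappa>'(2) by blast
  \<comment> \<open>Coordinate \<open>j\<close> of walk \<open>i\<close> has speed
    \<open>\<kappa>' i\<close>, that of the first walk has speed \<open>drift (p 0) $ j\<close>, and
    the quotient is the deterministic ratio of their time scales.\<close>
  with AE_subrange have "AE \<omega> in M. \<forall>i. (\<lambda>n. (1 / real n) *\<^sub>R real_site (X (enat i) n \<omega>))
      \<longlonglongrightarrow> (\<kappa>' i / drift (p 0) $ j) *\<^sub>R drift (p 0)"
  proof eventually_elim
    case (elim \<omega>)
    show ?case
    proof
      fix i
      have y: "(\<lambda>n. real_of_int (W 0 \<omega> n $ a) / real n) \<longlonglongrightarrow> drift (p 0) $ a" for a
        using elim(1) by (simp add: LLN0_def)
      show "(\<lambda>n. (1 / real n) *\<^sub>R real_site (X (enat i) n \<omega>)) \<longlonglongrightarrow> (\<kappa>' i / drift (p 0) $ j) *\<^sub>R drift (p 0)"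
      proof (rule speed_of_subrange[where y = "W 0 \<omega>", OF y drift_j])
        show "X (enat i) n \<omega> \<in> range (W 0 \<omega>)" for n using elim(1) by blast
        show "finite {n. X (enat i) n \<omega> = z}" for z using elim(1) by (simp add: fin_visits_def)
        show "(\<lambda>n. real_of_int (X (enat i) n \<omega> $ j) / real n) \<longlonglongrightarrow> \<kappa>' i" using elim(2) by blast
      qed
    qed
  qed
  moreover have "\<kappa>' i / drift (p 0) $ j \<ge> 0" for i using \<kappa>'(1)[of i] drift_j by simp
  ultimately show ?thesis by (intro exI[of _ "\<lambda>i. \<kappa>' i / drift (p 0) $ j"]) blast
qed

end

theorem theorem1:
  fixes M :: "'w measure"
    and p :: "enat \<Rightarrow> ('d::finite) site pmf"
    and X :: "enat \<Rightarrow> nat \<Rightarrow> 'w \<Rightarrow> 'd site"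
    and j1 :: 'd
  assumes "CARD('d) \<ge> 2"
    and "nested_random_walks M p X"
    and "condition1 p j1"
  shows "(AE \<omega> in M. \<forall>i::enat. \<forall>l::real ^ 'd. l \<bullet> drift (p 0) > 0 \<longrightarrow>
            filterlim (\<lambda>n. real_site (X i n \<omega>) \<bullet> l) at_top sequentially)
       \<and> (\<exists>\<kappa> :: nat \<Rightarrow> real. (\<forall>i. \<kappa> i \<ge> 0) \<and>
            (AE \<omega> in M. \<forall>i. (\<lambda>n. (1 / real n) *\<^sub>R real_site (X (enat i) n \<omega>))
                              \<longlonglongrightarrow> \<kappa> i *\<^sub>R drift (p 0)))"
proof -
  interpret nested_random_walks M p X by (rule assms(2))
  interpret conditioned_walks M p X j1 by unfold_locales (rule assms(3))
  show ?thesis using transience law_of_large_numbers by blast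
qed

end
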